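(* Let $G=G(\alpha,\beta)$ be a $3$-dimensional non-unimodular Lie group, equipped with a left invariant Riemannian metric $g$ as described in the context, which is not locally symmetric. Then the following hold. (1) If $\alpha\neq 1$, then the only homogeneous Riemannian structure is $S=\nabla^{(-)}-\nabla$, where $\nabla^{(-)}$ is Cartan-Schouten's $(-)$-connection. The coset representation is $G=G/\{\mathsf{e}\}$. (2) If $\alpha=1$, then the homogeneous Riemannian structure of $G=G(1,\beta)$ is $S=\nabla^{(-)}-\nabla$ or \[ S^{(r)}=-2r\,\theta^3\otimes(\theta^1\wedge\theta^2)-2\beta\,\theta^1\otimes(\theta^2\wedge\theta^3)-2\beta\,\theta^2\otimes(\theta^3\wedge\theta^1),\quad r\in\mathbb{R}. \] The coset space representation of $G$ corresponding to $S$ is $G=G/\{\mathsf{e}\}$, and the coset space representation corresponding to $S^{(r)}$ is \[ G=\begin{cases} L\times\mathrm{SO}(2)/\mathrm{SO}(2), & r\neq-(\beta^2+2)/\beta,\\ L/\{\mathsf{e}\}, & r=-(\beta^2+2)/\beta,\end{cases} \] where $L$ is a Lie group acting transitively and isometrically on $G$ and its Lie algebra $\mathfrak{l}$ is isomorphic to $\mathfrak{sl}_2\mathbb{R}$.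
   Context: The group $G(\alpha,\beta)$. $G=G(\alpha,\beta)$ denotes a $3$-dimensional non-unimodular Lie group with a left invariant Riemannian metric $g$ whose Lie algebra $\mathfrak{g}(\alpha,\beta)$ has an orthonormal basis $\{e_1,e_2,e_3\}$ satisfying \[ [e_1,e_2]=(1+\alpha)e_2+(1+\alpha)\beta e_3,\quad [e_2,e_3]=0,\quad [e_3,e_1]=(1-\alpha)\beta e_2-(1-\alpha)e_3, \] where $\alpha$ and $\beta$ are non-negative constants (every left invariant metric on a $3$-dimensional non-unimodular Lie group can be brought to this form after a suitable homothetic change). The metric is locally symmetric if and only if $\alpha=0$ or $(\alpha,\beta)=(1,0)$. $\{\theta^1,\theta^2,\theta^3\}$ is the left invariant coframe field metrically dual to $\{e_1,e_2,e_3\}$, $\nabla$ is the Levi-Civita connection of $g$, and $\mathsf{e}$ is the unit element of $G$. Homogeneous Riemannian structures. Let $(M,g)$ be a Riemannian manifold with Levi-Civita connection $\nabla$ and curvature $R(X,Y)=[\nabla_X,\nabla_Y]-\nabla_{[X,Y]}$. A homogeneous Riemannian structure on $(M,g)$ is a tensor field $S$ of type $(1,2)$ such that the linear connection $\tilde{\nabla}=\nabla+S$, i.e. $\tilde\nabla_XY=\nabla_XY+S(X)Y$, satisfies $\tilde{\nabla}g=0$, $\tilde{\nabla}R=0$, $\tilde{\nabla}S=0$. Left invariance of $S$ is not assumed. $S$ is identified with its covariant form $S_\flat(X,Y,Z)=g(S(X)Y,Z)$; the formula for $S^{(r)}$ is in this covariant form. The wedge product convention is $(\theta^i\wedge\theta^j)(Y,Z)=\tfrac12\{\theta^i(Y)\theta^j(Z)-\theta^j(Y)\theta^i(Z)\}$.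 Cartan-Schouten's $(-)$-connection. $\nabla^{(-)}$ is the linear connection on $G$ with $\nabla^{(-)}_XY=0$ for all left invariant vector fields $X,Y$; it is the canonical connection of $G=G/\{\mathsf{e}\}$. Coset space representation. Given a simply connected Riemannian manifold $M$ with a homogeneous Riemannian structure $S$ and a point $o\in M$, put $\mathfrak{m}=\mathrm{T}_oM$, let $\tilde R$ be the curvature of $\tilde\nabla=\nabla+S$, and let $\mathfrak{h}\subset\mathfrak{so}(\mathfrak{m},g_o)$ be the holonomy algebra of $\tilde\nabla$, generated by the operators $\tilde R(X,Y)$, $X,Y\in\mathfrak{m}$. The space $\mathfrak{h}\oplus\mathfrak{m}$ is a Lie algebra with brackets \[ [U,V]=UV-VU,\quad [U,X]=U(X),\quad [X,Y]=-\tilde R(X,Y)-S(X)Y+S(Y)X \] for $U,V\in\mathfrak{h}$, $X,Y\in\mathfrak{m}$. Let $\tilde K$ be the simply connected Lie group with this Lie algebra and $\tilde H$ its Lie subgroup with Lie algebra $\mathfrak{h}$; then $M=\tilde K/\tilde H$. Dividing by the discrete normal subgroup $\Gamma$ of elements acting trivially on $M$, one obtains $K=\tilde K/\Gamma$, acting transitively and effectively on $M$ by isometries with isotropy subgroup $H=\tilde H/\Gamma$ at $o$. The expression $M=K/H$ is the coset space representation corresponding to $S$.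
   Formalization: If α=1, the left invariant structures are S and S^(r), and all structures are their images under isometries fixing e; for r≠-(β²+2)/β, L×SO(2) is not a direct product but normal L times isotropy SO(2), meeting trivially. G is simply connected in the coset claims. *)

theory Defs
  imports "HOL-Analysis.Analysis" "HOL-Algebra.Generated_Groups" "HOL-Algebra.Group_Action"
begin

section \<open>Smooth manifolds\<close>

primrec Ck_on :: "nat \<Rightarrow> 'e::euclidean_space set \<Rightarrow> ('e \<Rightarrow> 'f::real_normed_vector) \<Rightarrow> bool" where
  "Ck_on 0 U f \<longleftrightarrow> continuous_on U f"
| "Ck_on (Suc k) U f \<longleftrightarrow> (\<forall>x\<in>U. f differentiable (at x)) \<and>
     (\<forall>v. Ck_on k U (\<lambda>x. frechet_derivative f (at x) v))"

text \<open>Only used for open \<open>U\<close>.\<close>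

definition smooth_on :: "'e::euclidean_space set \<Rightarrow> ('e \<Rightarrow> 'f::real_normed_vector) \<Rightarrow> bool" where
  "smooth_on U f \<longleftrightarrow> (\<forall>k. Ck_on k U f)"

text \<open>A manifold is a Hausdorff second countable type (the class constraints are put where the
  manifold is fixed) with a set of charts \<open>(U, \<phi>)\<close>; values of \<open>\<phi>\<close> outside \<open>U\<close> are irrelevant.\<close>

type_synonym ('p, 'e) atlas = "('p set \<times> ('p \<Rightarrow> 'e)) set"

definition smooth_atlas :: "('p::topological_space, 'e::euclidean_space) atlas \<Rightarrow> bool" where
  "smooth_atlas A \<longleftrightarrow>
     (\<forall>(U, \<phi>)\<in>A. open U \<and> open (\<phi> ` U) \<and> homeomorphism U (\<phi> ` U) \<phi> (inv_into U \<phi>)) \<and>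
     (\<Union>(U, \<phi>)\<in>A. U) = UNIV \<and>
     (\<forall>(U, \<phi>)\<in>A. \<forall>(V, \<psi>)\<in>A. smooth_on (\<phi> ` (U \<inter> V)) (\<psi> \<circ> inv_into U \<phi>))"

definition smooth_map ::
  "('p::topological_space, 'e::euclidean_space) atlas \<Rightarrow>
   ('q::topological_space, 'f::euclidean_space) atlas \<Rightarrow> ('p \<Rightarrow> 'q) \<Rightarrow> bool" where
  "smooth_map A B F \<longleftrightarrow> continuous_on UNIV F \<and>
     (\<forall>(U, \<phi>)\<in>A. \<forall>(V, \<psi>)\<in>B. smooth_on (\<phi> ` (U \<inter> F -` V)) (\<psi> \<circ> F \<circ> inv_into U \<phi>))"

definition smooth_functions ::
  "('p::topological_space, 'e::euclidean_space) atlas \<Rightarrow> ('p \<Rightarrow> real) set" where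
  "smooth_functions A = {f. \<forall>(U, \<phi>)\<in>A. smooth_on (\<phi> ` U) (f \<circ> inv_into U \<phi>)}"

definition prod_atlas :: "('p, 'e) atlas \<Rightarrow> ('q, 'f) atlas \<Rightarrow> ('p \<times> 'q, 'e \<times> 'f) atlas" where
  "prod_atlas A B = {(U \<times> V, map_prod \<phi> \<psi>) | U \<phi> V \<psi>. (U, \<phi>) \<in> A \<and> (V, \<psi>) \<in> B}"

definition real_atlas :: "(real, real) atlas" where
  "real_atlas = {(UNIV, id)}"


section \<open>Vector fields and tensor fields\<close>

text \<open>Tangent vectors are derivations of the algebra of smooth functions at a point. They vanish
  by convention on functions that are not smooth, so that equal derivations are equal as HOL
  functions. Sums and multiples are formed pointwise.\<close>

type_synonym 'p tangent = "('p \<Rightarrow> real) \<Rightarrow> real"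
type_synonym 'p vfield = "'p \<Rightarrow> 'p tangent"
type_synonym 'p connection = "'p vfield \<Rightarrow> 'p vfield \<Rightarrow> 'p vfield"
type_synonym 'p metric = "'p \<Rightarrow> 'p tangent \<Rightarrow> 'p tangent \<Rightarrow> real"
type_synonym 'p tensor12 = "'p \<Rightarrow> 'p tangent \<Rightarrow> 'p tangent \<Rightarrow> 'p tangent"

definition tadd :: "'p tangent \<Rightarrow> 'p tangent \<Rightarrow> 'p tangent" where
  "tadd u v = (\<lambda>f. u f + v f)"

definition tscale :: "real \<Rightarrow> 'p tangent \<Rightarrow> 'p tangent" where
  "tscale c u = (\<lambda>f. c * u f)"

abbreviation tzero :: "'p tangent" where
  "tzero \<equiv> (\<lambda>f. 0)"

definition tangent_space ::
  "('p::topological_space, 'e::euclidean_space) atlas \<Rightarrow> 'p \<Rightarrow> 'p tangent set" where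
  "tangent_space A p = {v.
     (\<forall>f\<in>smooth_functions A. \<forall>h\<in>smooth_functions A. \<forall>a b.
        v (\<lambda>x. a * f x + b * h x) = a * v f + b * v h) \<and>
     (\<forall>f\<in>smooth_functions A. \<forall>h\<in>smooth_functions A.
        v (\<lambda>x. f x * h x) = f p * v h + h p * v f) \<and>
     (\<forall>f. f \<notin> smooth_functions A \<longrightarrow> v f = 0)}"

definition vector_fields ::
  "('p::topological_space, 'e::euclidean_space) atlas \<Rightarrow> 'p vfield set" where
  "vector_fields A = {X. (\<forall>p. X p \<in> tangent_space A p) \<and>
     (\<forall>f\<in>smooth_functions A. (\<lambda>p. X p f) \<in> smooth_functions A)}"

definition vadd :: "'p vfield \<Rightarrow> 'p vfield \<Rightarrow> 'p vfield" where
  "vadd X Y = (\<lambda>p. tadd (X p) (Y p))"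

definition vsub :: "'p vfield \<Rightarrow> 'p vfield \<Rightarrow> 'p vfield" where
  "vsub X Y = (\<lambda>p f. X p f - Y p f)"

definition vscale :: "('p \<Rightarrow> real) \<Rightarrow> 'p vfield \<Rightarrow> 'p vfield" where
  "vscale h X = (\<lambda>p. tscale (h p) (X p))"

abbreviation vzero :: "'p vfield" where
  "vzero \<equiv> (\<lambda>p f. 0)"

definition vbracket ::
  "('p::topological_space, 'e::euclidean_space) atlas \<Rightarrow> 'p vfield \<Rightarrow> 'p vfield \<Rightarrow> 'p vfield" where
  "vbracket A X Y = (\<lambda>p f. if f \<in> smooth_functions A
     then X p (\<lambda>q. Y q f) - Y p (\<lambda>q. X q f) else 0)"

text \<open>The differential of a map at any point, with target atlas \<open>B\<close>.\<close>

definition push ::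
  "('q::topological_space, 'f::euclidean_space) atlas \<Rightarrow> ('p \<Rightarrow> 'q) \<Rightarrow> 'p tangent \<Rightarrow> 'q tangent" where
  "push B F v = (\<lambda>f. if f \<in> smooth_functions B then v (f \<circ> F) else 0)"

text \<open>Tensor fields are given pointwise; their values outside the tangent spaces are irrelevant.\<close>

definition riemannian_metric ::
  "('p::topological_space, 'e::euclidean_space) atlas \<Rightarrow> 'p metric \<Rightarrow> bool" where
  "riemannian_metric A g \<longleftrightarrow>
     (\<forall>p. \<forall>u\<in>tangent_space A p. \<forall>v\<in>tangent_space A p. \<forall>w\<in>tangent_space A p. \<forall>c.
        g p u v = g p v u \<and> g p (tadd u v) w = g p u w + g p v w \<and>
        g p (tscale c u) v = c * g p u v \<and> (u \<noteq> tzero \<longrightarrow> g p u u > 0)) \<and>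
     (\<forall>X\<in>vector_fields A. \<forall>Y\<in>vector_fields A. (\<lambda>p. g p (X p) (Y p)) \<in> smooth_functions A)"

definition tensor_field12 ::
  "('p::topological_space, 'e::euclidean_space) atlas \<Rightarrow> 'p tensor12 \<Rightarrow> bool" where
  "tensor_field12 A S \<longleftrightarrow>
     (\<forall>p. \<forall>u\<in>tangent_space A p. \<forall>v\<in>tangent_space A p. \<forall>w\<in>tangent_space A p. \<forall>c.
        S p u v \<in> tangent_space A p \<and>
        S p (tadd u v) w = tadd (S p u w) (S p v w) \<and>
        S p w (tadd u v) = tadd (S p w u) (S p w v) \<and>
        S p (tscale c u) v = tscale c (S p u v) \<and>
        S p u (tscale c v) = tscale c (S p u v)) \<and>
     (\<forall>X\<in>vector_fields A. \<forall>Y\<in>vector_fields A. (\<lambda>p. S p (X p) (Y p)) \<in> vector_fields A)"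

definition isometry ::
  "('p::topological_space, 'e::euclidean_space) atlas \<Rightarrow> 'p metric \<Rightarrow> ('p \<Rightarrow> 'p) \<Rightarrow> bool" where
  "isometry A g F \<longleftrightarrow> bij F \<and> smooth_map A A F \<and> smooth_map A A (inv_into UNIV F) \<and>
     (\<forall>p. \<forall>u\<in>tangent_space A p. \<forall>v\<in>tangent_space A p.
        g (F p) (push A F u) (push A F v) = g p u v)"

text \<open>The diffeomorphism \<open>F\<close> carries \<open>S\<close> to \<open>S'\<close>. Homogeneous structures related by an isometry
  are called isomorphic; an isometry that is not an automorphism of a left invariant structure
  carries it to a homogeneous structure that need not be left invariant.\<close>

definition carries_tensor ::
  "('p::topological_space, 'e::euclidean_space) atlas \<Rightarrow> ('p \<Rightarrow> 'p) \<Rightarrow>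
   'p tensor12 \<Rightarrow> 'p tensor12 \<Rightarrow> bool" where
  "carries_tensor A F S S' \<longleftrightarrow> (\<forall>p. \<forall>u\<in>tangent_space A p. \<forall>v\<in>tangent_space A p.
     S' (F p) (push A F u) (push A F v) = push A F (S p u v))"


section \<open>Connections and homogeneous Riemannian structures\<close>

definition affine_connection ::
  "('p::topological_space, 'e::euclidean_space) atlas \<Rightarrow> 'p connection \<Rightarrow> bool" where
  "affine_connection A D \<longleftrightarrow>
     (\<forall>X\<in>vector_fields A. \<forall>Y\<in>vector_fields A. \<forall>Z\<in>vector_fields A. \<forall>f\<in>smooth_functions A.
        D X Y \<in> vector_fields A \<and>
        D (vadd X Y) Z = vadd (D X Z) (D Y Z) \<and>
        D (vscale f X) Z = vscale f (D X Z) \<and>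
        D X (vadd Y Z) = vadd (D X Y) (D X Z) \<and>
        D X (vscale f Y) = vadd (vscale f (D X Y)) (vscale (\<lambda>p. X p f) Y))"

definition metric_connection ::
  "('p::topological_space, 'e::euclidean_space) atlas \<Rightarrow> 'p metric \<Rightarrow> 'p connection \<Rightarrow> bool" where
  "metric_connection A g D \<longleftrightarrow>
     (\<forall>X\<in>vector_fields A. \<forall>Y\<in>vector_fields A. \<forall>Z\<in>vector_fields A. \<forall>p.
        X p (\<lambda>q. g q (Y q) (Z q)) = g p (D X Y p) (Z p) + g p (Y p) (D X Z p))"

definition levi_civita ::
  "('p::topological_space, 'e::euclidean_space) atlas \<Rightarrow> 'p metric \<Rightarrow> 'p connection \<Rightarrow> bool" where
  "levi_civita A g D \<longleftrightarrow> affine_connection A D \<and> metric_connection A g D \<and>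
     (\<forall>X\<in>vector_fields A. \<forall>Y\<in>vector_fields A. vsub (D X Y) (D Y X) = vbracket A X Y)"

definition curvature ::
  "('p::topological_space, 'e::euclidean_space) atlas \<Rightarrow> 'p connection \<Rightarrow>
   'p vfield \<Rightarrow> 'p vfield \<Rightarrow> 'p vfield \<Rightarrow> 'p vfield" where
  "curvature A D X Y Z = vsub (vsub (D X (D Y Z)) (D Y (D X Z))) (D (vbracket A X Y) Z)"

text \<open>\<open>parallel_curvature A D' D\<close>: the curvature of \<open>D\<close> is parallel for \<open>D'\<close>.\<close>

definition parallel_curvature ::
  "('p::topological_space, 'e::euclidean_space) atlas \<Rightarrow> 'p connection \<Rightarrow> 'p connection \<Rightarrow> bool" where
  "parallel_curvature A D' D \<longleftrightarrow>
     (\<forall>X\<in>vector_fields A. \<forall>Y\<in>vector_fields A. \<forall>Z\<in>vector_fields A. \<forall>W\<in>vector_fields A.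
        D' X (curvature A D Y Z W) =
          vadd (vadd (curvature A D (D' X Y) Z W) (curvature A D Y (D' X Z) W))
               (curvature A D Y Z (D' X W)))"

definition locally_symmetric ::
  "('p::topological_space, 'e::euclidean_space) atlas \<Rightarrow> 'p connection \<Rightarrow> bool" where
  "locally_symmetric A D \<longleftrightarrow> parallel_curvature A D D"

definition parallel_tensor12 ::
  "('p::topological_space, 'e::euclidean_space) atlas \<Rightarrow> 'p connection \<Rightarrow> 'p tensor12 \<Rightarrow> bool" where
  "parallel_tensor12 A D' S \<longleftrightarrow>
     (\<forall>X\<in>vector_fields A. \<forall>Y\<in>vector_fields A. \<forall>Z\<in>vector_fields A.
        D' X (\<lambda>p. S p (Y p) (Z p)) =
          vadd (\<lambda>p. S p (D' X Y p) (Z p)) (\<lambda>p. S p (Y p) (D' X Z p)))"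

definition connection_plus :: "'p connection \<Rightarrow> 'p tensor12 \<Rightarrow> 'p connection" where
  "connection_plus D S X Y = vadd (D X Y) (\<lambda>p. S p (X p) (Y p))"

text \<open>\<open>D\<close> is meant to be the Levi-Civita connection of \<open>g\<close>.\<close>

definition homogeneous_structure ::
  "('p::topological_space, 'e::euclidean_space) atlas \<Rightarrow> 'p metric \<Rightarrow> 'p connection \<Rightarrow>
   'p tensor12 \<Rightarrow> bool" where
  "homogeneous_structure A g D S \<longleftrightarrow> tensor_field12 A S \<and>
     metric_connection A g (connection_plus D S) \<and>
     parallel_curvature A (connection_plus D S) D \<and>
     parallel_tensor12 A (connection_plus D S) S"

text \<open>\<open>S = D' - D\<close>\<close>

definition difference_tensor ::
  "('p::topological_space, 'e::euclidean_space) atlas \<Rightarrow> 'p connection \<Rightarrow> 'p connection \<Rightarrow>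
   'p tensor12 \<Rightarrow> bool" where
  "difference_tensor A D' D S \<longleftrightarrow> tensor_field12 A S \<and>
     (\<forall>X\<in>vector_fields A. \<forall>Y\<in>vector_fields A. (\<lambda>p. S p (X p) (Y p)) = vsub (D' X Y) (D X Y))"


section \<open>Lie algebras and Lie groups\<close>

record 'v lie_algebra =
  lcarrier :: "'v set"
  ladd :: "'v \<Rightarrow> 'v \<Rightarrow> 'v"
  lscale :: "real \<Rightarrow> 'v \<Rightarrow> 'v"
  lbracket :: "'v \<Rightarrow> 'v \<Rightarrow> 'v"

definition lie_isomorphism :: "'v lie_algebra \<Rightarrow> 'w lie_algebra \<Rightarrow> ('v \<Rightarrow> 'w) \<Rightarrow> bool" where
  "lie_isomorphism P Q \<Phi> \<longleftrightarrow> bij_betw \<Phi> (lcarrier P) (lcarrier Q) \<and>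
     (\<forall>x\<in>lcarrier P. \<forall>y\<in>lcarrier P. \<forall>c.
        \<Phi> (ladd P x y) = ladd Q (\<Phi> x) (\<Phi> y) \<and>
        \<Phi> (lscale P c x) = lscale Q c (\<Phi> x) \<and>
        \<Phi> (lbracket P x y) = lbracket Q (\<Phi> x) (\<Phi> y))"

definition sl2R :: "(real^2^2) lie_algebra" where
  "sl2R = \<lparr>lcarrier = {M. trace M = 0}, ladd = (+), lscale = scaleR,
           lbracket = (\<lambda>M N. M ** N - N ** M)\<rparr>"

definition lie_group ::
  "'p::{t2_space, second_countable_topology} monoid \<Rightarrow> ('p, 'e::euclidean_space) atlas \<Rightarrow> bool" where
  "lie_group G A \<longleftrightarrow> group G \<and> carrier G = UNIV \<and> smooth_atlas A \<and>
     smooth_map (prod_atlas A A) A (\<lambda>(x, y). x \<otimes>\<^bsub>G\<^esub> y) \<and> smooth_map A A (\<lambda>x. inv\<^bsub>G\<^esub> x)"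

definition left_invariant_fields ::
  "'p::topological_space monoid \<Rightarrow> ('p, 'e::euclidean_space) atlas \<Rightarrow> 'p vfield set" where
  "left_invariant_fields G A = {X \<in> vector_fields A.
     \<forall>a p. push A (\<lambda>x. a \<otimes>\<^bsub>G\<^esub> x) (X p) = X (a \<otimes>\<^bsub>G\<^esub> p)}"

definition lie_algebra_of ::
  "'p::topological_space monoid \<Rightarrow> ('p, 'e::euclidean_space) atlas \<Rightarrow> ('p vfield) lie_algebra" where
  "lie_algebra_of G A = \<lparr>lcarrier = left_invariant_fields G A, ladd = vadd,
     lscale = (\<lambda>c. vscale (\<lambda>_. c)), lbracket = vbracket A\<rparr>"

definition left_invariant_metric ::
  "'p::topological_space monoid \<Rightarrow> ('p, 'e::euclidean_space) atlas \<Rightarrow> 'p metric \<Rightarrow> bool" where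
  "left_invariant_metric G A g \<longleftrightarrow> riemannian_metric A g \<and>
     (\<forall>a p. \<forall>u\<in>tangent_space A p. \<forall>v\<in>tangent_space A p.
        g (a \<otimes>\<^bsub>G\<^esub> p) (push A (\<lambda>x. a \<otimes>\<^bsub>G\<^esub> x) u) (push A (\<lambda>x. a \<otimes>\<^bsub>G\<^esub> x) v) = g p u v)"

definition left_invariant_tensor ::
  "'p::topological_space monoid \<Rightarrow> ('p, 'e::euclidean_space) atlas \<Rightarrow> 'p tensor12 \<Rightarrow> bool" where
  "left_invariant_tensor G A S \<longleftrightarrow> (\<forall>a. carries_tensor A (\<lambda>x. a \<otimes>\<^bsub>G\<^esub> x) S S)"

definition cartan_schouten_minus ::
  "'p::topological_space monoid \<Rightarrow> ('p, 'e::euclidean_space) atlas \<Rightarrow> 'p connection \<Rightarrow> bool" where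
  "cartan_schouten_minus G A D \<longleftrightarrow> affine_connection A D \<and>
     (\<forall>X\<in>left_invariant_fields G A. \<forall>Y\<in>left_invariant_fields G A. D X Y = vzero)"

definition real_group :: "real monoid" where
  "real_group = \<lparr>carrier = UNIV, mult = (+), one = 0\<rparr>"

definition one_parameter_subgroup ::
  "'p::topological_space monoid \<Rightarrow> ('p, 'e::euclidean_space) atlas \<Rightarrow> (real \<Rightarrow> 'p) \<Rightarrow> bool" where
  "one_parameter_subgroup G A \<gamma> \<longleftrightarrow> \<gamma> \<in> hom real_group G \<and> smooth_map real_atlas A \<gamma>"

text \<open>The connected Lie subgroup with Lie algebra \<open>\<aa>\<close> is the one generated by
  \<open>exp \<aa>\<close>, i.e. by the one-parameter subgroups whose initial velocity lies in \<open>\<aa>\<close>.\<close>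

definition lie_subgroup_of_algebra ::
  "'p::topological_space monoid \<Rightarrow> ('p, 'e::euclidean_space) atlas \<Rightarrow> 'p vfield set \<Rightarrow> 'p set" where
  "lie_subgroup_of_algebra G A \<aa> = generate G {\<gamma> t | \<gamma> t. one_parameter_subgroup G A \<gamma> \<and>
     (\<exists>X\<in>\<aa>. \<forall>f\<in>smooth_functions A.
        ((\<lambda>s. f (\<gamma> s)) has_real_derivative X \<one>\<^bsub>G\<^esub> f) (at 0))}"


section \<open>The coset space representation of a homogeneous structure\<close>

definition curvature_at ::
  "('p::topological_space, 'e::euclidean_space) atlas \<Rightarrow> 'p connection \<Rightarrow> 'p \<Rightarrow>
   'p tangent \<Rightarrow> 'p tangent \<Rightarrow> 'p tangent \<Rightarrow> 'p tangent" where
  "curvature_at A D p u v w =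
     (if u \<in> tangent_space A p \<and> v \<in> tangent_space A p \<and> w \<in> tangent_space A p
      then (THE t. \<exists>X\<in>vector_fields A. \<exists>Y\<in>vector_fields A. \<exists>Z\<in>vector_fields A.
              X p = u \<and> Y p = v \<and> Z p = w \<and> t = curvature A D X Y Z p)
      else tzero)"

text \<open>The elements of the holonomy algebra at \<open>p\<close> are operators on the tangent space at \<open>p\<close>,
  extended by zero.\<close>

inductive_set holonomy_algebra ::
  "('p::topological_space, 'e::euclidean_space) atlas \<Rightarrow> 'p connection \<Rightarrow> 'p \<Rightarrow>
   ('p tangent \<Rightarrow> 'p tangent) set"
  for A D p where
    curv: "u \<in> tangent_space A p \<Longrightarrow> v \<in> tangent_space A p \<Longrightarrow>
           curvature_at A D p u v \<in> holonomy_algebra A D p"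
  | add: "U \<in> holonomy_algebra A D p \<Longrightarrow> V \<in> holonomy_algebra A D p \<Longrightarrow>
          (\<lambda>w. tadd (U w) (V w)) \<in> holonomy_algebra A D p"
  | scale: "U \<in> holonomy_algebra A D p \<Longrightarrow> (\<lambda>w. tscale c (U w)) \<in> holonomy_algebra A D p"
  | commutator: "U \<in> holonomy_algebra A D p \<Longrightarrow> V \<in> holonomy_algebra A D p \<Longrightarrow>
          (\<lambda>w f. U (V w) f - V (U w) f) \<in> holonomy_algebra A D p"

text \<open>The Lie algebra \<open>\<hh> \<oplus> \<mm>\<close>, where \<open>\<mm>\<close> is the tangent space at \<open>x\<close>.\<close>

definition transvection_algebra ::
  "('p::topological_space, 'e::euclidean_space) atlas \<Rightarrow> 'p connection \<Rightarrow> 'p tensor12 \<Rightarrow> 'p \<Rightarrow>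
   (('p tangent \<Rightarrow> 'p tangent) \<times> 'p tangent) lie_algebra" where
  "transvection_algebra A D S x = \<lparr>
     lcarrier = holonomy_algebra A (connection_plus D S) x \<times> tangent_space A x,
     ladd = (\<lambda>(U, X) (V, Y). (\<lambda>w. tadd (U w) (V w), tadd X Y)),
     lscale = (\<lambda>c (U, X). (\<lambda>w. tscale c (U w), tscale c X)),
     lbracket = (\<lambda>(U, X) (V, Y).
       (\<lambda>w f. U (V w) f - V (U w) f - curvature_at A (connection_plus D S) x X Y w f,
        \<lambda>f. U Y f - V X f - S x X Y f + S x Y X f))\<rparr>"

definition smooth_action ::
  "'k::topological_space monoid \<Rightarrow> ('k, 'f::euclidean_space) atlas \<Rightarrow>
   ('p::topological_space, 'e::euclidean_space) atlas \<Rightarrow> ('k \<Rightarrow> 'p \<Rightarrow> 'p) \<Rightarrow> bool" where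
  "smooth_action K B A act \<longleftrightarrow> group_action K UNIV act \<and>
     smooth_map (prod_atlas B A) A (\<lambda>(k, p). act k p)"

definition transitive_isometric_action ::
  "'k::topological_space monoid \<Rightarrow> ('k, 'f::euclidean_space) atlas \<Rightarrow>
   ('p::topological_space, 'e::euclidean_space) atlas \<Rightarrow> 'p metric \<Rightarrow> ('k \<Rightarrow> 'p \<Rightarrow> 'p) \<Rightarrow> bool" where
  "transitive_isometric_action K B A g act \<longleftrightarrow> smooth_action K B A act \<and>
     transitive_action K UNIV act \<and> (\<forall>k\<in>carrier K. isometry A g (act k))"

text \<open>\<open>K\<close> is the simply connected Lie group with Lie algebra \<open>\<hh> \<oplus> \<mm>\<close>, and \<open>act\<close> is its action
  on the manifold under the identification with \<open>K\<close> modulo the Lie subgroup with Lie algebra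
  \<open>\<hh>\<close>: that subgroup is the isotropy group at \<open>x\<close>, the action is isometric, and the differential
  of the orbit map \<open>k \<mapsto> act k x\<close> at the unit is the projection onto \<open>\<mm>\<close>. These
  conditions determine \<open>K\<close> and \<open>act\<close> up to isomorphism.\<close>

definition coset_presentation ::
  "('p::topological_space, 'e::euclidean_space) atlas \<Rightarrow> 'p metric \<Rightarrow> 'p connection \<Rightarrow>
   'p tensor12 \<Rightarrow> 'p \<Rightarrow>
   'k::{t2_space, second_countable_topology} monoid \<Rightarrow> ('k, 'f::euclidean_space) atlas \<Rightarrow>
   ('k \<Rightarrow> 'p \<Rightarrow> 'p) \<Rightarrow> bool" where
  "coset_presentation A g D S x K B act \<longleftrightarrow>
     lie_group K B \<and> simply_connected (UNIV :: 'k set) \<and>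
     transitive_isometric_action K B A g act \<and>
     (\<exists>\<Phi>. lie_isomorphism (transvection_algebra A D S x) (lie_algebra_of K B) \<Phi> \<and>
        (\<forall>(U, v)\<in>lcarrier (transvection_algebra A D S x).
           push A (\<lambda>k. act k x) (\<Phi> (U, v) \<one>\<^bsub>K\<^esub>) = v) \<and>
        stabilizer K act x =
          lie_subgroup_of_algebra K B
            (\<Phi> ` (holonomy_algebra A (connection_plus D S) x \<times> {tzero})))"

text \<open>\<open>\<Gamma>\<close>, the group of elements acting trivially. The group acting effectively is the quotient
  \<open>K Mod \<Gamma>\<close>, with isotropy group the image of the isotropy group in \<open>K\<close>.\<close>

definition ineffective_kernel :: "'k monoid \<Rightarrow> ('k \<Rightarrow> 'p \<Rightarrow> 'p) \<Rightarrow> 'k set" where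
  "ineffective_kernel K act = kernel K (BijGroup UNIV) act"

text \<open>The coset space representation is \<open>K/{e}\<close>, with \<open>K\<close> itself acting effectively by \<open>act\<close>.\<close>

definition coset_representation_trivial_isotropy ::
  "('p::topological_space, 'e::euclidean_space) atlas \<Rightarrow> 'p metric \<Rightarrow> 'p connection \<Rightarrow>
   'p tensor12 \<Rightarrow> 'p \<Rightarrow>
   'k::{t2_space, second_countable_topology} monoid \<Rightarrow> ('k, 'f::euclidean_space) atlas \<Rightarrow>
   ('k \<Rightarrow> 'p \<Rightarrow> 'p) \<Rightarrow> bool" where
  "coset_representation_trivial_isotropy A g D S x K B act \<longleftrightarrow>
     coset_presentation A g D S x K B act \<and>
     ineffective_kernel K act = {\<one>\<^bsub>K\<^esub>} \<and> stabilizer K act x = {\<one>\<^bsub>K\<^esub>}"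

definition SO2 :: "(real^2^2) monoid" where
  "SO2 = \<lparr>carrier = {M. orthogonal_matrix M \<and> det M = 1}, mult = (**), one = mat 1\<rparr>"

definition rotation2 :: "real \<Rightarrow> real^2^2" where
  "rotation2 t = vector [vector [cos t, - sin t], vector [sin t, cos t]]"

text \<open>The coset space representation is \<open>L \<times> SO(2)/SO(2)\<close>, where \<open>L\<close> acts by \<open>\<rho>\<close>.
  The simply connected group is the direct product of \<open>L\<close> with the universal
  covering group \<open>\<real>\<close> of \<open>SO(2)\<close>. The effective quotient \<open>Q\<close> is the product of the normal subgroup
  \<open>L\<close> and the isotropy group \<open>H \<cong> SO(2)\<close>, which meet in the unit element only; so the multiplication
  \<open>L \<times> H \<rightarrow> Q\<close> is bijective. It cannot be required to be a homomorphism from the direct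
  product: \<open>H\<close> does not centralise \<open>L\<close> in \<open>Q\<close>.
  The isomorphism between \<open>SO(2)\<close> and \<open>H\<close> is smooth because it lifts to
  the one-parameter subgroup \<open>\<gamma>\<close>.\<close>

definition coset_representation_SO2 ::
  "('p::topological_space, 'e::euclidean_space) atlas \<Rightarrow> 'p metric \<Rightarrow> 'p connection \<Rightarrow>
   'p tensor12 \<Rightarrow> 'p \<Rightarrow>
   'l::{t2_space, second_countable_topology} monoid \<Rightarrow> ('l, 'f::euclidean_space) atlas \<Rightarrow>
   ('l \<Rightarrow> 'p \<Rightarrow> 'p) \<Rightarrow> bool" where
  "coset_representation_SO2 A g D S x L B \<rho> \<longleftrightarrow>
     (let K = L \<times>\<times> real_group; C = prod_atlas B real_atlas in
      \<exists>act. coset_presentation A g D S x K C act \<and> (\<forall>a. act (a, 0) = \<rho> a) \<and>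
        (let \<Gamma> = ineffective_kernel K act; Q = K Mod \<Gamma>;
             \<iota> = (\<lambda>a. \<Gamma> #>\<^bsub>K\<^esub> (a, 0)); H = (\<lambda>k. \<Gamma> #>\<^bsub>K\<^esub> k) ` stabilizer K act x in
           inj \<iota> \<and> range \<iota> \<lhd> Q \<and> subgroup H Q \<and>
           range \<iota> <#>\<^bsub>Q\<^esub> H = carrier Q \<and> range \<iota> \<inter> H = {\<one>\<^bsub>Q\<^esub>} \<and>
           (\<exists>\<gamma>. one_parameter_subgroup K C \<gamma> \<and> range \<gamma> = stabilizer K act x \<and>
              (\<exists>\<psi>\<in>iso SO2 (Q\<lparr>carrier := H\<rparr>). \<forall>t. \<psi> (rotation2 t) = \<Gamma> #>\<^bsub>K\<^esub> \<gamma> t))))"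


section \<open>The groups \<open>G(\<alpha>, \<beta>)\<close>\<close>

text \<open>Three vector fields orthonormal at every point of a three-dimensional manifold form a frame,
  so \<open>e1, e2, e3\<close> is a basis of the Lie algebra. Non-unimodularity follows from the brackets
  (the trace of \<open>ad e1\<close> is \<open>2\<close>).\<close>

definition group_G ::
  "real \<Rightarrow> real \<Rightarrow> 'p::{t2_space, second_countable_topology} monoid \<Rightarrow> ('p, real^3) atlas \<Rightarrow>
   'p metric \<Rightarrow> 'p vfield \<Rightarrow> 'p vfield \<Rightarrow> 'p vfield \<Rightarrow> bool" where
  "group_G \<alpha> \<beta> G A g e1 e2 e3 \<longleftrightarrow>
     \<alpha> \<ge> 0 \<and> \<beta> \<ge> 0 \<and> lie_group G A \<and> connected (UNIV :: 'p set) \<and> left_invariant_metric G A g \<and>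
     {e1, e2, e3} \<subseteq> left_invariant_fields G A \<and>
     (\<forall>p. g p (e1 p) (e1 p) = 1 \<and> g p (e2 p) (e2 p) = 1 \<and> g p (e3 p) (e3 p) = 1 \<and>
          g p (e1 p) (e2 p) = 0 \<and> g p (e2 p) (e3 p) = 0 \<and> g p (e1 p) (e3 p) = 0) \<and>
     vbracket A e1 e2 = vadd (vscale (\<lambda>_. 1 + \<alpha>) e2) (vscale (\<lambda>_. (1 + \<alpha>) * \<beta>) e3) \<and>
     vbracket A e2 e3 = vzero \<and>
     vbracket A e3 e1 = vadd (vscale (\<lambda>_. (1 - \<alpha>) * \<beta>) e2) (vscale (\<lambda>_. - (1 - \<alpha>)) e3)"

definition wedge :: "('v \<Rightarrow> real) \<Rightarrow> ('v \<Rightarrow> real) \<Rightarrow> 'v \<Rightarrow> 'v \<Rightarrow> real" where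
  "wedge \<theta> \<eta> v w = (\<theta> v * \<eta> w - \<eta> v * \<theta> w) / 2"

text \<open>\<open>S\<close> is the tensor field \<open>S\<^sup>(\<^sup>r\<^sup>)\<close>; the covectors \<open>\<theta>\<close> are metrically dual to the frame.\<close>

definition structure_r ::
  "('p::topological_space, 'e::euclidean_space) atlas \<Rightarrow> 'p metric \<Rightarrow>
   'p vfield \<Rightarrow> 'p vfield \<Rightarrow> 'p vfield \<Rightarrow> real \<Rightarrow> real \<Rightarrow> 'p tensor12 \<Rightarrow> bool" where
  "structure_r A g e1 e2 e3 \<beta> r S \<longleftrightarrow> tensor_field12 A S \<and>
     (\<forall>p. let \<theta>1 = g p (e1 p); \<theta>2 = g p (e2 p); \<theta>3 = g p (e3 p) in
        \<forall>u\<in>tangent_space A p. \<forall>v\<in>tangent_space A p. \<forall>w\<in>tangent_space A p.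
          g p (S p u v) w = - 2 * r * \<theta>3 u * wedge \<theta>1 \<theta>2 v w
             - 2 * \<beta> * \<theta>1 u * wedge \<theta>2 \<theta>3 v w - 2 * \<beta> * \<theta>2 u * wedge \<theta>3 \<theta>1 v w)"

end

theory Submission
 imports Defs "HOL-Complex_Analysis.Complex_Analysis"
begin

text \<open>
In the left invariant frame everything becomes linear algebra on \<open>\<real>\<^sup>3\<close>. An alternating bilinear map is a linear map applied to
the cross product, and a skew operator is a cross product with a vector. So the brackets, the Levi-Civita connection and
its curvature are given by three linear maps \<open>brk\<close>, \<open>lam\<close>, \<open>curvop\<close>, and a metric connection by \<open>\<nabla>\<^sub>x y = \<tau> x \<times> y\<close> with a
function \<open>\<tau>\<close> on \<open>G\<close> whose values are linear maps. If \<open>\<nabla> + S\<close> makes the curvature parallel, every \<open>\<tau> x \<times> _\<close> commutes with \<open>curvop\<close>.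

For \<open>\<alpha> \<noteq> 0, 1\<close> the eigenvalues of \<open>curvop\<close> are distinct, so \<open>\<tau> = 0\<close>: the frame is parallel and \<open>\<nabla> + S = \<nabla>\<^sup>(\<^sup>-\<^sup>)\<close>
(\<open>homogeneous_generic\<close>).

For \<open>\<alpha> = 1\<close> rotations about \<open>e\<^sub>3\<close> remain: \<open>\<tau> x = (\<mu> \<bullet> x - 2 x\<^sub>2 - \<beta> x\<^sub>3) e\<^sub>3\<close> with a function \<open>\<mu>\<close> on \<open>G\<close>. That \<open>S\<close> is parallel
prescribes all derivatives of \<open>\<mu>\<close> (\<open>twist_equation\<close>), and integrability leaves two kinds of solutions. Either
\<open>\<mu> = (0, 0, - r)\<close>, which is \<open>S\<^sup>(\<^sup>r\<^sup>)\<close>, or \<open>\<mu>\<close> has \<open>\<mu>\<^sub>3 = \<beta>\<close> and runs on a circle of radius 2. The constant \<open>(0, 2, \<beta>)\<close> is one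
solution of the second kind, namely \<open>\<nabla>\<^sup>(\<^sup>-\<^sup>) - \<nabla>\<close>. By a Gronwall estimate such a solution is determined by its value at the unit, so
the others are images of this one under isometries that fix the unit and rotate its tangent space about \<open>e\<^sub>3\<close>
(\<open>homogeneous_carried\<close>).

These isometries come from a model. One-parameter subgroups give a covering homomorphism \<open>Psi\<close> from \<open>\<real>\<^sup>3\<close>, viewed as the half-plane
times a line, onto \<open>G\<close>. Up to a turning by an angle proportional to the third coordinate, the pulled back coframe is \<open>phi\<close>, and
the maps that rotate \<open>phi\<close> by a constant angle are determined by this angle and one value (\<open>turns_unique\<close>). Rotations of the
Poincare disc lift to such maps \<open>spin \<theta>\<close> fixing the origin. Those of angle zero form a group \<open>L\<close> that acts simply transitively and
has Lie algebra \<open>sl\<^sub>2\<real>\<close>. Since all of them commute with the kernel of \<open>Psi\<close>, which is vertical, \<open>spin \<theta>\<close> descends to \<open>G\<close>.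

The curvature of \<open>\<nabla> + S\<^sup>(\<^sup>r\<^sup>)\<close> is \<open>k = 4 + 2 \<beta> (\<beta> + r)\<close> times the rotation about \<open>e\<^sub>3\<close>. For \<open>k = 0\<close> the transvection algebra is that of
\<open>L\<close>. Otherwise it has dimension four and is the Lie algebra of \<open>L \<times> \<real>\<close>, whose second factor acts by the central translations of
\<open>G\<close>. The stabilizer of the unit is a line acting by the \<open>spin t\<close>; the multiples of \<open>2 \<pi>\<close> act trivially, so that its effective quotient is
the circle.
\<close>

no_notation fps_nth (infixl "$" 75)

section \<open>Smooth functions on open sets\<close>

notation smooth_functions ("\<F>") and tangent_space ("\<T>") and vector_fields ("\<XX>") and left_invariant_fields ("\<L>")

abbreviation Df :: "('a::real_normed_vector => 'b::real_normed_vector) => 'a => 'a => 'b" where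
 "Df f x \<equiv> frechet_derivative f (at x)"

lemma Ck_on_imp_continuous_on: "Ck_on k U f ==> continuous_on U f"
 by (cases k) (auto intro!: continuous_at_imp_continuous_on differentiable_imp_continuous_within)

lemma Ck_on_subset: "Ck_on k U f ==> V \<subseteq> U ==> Ck_on k V f"
 by (induction k arbitrary: f) (auto intro: continuous_on_subset)

lemma Ck_on_SucD: "Ck_on (Suc k) U f ==> Ck_on k U f"
proof (induction k arbitrary: f)
 case 0
 thus ?case using Ck_on_imp_continuous_on by (metis Ck_on.simps(1))
next
 case (Suc k)
 thus ?case by (metis Ck_on.simps(2))
qed

lemma Ck_on_cong:
 assumes "open U" "!!x. x : U ==> f x = g x" "Ck_on k U f"
 shows "Ck_on k U g"
 using assms(2,3)
proof (induction k arbitrary: f g)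
 case 0
 thus ?case by (auto cong: continuous_on_cong)
next
 case (Suc k)
 have d: "(g has_derivative Df f x) (at x)" if "x : U" for x
  using Suc.prems that assms(1)
  by (auto intro: has_derivative_transform_within_open[of f] simp: frechet_derivative_works[symmetric])
 have e: "Df f x = Df g x" if "x : U" for x
  by (rule frechet_derivative_at[OF d[OF that]])
 have "Ck_on k U (%x. Df g x v)" for v
  using Suc.IH[of "%x. Df f x v"] Suc.prems(2) e by auto
 thus ?case using d by (auto simp: differentiable_def)
qed

lemma Ck_on_local:
 assumes "!!x. x : U ==> \<exists>V. open V & x : V & Ck_on k V f"
 shows "Ck_on k U f"
 using assms
proof (induction k arbitrary: f)
 case 0
 thus ?case
  by (metis Ck_on.simps(1) continuous_at_imp_continuous_on continuous_on_eq_continuous_at)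
next
 case (Suc k)
 have "f differentiable at x" if "x : U" for x using Suc.prems[OF that] by auto
 moreover have "Ck_on k U (%x. Df f x v)" for v
  using Suc.prems by (intro Suc.IH) (metis Ck_on.simps(2))
 ultimately show ?case by auto
qed

lemma Ck_on_SucI:
 assumes "open U" "!!x. x : U ==> (f has_derivative f' x) (at x)" "!!v. Ck_on k U (%x. f' x v)"
 shows "Ck_on (Suc k) U f"
proof -
 have "f' x = Df f x" if "x : U" for x
  by (rule frechet_derivative_at[OF assms(2)[OF that]])
 hence "Ck_on k U (%x. Df f x v)" for v
  by (intro Ck_on_cong[OF assms(1) _ assms(3)[of v]]) simp
 thus ?thesis using assms(2) by (auto simp: differentiable_def)
qed

lemma Ck_on_has_derivative:
 "Ck_on (Suc k) U f ==> x : U ==> (f has_derivative Df f x) (at x)"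
 by (simp add: frechet_derivative_works[symmetric])

lemma Ck_on_const: "Ck_on k U (%x. c)"
 by (induction k arbitrary: c) auto

lemma Ck_on_bounded_linear_comp:
 assumes "open U" "bounded_linear L" "Ck_on k U f"
 shows "Ck_on k U (%x. L (f x))"
 using assms(3)
proof (induction k arbitrary: f)
 case 0
 thus ?case using assms(2) by (auto intro: bounded_linear.continuous_on)
next
 case (Suc k)
 show ?case
 proof (rule Ck_on_SucI[OF assms(1)])
  show "((%x. L (f x)) has_derivative (%v. L (Df f x v))) (at x)" if "x : U" for x
   by (rule bounded_linear.has_derivative[OF assms(2) Ck_on_has_derivative[OF Suc.prems that]])
  show "Ck_on k U (%x. L (Df f x v))" for v
   using Suc.prems by (intro Suc.IH) simp
 qed
qed

lemma Ck_on_add: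
 assumes "open U" "Ck_on k U f" "Ck_on k U g"
 shows "Ck_on k U (%x. f x + g x)"
 using assms(2,3)
proof (induction k arbitrary: f g)
 case 0
 thus ?case by (simp add: continuous_on_add)
next
 case (Suc k)
 show ?case
 proof (rule Ck_on_SucI[OF assms(1)])
  show "((%x. f x + g x) has_derivative
    (%v. Df f x v + Df g x v)) (at x)" if "x : U" for x
   by (rule has_derivative_add[OF Ck_on_has_derivative[OF Suc.prems(1) that] Ck_on_has_derivative[OF Suc.prems(2) that]])
  show "Ck_on k U (%x. Df f x v + Df g x v)" for v
   using Suc.prems by (intro Suc.IH) auto
 qed
qed

lemma Ck_on_sum:
 assumes "open U" "!!i. i : I ==> Ck_on k U (f i)"
 shows "Ck_on k U (%x. SUM i:I. f i x)"
 using assms(2)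
 by (induction I rule: infinite_finite_induct) (auto intro: Ck_on_add[OF assms(1)] Ck_on_const)

lemma Ck_on_bilinear:
 assumes "open U" "bounded_bilinear p" "Ck_on k U f" "Ck_on k U g"
 shows "Ck_on k U (%x. p (f x) (g x))"
 using assms(3,4)
proof (induction k arbitrary: f g)
 case 0
 thus ?case using assms(2) by (auto intro: bounded_bilinear.continuous_on)
next
 case (Suc k)
 note f = Suc.prems(1) and g = Suc.prems(2)
 show ?case
 proof (rule Ck_on_SucI[OF assms(1)])
  show "((%x. p (f x) (g x)) has_derivative
    (%v. p (f x) (Df g x v) + p (Df f x v) (g x))) (at x)"
   if "x : U" for x
   by (rule bounded_bilinear.FDERIV[OF assms(2) Ck_on_has_derivative[OF f that] Ck_on_has_derivative[OF g that]])
  show "Ck_on k U (%x. p (f x) (Df g x v) + p (Df f x v) (g x))" for v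
   using f g Ck_on_SucD[OF f] Ck_on_SucD[OF g] by (intro Ck_on_add[OF assms(1)] Suc.IH) auto
 qed
qed

lemma Ck_on_componentwise:
 fixes f :: "'e::euclidean_space => 'f::euclidean_space"
 assumes "open U" "!!b. b : Basis ==> Ck_on k U (%x. f x \<bullet> b)"
 shows "Ck_on k U f"
proof -
 have "Ck_on k U (%x. SUM b:Basis. (f x \<bullet> b) *\<^sub>R b)"
  by (intro Ck_on_sum[OF assms(1)] Ck_on_bilinear[OF assms(1) bounded_bilinear_scaleR] assms(2) Ck_on_const)
 thus ?thesis by (simp add: euclidean_representation)
qed

lemma Ck_on_compose:
 fixes f :: "'e::euclidean_space => 'f::euclidean_space" and g :: "'f => 'h::real_normed_vector"
 assumes U: "open U" and V: "!!x. x : U ==> f x : V" and "Ck_on k U f" "Ck_on k V g"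
 shows "Ck_on k U (%x. g (f x))"
 using assms(3,4)
proof (induction k arbitrary: g)
 case 0
 thus ?case using V by (auto intro: continuous_on_compose2)
next
 case (Suc k)
 let ?Df = "%x. Df f x" and ?Dg = "%x. Df g x"
 have "Ck_on k U (%x. SUM b:Basis. (?Df x v \<bullet> b) *\<^sub>R ?Dg (f x) b)" for v
  using Suc.prems Ck_on_SucD[OF Suc.prems(1)]
  by (intro Ck_on_sum[OF U] Ck_on_bilinear[OF U bounded_bilinear_scaleR] Suc.IH
    Ck_on_bounded_linear_comp[OF U bounded_linear_inner_left]) auto
 moreover have "((%x. g (f x)) has_derivative (%v. SUM b:Basis. (?Df x v \<bullet> b) *\<^sub>R ?Dg (f x) b)) (at x)"
  if "x : U" for x
 proof -
  have g: "(g has_derivative ?Dg (f x)) (at (f x))" using Suc.prems(2) V that Ck_on_has_derivative by blast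
  have "((%x. g (f x)) has_derivative (%v. ?Dg (f x) (?Df x v))) (at x)"
   by (rule has_derivative_compose[OF Ck_on_has_derivative[OF Suc.prems(1) that] g])
  moreover have "?Dg (f x) (?Df x v) = (SUM b:Basis. (?Df x v \<bullet> b) *\<^sub>R ?Dg (f x) b)" for v
  proof -
   have "linear (?Dg (f x))" using has_derivative_linear[OF g] .
   hence "?Dg (f x) (SUM b:Basis. (?Df x v \<bullet> b) *\<^sub>R b) = (SUM b:Basis. (?Df x v \<bullet> b) *\<^sub>R ?Dg (f x) b)"
    by (simp add: linear_sum linear_cmul)
   thus ?thesis by (simp add: euclidean_representation)
  qed
  ultimately show ?thesis by simp
 qed
 ultimately show ?case by (intro Ck_on_SucI[OF U])
qed

named_theorems smooth_intros

lemma smooth_on_has_derivative: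
 "smooth_on U f ==> x : U ==> (f has_derivative Df f x) (at x)"
 unfolding smooth_on_def by (rule Ck_on_has_derivative) (erule spec)

lemma smooth_on_frechet_derivative: "smooth_on U f ==> smooth_on U (%x. Df f x v)"
 unfolding smooth_on_def by (metis Ck_on.simps(2))

lemma smooth_on_imp_continuous_on: "smooth_on U f ==> continuous_on U f"
 unfolding smooth_on_def by (erule allE[of _ 0]) simp

lemma smooth_on_subset: "smooth_on U f ==> V \<subseteq> U ==> smooth_on V f"
 unfolding smooth_on_def by (blast intro: Ck_on_subset)

lemma smooth_on_cong: "smooth_on U f ==> open U ==> (!!x. x : U ==> f x = g x) ==> smooth_on U g"
 unfolding smooth_on_def by (rule allI, rule Ck_on_cong[where f=f and g=g]) simp_all

lemma smooth_on_local: "(!!x. x : U ==> \<exists>V. open V & x : V & smooth_on V f) ==> smooth_on U f"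
 unfolding smooth_on_def by (rule allI, rule Ck_on_local) blast

lemma smooth_on_const [smooth_intros]: "smooth_on U (%x. c)"
 unfolding smooth_on_def by (rule allI, rule Ck_on_const)

lemma smooth_on_bounded_linear_comp:
 "open U ==> bounded_linear L ==> smooth_on U f ==> smooth_on U (%x. L (f x))"
 unfolding smooth_on_def by (rule allI, rule Ck_on_bounded_linear_comp) simp_all

lemma smooth_on_bounded_linear:
 assumes "bounded_linear L" shows "smooth_on U L"
proof -
 have "Ck_on k UNIV L" for k
 proof (cases k)
  case 0
  thus ?thesis using assms by (simp add: linear_continuous_on)
 next
  case (Suc n)
  show ?thesis unfolding Suc
   by (rule Ck_on_SucI[where f'="%x. L"]) (simp_all add: assms bounded_linear_imp_has_derivative Ck_on_const)
 qed
 thus ?thesis unfolding smooth_on_def using Ck_on_subset[OF _ subset_UNIV] by blast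
qed

lemma smooth_on_ident [smooth_intros]: "smooth_on U (%x. x)"
 by (rule smooth_on_bounded_linear[OF bounded_linear_ident])

lemma smooth_on_add [smooth_intros]:
 "open U ==> smooth_on U f ==> smooth_on U g ==> smooth_on U (%x. f x + g x)"
 unfolding smooth_on_def by (rule allI, rule Ck_on_add) simp_all

lemma smooth_on_sum [smooth_intros]:
 "open U ==> (!!i. i : I ==> smooth_on U (f i)) ==> smooth_on U (%x. SUM i:I. f i x)"
 unfolding smooth_on_def by (rule allI, rule Ck_on_sum) simp_all

lemma smooth_on_bilinear:
 "open U ==> bounded_bilinear p ==> smooth_on U f ==> smooth_on U g ==> smooth_on U (%x. p (f x) (g x))"
 unfolding smooth_on_def by (rule allI, rule Ck_on_bilinear[where f=f and g=g]) simp_all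

lemmas smooth_on_scaleR [smooth_intros] = smooth_on_bilinear[OF _ bounded_bilinear_scaleR]
 and smooth_on_inner [smooth_intros] = smooth_on_bilinear[OF _ bounded_bilinear_inner]
 and smooth_on_mult [smooth_intros] = smooth_on_bilinear[OF _ bounded_bilinear_mult]
 and smooth_on_minus [smooth_intros] = smooth_on_bounded_linear_comp[OF _ bounded_linear_minus[OF bounded_linear_ident]]
 and smooth_on_Re [smooth_intros] = smooth_on_bounded_linear_comp[OF _ bounded_linear_Re]
 and smooth_on_Im [smooth_intros] = smooth_on_bounded_linear_comp[OF _ bounded_linear_Im]
 and smooth_on_of_real [smooth_intros] = smooth_on_bounded_linear_comp[OF _ bounded_linear_of_real]
 and smooth_on_fst [smooth_intros] = smooth_on_bounded_linear_comp[OF _ bounded_linear_fst]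
 and smooth_on_snd [smooth_intros] = smooth_on_bounded_linear_comp[OF _ bounded_linear_snd]
 and smooth_on_vec_nth [smooth_intros] = smooth_on_bounded_linear_comp[OF _ bounded_linear_vec_nth]

lemma smooth_on_diff [smooth_intros]:
 "open U ==> smooth_on U f ==> smooth_on U g ==> smooth_on U (%x. f x - g x)"
 using smooth_on_add[of U f "%x. - g x"] smooth_on_minus[of U g] by simp

lemma smooth_on_componentwise:
 fixes f :: "'e::euclidean_space => 'f::euclidean_space"
 shows "open U ==> (!!b. b : Basis ==> smooth_on U (%x. f x \<bullet> b)) ==> smooth_on U f"
 unfolding smooth_on_def by (rule allI, rule Ck_on_componentwise) simp_all

lemma smooth_on_vec_lambda:
 fixes f :: "'e::euclidean_space => real^'n"
 shows "open U ==> (!!i. smooth_on U (%x. f x $ i)) ==> smooth_on U f"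
 by (rule smooth_on_componentwise) (auto simp: Basis_vec_def inner_axis)

lemma smooth_on_Pair [smooth_intros]:
 fixes f :: "'e::euclidean_space => 'f::euclidean_space" and g :: "'e => 'g::euclidean_space"
 shows "open U ==> smooth_on U f ==> smooth_on U g ==> smooth_on U (%x. (f x, g x))"
 by (rule smooth_on_componentwise)
  (auto simp: Basis_prod_def inner_Pair, (rule smooth_on_inner[OF _ _ smooth_on_const]; assumption)+)

lemma smooth_on_Complex [smooth_intros]:
 "open U ==> smooth_on U f ==> smooth_on U g ==> smooth_on U (%x. Complex (f x) (g x))"
 by (rule smooth_on_componentwise) (auto simp: Basis_complex_def inner_complex_def)

lemma smooth_on_compose:
 fixes f :: "'e::euclidean_space => 'f::euclidean_space" and g :: "'f => 'h::real_normed_vector"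
 shows "smooth_on V g ==> open U ==> smooth_on U f ==> (!!x. x : U ==> f x : V) ==> smooth_on U (%x. g (f x))"
 unfolding smooth_on_def by (rule allI, rule Ck_on_compose[where V=V]) auto

lemma smooth_on_power [smooth_intros]:
 fixes f :: "'e::euclidean_space => 'b::real_normed_field"
 shows "open U ==> smooth_on U f ==> smooth_on U (%x. f x ^ n)"
 by (induction n) (auto intro!: smooth_intros)

text \<open>Holomorphic functions are infinitely differentiable in the real sense, because
  their derivatives are holomorphic again. This yields the smoothness of all elementary
  functions below.\<close>

lemma holomorphic_on_imp_smooth_on:
 assumes "open U" "f holomorphic_on U"
 shows "smooth_on U f"
proof -
 have "Ck_on k U f" for k
  using assms(2)
 proof (induction k arbitrary: f)
  case 0
  thus ?case by (simp add: holomorphic_on_imp_continuous_on)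
 next
  case (Suc k)
  show ?case
  proof (rule Ck_on_SucI[OF assms(1)])
   show "(f has_derivative (%v. deriv f x * v)) (at x)" if "x : U" for x
    using Suc.prems assms(1) that holomorphic_derivI has_field_derivative_imp_has_derivative by blast
   show "Ck_on k U (%x. deriv f x * v)" for v
    using Suc assms(1) by (intro Suc.IH holomorphic_intros) auto
  qed
 qed
 thus ?thesis unfolding smooth_on_def by blast
qed

lemma smooth_on_holomorphic_comp:
 assumes "g holomorphic_on V" "open V" "open U" "smooth_on U f" "!!x. x : U ==> f x : V"
 shows "smooth_on U (%x. g (f x))"
 using smooth_on_compose[OF holomorphic_on_imp_smooth_on] assms by blast

lemma smooth_on_cexp [smooth_intros]:
 fixes f :: "'e::euclidean_space => complex"
 shows "open U ==> smooth_on U f ==> smooth_on U (%x. exp (f x))"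
 by (rule smooth_on_holomorphic_comp[of exp UNIV]) (auto intro!: holomorphic_intros)

lemma smooth_on_cinverse [smooth_intros]:
 fixes f :: "'e::euclidean_space => complex"
 shows "open U ==> smooth_on U f ==> (!!x. x : U ==> f x ~= 0) ==> smooth_on U (%x. inverse (f x))"
 by (rule smooth_on_holomorphic_comp[of inverse "-{0}"]) (auto intro!: holomorphic_intros)

lemma smooth_on_cdivide [smooth_intros]:
 fixes f :: "'e::euclidean_space => complex"
 shows "open U ==> smooth_on U f ==> smooth_on U g ==> (!!x. x : U ==> g x ~= 0) ==> smooth_on U (%x. f x / g x)"
 by (auto simp: divide_inverse intro!: smooth_intros)

lemma smooth_on_Ln [smooth_intros]:
 fixes f :: "'e::euclidean_space => complex"
 shows "open U ==> smooth_on U f ==> (!!x. x : U ==> f x \<notin> \<real>\<^sub>\<le>\<^sub>0) ==> smooth_on U (%x. Ln (f x))"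
 by (rule smooth_on_holomorphic_comp[of Ln "-\<real>\<^sub>\<le>\<^sub>0"]) (auto intro!: holomorphic_intros simp: open_Compl)

lemma smooth_on_exp [smooth_intros]:
 fixes f :: "'e::euclidean_space => real"
 assumes "open U" "smooth_on U f" shows "smooth_on U (%x. exp (f x))"
proof -
 have "smooth_on U (%x. Re (exp (of_real (f x))))" using assms by (intro smooth_intros)
 thus ?thesis by (simp add: exp_of_real)
qed

lemma smooth_on_inverse [smooth_intros]:
 fixes f :: "'e::euclidean_space => real"
 assumes "open U" "smooth_on U f" "!!x. x : U ==> f x ~= 0" shows "smooth_on U (%x. inverse (f x))"
proof -
 have "smooth_on U (%x. Re (inverse (of_real (f x))))" using assms by (intro smooth_intros) auto
 thus ?thesis by (simp flip: of_real_inverse)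
qed

lemma smooth_on_divide [smooth_intros]:
 fixes f :: "'e::euclidean_space => real"
 shows "open U ==> smooth_on U f ==> smooth_on U g ==> (!!x. x : U ==> g x ~= 0) ==> smooth_on U (%x. f x / g x)"
 by (auto simp: divide_inverse intro!: smooth_intros)

lemma smooth_on_ln [smooth_intros]:
 fixes f :: "'e::euclidean_space => real"
 assumes "open U" "smooth_on U f" "!!x. x : U ==> f x > 0" shows "smooth_on U (%x. ln (f x))"
proof -
 have "smooth_on U (%x. Re (Ln (of_real (f x))))" using assms
  by (intro smooth_intros) (auto simp: complex_nonpos_Reals_iff not_le)
 thus ?thesis by (rule smooth_on_cong[OF _ assms(1)]) (use assms in "simp add: Ln_of_real")
qed

lemma smooth_on_sin [smooth_intros]:
 fixes f :: "'e::euclidean_space => real"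
 assumes "open U" "smooth_on U f" shows "smooth_on U (%x. sin (f x))"
proof -
 have "smooth_on U (%x. Im (exp (\<i> * of_real (f x))))" using assms by (intro smooth_intros)
 thus ?thesis by (simp add: Im_exp)
qed

lemma smooth_on_cos [smooth_intros]:
 fixes f :: "'e::euclidean_space => real"
 assumes "open U" "smooth_on U f" shows "smooth_on U (%x. cos (f x))"
proof -
 have "smooth_on U (%x. Re (exp (\<i> * of_real (f x))))" using assms by (intro smooth_intros)
 thus ?thesis by (simp add: Re_exp)
qed

section \<open>Symmetry of second derivatives, cut-off functions and Hadamard's lemma\<close>

lemma smooth_on_has_real_derivative_line:
 fixes f :: "'e::euclidean_space => real"
 assumes "smooth_on U f" "a + s *\<^sub>R v : U"
 shows "((%s. f (a + s *\<^sub>R v)) has_real_derivative Df f (a + s *\<^sub>R v) v) (at s)"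
proof -
 have f: "(f has_derivative Df f (a + s *\<^sub>R v)) (at (a + s *\<^sub>R v))"
  by (rule smooth_on_has_derivative[OF assms])
 have "((%s. a + s *\<^sub>R v) has_derivative (%h. h *\<^sub>R v)) (at s)"
  by (auto intro!: derivative_eq_intros)
 from has_derivative_compose[OF this f]
 have "((%s. f (a + s *\<^sub>R v)) has_derivative (%h. Df f (a + s *\<^sub>R v) (h *\<^sub>R v))) (at s)" .
 moreover have "Df f (a + s *\<^sub>R v) (h *\<^sub>R v) = Df f (a + s *\<^sub>R v) v * h" for h
  using linear_cmul[OF has_derivative_linear[OF f]] by simp
 ultimately show ?thesis by (simp add: has_field_derivative_def)
qed

text \<open>The second difference quotient of \<open>f\<close> is a mixed second derivative at an intermediate
  point. As the quotient is symmetric in the two directions, so are the second derivatives.\<close>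

lemma second_difference_mean_value:
 fixes f :: "'e::euclidean_space => real"
 assumes f: "smooth_on U f" and h: "h > 0"
  and U: "!!s t. 0 <= s ==> s <= h ==> 0 <= t ==> t <= h ==> x + s *\<^sub>R v + t *\<^sub>R w : U"
 shows "\<exists>s t. 0 < s & s < h & 0 < t & t < h \<and>
  f (x + h *\<^sub>R v + h *\<^sub>R w) - f (x + h *\<^sub>R v) - f (x + h *\<^sub>R w) + f x =
   h\<^sup>2 * Df (%y. Df f y v) (x + s *\<^sub>R v + t *\<^sub>R w) w"
proof -
 let ?Df = "%y. Df f y v"
 have "\<exists>s. s > 0 & s < h \<and>
  (f ((x + h *\<^sub>R w) + h *\<^sub>R v) - f (x + h *\<^sub>R v)) - (f ((x + h *\<^sub>R w) + 0 *\<^sub>R v) - f (x + 0 *\<^sub>R v)) =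
   (h - 0) * (?Df ((x + h *\<^sub>R w) + s *\<^sub>R v) - ?Df (x + s *\<^sub>R v))"
 proof (rule MVT2[OF h])
  fix s assume s: "0 <= s" "s <= h"
  have 1: "x + s *\<^sub>R v : U" using U[of s 0] s h by simp
  have 2: "(x + h *\<^sub>R w) + s *\<^sub>R v : U" using U[of s h] s h by (simp add: algebra_simps)
  show "((%s. f ((x + h *\<^sub>R w) + s *\<^sub>R v) - f (x + s *\<^sub>R v)) has_real_derivative
    ?Df ((x + h *\<^sub>R w) + s *\<^sub>R v) - ?Df (x + s *\<^sub>R v)) (at s)"
   by (intro DERIV_diff smooth_on_has_real_derivative_line[OF f] 1 2)
 qed
 then obtain s where s: "s > 0" "s < h"
  "(f ((x + h *\<^sub>R w) + h *\<^sub>R v) - f (x + h *\<^sub>R v)) - (f ((x + h *\<^sub>R w) + 0 *\<^sub>R v) - f (x + 0 *\<^sub>R v)) =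
   (h - 0) * (?Df ((x + h *\<^sub>R w) + s *\<^sub>R v) - ?Df (x + s *\<^sub>R v))"
  by blast
 have "\<exists>t. t > 0 & t < h & ?Df ((x + s *\<^sub>R v) + h *\<^sub>R w) - ?Df ((x + s *\<^sub>R v) + 0 *\<^sub>R w) =
   (h - 0) * Df ?Df ((x + s *\<^sub>R v) + t *\<^sub>R w) w"
 proof (rule MVT2[OF h])
  fix t assume t: "0 <= t" "t <= h"
  have "(x + s *\<^sub>R v) + t *\<^sub>R w : U" using U[of s t] s t h by simp
  thus "((%t. ?Df ((x + s *\<^sub>R v) + t *\<^sub>R w)) has_real_derivative
    Df ?Df ((x + s *\<^sub>R v) + t *\<^sub>R w) w) (at t)"
   by (rule smooth_on_has_real_derivative_line[OF smooth_on_frechet_derivative[OF f]])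
 qed
 then obtain t where t: "t > 0" "t < h" "?Df ((x + s *\<^sub>R v) + h *\<^sub>R w) - ?Df ((x + s *\<^sub>R v) + 0 *\<^sub>R w) =
   (h - 0) * Df ?Df ((x + s *\<^sub>R v) + t *\<^sub>R w) w"
  by blast
 have e: "(x + h *\<^sub>R w) + s *\<^sub>R v = (x + s *\<^sub>R v) + h *\<^sub>R w" "(x + h *\<^sub>R w) + h *\<^sub>R v = x + h *\<^sub>R v + h *\<^sub>R w"
  by (simp_all add: algebra_simps)
 have s3: "f (x + h *\<^sub>R v + h *\<^sub>R w) - f (x + h *\<^sub>R v) - (f (x + h *\<^sub>R w) - f x) =
   h * (?Df (x + s *\<^sub>R v + h *\<^sub>R w) - ?Df (x + s *\<^sub>R v))"
  using s(3) unfolding e by simp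
 have t3: "?Df (x + s *\<^sub>R v + h *\<^sub>R w) - ?Df (x + s *\<^sub>R v) =
   h * Df ?Df (x + s *\<^sub>R v + t *\<^sub>R w) w"
  using t(3) by simp
 have "f (x + h *\<^sub>R v + h *\<^sub>R w) - f (x + h *\<^sub>R v) - f (x + h *\<^sub>R w) + f x =
   h\<^sup>2 * Df ?Df (x + s *\<^sub>R v + t *\<^sub>R w) w"
  using s3 unfolding t3 by (simp add: power2_eq_square)
 thus ?thesis using s t by blast
qed

lemma smooth_on_second_derivative_symmetric:
 fixes f :: "'e::euclidean_space => real"
 assumes U: "open U" "x : U" and f: "smooth_on U f"
 shows "Df (%y. Df f y v) x w =
     Df (%y. Df f y w) x v"
proof (rule ccontr)
 define P where "P = (%y. Df (%y. Df f y v) y w)"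
 define Q where "Q = (%y. Df (%y. Df f y w) y v)"
 assume "\<not> ?thesis"
 hence ne: "P x ~= Q x" by (simp add: P_def Q_def)
 have "continuous_on U P" "continuous_on U Q" unfolding P_def Q_def
  by (intro smooth_on_imp_continuous_on smooth_on_frechet_derivative f)+
 hence c: "isCont P x" "isCont Q x" using U by (auto simp: continuous_on_eq_continuous_at)
 define e where "e = \<bar>P x - Q x\<bar> / 2"
 have e: "e > 0" using ne by (simp add: e_def)
 obtain d1 where d1: "d1 > 0" "!!y. dist y x < d1 ==> dist (P y) (P x) < e"
  using c(1) e unfolding continuous_at_eps_delta by (metis dist_commute)
 obtain d2 where d2: "d2 > 0" "!!y. dist y x < d2 ==> dist (Q y) (Q x) < e"
  using c(2) e unfolding continuous_at_eps_delta by (metis dist_commute)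
 obtain d3 where d3: "d3 > 0" "ball x d3 \<subseteq> U" using U open_contains_ball by blast
 define d where "d = min d1 (min d2 d3)"
 have d: "d > 0" using d1 d2 d3 by (simp add: d_def)
 define h where "h = d / (norm v + norm w + 1)"
 have np: "norm v + norm w + 1 > 0" by (simp add: add_nonneg_pos)
 have h: "h > 0" using d np by (simp add: h_def)
 have hd: "h * (norm v + norm w) < d"
 proof -
  have "h * (norm v + norm w + 1) = d" using np by (simp add: h_def)
  thus ?thesis using h by (simp add: algebra_simps)
 qed
 have close: "dist (x + s *\<^sub>R a + t *\<^sub>R b) x < d"
  if "0 <= s" "s <= h" "0 <= t" "t <= h" "{a, b} = {v, w}" for s t a b
 proof -
  have "dist (x + s *\<^sub>R a + t *\<^sub>R b) x <= norm (s *\<^sub>R a) + norm (t *\<^sub>R b)"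
   unfolding dist_norm by (metis add.assoc add_diff_cancel_left' norm_triangle_ineq)
  also have "\<dots> <= h * norm a + h * norm b" using that
   by (simp add: mult_right_mono add_mono)
  also have "\<dots> = h * (norm v + norm w)" using that(5) by (auto simp: doubleton_eq_iff algebra_simps)
  also have "\<dots> < d" by (rule hd)
  finally show ?thesis .
 qed
 have inU: "x + s *\<^sub>R a + t *\<^sub>R b : U"
  if "0 <= s" "s <= h" "0 <= t" "t <= h" "{a, b} = {v, w}" for s t a b
  using close[OF that] d3 by (auto simp: d_def dist_commute subset_iff)
 obtain s t where st: "0 < s" "s < h" "0 < t" "t < h"
  "f (x + h *\<^sub>R v + h *\<^sub>R w) - f (x + h *\<^sub>R v) - f (x + h *\<^sub>R w) + f x = h\<^sup>2 * P (x + s *\<^sub>R v + t *\<^sub>R w)"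
  using second_difference_mean_value[OF f h, of x v w] inU unfolding P_def by blast
 obtain s' t' where st': "0 < s'" "s' < h" "0 < t'" "t' < h"
  "f (x + h *\<^sub>R w + h *\<^sub>R v) - f (x + h *\<^sub>R w) - f (x + h *\<^sub>R v) + f x = h\<^sup>2 * Q (x + s' *\<^sub>R w + t' *\<^sub>R v)"
  using second_difference_mean_value[OF f h, of x w v] inU unfolding Q_def by blast
 have "h\<^sup>2 * P (x + s *\<^sub>R v + t *\<^sub>R w) = h\<^sup>2 * Q (x + s' *\<^sub>R w + t' *\<^sub>R v)"
  using st(5) st'(5) by (simp add: algebra_simps)
 hence eq: "P (x + s *\<^sub>R v + t *\<^sub>R w) = Q (x + s' *\<^sub>R w + t' *\<^sub>R v)" using h by simp
 have "dist (P (x + s *\<^sub>R v + t *\<^sub>R w)) (P x) < e" using close[of s t v w] st d1 by (simp add: d_def)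
 moreover have "dist (Q (x + s' *\<^sub>R w + t' *\<^sub>R v)) (Q x) < e"
  using close[of s' t' w v] st' d2 by (simp add: d_def insert_commute)
 ultimately show False using eq by (simp add: e_def dist_real_def abs_if split: if_splits)
qed

text \<open>The functions \<open>exp (- 1 / t) / t ^ n\<close>, extended by zero to \<open>t \<le> 0\<close>: all of them together,
  because the derivative of each is a combination of two others.\<close>

definition flat_exp :: "nat => real => real" where
 "flat_exp n t = (if t > 0 then exp (- 1 / t) / t ^ n else 0)"

lemma flat_exp_tendsto_0: "(flat_exp n \<longlongrightarrow> 0) (at 0)"
proof -
 have "((%x. inverse x ^ n / exp (inverse x)) \<longlongrightarrow> (0::real)) (at_right 0)"
  by (rule filterlim_compose[OF tendsto_power_div_exp_0 filterlim_inverse_at_top_right])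
 moreover have "\<forall>\<^sub>F x::real in at_right 0. inverse x ^ n / exp (inverse x) = flat_exp n x"
  by (rule eventually_at_rightI[of 0 1])
   (auto simp: flat_exp_def exp_minus divide_simps power_inverse)
 ultimately have "(flat_exp n \<longlongrightarrow> 0) (at_right 0)" using tendsto_cong by fast
 moreover have "(flat_exp n \<longlongrightarrow> 0) (at_left 0)"
 proof -
  have "\<forall>\<^sub>F x::real in at_left 0. 0 = flat_exp n x"
   by (rule eventually_at_leftI[of "-1"]) (auto simp: flat_exp_def)
  thus ?thesis using tendsto_cong tendsto_const by fast
 qed
 ultimately show ?thesis by (rule filterlim_split_at_real[rotated])
qed

lemma flat_exp_has_derivative:
 "(flat_exp n has_real_derivative flat_exp (n + 2) t - n * flat_exp (n + 1) t) (at t)"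
proof -
 consider "t > 0" | "t < 0" | "t = 0" by linarith
 thus ?thesis
 proof cases
  case 1
  have "((%t. exp (- 1 / t) / t ^ n) has_real_derivative flat_exp (n + 2) t - n * flat_exp (n + 1) t) (at t)"
  proof (rule DERIV_cong)
   have "((%t. - 1 / t) has_real_derivative 1 / t\<^sup>2) (at t)"
    using 1 by (auto intro!: derivative_eq_intros simp: power2_eq_square)
   from DERIV_divide[OF DERIV_fun_exp[OF this] DERIV_pow]
   show "((%t. exp (- 1 / t) / t ^ n) has_real_derivative
     (exp (- 1 / t) * (1 / t\<^sup>2) * t ^ n - exp (- 1 / t) * (n * t ^ (n - Suc 0))) / (t ^ n * t ^ n)) (at t)"
    using 1 by simp
   show "(exp (- 1 / t) * (1 / t\<^sup>2) * t ^ n - exp (- 1 / t) * (n * t ^ (n - Suc 0))) / (t ^ n * t ^ n) =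
     flat_exp (n + 2) t - n * flat_exp (n + 1) t"
    using 1 by (cases n) (simp_all add: flat_exp_def field_simps power2_eq_square)
  qed
  thus ?thesis
   by (rule has_field_derivative_transform_within_open[of _ _ _ "{0<..}"]) (use 1 in "auto simp: flat_exp_def")
 next
  case 2
  have "((%t. 0) has_real_derivative flat_exp (n + 2) t - n * flat_exp (n + 1) t) (at t)"
   using 2 by (auto simp: flat_exp_def)
  thus ?thesis
   by (rule has_field_derivative_transform_within_open[of _ _ _ "{..<0}"]) (use 2 in "auto simp: flat_exp_def")
 next
  case 3
  have "(%h. (flat_exp n (0 + h) - flat_exp n 0) / h) = flat_exp (n + 1)"
   by (auto simp: flat_exp_def field_simps)
  thus ?thesis unfolding DERIV_def 3 using flat_exp_tendsto_0[of "n + 1"] by (simp add: flat_exp_def)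
 qed
qed

lemma smooth_on_flat_exp: "smooth_on UNIV (flat_exp n)"
proof -
 have "Ck_on k UNIV (flat_exp n)" for k
 proof (induction k arbitrary: n)
  case 0
  thus ?case using DERIV_isCont[OF flat_exp_has_derivative] by (auto intro: continuous_at_imp_continuous_on)
 next
  case (Suc k)
  show ?case
  proof (rule Ck_on_SucI)
   show "(flat_exp n has_derivative (%v. v *\<^sub>R flat_exp (n + 2) t + (- v * n) *\<^sub>R flat_exp (n + 1) t)) (at t)" for t
    using flat_exp_has_derivative[of n t] unfolding has_field_derivative_def
    by (rule has_derivative_eq_rhs) (simp add: fun_eq_iff algebra_simps)
   show "Ck_on k UNIV (%t. v *\<^sub>R flat_exp (n + 2) t + (- v * n) *\<^sub>R flat_exp (n + 1) t)" for v
    using Suc.IH by (intro Ck_on_add Ck_on_bilinear[OF _ bounded_bilinear_scaleR] Ck_on_const) auto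
  qed simp
 qed
 thus ?thesis unfolding smooth_on_def by blast
qed

lemma exists_cutoff_function:
 fixes c :: "'e::euclidean_space"
 assumes "open W" "c : W"
 obtains \<eta> :: "'e => real" and V K where "smooth_on UNIV \<eta>" "open V" "c : V" "V \<subseteq> K"
  "!!x. x : V ==> \<eta> x = 1" "compact K" "K \<subseteq> W" "!!x. x \<notin> K ==> \<eta> x = 0"
proof -
 obtain r where r: "r > 0" "cball c r \<subseteq> W" using assms open_contains_cball by blast
 define u where "u = (%x. 2 - 2 * ((x - c) \<bullet> (x - c)) / r\<^sup>2)"
 define \<eta> where "\<eta> = (%x. flat_exp 0 (u x) / (flat_exp 0 (u x) + flat_exp 0 (1 - u x)))"
 have pos: "flat_exp 0 t + flat_exp 0 (1 - t) > 0" for t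
  by (cases "t > 0") (auto simp: flat_exp_def add_pos_nonneg)
 have u: "smooth_on UNIV u" unfolding u_def using r by (intro smooth_intros) auto
 have fu: "smooth_on UNIV (%x. flat_exp 0 (u x))" "smooth_on UNIV (%x. flat_exp 0 (1 - u x))"
  by (intro smooth_on_compose[OF smooth_on_flat_exp] smooth_intros u open_UNIV UNIV_I)+
 have "smooth_on UNIV \<eta>" unfolding \<eta>_def
  by (intro smooth_intros fu open_UNIV) (metis pos less_irrefl)
 moreover define V where "V = {x. (x - c) \<bullet> (x - c) < r\<^sup>2 / 2}"
 moreover have "open V" unfolding V_def by (intro open_Collect_less continuous_intros)
 moreover have "c : V" using r by (simp add: V_def)
 moreover have "V \<subseteq> cball c r"
 proof
  fix x assume "x : V"
  hence "(norm (x - c))\<^sup>2 <= r\<^sup>2"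
   by (simp add: V_def power2_norm_eq_inner field_simps) (use inner_ge_zero[of "x - c"] in linarith)
  hence "norm (x - c) <= r" using r by (simp add: power2_le_iff_abs_le)
  thus "x : cball c r" by (simp add: dist_norm norm_minus_commute)
 qed
 moreover have "\<eta> x = 1" if "x : V" for x
 proof -
  have "u x > 1" using that r by (simp add: V_def u_def field_simps)
  thus ?thesis by (simp add: \<eta>_def flat_exp_def)
 qed
 moreover have "compact (cball c r)" "cball c r \<subseteq> W" using r by auto
 moreover have "\<eta> x = 0" if "x \<notin> cball c r" for x
 proof -
  have "norm (x - c) > r" using that by (simp add: dist_norm norm_minus_commute)
  hence "(norm (x - c))\<^sup>2 > r\<^sup>2" using r by (simp add: power_strict_mono)
  hence "u x <= 0" using r by (simp add: u_def power2_norm_eq_inner field_simps)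
  thus ?thesis by (simp add: \<eta>_def flat_exp_def)
 qed
 ultimately show thesis using that by blast
qed

lemma segment_integral_has_derivative:
 fixes h :: "'e::euclidean_space => real"
 assumes h: "smooth_on (ball c r) h" and x: "x : ball c r"
 shows "((%x. integral (cbox 0 1) (%t. t ^ n * h (c + t *\<^sub>R (x - c)))) has_derivative
  (%v. integral (cbox 0 1) (%t. t ^ Suc n * Df h (c + t *\<^sub>R (x - c)) v))) (at x)"
proof -
 let ?B = "ball c r"
 let ?p = "%x t. c + t *\<^sub>R (x - c)"
 have inB: "?p x t : ?B" if "x : ?B" "t : cbox 0 1" for x t
 proof -
  have "\<bar>t\<bar> * norm (x - c) <= 1 * norm (x - c)" using that(2) by (intro mult_right_mono) auto
  thus ?thesis using that by (simp add: dist_norm norm_minus_commute)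
 qed
 let ?f' = "%x t v. t ^ Suc n * Df h (?p x t) v"
 have dh: "(h has_derivative Df h (?p x t)) (at (?p x t))"
  if "x : ?B" "t : cbox 0 1" for x t
  by (rule smooth_on_has_derivative[OF h inB[OF that]])
 have bl: "bounded_linear (?f' x t)" if "x : ?B" "t : cbox 0 1" for x t
  using dh[OF that] by (intro bounded_linear_const_mult) (auto dest: has_derivative_bounded_linear)
 define F where "F = (%x t. Blinfun (?f' x t))"
 have F: "blinfun_apply (F x t) = ?f' x t" if "x : ?B" "t : cbox 0 1" for x t
  unfolding F_def using bl[OF that] by (rule bounded_linear_Blinfun_apply)
 have cont: "continuous_on (?B \<times> cbox 0 1) (%(x, t). F x t)"
 proof (rule continuous_on_blinfun_componentwise)
  fix i :: 'e
  have "continuous_on ?B (%y. Df h y i)"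
   by (intro smooth_on_imp_continuous_on smooth_on_frechet_derivative h)
  hence "continuous_on (?B \<times> cbox 0 1) (%z. Df h (?p (fst z) (snd z)) i)"
   by (rule continuous_on_compose2) (use inB in "auto intro!: continuous_intros simp del: mem_ball mem_box")
  hence "continuous_on (?B \<times> cbox 0 1) (%z. ?f' (fst z) (snd z) i)"
   by (intro continuous_intros)
  thus "continuous_on (?B \<times> cbox 0 1) (%z. blinfun_apply (case z of (x, t) => F x t) i)"
   by (rule continuous_on_cong[THEN iffD1, rotated 2, OF _ refl]) (auto simp: F simp del: mem_ball mem_box)
 qed
 have "((%x. integral (cbox 0 1) (%t. t ^ n * h (?p x t))) has_derivative
   blinfun_apply (integral (cbox 0 1) (F x))) (at x within ?B)"
 proof (rule leibniz_rule[OF _ _ cont x convex_ball])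
  fix x t assume xt: "x : ?B" "t : cbox 0 (1::real)"
  have "((%x. ?p x t) has_derivative (%v. t *\<^sub>R v)) (at x)"
   by (auto intro!: derivative_eq_intros)
  from has_derivative_compose[OF this dh[OF xt]]
  have "((%x. t ^ n * h (?p x t)) has_derivative (%v. t ^ n * Df h (?p x t) (t *\<^sub>R v))) (at x)"
   by (rule has_derivative_mult_right)
  moreover have "(%v. t ^ n * Df h (?p x t) (t *\<^sub>R v)) = ?f' x t"
   using linear_cmul[OF has_derivative_linear[OF dh[OF xt]]] by (auto simp: mult_ac)
  ultimately show "((%x. t ^ n * h (?p x t)) has_derivative blinfun_apply (F x t)) (at x within ?B)"
   using F[OF xt] has_derivative_at_withinI by metis
 next
  fix x assume xB: "x : ?B"
  have "continuous_on (cbox 0 1) (%t. h (?p x t))"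
   by (rule continuous_on_compose2[OF smooth_on_imp_continuous_on[OF h]])
    (use inB[OF xB] in "auto intro!: continuous_intros simp del: mem_ball mem_box")
  thus "(%t. t ^ n * h (?p x t)) integrable_on cbox 0 1"
   by (intro integrable_continuous continuous_intros)
 qed
 moreover have "F x integrable_on cbox 0 1"
 proof (rule integrable_continuous)
  show "continuous_on (cbox 0 1) (F x)"
   by (rule continuous_on_compose2[OF cont, of _ "%t. (x, t)", simplified split]) (use x in "auto intro!: continuous_intros")
 qed
 hence "blinfun_apply (integral (cbox 0 1) (F x)) v = integral (cbox 0 1) (%t. blinfun_apply (F x t) v)" for v
  using integral_linear[of "F x" "cbox 0 1" "%G. blinfun_apply G v"] blinfun.bounded_linear_left[of v]
  by (simp add: o_def)
 moreover have "integral (cbox 0 1) (%t. blinfun_apply (F x t) v) = integral (cbox 0 1) (%t. ?f' x t v)" for v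
  by (rule integral_cong) (use F[OF x] in auto)
 ultimately have "((%x. integral (cbox 0 1) (%t. t ^ n * h (?p x t))) has_derivative
   (%v. integral (cbox 0 1) (%t. ?f' x t v))) (at x within ?B)"
  by (metis (no_types, lifting) ext)
 thus ?thesis using x at_within_open[OF x open_ball] by metis
qed

lemma smooth_on_segment_integral:
 fixes h :: "'e::euclidean_space => real"
 assumes "smooth_on (ball c r) h"
 shows "smooth_on (ball c r) (%x. integral (cbox 0 1) (%t. t ^ n * h (c + t *\<^sub>R (x - c))))"
proof -
 have "Ck_on k (ball c r) (%x. integral (cbox 0 1) (%t. t ^ n * h (c + t *\<^sub>R (x - c))))" for k
  using assms
 proof (induction k arbitrary: n h)
  case 0
  show ?case
   using segment_integral_has_derivative[OF 0] has_derivative_continuous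
   by (fastforce intro: continuous_at_imp_continuous_on)
 next
  case (Suc k)
  show ?case
   by (rule Ck_on_SucI[OF open_ball segment_integral_has_derivative[OF Suc.prems]])
    (assumption, rule Suc.IH[OF smooth_on_frechet_derivative[OF Suc.prems]])
 qed
 thus ?thesis unfolding smooth_on_def by blast
qed

text \<open>Hadamard's lemma: the integral \<open>g b x\<close> of the derivative \<open>D\<^sub>b f\<close> over the segment from \<open>c\<close> to \<open>x\<close> depends
  smoothly on \<open>x\<close>.\<close>

lemma Hadamard_lemma:
 fixes f :: "'e::euclidean_space => real"
 assumes f: "smooth_on (ball c r) f" and r: "r > 0"
 obtains g where "!!b. smooth_on (ball c r) (g b)" "!!b. g b c = Df f c b"
  "!!x. x : ball c r ==> f x = f c + (SUM b:Basis. ((x - c) \<bullet> b) * g b x)"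
proof -
 let ?p = "%x t. c + t *\<^sub>R (x - c)"
 define g where "g = (%b x. integral (cbox 0 1) (%t. t ^ 0 * Df f (?p x t) b))"
 have "smooth_on (ball c r) (g b)" for b
  unfolding g_def by (rule smooth_on_segment_integral[OF smooth_on_frechet_derivative[OF f]])
 moreover have "g b c = Df f c b" for b by (simp add: g_def)
 moreover have "f x = f c + (SUM b:Basis. ((x - c) \<bullet> b) * g b x)" if x: "x : ball c r" for x
 proof -
  have inB: "?p x t : ball c r" if "t : {0..1}" for t
  proof -
   have "\<bar>t\<bar> * norm (x - c) <= 1 * norm (x - c)" using that by (intro mult_right_mono) auto
   thus ?thesis using x by (simp add: dist_norm norm_minus_commute)
  qed
  have int: "(%t. Df f (?p x t) b) integrable_on {0..1}" for b
  proof -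
   have "continuous_on (ball c r) (%y. Df f y b)"
    by (intro smooth_on_imp_continuous_on smooth_on_frechet_derivative f)
   hence "continuous_on {0..1} (%t. Df f (?p x t) b)"
    by (rule continuous_on_compose2) (use inB in "auto intro!: continuous_intros simp del: mem_ball")
   thus ?thesis by (rule integrable_continuous_interval)
  qed
  have "((%t. Df f (?p x t) (x - c)) has_integral (f (?p x 1) - f (?p x 0))) {0..1}"
  proof (rule fundamental_theorem_of_calculus)
   fix t :: real assume "t : {0..1}"
   thus "((%t. f (?p x t)) has_vector_derivative Df f (?p x t) (x - c)) (at t within {0..1})"
    using smooth_on_has_real_derivative_line[OF f inB]
    by (auto simp: has_real_derivative_iff_has_vector_derivative intro: has_vector_derivative_at_within)
  qed simp
  hence "f x - f c = integral {0..1} (%t. Df f (?p x t) (x - c))"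
   by (simp add: integral_unique)
  also have "\<dots> = integral {0..1} (%t. SUM b:Basis. ((x - c) \<bullet> b) * Df f (?p x t) b)"
  proof (rule integral_cong)
   fix t :: real assume "t : {0..1}"
   hence l: "linear (Df f (?p x t))"
    using smooth_on_has_derivative[OF f inB] has_derivative_linear by blast
   have "Df f (?p x t) (SUM b:Basis. ((x - c) \<bullet> b) *\<^sub>R b) =
     (SUM b:Basis. ((x - c) \<bullet> b) * Df f (?p x t) b)"
    by (simp add: linear_sum[OF l] linear_cmul[OF l])
   thus "Df f (?p x t) (x - c) =
     (SUM b:Basis. ((x - c) \<bullet> b) * Df f (?p x t) b)"
    by (simp only: euclidean_representation)
  qed
  also have "\<dots> = (SUM b:Basis. integral {0..1} (%t. ((x - c) \<bullet> b) * Df f (?p x t) b))"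
   by (rule integral_sum) (auto intro: integrable_on_mult_right int)
  also have "\<dots> = (SUM b:Basis. ((x - c) \<bullet> b) * g b x)"
   by (simp add: g_def)
  finally show ?thesis by simp
 qed
 ultimately show thesis using that by blast
qed

section \<open>Ordinary differential equations\<close>

lemma gronwall_zero:
 fixes h h' :: "real => real"
 assumes d: "!!t. t : {a..b} ==> (h has_real_derivative h' t) (at t)"
  and bd: "!!t. t : {a..b} ==> \<bar>h' t\<bar> <= C * h t" and nn: "!!t. t : {a..b} ==> h t >= 0"
  and s: "s : {a..b}" "h s = 0" and t: "t : {a..b}"
 shows "h t = 0"
proof -
 have D: "((%t. h t * exp (k * t)) has_real_derivative (h' t + k * h t) * exp (k * t)) (at t)"
  if "t : {a..b}" for t k
  by (rule derivative_eq_intros d[OF that] refl | simp add: algebra_simps)+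
 have "h t <= 0"
 proof (cases "s <= t")
  case True
  have "h t * exp (- C * t) <= h s * exp (- C * s)"
  proof (rule DERIV_nonpos_imp_nonincreasing[OF True])
   fix x assume "s <= x" "x <= t"
   hence x: "x : {a..b}" using s t by auto
   have "(h' x + - C * h x) * exp (- C * x) <= 0"
    using bd[OF x] by (intro mult_nonpos_nonneg) auto
   thus "\<exists>y. ((%t. h t * exp (- C * t)) has_real_derivative y) (at x) & y <= 0" using D[OF x] by blast
  qed
  thus ?thesis using s by (simp add: mult_le_0_iff)
 next
  case False
  hence ts: "t <= s" by simp
  have "h t * exp (C * t) <= h s * exp (C * s)"
  proof (rule DERIV_nonneg_imp_nondecreasing[OF ts])
   fix x assume "t <= x" "x <= s"
   hence x: "x : {a..b}" using s t by auto
   have "(h' x + C * h x) * exp (C * x) >= 0"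
    using bd[OF x] by (intro mult_nonneg_nonneg) auto
   thus "\<exists>y. ((%t. h t * exp (C * t)) has_real_derivative y) (at x) & 0 <= y" using D[OF x] by blast
  qed
  thus ?thesis using s by (simp add: mult_le_0_iff)
 qed
 thus ?thesis using nn[OF t] by simp
qed

text \<open>The local existence theorem. After multiplying the vector field by a cut-off function it is bounded and Lipschitz on
  the whole space, so that Picard's operator acts on all bounded continuous curves.\<close>

lemma Picard_Lindelof_global_Lipschitz:
 fixes V :: "'e::euclidean_space => 'e"
 assumes L: "!!x y. norm (V x - V y) <= L * norm (x - y)" and B: "!!x. norm (V x) <= B"
 obtains c e where "e > 0" "c 0 = x0" "!!t. t : {-e<..<e} ==> (c has_vector_derivative V (c t)) (at t)"
proof -
 have L0: "L >= 0"
 proof -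
  have "0 <= L * norm (x0 + (SOME b. b : Basis) - x0)" using L norm_ge_zero order_trans by blast
  thus ?thesis using nonzero_Basis[OF some_in_eq[THEN iffD2, OF nonempty_Basis]]
   by (auto simp: zero_le_mult_iff)
 qed
 define e where "e = 1 / (8 * (L + 1))"
 have e: "e > 0" "4 * e * L <= 1 / 2" using L0 by (auto simp: e_def field_simps)
 define clip where "clip = (%t. max (- e) (min e t))"
 have clip: "clip t : {-e..e}" for t using e by (auto simp: clip_def)
 have clip_id: "clip t = t" if "t : {-e..e}" for t using that by (auto simp: clip_def)
 have contV: "continuous_on UNIV V"
  unfolding continuous_on_iff
 proof (intro ballI allI impI)
  fix x and d :: real assume d: "d > 0"
  have "dist (V y) (V x) < d" if "dist y x < d / (L + 1)" for y
  proof -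
   have "dist (V y) (V x) <= (L + 1) * dist y x" using L[of y x] norm_ge_zero[of "y - x"]
    by (simp add: dist_norm distrib_right del: norm_ge_zero)
   also have "\<dots> < d" using that L0 by (simp add: field_simps)
   finally show ?thesis .
  qed
  thus "\<exists>k>0. \<forall>y\<in>UNIV. dist y x < k --> dist (V y) (V x) < d" using d L0
   by (intro exI[of _ "d / (L + 1)"]) auto
 qed
 have contVf: "continuous_on S (%s. V (apply_bcontfun f s))" for S f
  by (rule continuous_on_compose2[OF contV]) (simp_all add: continuous_on_apply_bcontfun)
 define I where "I = (%f t. integral {-e..t} (%s. V (apply_bcontfun f s)))"
 have I_deriv: "(I f has_vector_derivative V (apply_bcontfun f t)) (at t within {-e..e})" if "t : {-e..e}" for f t
  unfolding I_def by (rule integral_has_vector_derivative[OF contVf that])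
 have I_cont: "continuous_on {-e..e} (I f)" for f
  using I_deriv has_vector_derivative_continuous unfolding continuous_on_eq_continuous_within by blast
 have I_bd: "norm (I f t) <= B * (2 * e)" if "t : {-e..e}" for f t
 proof -
  have "norm (I f t) <= B * (t - - e)" unfolding I_def
   by (rule integral_bound) (use that contVf B in auto)
  also have "\<dots> <= B * (2 * e)" using that order_trans[OF norm_ge_zero B[of x0]] by (intro mult_left_mono) auto
  finally show ?thesis .
 qed
 have I_diff: "norm (I f t - I g t) <= L * dist f g * (2 * e)" if "t : {-e..e}" for f g t
 proof -
  have "I f t - I g t = integral {-e..t} (%s. V (apply_bcontfun f s) - V (apply_bcontfun g s))"
   unfolding I_def by (rule integral_diff[symmetric]) (intro integrable_continuous_interval contVf)+
  moreover have "norm (integral {-e..t} (%s. V (apply_bcontfun f s) - V (apply_bcontfun g s))) <= L * dist f g * (t - - e)"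
  proof (rule integral_bound)
   fix s
   have "norm (V (apply_bcontfun f s) - V (apply_bcontfun g s)) <= L * dist (apply_bcontfun f s) (apply_bcontfun g s)"
    using L by (simp add: dist_norm)
   also have "\<dots> <= L * dist f g" using L0 by (intro mult_left_mono dist_bounded)
   finally show "norm (V (apply_bcontfun f s) - V (apply_bcontfun g s)) <= L * dist f g" .
  qed (use that in "auto intro!: continuous_intros contVf")
  moreover have "L * dist f g * (t - - e) <= L * dist f g * (2 * e)"
   using that L0 by (intro mult_left_mono) auto
  ultimately show ?thesis by simp
 qed
 define T where "T = (%f. Bcontfun (%t. x0 + I f (clip t) - I f 0))"
 have T: "apply_bcontfun (T f) = (%t. x0 + I f (clip t) - I f 0)" for f
  unfolding T_def
 proof (rule Bcontfun_inverse, rule bcontfun_normI)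
  have "continuous_on UNIV (%t. I f (clip t))"
   by (rule continuous_on_compose2[OF I_cont, of _ clip]) (use clip in "auto intro!: continuous_intros simp: clip_def")
  thus "continuous_on UNIV (%t. x0 + I f (clip t) - I f 0)" by (intro continuous_intros)
  show "norm (x0 + I f (clip t) - I f 0) <= norm x0 + B * (2 * e) + B * (2 * e)" for t
   using norm_triangle_ineq4[of "x0 + I f (clip t)" "I f 0"] norm_triangle_ineq[of x0 "I f (clip t)"]
    I_bd[OF clip, of f t] I_bd[of 0 f] e by auto
 qed
 have z: "0 : {-e..e}" using e by simp
 have "dist (T f) (T g) <= 1 / 2 * dist f g" for f g
 proof (rule dist_bound)
  fix t
  have "dist (apply_bcontfun (T f) t) (apply_bcontfun (T g) t) = norm ((I f (clip t) - I g (clip t)) - (I f 0 - I g 0))"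
   by (simp add: T dist_norm algebra_simps)
  also have "\<dots> <= L * dist f g * (2 * e) + L * dist f g * (2 * e)"
   using norm_triangle_ineq4[of "I f (clip t) - I g (clip t)" "I f 0 - I g 0"]
    I_diff[OF clip, of f t g] I_diff[OF z, of f g] by linarith
  also have "\<dots> = 4 * e * L * dist f g" by simp
  also have "\<dots> <= 1 / 2 * dist f g" using e(2) by (intro mult_right_mono) auto
  finally show "dist (apply_bcontfun (T f) t) (apply_bcontfun (T g) t) <= 1 / 2 * dist f g" .
 qed
 hence "\<exists>!f. T f = f" by (intro banach_fix_type[of "1/2"]) auto
 then obtain f where f: "T f = f" by blast
 define c where "c = apply_bcontfun f"
 have c: "c t = x0 + I f (clip t) - I f 0" for t unfolding c_def using T[of f] f by metis
 have "c 0 = x0" using c[of 0] clip_id[of 0] e by simp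
 moreover have "(c has_vector_derivative V (c t)) (at t)" if t: "t : {-e<..<e}" for t
 proof -
  have "(I f has_vector_derivative V (c t)) (at t within {-e..e})"
   using I_deriv[of t f] t by (simp add: c_def)
  hence "(I f has_vector_derivative V (c t)) (at t)"
   using t at_within_Icc_at[of "-e" t e] by simp
  hence "((%t. x0 + I f t - I f 0) has_vector_derivative V (c t)) (at t)"
   by (auto intro!: derivative_eq_intros)
  thus ?thesis
  proof (rule has_vector_derivative_transform_within_open[of _ _ _ "{-e<..<e}"])
   show "x0 + I f s - I f 0 = c s" if "s : {-e<..<e}" for s
    using that by (subst c, subst clip_id) auto
  qed (use t in auto)
 qed
 ultimately show thesis using that e(1) by blast
qed

lemma smooth_on_compact_support_bounded:
 fixes V :: "'e::euclidean_space => 'f::euclidean_space"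
 assumes "smooth_on UNIV V" "compact K" "!!x. x \<notin> K ==> V x = 0"
 obtains B where "!!x. norm (V x) <= B"
proof -
 have "compact (V ` K)" using assms by (intro compact_continuous_image continuous_on_subset[OF smooth_on_imp_continuous_on]) auto
 then obtain B where "\<forall>y\<in>V ` K. norm y <= B" using compact_imp_bounded bounded_iff by blast
 hence "norm (V x) <= max B 0" for x by (cases "x : K") (auto simp: assms(3) max.coboundedI1)
 thus thesis using that by blast
qed

lemma Picard_Lindelof:
 fixes V :: "'e::euclidean_space => 'e"
 assumes W: "open W" "x0 : W" and V: "smooth_on W V"
 obtains c e where "e > 0" "c 0 = x0" "!!t. t : {-e<..<e} ==> c t : W"
  "!!t. t : {-e<..<e} ==> (c has_vector_derivative V (c t)) (at t)"
proof -
 obtain \<eta> :: "'e => real" and U K where \<eta>: "smooth_on UNIV \<eta>" "open U" "x0 : U" "U \<subseteq> K"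
  "!!x. x : U ==> \<eta> x = 1" "compact K" "K \<subseteq> W" "!!x. x \<notin> K ==> \<eta> x = 0"
  using exists_cutoff_function[OF W] by blast
 define Y where "Y = (%x. \<eta> x *\<^sub>R V x)"
 have Y0: "Y x = 0" if "x \<notin> K" for x using \<eta>(8)[OF that] by (simp add: Y_def)
 have "smooth_on UNIV Y"
 proof (rule smooth_on_local)
  fix x
  show "\<exists>V. open V & x : V & smooth_on V Y"
  proof (cases "x : W")
   case True
   have "smooth_on W Y" unfolding Y_def
    by (intro smooth_intros W(1) V smooth_on_subset[OF \<eta>(1)]) simp
   thus ?thesis using True W(1) by blast
  next
   case False
   have "open (- K)" using \<eta>(6) by (simp add: compact_imp_closed open_Compl)
   moreover have "smooth_on (- K) Y"
    by (rule smooth_on_cong[OF smooth_on_const[of _ 0] \<open>open (- K)\<close>]) (use Y0 in auto)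
   moreover have "x : - K" using False \<eta>(7) by auto
   ultimately show ?thesis by blast
  qed
 qed
 note Y = this
 have DY0: "Df Y x b = 0" if "x \<notin> K" for x b
 proof -
  have "open (- K)" using \<eta>(6) by (simp add: compact_imp_closed open_Compl)
  hence "(Y has_derivative (%v. 0)) (at x)"
   by (rule has_derivative_transform_within_open[OF has_derivative_const[of 0]]) (use that Y0 in auto)
  thus ?thesis using frechet_derivative_at by metis
 qed
 have "\<exists>B. \<forall>x. norm (Df Y x b) <= B" for b
  using smooth_on_compact_support_bounded[OF smooth_on_frechet_derivative[OF Y] \<eta>(6) DY0, of b] by blast
 then obtain M where M: "!!b x. norm (Df Y x b) <= M b" by metis
 have L: "norm (Y x - Y y) <= (SUM b:Basis. M b) * norm (x - y)" for x y
 proof (rule differentiable_bound[of UNIV Y])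
  fix z :: 'e
  have Dz: "(Y has_derivative Df Y z) (at z)" by (rule smooth_on_has_derivative[OF Y UNIV_I])
  thus "(Y has_derivative Df Y z) (at z within UNIV)" by simp
  have l: "linear (Df Y z)" by (rule has_derivative_linear[OF Dz])
  show "onorm (Df Y z) <= (SUM b:Basis. M b)"
  proof (rule onorm_le)
   fix v
   have "norm (Df Y z (SUM b:Basis. (v \<bullet> b) *\<^sub>R b)) <= (SUM b:Basis. M b * norm v)"
    unfolding linear_sum[OF l] linear_cmul[OF l]
   proof (rule sum_norm_le)
    fix b :: 'e assume b: "b : Basis"
    have "norm ((v \<bullet> b) *\<^sub>R Df Y z b) <= norm v * M b"
     using Basis_le_norm[OF b, of v] M[of z b] by (simp add: mult_mono)
    thus "norm ((v \<bullet> b) *\<^sub>R Df Y z b) <= M b * norm v" by (simp add: mult.commute)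
   qed
   thus "norm (Df Y z v) <= (SUM b:Basis. M b) * norm v"
    by (simp add: euclidean_representation sum_distrib_right)
  qed
 qed auto
 obtain B where B: "!!x. norm (Y x) <= B" using smooth_on_compact_support_bounded[OF Y \<eta>(6) Y0] by blast
 obtain c e where c: "e > 0" "c 0 = x0" "!!t. t : {-e<..<e} ==> (c has_vector_derivative Y (c t)) (at t)"
  using Picard_Lindelof_global_Lipschitz[OF L B, of x0] by blast
 have "isCont c 0" using c(3)[of 0] c(1) by (auto intro: has_vector_derivative_continuous)
 hence "\<forall>\<^sub>F t in nhds 0. c t : U"
  using \<eta>(2,3) c(2) by (simp add: continuous_at_open eventually_nhds)
 then obtain d where d: "d > 0" "!!t. dist t 0 < d ==> c t : U"
  unfolding eventually_nhds_metric by blast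
 show thesis
 proof (rule that[of "min d e" c])
  fix t assume t: "t : {- min d e<..<min d e}"
  hence U: "c t : U" by (intro d(2)) (auto simp: dist_real_def)
  thus "c t : W" using \<eta>(4,7) by blast
  have "(c has_vector_derivative Y (c t)) (at t)" using c(3)[of t] t by auto
  thus "(c has_vector_derivative V (c t)) (at t)" using \<eta>(5)[OF U] by (simp add: Y_def)
 qed (use c d in auto)
qed

text \<open>The derivative of a solution is a smooth function of the solution, so smoothness follows by induction on the order.\<close>

lemma smooth_on_integral_curve:
 fixes V :: "'e::euclidean_space => 'e"
 assumes V: "smooth_on W V" and T: "open T"
  and c: "!!t. t : T ==> c t : W" "!!t. t : T ==> (c has_vector_derivative V (c t)) (at t)"
 shows "smooth_on T c"
proof -
 have "Ck_on k T c" for k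
 proof (induction k)
  case 0
  show ?case using c(2) has_vector_derivative_continuous by (fastforce intro: continuous_at_imp_continuous_on)
 next
  case (Suc k)
  show ?case
  proof (rule Ck_on_SucI[OF T])
   show "(c has_derivative (%v. v *\<^sub>R V (c t))) (at t)" if "t : T" for t
    using c(2)[OF that] by (simp add: has_vector_derivative_def)
   show "Ck_on k T (%t. v *\<^sub>R V (c t))" for v
    using V unfolding smooth_on_def
    by (intro Ck_on_bilinear[OF T bounded_bilinear_scaleR] Ck_on_const Ck_on_compose[OF T c(1) Suc.IH]) auto
  qed
 qed
 thus ?thesis unfolding smooth_on_def by blast
qed

section \<open>Smooth manifolds, smooth maps and tangent vectors\<close>

locale smooth_manifold =
 fixes A :: "('p::t2_space, 'e::euclidean_space) atlas"
 assumes smooth_atlas: "smooth_atlas A"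
begin

lemma chart:
 assumes "(U, \<phi>) : A"
 shows "open U" "open (\<phi> ` U)" "homeomorphism U (\<phi> ` U) \<phi> (inv_into U \<phi>)" "inj_on \<phi> U"
  "continuous_on U \<phi>" "continuous_on (\<phi> ` U) (inv_into U \<phi>)"
proof -
 show "open U" "open (\<phi> ` U)" and h: "homeomorphism U (\<phi> ` U) \<phi> (inv_into U \<phi>)"
  using smooth_atlas assms unfolding smooth_atlas_def by blast+
 show "inj_on \<phi> U" using homeomorphism_apply1[OF h] by (metis inj_onI)
 show "continuous_on U \<phi>" "continuous_on (\<phi> ` U) (inv_into U \<phi>)"
  using h unfolding homeomorphism_def by blast+
qed

lemma chart_inverse [simp]:
 assumes "(U, \<phi>) : A" "p : U"
 shows "inv_into U \<phi> (\<phi> p) = p"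
 using inv_into_f_f[OF chart(4)[OF assms(1)] assms(2)] .

lemma chart_inverse_mem:
 assumes "(U, \<phi>) : A" "W \<subseteq> U" "y : \<phi> ` W"
 shows "inv_into U \<phi> y : W"
 using assms by (auto simp: subset_iff)

lemma chart_at:
 obtains U \<phi> where "(U, \<phi>) : A" "p : U"
 using smooth_atlas unfolding smooth_atlas_def by blast

lemma transition_smooth:
 "(U, \<phi>) : A ==> (V, \<psi>) : A ==> smooth_on (\<phi> ` (U \<inter> V)) (\<psi> \<circ> inv_into U \<phi>)"
 using smooth_atlas unfolding smooth_atlas_def by blast

lemma open_chart_image:
 assumes "(U, \<phi>) : A" "open W" "W \<subseteq> U"
 shows "open (\<phi> ` W)"
proof -
 have "\<phi> ` W = \<phi> ` U \<inter> inv_into U \<phi> -` W"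
  using assms by (auto simp: subset_iff)
 thus ?thesis
  using continuous_open_preimage[OF chart(6)[OF assms(1)] chart(2)[OF assms(1)] assms(2)] by simp
qed

end

text \<open>Smoothness of a map at a point, in suitable charts; by the compatibility of charts it does not matter which.\<close>

definition smooth_at ::
 "('p::topological_space, 'e::euclidean_space) atlas =>
  ('q::topological_space, 'f::euclidean_space) atlas => ('p => 'q) => 'p => bool" where
 "smooth_at A B F p \<longleftrightarrow> (\<exists>U \<phi> V \<psi> W. (U, \<phi>) : A & (V, \<psi>) : B & open W & p : W & W \<subseteq> U & F ` W \<subseteq> V \<and>
   smooth_on (\<phi> ` W) (%y. \<psi> (F (inv_into U \<phi> y))))"

lemma smooth_atI:
 assumes "(U, \<phi>) : A" "(V, \<psi>) : B" "open W" "p : W" "W \<subseteq> U" "!!q. q : W ==> F q : V"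
  "smooth_on (\<phi> ` W) (%y. \<psi> (F (inv_into U \<phi> y)))"
 shows "smooth_at A B F p"
 unfolding smooth_at_def using assms by (metis image_subsetI)

locale two_manifolds = M: smooth_manifold A + N: smooth_manifold B
 for A :: "('p::t2_space, 'e::euclidean_space) atlas" and B :: "('q::t2_space, 'f::euclidean_space) atlas"
begin

lemma smooth_at_charts:
 assumes "smooth_at A B F p" and U: "(U, \<phi>) : A" "p : U" and V: "(V, \<psi>) : B" "F p : V"
 obtains W where "open W" "p : W" "W \<subseteq> U" "F ` W \<subseteq> V" "smooth_on (\<phi> ` W) (%y. \<psi> (F (inv_into U \<phi> y)))"
  "continuous_on W F"
proof -
 obtain U' \<phi>' V' \<psi>' W' where 1: "(U', \<phi>') : A" "(V', \<psi>') : B" "open W'" "p : W'" "W' \<subseteq> U'" "F ` W' \<subseteq> V'"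
  "smooth_on (\<phi>' ` W') (%y. \<psi>' (F (inv_into U' \<phi>' y)))"
  using assms(1) unfolding smooth_at_def by blast
 have "continuous_on W' (%q. \<psi>' (F (inv_into U' \<phi>' (\<phi>' q))))"
  by (rule continuous_on_compose2[OF smooth_on_imp_continuous_on[OF 1(7)]])
   (use M.chart(5)[OF 1(1)] 1(5) continuous_on_subset in auto)
 hence "continuous_on W' (%q. \<psi>' (F q))"
  by (rule continuous_on_cong[THEN iffD1, rotated 2, OF _ refl]) (use 1 in auto)
 hence "continuous_on W' (%q. inv_into V' \<psi>' (\<psi>' (F q)))"
  by (rule continuous_on_compose2[OF N.chart(6)[OF 1(2)]]) (use 1 in auto)
 hence contF: "continuous_on W' F"
  by (rule continuous_on_cong[THEN iffD1, rotated 2, OF _ refl]) (use 1 in "auto simp: N.chart_inverse[OF 1(2)]")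
 define W where "W = W' \<inter> F -` V \<inter> U"
 have W: "open W" "p : W" "W \<subseteq> U" "F ` W \<subseteq> V" "W \<subseteq> W'"
  using continuous_open_preimage[OF contF 1(3) N.chart(1)[OF V(1)]] M.chart(1)[OF U(1)] 1(4) U(2) V(2)
  by (auto simp: W_def)
 have oW: "open (\<phi> ` W)" by (rule M.open_chart_image[OF U(1) W(1,3)])
 have inW: "inv_into U \<phi> y : W" if "y : \<phi> ` W" for y by (rule M.chart_inverse_mem[OF U(1) W(3) that])
 have inW': "inv_into U \<phi> y : W'" "inv_into U \<phi> y : U'" "F (inv_into U \<phi> y) : V'" "F (inv_into U \<phi> y) : V"
  if "y : \<phi> ` W" for y
  using inW[OF that] W(4,5) 1(5,6) by blast+
 have "\<phi> ` W \<subseteq> \<phi> ` (U \<inter> U')" using W(3,5) 1(5) by blast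
 hence t1: "smooth_on (\<phi> ` W) (%y. \<phi>' (inv_into U \<phi> y))"
  using smooth_on_subset[OF M.transition_smooth[OF U(1) 1(1)]] unfolding o_def by blast
 have "smooth_on (\<phi> ` W) (%y. \<psi>' (F (inv_into U' \<phi>' (\<phi>' (inv_into U \<phi> y)))))"
  by (rule smooth_on_compose[OF 1(7) oW t1]) (use inW' in blast)
 hence t2: "smooth_on (\<phi> ` W) (%y. \<psi>' (F (inv_into U \<phi> y)))"
  by (rule smooth_on_cong[OF _ oW]) (simp add: M.chart_inverse[OF 1(1)] inW')
 have "smooth_on (\<phi> ` W) (%y. (\<psi> \<circ> inv_into V' \<psi>') (\<psi>' (F (inv_into U \<phi> y))))"
  by (rule smooth_on_compose[OF N.transition_smooth[OF 1(2) V(1)] oW t2]) (use inW' in blast)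
 hence "smooth_on (\<phi> ` W) (%y. \<psi> (F (inv_into U \<phi> y)))"
  by (rule smooth_on_cong[OF _ oW]) (simp add: N.chart_inverse[OF 1(2)] inW')
 thus thesis using that W continuous_on_subset[OF contF] by blast
qed

lemma smooth_map_iff: "smooth_map A B F \<longleftrightarrow> (\<forall>p. smooth_at A B F p)"
proof
 assume F: "smooth_map A B F"
 show "\<forall>p. smooth_at A B F p"
 proof
  fix p
  obtain U \<phi> where U: "(U, \<phi>) : A" "p : U" by (rule M.chart_at)
  obtain V \<psi> where V: "(V, \<psi>) : B" "F p : V" by (rule N.chart_at)
  have "open (F -` V)" using F N.chart(1)[OF V(1)] unfolding smooth_map_def by (simp add: open_vimage)
  moreover have "smooth_on (\<phi> ` (U \<inter> F -` V)) (\<psi> \<circ> F \<circ> inv_into U \<phi>)"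
   using F U V unfolding smooth_map_def by blast
  ultimately show "smooth_at A B F p"
   using U V M.chart(1)[OF U(1)]
   by (intro smooth_atI[OF U(1) V(1), of "U \<inter> F -` V"]) (auto simp: o_def)
 qed
next
 assume F: "\<forall>p. smooth_at A B F p"
 have cont: "continuous_on UNIV F"
 proof (rule continuous_at_imp_continuous_on, rule ballI)
  fix p
  obtain U \<phi> where U: "(U, \<phi>) : A" "p : U" by (rule M.chart_at)
  obtain V \<psi> where V: "(V, \<psi>) : B" "F p : V" by (rule N.chart_at)
  obtain W where "open W" "p : W" "W \<subseteq> U" "F ` W \<subseteq> V"
    "smooth_on (\<phi> ` W) (%y. \<psi> (F (inv_into U \<phi> y)))" "continuous_on W F"
   by (rule smooth_at_charts[OF spec[OF F] U V])
  thus "isCont F p" by (simp add: continuous_on_eq_continuous_at)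
 qed
 have "smooth_on (\<phi> ` (U \<inter> F -` V)) (\<psi> \<circ> F \<circ> inv_into U \<phi>)" if U: "(U, \<phi>) : A" and V: "(V, \<psi>) : B" for U \<phi> V \<psi>
 proof (rule smooth_on_local)
  fix y assume "y : \<phi> ` (U \<inter> F -` V)"
  then obtain p where p: "p : U" "F p : V" "y = \<phi> p" by blast
  obtain W where W: "open W" "p : W" "W \<subseteq> U" "F ` W \<subseteq> V"
    "smooth_on (\<phi> ` W) (%y. \<psi> (F (inv_into U \<phi> y)))" "continuous_on W F"
   by (rule smooth_at_charts[OF spec[OF F] U p(1) V p(2)])
  thus "\<exists>N. open N & y : N & smooth_on N (\<psi> \<circ> F \<circ> inv_into U \<phi>)"
   using M.open_chart_image[OF U W(1,3)] p by (intro exI[of _ "\<phi> ` W"]) (auto simp: o_def)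
 qed
 thus "smooth_map A B F" using cont unfolding smooth_map_def by auto
qed

lemma smooth_at_local:
 assumes "smooth_at A B F p" "open W" "p : W" "!!q. q : W ==> F q = G q"
 shows "smooth_at A B G p"
proof -
 obtain U \<phi> where U: "(U, \<phi>) : A" "p : U" by (rule M.chart_at)
 obtain V \<psi> where V: "(V, \<psi>) : B" "F p : V" by (rule N.chart_at)
 obtain W' where W': "open W'" "p : W'" "W' \<subseteq> U" "F ` W' \<subseteq> V" "smooth_on (\<phi> ` W') (%y. \<psi> (F (inv_into U \<phi> y)))" "continuous_on W' F"
  by (rule smooth_at_charts[OF assms(1) U V])
 have o: "open (\<phi> ` (W \<inter> W'))" by (rule M.open_chart_image[OF U(1)]) (use W' assms in auto)
 have sm: "smooth_on (\<phi> ` (W \<inter> W')) (%y. \<psi> (G (inv_into U \<phi> y)))"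
 proof (rule smooth_on_cong[OF smooth_on_subset[OF W'(5)] o])
  show "\<phi> ` (W \<inter> W') \<subseteq> \<phi> ` W'" by blast
  fix y assume "y : \<phi> ` (W \<inter> W')"
  hence "inv_into U \<phi> y : W \<inter> W'" using M.chart_inverse_mem[OF U(1), of "W \<inter> W'"] W'(3) by blast
  thus "\<psi> (F (inv_into U \<phi> y)) = \<psi> (G (inv_into U \<phi> y))" using assms(4) by simp
 qed
 have GV: "G q : V" if "q : W \<inter> W'" for q
 proof -
  have "F q : V" using that W'(4) by blast
  thus ?thesis using that assms(4) by simp
 qed
 show ?thesis
  by (rule smooth_atI[OF U(1) V(1) _ _ _ GV sm]) (use W' assms(2,3) in auto)
qed

end

lemma smooth_at_compose:
 assumes A: "smooth_manifold A" and B: "smooth_manifold B" and C: "smooth_manifold C"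
  and F: "smooth_at A B F p" and G: "smooth_at B C G (F p)"
 shows "smooth_at A C (%x. G (F x)) p"
proof -
 interpret A: smooth_manifold A by fact
 interpret B: smooth_manifold B by fact
 interpret C: smooth_manifold C by fact
 interpret AB: two_manifolds A B ..
 interpret BC: two_manifolds B C ..
 obtain U \<phi> where U: "(U, \<phi>) : A" "p : U" by (rule A.chart_at)
 obtain V \<psi> where V: "(V, \<psi>) : B" "F p : V" by (rule B.chart_at)
 obtain V' \<psi>' where V': "(V', \<psi>') : C" "G (F p) : V'" by (rule C.chart_at)
 obtain W' where W': "open W'" "F p : W'" "W' \<subseteq> V" "G ` W' \<subseteq> V'" "smooth_on (\<psi> ` W') (%y. \<psi>' (G (inv_into V \<psi> y)))" "continuous_on W' G"
  by (rule BC.smooth_at_charts[OF G V V'])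
 obtain W where W: "open W" "p : W" "W \<subseteq> U" "F ` W \<subseteq> V" "smooth_on (\<phi> ` W) (%y. \<psi> (F (inv_into U \<phi> y)))" "continuous_on W F"
  by (rule AB.smooth_at_charts[OF F U V])
 define X where "X = W \<inter> F -` W'"
 have X: "open X" "p : X" "X \<subseteq> U" "F ` X \<subseteq> W'"
  using continuous_open_preimage[OF W(6,1) W'(1)] W W' by (auto simp: X_def)
 have o: "open (\<phi> ` X)" by (rule A.open_chart_image[OF U(1) X(1,3)])
 have inX: "inv_into U \<phi> y : X" if "y : \<phi> ` X" for y by (rule A.chart_inverse_mem[OF U(1) X(3) that])
 have inW': "F (inv_into U \<phi> y) : W'" "F (inv_into U \<phi> y) : V" if "y : \<phi> ` X" for y
  using inX[OF that] X(4) W'(3) by blast+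
 have "smooth_on (\<phi> ` X) (%y. \<psi> (F (inv_into U \<phi> y)))" by (rule smooth_on_subset[OF W(5)]) (auto simp: X_def)
 hence "smooth_on (\<phi> ` X) (%y. \<psi>' (G (inv_into V \<psi> (\<psi> (F (inv_into U \<phi> y))))))"
  by (rule smooth_on_compose[OF W'(5) o]) (use inW' in blast)
 hence "smooth_on (\<phi> ` X) (%y. \<psi>' (G (F (inv_into U \<phi> y))))"
  by (rule smooth_on_cong[OF _ o]) (simp add: B.chart_inverse[OF V(1)] inW')
 thus ?thesis
  by (rule smooth_atI[OF U(1) V'(1) X(1,2,3), rotated]) (use X(4) W'(4) in blast)
qed

lemma smooth_map_compose:
 assumes "smooth_manifold A" "smooth_manifold B" "smooth_manifold C" "smooth_map A B F" "smooth_map B C G"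
 shows "smooth_map A C (%x. G (F x))"
proof -
 interpret A: smooth_manifold A by fact
 interpret B: smooth_manifold B by fact
 interpret C: smooth_manifold C by fact
 interpret AB: two_manifolds A B ..
 interpret BC: two_manifolds B C ..
 interpret AC: two_manifolds A C ..
 show ?thesis using assms smooth_at_compose[OF assms(1-3)]
  unfolding AB.smooth_map_iff BC.smooth_map_iff AC.smooth_map_iff by blast
qed

lemma smooth_at_id: "smooth_manifold A ==> smooth_at A A (%x. x) p"
proof -
 assume "smooth_manifold A"
 then interpret smooth_manifold A .
 obtain U \<phi> where U: "(U, \<phi>) : A" "p : U" by (rule chart_at)
 have "smooth_on (\<phi> ` U) (%y. \<phi> (inv_into U \<phi> y))"
  by (rule smooth_on_cong[OF smooth_on_ident chart(2)[OF U(1)]]) (auto simp: f_inv_into_f)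
 thus ?thesis by (intro smooth_atI[OF U(1) U(1) chart(1)[OF U(1)] U(2) subset_refl])
qed

lemma smooth_at_const:
 assumes "smooth_manifold A" "smooth_manifold B"
 shows "smooth_at A B (%x. c) p"
proof -
 interpret A: smooth_manifold A by fact
 interpret B: smooth_manifold B by fact
 obtain U \<phi> where U: "(U, \<phi>) : A" "p : U" by (rule A.chart_at)
 obtain V \<psi> where V: "(V, \<psi>) : B" "c : V" by (rule B.chart_at)
 show ?thesis by (intro smooth_atI[OF U(1) V(1) A.chart(1)[OF U(1)] U(2) subset_refl] V(2) smooth_on_const)
qed

subsection \<open>Euclidean spaces and products\<close>

abbreviation flat_atlas :: "('e::euclidean_space, 'e) atlas" where
 "flat_atlas \<equiv> {(UNIV, id)}"

lemma inv_into_UNIV_id [simp]: "inv_into UNIV id = id"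
 by (simp add: inv_equality)

lemma smooth_manifold_flat: "smooth_manifold flat_atlas"
 using smooth_on_ident[of UNIV] by unfold_locales (auto simp: smooth_atlas_def homeomorphism_def id_def[abs_def] o_def)

lemma real_atlas_flat: "real_atlas = flat_atlas"
 by (simp add: real_atlas_def)

lemma prod_flat_atlas: "prod_atlas flat_atlas flat_atlas = flat_atlas"
 by (auto simp: prod_atlas_def prod.map_id0)

lemma smooth_at_flat:
 "smooth_at flat_atlas flat_atlas F p \<longleftrightarrow> (\<exists>W. open W & p : W & smooth_on W F)"
 by (auto simp: smooth_at_def)

lemma smooth_map_flat: "smooth_map flat_atlas flat_atlas F \<longleftrightarrow> smooth_on UNIV F"
 by (auto simp: smooth_map_def smooth_on_imp_continuous_on)

lemma smooth_functions_flat: "\<F> flat_atlas = {f. smooth_on UNIV f}"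
 by (auto simp: smooth_functions_def)

lemma inv_into_map_prod:
 assumes "y : \<phi> ` U" "z : \<psi> ` V" "inj_on \<phi> U" "inj_on \<psi> V"
 shows "inv_into (U \<times> V) (map_prod \<phi> \<psi>) (y, z) = (inv_into U \<phi> y, inv_into V \<psi> z)"
proof (rule inv_into_f_eq)
 show "inj_on (map_prod \<phi> \<psi>) (U \<times> V)" by (rule map_prod_inj_on[OF assms(3,4)])
qed (use assms in "auto simp: inv_into_into f_inv_into_f")

lemma smooth_manifold_prod:
 assumes "smooth_manifold A" "smooth_manifold B"
 shows "smooth_manifold (prod_atlas A B)"
proof -
 interpret A: smooth_manifold A by fact
 interpret B: smooth_manifold B by fact
 have inv: "inv_into (U \<times> V) (map_prod \<phi> \<psi>) y = map_prod (inv_into U \<phi>) (inv_into V \<psi>) y"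
  if "(U, \<phi>) : A" "(V, \<psi>) : B" "y : \<phi> ` U \<times> \<psi> ` V" for U \<phi> V \<psi> y
  using inv_into_map_prod[OF _ _ A.chart(4)[OF that(1)] B.chart(4)[OF that(2)], of "fst y" "snd y"] that(3)
  by (cases y) auto
 have im: "map_prod \<phi> \<psi> ` (U \<times> V) = \<phi> ` U \<times> \<psi> ` V" for \<phi> U \<psi> V by force
 show ?thesis
 proof (unfold_locales, unfold smooth_atlas_def, intro conjI)
  show "\<forall>(W, \<zeta>)\<in>prod_atlas A B. open W & open (\<zeta> ` W) & homeomorphism W (\<zeta> ` W) \<zeta> (inv_into W \<zeta>)"
  proof clarify
   fix W \<zeta> assume "(W, \<zeta>) : prod_atlas A B"
   then obtain U \<phi> V \<psi> where W: "W = U \<times> V" "\<zeta> = map_prod \<phi> \<psi>" and U: "(U, \<phi>) : A" and V: "(V, \<psi>) : B"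
    unfolding prod_atlas_def by blast
   have "continuous_on (U \<times> V) (%z. (\<phi> (fst z), \<psi> (snd z)))"
    by (intro continuous_on_Pair continuous_on_compose2[OF A.chart(5)[OF U]]
      continuous_on_compose2[OF B.chart(5)[OF V]] continuous_intros) auto
   hence c1: "continuous_on (U \<times> V) (map_prod \<phi> \<psi>)" by (simp add: map_prod_def case_prod_unfold)
   have "continuous_on (\<phi> ` U \<times> \<psi> ` V) (%z. (inv_into U \<phi> (fst z), inv_into V \<psi> (snd z)))"
    by (intro continuous_on_Pair continuous_on_compose2[OF A.chart(6)[OF U]]
      continuous_on_compose2[OF B.chart(6)[OF V]] continuous_intros) auto
   hence c2: "continuous_on (\<phi> ` U \<times> \<psi> ` V) (inv_into (U \<times> V) (map_prod \<phi> \<psi>))"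
    by (rule continuous_on_cong[THEN iffD1, rotated 2, OF _ refl]) (auto simp: inv[OF U V])
   have "inj_on (map_prod \<phi> \<psi>) (U \<times> V)" by (rule map_prod_inj_on[OF A.chart(4)[OF U] B.chart(4)[OF V]])
   hence "homeomorphism W (\<zeta> ` W) \<zeta> (inv_into W \<zeta>)"
    unfolding homeomorphism_def W im using c1 c2 by (auto simp: im[symmetric] inv_into_image_cancel f_inv_into_f)
   thus "open W & open (\<zeta> ` W) & homeomorphism W (\<zeta> ` W) \<zeta> (inv_into W \<zeta>)"
    using A.chart(1,2)[OF U] B.chart(1,2)[OF V] by (auto simp: W im open_Times)
  qed
  show "(\<Union>(U, \<phi>)\<in>prod_atlas A B. U) = UNIV"
  proof (intro equalityI subset_UNIV subsetI)
   fix z :: "'a \<times> 'c"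
   obtain U \<phi> where U: "(U, \<phi>) : A" "fst z : U" by (rule A.chart_at)
   obtain V \<psi> where V: "(V, \<psi>) : B" "snd z : V" by (rule B.chart_at)
   have "(U \<times> V, map_prod \<phi> \<psi>) : prod_atlas A B" using U V unfolding prod_atlas_def by blast
   thus "z : (\<Union>(U, \<phi>)\<in>prod_atlas A B. U)" using U V
    by (intro UN_I[of "(U \<times> V, map_prod \<phi> \<psi>)"]) (auto simp: mem_Times_iff)
  qed
  show "\<forall>(W, \<zeta>)\<in>prod_atlas A B. \<forall>(W', \<zeta>')\<in>prod_atlas A B. smooth_on (\<zeta> ` (W \<inter> W')) (\<zeta>' \<circ> inv_into W \<zeta>)"
  proof clarify
   fix W \<zeta> W' \<zeta>' assume "(W, \<zeta>) : prod_atlas A B" "(W', \<zeta>') : prod_atlas A B"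
   then obtain U \<phi> V \<psi> U' \<phi>' V' \<psi>' where W: "W = U \<times> V" "\<zeta> = map_prod \<phi> \<psi>" and U: "(U, \<phi>) : A" and V: "(V, \<psi>) : B"
    and W': "W' = U' \<times> V'" "\<zeta>' = map_prod \<phi>' \<psi>'" and U': "(U', \<phi>') : A" and V': "(V', \<psi>') : B"
    by (auto simp: prod_atlas_def)
   have eq: "\<zeta> ` (W \<inter> W') = \<phi> ` (U \<inter> U') \<times> \<psi> ` (V \<inter> V')" unfolding W W' Times_Int_Times by (rule im)
   have o: "open (\<phi> ` (U \<inter> U') \<times> \<psi> ` (V \<inter> V'))"
    by (intro open_Times A.open_chart_image[OF U] B.open_chart_image[OF V])
     (use A.chart(1)[OF U] A.chart(1)[OF U'] B.chart(1)[OF V] B.chart(1)[OF V'] in auto)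
   have "smooth_on (\<phi> ` (U \<inter> U') \<times> \<psi> ` (V \<inter> V')) (%z. ((\<phi>' \<circ> inv_into U \<phi>) (fst z), (\<psi>' \<circ> inv_into V \<psi>) (snd z)))"
    by (intro smooth_on_Pair o smooth_on_compose[OF A.transition_smooth[OF U U']]
      smooth_on_compose[OF B.transition_smooth[OF V V']] smooth_intros) auto
   thus "smooth_on (\<zeta> ` (W \<inter> W')) (\<zeta>' \<circ> inv_into W \<zeta>)"
    unfolding eq by (rule smooth_on_cong[OF _ o]) (auto simp: W W' inv[OF U V])
  qed
 qed
qed

lemma smooth_at_Pair:
 assumes A: "smooth_manifold A" and B: "smooth_manifold B" and C: "smooth_manifold C"
  and F: "smooth_at A B F p" and G: "smooth_at A C G p"
 shows "smooth_at A (prod_atlas B C) (%x. (F x, G x)) p"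
proof -
 interpret A: smooth_manifold A by fact
 interpret B: smooth_manifold B by fact
 interpret C: smooth_manifold C by fact
 interpret AB: two_manifolds A B ..
 interpret AC: two_manifolds A C ..
 obtain U \<phi> where U: "(U, \<phi>) : A" "p : U" by (rule A.chart_at)
 obtain V \<psi> where V: "(V, \<psi>) : B" "F p : V" by (rule B.chart_at)
 obtain V' \<psi>' where V': "(V', \<psi>') : C" "G p : V'" by (rule C.chart_at)
 obtain W where W: "open W" "p : W" "W \<subseteq> U" "F ` W \<subseteq> V" "smooth_on (\<phi> ` W) (%y. \<psi> (F (inv_into U \<phi> y)))" "continuous_on W F"
  by (rule AB.smooth_at_charts[OF F U V])
 obtain W' where W': "open W'" "p : W'" "W' \<subseteq> U" "G ` W' \<subseteq> V'" "smooth_on (\<phi> ` W') (%y. \<psi>' (G (inv_into U \<phi> y)))" "continuous_on W' G"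
  by (rule AC.smooth_at_charts[OF G U V'])
 have o: "open (\<phi> ` (W \<inter> W'))" by (rule A.open_chart_image[OF U(1)]) (use W W' in auto)
 have "smooth_on (\<phi> ` (W \<inter> W')) (%y. (\<psi> (F (inv_into U \<phi> y)), \<psi>' (G (inv_into U \<phi> y))))"
  by (intro smooth_on_Pair o smooth_on_subset[OF W(5)] smooth_on_subset[OF W'(5)]) auto
 moreover have "(V \<times> V', map_prod \<psi> \<psi>') : prod_atlas B C" using V V' unfolding prod_atlas_def by blast
 ultimately show ?thesis
  by (intro smooth_atI[OF U(1), of "V \<times> V'" "map_prod \<psi> \<psi>'" _ "W \<inter> W'"]) (use W W' in auto)
qed

lemma smooth_at_fst_snd:
 assumes "smooth_manifold A" "smooth_manifold B"
 shows "smooth_at (prod_atlas A B) A fst z" "smooth_at (prod_atlas A B) B snd z"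
proof -
 interpret A: smooth_manifold A by fact
 interpret B: smooth_manifold B by fact
 obtain U \<phi> where U: "(U, \<phi>) : A" "fst z : U" by (rule A.chart_at)
 obtain V \<psi> where V: "(V, \<psi>) : B" "snd z : V" by (rule B.chart_at)
 have W: "(U \<times> V, map_prod \<phi> \<psi>) : prod_atlas A B" using U V unfolding prod_atlas_def by blast
 have im: "map_prod \<phi> \<psi> ` (U \<times> V) = \<phi> ` U \<times> \<psi> ` V" by force
 have inv: "inv_into (U \<times> V) (map_prod \<phi> \<psi>) y = (inv_into U \<phi> (fst y), inv_into V \<psi> (snd y))"
  if "y : \<phi> ` U \<times> \<psi> ` V" for y
  using inv_into_map_prod[OF _ _ A.chart(4)[OF U(1)] B.chart(4)[OF V(1)], of "fst y" "snd y"] that by auto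
 have o: "open (\<phi> ` U \<times> \<psi> ` V)" "open (U \<times> V)" using A.chart(1,2)[OF U(1)] B.chart(1,2)[OF V(1)] by (auto simp: open_Times)
 have "smooth_on (\<phi> ` U \<times> \<psi> ` V) (%y. \<phi> (fst (inv_into (U \<times> V) (map_prod \<phi> \<psi>) y)))"
  by (rule smooth_on_cong[OF smooth_on_fst[OF o(1) smooth_on_ident] o(1)]) (auto simp: inv f_inv_into_f)
 thus "smooth_at (prod_atlas A B) A fst z"
  by (intro smooth_atI[OF W U(1) o(2)]) (use U V in "auto simp: im mem_Times_iff")
 have "smooth_on (\<phi> ` U \<times> \<psi> ` V) (%y. \<psi> (snd (inv_into (U \<times> V) (map_prod \<phi> \<psi>) y)))"
  by (rule smooth_on_cong[OF smooth_on_snd[OF o(1) smooth_on_ident] o(1)]) (auto simp: inv f_inv_into_f)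
 thus "smooth_at (prod_atlas A B) B snd z"
  by (intro smooth_atI[OF W V(1) o(2)]) (use U V in "auto simp: im mem_Times_iff")
qed

subsection \<open>Smooth functions\<close>

context smooth_manifold
begin

lemma smooth_functions_iff: "f : \<F> A \<longleftrightarrow> smooth_map A flat_atlas f"
proof -
 interpret F: smooth_manifold "flat_atlas :: (real, real) atlas" by (rule smooth_manifold_flat)
 have "continuous_on UNIV f" if f: "f : \<F> A"
 proof (rule continuous_at_imp_continuous_on, rule ballI)
  fix p
  obtain U \<phi> where U: "(U, \<phi>) : A" "p : U" by (rule chart_at)
  have "continuous_on (\<phi> ` U) (f \<circ> inv_into U \<phi>)"
   by (rule smooth_on_imp_continuous_on) (use f U(1) in "auto simp: smooth_functions_def")
  hence "continuous_on U (%q. (f \<circ> inv_into U \<phi>) (\<phi> q))"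
   by (rule continuous_on_compose2[OF _ chart(5)[OF U(1)]]) auto
  hence "continuous_on U f" by (rule continuous_on_cong[THEN iffD1, rotated 2, OF _ refl]) (use U in auto)
  thus "isCont f p" using U chart(1)[OF U(1)] by (simp add: continuous_on_eq_continuous_at)
 qed
 thus ?thesis by (auto simp: smooth_map_def smooth_functions_def)
qed

lemma smooth_functions_chart:
 "f : \<F> A ==> (U, \<phi>) : A ==> smooth_on (\<phi> ` U) (%y. f (inv_into U \<phi> y))"
 by (auto simp: smooth_functions_def o_def)

lemma smooth_functionsI:
 "(!!U \<phi>. (U, \<phi>) : A ==> smooth_on (\<phi> ` U) (%y. f (inv_into U \<phi> y))) ==> f : \<F> A"
 by (auto simp: smooth_functions_def o_def)

lemma smooth_functionsI_local:
 assumes "!!p. \<exists>U \<phi> W. (U, \<phi>) : A & open W & p : W & W \<subseteq> U & smooth_on (\<phi> ` W) (%y. f (inv_into U \<phi> y))"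
 shows "f : \<F> A"
proof -
 interpret F: smooth_manifold "flat_atlas :: (real, real) atlas" by (rule smooth_manifold_flat)
 interpret AF: two_manifolds A "flat_atlas :: (real, real) atlas" ..
 show ?thesis unfolding smooth_functions_iff AF.smooth_map_iff
 proof
  fix p
  obtain U \<phi> W where "(U, \<phi>) : A" "open W" "p : W" "W \<subseteq> U" "smooth_on (\<phi> ` W) (%y. f (inv_into U \<phi> y))"
   using assms by blast
  thus "smooth_at A flat_atlas f p"
   by (intro smooth_atI[of U \<phi> A UNIV id _ W]) auto
 qed
qed

lemma smooth_functions_const: "(%x. c) : \<F> A"
 by (auto intro!: smooth_functionsI smooth_intros)

lemma smooth_functions_add: "f : \<F> A ==> g : \<F> A ==> (%x. f x + g x) : \<F> A"
 by (rule smooth_functionsI, rule smooth_on_add) (auto intro: chart smooth_functions_chart)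

lemma smooth_functions_mult: "f : \<F> A ==> g : \<F> A ==> (%x. f x * g x) : \<F> A"
 by (rule smooth_functionsI, rule smooth_on_mult) (auto intro: chart smooth_functions_chart)

lemma smooth_functions_cmult: "f : \<F> A ==> (%x. c * f x) : \<F> A"
 by (rule smooth_functions_mult[OF smooth_functions_const])

lemma smooth_functions_minus: "f : \<F> A ==> (%x. - f x) : \<F> A"
 using smooth_functions_cmult[of f "-1"] by simp

lemma smooth_functions_diff: "f : \<F> A ==> g : \<F> A ==> (%x. f x - g x) : \<F> A"
 using smooth_functions_add[OF _ smooth_functions_minus] by simp

lemma smooth_functions_sum:
 "(!!i. i : I ==> f i : \<F> A) ==> (%x. SUM i:I. f i x) : \<F> A"
 by (induction I rule: infinite_finite_induct) (auto intro: smooth_functions_const smooth_functions_add)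

lemmas smooth_functions_intros = smooth_functions_const smooth_functions_add smooth_functions_mult
 smooth_functions_cmult smooth_functions_minus smooth_functions_diff smooth_functions_sum

lemma smooth_functions_continuous: "f : \<F> A ==> continuous_on UNIV f"
 unfolding smooth_functions_iff smooth_map_def by blast

text \<open>A smooth function on an open part of a chart domain becomes globally smooth after multiplication with a cut-off function;
  the support is closed in the manifold because it is compact and the manifold is Hausdorff.\<close>

lemma cutoff_extension_smooth:
 assumes U: "(U, \<phi>) : A" and N: "open N" "N \<subseteq> \<phi> ` U" and h: "smooth_on N h"
  and \<eta>: "smooth_on UNIV \<eta>" "compact K" "K \<subseteq> N" "!!y. y \<notin> K ==> \<eta> y = 0"
 shows "(%q. if q : U then \<eta> (\<phi> q) * h (\<phi> q) else (0::real)) : \<F> A" (is "?f : _")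
proof (rule smooth_functionsI_local)
 fix p
 show "\<exists>U \<phi> W. (U, \<phi>) : A & open W & p : W & W \<subseteq> U & smooth_on (\<phi> ` W) (%y. ?f (inv_into U \<phi> y))"
 proof (cases "p : U")
  case True
  have "smooth_on (\<phi> ` U) (%y. \<eta> y * h y)"
  proof (rule smooth_on_local)
   fix y assume y: "y : \<phi> ` U"
   show "\<exists>V. open V & y : V & smooth_on V (%y. \<eta> y * h y)"
   proof (cases "y : N")
    case True
    thus ?thesis using N(1) by (intro exI[of _ N]) (auto intro!: smooth_intros smooth_on_subset[OF \<eta>(1)] h)
   next
    case False
    have o: "open (- K)" using \<eta>(2) by (simp add: compact_imp_closed open_Compl)
    have "smooth_on (- K) (%y. \<eta> y * h y)"
     by (rule smooth_on_cong[OF smooth_on_const[of _ 0] o]) (simp add: \<eta>(4))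
    thus ?thesis using o False \<eta>(3) by blast
   qed
  qed
  hence "smooth_on (\<phi> ` U) (%y. ?f (inv_into U \<phi> y))"
   by (rule smooth_on_cong[OF _ chart(2)[OF U]]) (auto simp: inv_into_into f_inv_into_f U)
  thus ?thesis using True U chart(1)[OF U] by blast
 next
  case False
  define C where "C = inv_into U \<phi> ` K"
  have "compact C" unfolding C_def
   using \<eta>(2,3) N(2) by (intro compact_continuous_image continuous_on_subset[OF chart(6)[OF U]]) auto
  hence "closed C" by (rule compact_imp_closed)
  have CU: "C \<subseteq> U" using \<eta>(3) N(2) by (auto simp: C_def inv_into_into subset_iff)
  have f0: "?f q = 0" if "q \<notin> C" for q
   using that \<eta>(4)[of "\<phi> q"] unfolding C_def by (metis U chart_inverse image_eqI mult_zero_left)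
  obtain V \<psi> where V: "(V, \<psi>) : A" "p : V" by (rule chart_at)
  have W: "open (V - C)" "p : V - C" "V - C \<subseteq> V" using chart(1)[OF V(1)] V(2) \<open>closed C\<close> CU False by auto
  have "smooth_on (\<psi> ` (V - C)) (%y. ?f (inv_into V \<psi> y))"
  proof (rule smooth_on_cong[OF smooth_on_const[of _ 0] open_chart_image[OF V(1) W(1,3)]])
   fix y assume "y : \<psi> ` (V - C)"
   hence "inv_into V \<psi> y : V - C" by (rule chart_inverse_mem[OF V(1) W(3)])
   thus "0 = ?f (inv_into V \<psi> y)" using f0[of "inv_into V \<psi> y"] by simp
  qed
  thus ?thesis using V W by blast
 qed
qed

lemma local_function_extension:
 assumes U: "(U, \<phi>) : A" "p : U" and h: "smooth_on (\<phi> ` U) h"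
 obtains f W where "f : \<F> A" "open W" "p : W" "W \<subseteq> U" "!!q. q : W ==> f q = (h (\<phi> q) :: real)"
proof -
 obtain \<eta> :: "'e => real" and V K where \<eta>: "smooth_on UNIV \<eta>" "open V" "\<phi> p : V" "V \<subseteq> K"
  "!!x. x : V ==> \<eta> x = 1" "compact K" "K \<subseteq> \<phi> ` U" "!!x. x \<notin> K ==> \<eta> x = 0"
  using exists_cutoff_function[OF chart(2)[OF U(1)], of "\<phi> p"] U(2) by blast
 show thesis
 proof (rule that)
  show "(%q. if q : U then \<eta> (\<phi> q) * h (\<phi> q) else 0) : \<F> A"
   by (rule cutoff_extension_smooth[OF U(1) chart(2)[OF U(1)] subset_refl h \<eta>(1,6,7,8)])
  show "open (U \<inter> \<phi> -` V)" by (rule continuous_open_preimage[OF chart(5)[OF U(1)] chart(1)[OF U(1)] \<eta>(2)])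
 qed (use U \<eta> in auto)
qed

end

section \<open>Tangent vectors and vector fields\<close>

lemma tadd_apply [simp]: "tadd u v f = u f + v f" by (simp add: tadd_def)
lemma tscale_apply [simp]: "tscale c u f = c * u f" by (simp add: tscale_def)

context smooth_manifold
begin

lemma tangent_linear:
 assumes "v : \<T> A p" "f : \<F> A" "h : \<F> A"
 shows "v (%x. a * f x + b * h x) = a * v f + b * v h"
 using assms unfolding tangent_space_def by blast

lemma tangent_add:
 assumes "v : \<T> A p" "f : \<F> A" "h : \<F> A"
 shows "v (%x. f x + h x) = v f + v h"
 using tangent_linear[OF assms, of 1 1] by simp

lemma tangent_diff:
 assumes "v : \<T> A p" "f : \<F> A" "h : \<F> A"
 shows "v (%x. f x - h x) = v f - v h"
 using tangent_linear[OF assms, of 1 "-1"] by simp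

lemma tangent_mult:
 assumes "v : \<T> A p" "f : \<F> A" "h : \<F> A"
 shows "v (%x. f x * h x) = f p * v h + h p * v f"
 using assms unfolding tangent_space_def by blast

lemma tangent_const:
 assumes "v : \<T> A p" shows "v (%x. c) = 0"
proof -
 have "v (%x. 1) = 0"
  using tangent_mult[OF assms smooth_functions_const smooth_functions_const, of 1 1] by simp
 moreover have "v (%x. c * 1 + 0 * 1) = c * v (%x. 1) + 0 * v (%x. 1)"
  by (rule tangent_linear[OF assms smooth_functions_const smooth_functions_const])
 ultimately show ?thesis by simp
qed

lemma tangent_cmult:
 assumes "v : \<T> A p" "f : \<F> A"
 shows "v (%x. c * f x) = c * v f"
 using tangent_mult[OF assms(1) smooth_functions_const assms(2)] tangent_const[OF assms(1)] by simp

lemma tangent_sum: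
 assumes "v : \<T> A p" "!!i. i : I ==> f i : \<F> A"
 shows "v (%x. SUM i:I. f i x) = (SUM i:I. v (f i))"
 using assms(2)
proof (induction I rule: infinite_finite_induct)
 case (insert i I)
 thus ?case
  using tangent_add[OF assms(1), of "f i" "%x. SUM i:I. f i x"] by (simp add: smooth_functions_sum)
qed (simp_all add: tangent_const[OF assms(1)])

lemma tangent_nonsmooth: "v : \<T> A p ==> f \<notin> \<F> A ==> v f = 0"
 unfolding tangent_space_def by blast

lemma tangent_eqI:
 assumes "u : \<T> A p" "v : \<T> A q" "!!f. f : \<F> A ==> u f = v f"
 shows "u = v"
 using assms tangent_nonsmooth by (metis ext)

lemma tangent_combination:
 assumes "!!i. i : I ==> e i : \<T> A p"
 shows "(%f. SUM i:I. c i * e i f) : \<T> A p"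
proof -
 let ?s = "%f. SUM i:I. c i * e i f"
 have "?s (%x. a * f x + b * h x) = a * ?s f + b * ?s h"
  if "f : \<F> A" "h : \<F> A" for f h a b
  using tangent_linear[OF assms that] by (simp add: sum_distrib_left sum.distrib algebra_simps)
 moreover have "?s (%x. f x * h x) = f p * ?s h + h p * ?s f"
  if "f : \<F> A" "h : \<F> A" for f h
  using tangent_mult[OF assms that] by (simp add: sum_distrib_left sum.distrib algebra_simps)
 moreover have "?s f = 0" if "f \<notin> \<F> A" for f
  using tangent_nonsmooth[OF assms that] by simp
 ultimately show ?thesis unfolding tangent_space_def by blast
qed

lemma tangent_tadd: "u : \<T> A p ==> v : \<T> A p ==> tadd u v : \<T> A p"
 using tangent_combination[of "{True, False}" "%i. if i then u else v" p "%_. 1"] by (simp add: tadd_def)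

lemma tangent_tscale: "u : \<T> A p ==> tscale c u : \<T> A p"
 using tangent_combination[of "{()}" "%_. u" p "%_. c"] by (simp add: tscale_def)

lemma tangent_tzero: "tzero : \<T> A p"
 using tangent_combination[of "{}"] by simp

subsection \<open>Derivations are directional derivatives\<close>

definition chart_tangent :: "'p set => ('p => 'e) => 'p => 'e => 'p tangent" where
 "chart_tangent U \<phi> p a = (%f. if f : \<F> A
   then Df (%y. f (inv_into U \<phi> y)) (\<phi> p) a else 0)"

lemma chart_rep_has_derivative:
 assumes "(U, \<phi>) : A" "p : U" "f : \<F> A"
 shows "((%y. f (inv_into U \<phi> y)) has_derivative (%a. chart_tangent U \<phi> p a f)) (at (\<phi> p))"
 using smooth_on_has_derivative[OF smooth_functions_chart[OF assms(3,1)], of "\<phi> p"] assms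
 by (simp add: chart_tangent_def)

lemma chart_tangent_eqI:
 assumes "(U, \<phi>) : A" "p : U" "f : \<F> A"
  "((%y. f (inv_into U \<phi> y)) has_derivative D) (at (\<phi> p))"
 shows "chart_tangent U \<phi> p a f = D a"
 using has_derivative_unique[OF chart_rep_has_derivative[OF assms(1-3)] assms(4)] by metis

lemma chart_tangent_linear:
 assumes "(U, \<phi>) : A" "p : U"
 shows "tadd (chart_tangent U \<phi> p a) (chart_tangent U \<phi> p b) = chart_tangent U \<phi> p (a + b)"
  and "tscale c (chart_tangent U \<phi> p a) = chart_tangent U \<phi> p (c *\<^sub>R a)"
  and "(%f. SUM i:I. d i * chart_tangent U \<phi> p (w i) f) = chart_tangent U \<phi> p (SUM i:I. d i *\<^sub>R w i)"
proof -
 have l: "linear (%a. chart_tangent U \<phi> p a f)" if "f : \<F> A" for f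
  using has_derivative_linear[OF chart_rep_has_derivative[OF assms that]] .
 show "tadd (chart_tangent U \<phi> p a) (chart_tangent U \<phi> p b) = chart_tangent U \<phi> p (a + b)"
  using linear_add[OF l] by (auto simp: fun_eq_iff) (metis add.right_neutral chart_tangent_def)
 show "tscale c (chart_tangent U \<phi> p a) = chart_tangent U \<phi> p (c *\<^sub>R a)"
  using linear_cmul[OF l] by (auto simp: fun_eq_iff) (metis mult_zero_right chart_tangent_def real_scaleR_def)
 show "(%f. SUM i:I. d i * chart_tangent U \<phi> p (w i) f) = chart_tangent U \<phi> p (SUM i:I. d i *\<^sub>R w i)"
 proof
  fix f
  show "(SUM i:I. d i * chart_tangent U \<phi> p (w i) f) = chart_tangent U \<phi> p (SUM i:I. d i *\<^sub>R w i) f"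
  proof (cases "f : \<F> A")
   case True
   show ?thesis using linear_sum[OF l[OF True], of "%i. d i *\<^sub>R w i" I] linear_cmul[OF l[OF True]] by simp
  qed (simp add: chart_tangent_def)
 qed
qed

lemma chart_tangent_in_tangent_space:
 assumes "(U, \<phi>) : A" "p : U"
 shows "chart_tangent U \<phi> p a : \<T> A p"
proof -
 note D = chart_rep_has_derivative[OF assms] and eqI = chart_tangent_eqI[OF assms]
 have "chart_tangent U \<phi> p a (%x. s * f x + t * h x) = s * chart_tangent U \<phi> p a f + t * chart_tangent U \<phi> p a h"
  if f: "f : \<F> A" and h: "h : \<F> A" for f h s t
  by (rule eqI[OF _ has_derivative_add[OF has_derivative_mult_right[OF D[OF f]] has_derivative_mult_right[OF D[OF h]]]])
   (intro smooth_functions_intros f h)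
 moreover have "chart_tangent U \<phi> p a (%x. f x * h x) = f p * chart_tangent U \<phi> p a h + h p * chart_tangent U \<phi> p a f"
  if f: "f : \<F> A" and h: "h : \<F> A" for f h
  using eqI[OF smooth_functions_mult[OF f h] has_derivative_mult[OF D[OF f] D[OF h]]] assms by simp
 ultimately show ?thesis unfolding tangent_space_def by (auto simp: chart_tangent_def)
qed

lemma coordinate_extension:
 assumes "(U, \<phi>) : A" "p : U"
 obtains f W where "f : \<F> A" "open W" "p : W" "W \<subseteq> U" "!!q. q : W ==> f q = \<phi> q \<bullet> b"
  "!!q a. q : W ==> chart_tangent U \<phi> q a f = a \<bullet> b"
proof -
 have "smooth_on (\<phi> ` U) (%y. y \<bullet> b)" by (intro smooth_intros chart(2)[OF assms(1)])
 then obtain f W where f: "f : \<F> A" "open W" "p : W" "W \<subseteq> U" "!!q. q : W ==> f q = \<phi> q \<bullet> b"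
  by (rule local_function_extension[OF assms]) blast
 have "chart_tangent U \<phi> q a f = a \<bullet> b" if q: "q : W" for q a
 proof (rule chart_tangent_eqI[OF assms(1) _ f(1)])
  show "q : U" using q f(4) by blast
  have "((%y. y \<bullet> b) has_derivative (%a. a \<bullet> b)) (at (\<phi> q))"
   by (rule bounded_linear_imp_has_derivative[OF bounded_linear_inner_left])
  thus "((%y. f (inv_into U \<phi> y)) has_derivative (%a. a \<bullet> b)) (at (\<phi> q))"
  proof (rule has_derivative_transform_within_open[OF _ open_chart_image[OF assms(1) f(2,4)]])
   show "y \<bullet> b = f (inv_into U \<phi> y)" if "y : \<phi> ` W" for y
    using that f(4,5) assms(1) by (auto simp: subset_iff)
  qed (use q in auto)
 qed
 thus thesis using that f by blast
qed

lemma chart_tangent_inject: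
 assumes "(U, \<phi>) : A" "p : U" "chart_tangent U \<phi> p a = chart_tangent U \<phi> p b"
 shows "a = b"
proof (rule euclidean_eqI)
 fix c :: 'e
 obtain f W where "f : \<F> A" "open W" "p : W" "W \<subseteq> U" "!!q. q : W ==> f q = \<phi> q \<bullet> c"
  "!!q a. q : W ==> chart_tangent U \<phi> q a f = a \<bullet> c"
  by (rule coordinate_extension[OF assms(1,2), where b=c]) blast
 thus "a \<bullet> c = b \<bullet> c" using assms(3) by metis
qed

text \<open>By Hadamard's lemma a function is, up to a constant and near \<open>p\<close>, a combination of the coordinates centred at
  \<open>p\<close> with smooth coefficients. The product rule leaves only the values of the coefficients at \<open>p\<close>.\<close>

lemma tangent_is_chart_tangent:
 assumes U: "(U, \<phi>) : A" "p : U" and v: "v : \<T> A p"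
 obtains a where "v = chart_tangent U \<phi> p a"
proof -
 let ?c = "\<phi> p"
 obtain r where r: "r > 0" "ball ?c r \<subseteq> \<phi> ` U"
  using chart(2)[OF U(1)] U(2) open_contains_ball by blast
 have "?c : ball ?c r" using r by simp
 then obtain \<eta> :: "'e => real" and V K where \<eta>: "smooth_on UNIV \<eta>" "open V" "?c : V" "V \<subseteq> K"
  "!!x. x : V ==> \<eta> x = 1" "compact K" "K \<subseteq> ball ?c r" "!!x. x \<notin> K ==> \<eta> x = 0"
  by (rule exists_cutoff_function[OF open_ball]) blast
 define E where "E = (%h q. if q : U then \<eta> (\<phi> q) * h (\<phi> q) else (0::real))"
 have E: "E h : \<F> A" if "smooth_on (ball ?c r) h" for h
  unfolding E_def by (rule cutoff_extension_smooth[OF U(1) open_ball r(2) that \<eta>(1,6,7,8)])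
 have E1: "E (%_. 1) : \<F> A" by (rule E[OF smooth_on_const])
 have E1p: "E (%_. 1) p = 1" using U \<eta> by (simp add: E_def)
 have Ec: "E (%y. (y - ?c) \<bullet> b) : \<F> A" for b
  by (rule E) (intro smooth_intros open_ball)
 define a where "a = (SUM b:Basis. v (E (%y. (y - ?c) \<bullet> b)) *\<^sub>R b)"
 have "v f = chart_tangent U \<phi> p a f" if f: "f : \<F> A" for f
 proof -
  let ?F = "%y. f (inv_into U \<phi> y)"
  have F: "smooth_on (ball ?c r) ?F" by (rule smooth_on_subset[OF smooth_functions_chart[OF f U(1)] r(2)])
  obtain g where g: "!!b. smooth_on (ball ?c r) (g b)" "!!b. g b ?c = Df ?F ?c b"
   "!!x. x : ball ?c r ==> ?F x = ?F ?c + (SUM b:Basis. ((x - ?c) \<bullet> b) * g b x)"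
   using Hadamard_lemma[OF F r(1)] by blast
  have Eg: "E (g b) : \<F> A" for b by (rule E[OF g(1)])
  have eq: "E (%_. 1) q * (E (%_. 1) q * f q) =
    f p * (E (%_. 1) q * E (%_. 1) q) + (SUM b:Basis. E (%y. (y - ?c) \<bullet> b) q * E (g b) q)" for q
  proof (cases "q : U & \<phi> q : ball ?c r")
   case True
   hence "f q = f p + (SUM b:Basis. ((\<phi> q - ?c) \<bullet> b) * g b (\<phi> q))"
    using g(3)[of "\<phi> q"] U by simp
   thus ?thesis using True by (simp add: E_def algebra_simps sum_distrib_left del: mem_ball)
  next
   case False
   hence "\<phi> q \<notin> K" if "q : U" using that \<eta>(7) by blast
   hence "q : U ==> \<eta> (\<phi> q) = 0" using \<eta>(8) by blast
   thus ?thesis by (simp add: E_def)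
  qed
  have "v (%q. E (%_. 1) q * (E (%_. 1) q * f q)) = v f + 2 * f p * v (E (%_. 1))"
   using tangent_mult[OF v E1 smooth_functions_mult[OF E1 f]] tangent_mult[OF v E1 f] E1p by simp
  moreover have "v (%q. f p * (E (%_. 1) q * E (%_. 1) q) + (SUM b:Basis. E (%y. (y - ?c) \<bullet> b) q * E (g b) q)) =
    2 * f p * v (E (%_. 1)) + (SUM b:Basis. v (E (%y. (y - ?c) \<bullet> b)) * Df ?F ?c b)"
  proof -
   have "E (%y. (y - ?c) \<bullet> b) p = 0" "E (g b) p = Df ?F ?c b" for b
    using U \<eta>(3,5) g(2) by (auto simp: E_def)
   hence "v (%q. E (%y. (y - ?c) \<bullet> b) q * E (g b) q) =
     v (E (%y. (y - ?c) \<bullet> b)) * Df ?F ?c b" for b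
    using tangent_mult[OF v Ec Eg, of b b] by simp
   hence "v (%q. SUM b:Basis. E (%y. (y - ?c) \<bullet> b) q * E (g b) q) =
     (SUM b:Basis. v (E (%y. (y - ?c) \<bullet> b)) * Df ?F ?c b)"
    using tangent_sum[OF v, of Basis "%b q. E (%y. (y - ?c) \<bullet> b) q * E (g b) q"] smooth_functions_mult[OF Ec Eg] by simp
   moreover have "v (%q. f p * (E (%_. 1) q * E (%_. 1) q)) = 2 * f p * v (E (%_. 1))"
    using tangent_cmult[OF v smooth_functions_mult[OF E1 E1]] tangent_mult[OF v E1 E1] E1p by simp
   moreover have "(%q. f p * (E (%_. 1) q * E (%_. 1) q)) : \<F> A"
    "(%q. SUM b:Basis. E (%y. (y - ?c) \<bullet> b) q * E (g b) q) : \<F> A"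
    by (intro smooth_functions_cmult smooth_functions_mult smooth_functions_sum E1 Ec Eg)+
   ultimately show ?thesis using tangent_add[OF v] by simp
  qed
  ultimately have "v f = (SUM b:Basis. v (E (%y. (y - ?c) \<bullet> b)) * Df ?F ?c b)"
   unfolding eq by simp
  also have "\<dots> = Df ?F ?c a"
  proof -
   have l: "linear (Df ?F ?c)"
    using has_derivative_linear[OF smooth_on_has_derivative[OF F]] r by simp
   show ?thesis unfolding a_def linear_sum[OF l] linear_cmul[OF l] by simp
  qed
  finally show ?thesis using f by (simp add: chart_tangent_def)
 qed
 hence "v = chart_tangent U \<phi> p a"
  by (rule tangent_eqI[OF v chart_tangent_in_tangent_space[OF U]])
 thus thesis by (rule that)
qed

subsection \<open>Vector fields in charts and frames\<close>

lemma vector_fieldD: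
 assumes "X : \<XX> A"
 shows "X p : \<T> A p" "f : \<F> A ==> (%p. X p f) : \<F> A"
 using assms unfolding vector_fields_def by auto

lemma vector_field_chart_rep:
 assumes X: "X : \<XX> A" and U: "(U, \<phi>) : A"
 obtains V where "smooth_on (\<phi> ` U) V" "!!p. p : U ==> X p = chart_tangent U \<phi> p (V (\<phi> p))"
proof -
 have "\<forall>y. \<exists>a. y : \<phi> ` U --> X (inv_into U \<phi> y) = chart_tangent U \<phi> (inv_into U \<phi> y) a"
  using tangent_is_chart_tangent[OF U _ vector_fieldD(1)[OF X]] by (metis inv_into_into)
 then obtain V where V: "!!y. y : \<phi> ` U ==> X (inv_into U \<phi> y) = chart_tangent U \<phi> (inv_into U \<phi> y) (V y)"
  by metis
 have VX: "X p = chart_tangent U \<phi> p (V (\<phi> p))" if "p : U" for p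
  using V[of "\<phi> p"] that U by simp
 have "smooth_on (\<phi> ` U) V"
 proof (rule smooth_on_componentwise[OF chart(2)[OF U]], rule smooth_on_local)
  fix b :: 'e and y assume "y : \<phi> ` U"
  then obtain p where p: "p : U" "y = \<phi> p" by blast
  obtain f W where f: "f : \<F> A" "open W" "p : W" "W \<subseteq> U" "!!q. q : W ==> f q = \<phi> q \<bullet> b"
   "!!q a. q : W ==> chart_tangent U \<phi> q a f = a \<bullet> b" by (rule coordinate_extension[OF U p(1), where b=b]) blast
  have o: "open (\<phi> ` W)" by (rule open_chart_image[OF U f(2,4)])
  have "smooth_on (\<phi> ` W) (%y. X (inv_into U \<phi> y) f)"
   by (rule smooth_on_subset[OF smooth_functions_chart[OF vector_fieldD(2)[OF X f(1)] U]]) (use f(4) in blast)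
  hence "smooth_on (\<phi> ` W) (%y. V y \<bullet> b)"
  proof (rule smooth_on_cong[OF _ o])
   fix z assume "z : \<phi> ` W"
   then obtain q where q: "q : W" "q : U" "z = \<phi> q" using f(4) by blast
   thus "X (inv_into U \<phi> z) f = V z \<bullet> b" using VX[OF q(2)] f(6)[OF q(1)] U by simp
  qed
  thus "\<exists>N. open N & y : N & smooth_on N (%y. V y \<bullet> b)" using o p f(3) by blast
 qed
 thus thesis using that VX by blast
qed

lemma coordinate_field_extension:
 assumes U: "(U, \<phi>) : A" "p : U"
 obtains X W where "X : \<XX> A" "open W" "p : W" "W \<subseteq> U" "!!q. q : W ==> X q = chart_tangent U \<phi> q b"
proof -
 obtain \<eta> :: "'e => real" and V K where \<eta>: "smooth_on UNIV \<eta>" "open V" "\<phi> p : V" "V \<subseteq> K"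
  "!!x. x : V ==> \<eta> x = 1" "compact K" "K \<subseteq> \<phi> ` U" "!!x. x \<notin> K ==> \<eta> x = 0"
  using exists_cutoff_function[OF chart(2)[OF U(1)], of "\<phi> p"] U(2) by blast
 define X where "X = (%q. if q : U then tscale (\<eta> (\<phi> q)) (chart_tangent U \<phi> q b) else tzero)"
 have "X q : \<T> A q" for q
  by (simp add: X_def tangent_tzero tangent_tscale chart_tangent_in_tangent_space[OF U(1)])
 moreover have "(%q. X q f) : \<F> A" if f: "f : \<F> A" for f
 proof -
  have "(%q. if q : U then \<eta> (\<phi> q) * Df (%y. f (inv_into U \<phi> y)) (\<phi> q) b else 0) : \<F> A"
   by (rule cutoff_extension_smooth[OF U(1) chart(2)[OF U(1)] subset_refl
      smooth_on_frechet_derivative[OF smooth_functions_chart[OF f U(1)]] \<eta>(1,6,7,8)])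
  moreover have "(%q. X q f) = (%q. if q : U then \<eta> (\<phi> q) * Df (%y. f (inv_into U \<phi> y)) (\<phi> q) b else 0)"
   using f by (auto simp: X_def chart_tangent_def)
  ultimately show ?thesis by simp
 qed
 ultimately have X: "X : \<XX> A" unfolding vector_fields_def by blast
 have o: "open (U \<inter> \<phi> -` V)" by (rule continuous_open_preimage[OF chart(5)[OF U(1)] chart(1)[OF U(1)] \<eta>(2)])
 have "X q = chart_tangent U \<phi> q b" if "q : U \<inter> \<phi> -` V" for q
  using that \<eta>(5) by (auto simp: X_def tscale_def)
 thus thesis using that[OF X o] U \<eta>(3) by blast
qed

lemma vector_field_combination:
 assumes "!!i. i : I ==> X i : \<XX> A" "!!i. i : I ==> c i : \<F> A"
 shows "(%p f. SUM i:I. c i p * X i p f) : \<XX> A"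
 unfolding vector_fields_def
proof (intro CollectI conjI allI ballI)
 show "(%f. SUM i:I. c i p * X i p f) : \<T> A p" for p
  by (rule tangent_combination) (use assms vector_fieldD(1) in blast)
 show "(%p. SUM i:I. c i p * X i p f) : \<F> A" if "f : \<F> A" for f
  by (intro smooth_functions_sum smooth_functions_mult assms(2)) (use assms vector_fieldD(2) that in blast)+
qed

lemma independent_tangents_span:
 fixes e :: "'n::finite => 'p tangent"
 assumes e: "!!i. e i : \<T> A p" and dim: "CARD('n) = DIM('e)"
  and ind: "!!c :: real^'n. (%f. SUM i:UNIV. c $ i * e i f) = tzero ==> c = 0" and u: "u : \<T> A p"
 obtains c :: "real^'n" where "u = (%f. SUM i:UNIV. c $ i * e i f)"
proof -
 obtain U \<phi> where U: "(U, \<phi>) : A" "p : U" by (rule chart_at)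
 have "\<forall>i. \<exists>a. e i = chart_tangent U \<phi> p a" using tangent_is_chart_tangent[OF U e] by metis
 then obtain a where a: "!!i. e i = chart_tangent U \<phi> p (a i)" by metis
 obtain b where b: "u = chart_tangent U \<phi> p b" by (rule tangent_is_chart_tangent[OF U u])
 define L where "L = (%c::real^'n. SUM i:UNIV. (c $ i) *\<^sub>R a i)"
 have comb: "(%f. SUM i:UNIV. c $ i * e i f) = chart_tangent U \<phi> p (L c)" for c
  unfolding a L_def by (rule chart_tangent_linear(3)[OF U])
 have z: "chart_tangent U \<phi> p 0 = tzero"
  using chart_tangent_linear(2)[OF U, of 0 0] by (auto simp: fun_eq_iff)
 have lin: "linear L" unfolding L_def
  by (intro linearI) (auto simp: scaleR_left_distrib sum.distrib scaleR_sum_right)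
 moreover have "inj L" using linear_injective_0[OF lin] ind comb z by metis
 ultimately have "dim (range L) = DIM('e)" using dim_image_eq[of L UNIV] dim by simp
 hence "span (range L) = UNIV" using dim_eq_full by blast
 hence "range L = UNIV" using lin by (simp add: linear_subspace_image span_eq_iff[THEN iffD2])
 then obtain c where "L c = b" by (metis surjD)
 thus thesis using that comb b by metis
qed

end

subsection \<open>Differentials\<close>

context two_manifolds
begin

lemma smooth_functions_comp:
 assumes "smooth_map A B F" "f : \<F> B" shows "(%x. f (F x)) : \<F> A"
 using smooth_map_compose[OF M.smooth_manifold_axioms N.smooth_manifold_axioms smooth_manifold_flat assms(1)] assms(2)
 unfolding M.smooth_functions_iff N.smooth_functions_iff by blast

lemma push_apply: "f : \<F> B ==> push B F v f = v (%x. f (F x))"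
 by (simp add: push_def o_def)

lemma push_in_tangent_space:
 assumes F: "smooth_map A B F" and v: "v : \<T> A p"
 shows "push B F v : \<T> B (F p)"
 unfolding tangent_space_def
proof (intro CollectI conjI ballI allI impI)
 note S = smooth_functions_comp[OF F]
 show "push B F v (%x. a * f x + b * h x) = a * push B F v f + b * push B F v h"
  if "f : \<F> B" "h : \<F> B" for f h a b
  using that M.tangent_linear[OF v S S] N.smooth_functions_add[OF N.smooth_functions_cmult N.smooth_functions_cmult]
  by (simp add: push_apply)
 show "push B F v (%x. f x * h x) = f (F p) * push B F v h + h (F p) * push B F v f"
  if "f : \<F> B" "h : \<F> B" for f h
  using that M.tangent_mult[OF v S S] N.smooth_functions_mult by (simp add: push_apply)
qed (simp add: push_def)

end

lemma push_combination: "push B F (%f. SUM i:I. c i * e i f) = (%f. SUM i:I. c i * push B F (e i) f)"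
 by (auto simp: push_def)

lemma push_compose:
 assumes "smooth_manifold B" "smooth_manifold C" "smooth_map B C G"
 shows "push C G (push B F v) = push C (%x. G (F x)) v"
proof -
 interpret B: smooth_manifold B by fact
 interpret C: smooth_manifold C by fact
 interpret two_manifolds B C ..
 show ?thesis using smooth_functions_comp[OF assms(3)] by (auto simp: push_def o_def)
qed

lemma (in smooth_manifold) push_id: "v : \<T> A p ==> push A (%x. x) v = v"
 using tangent_nonsmooth by (auto simp: push_def o_def)

section \<open>Curves and their velocities\<close>

definition has_velocity ::
 "('p::topological_space, 'e::euclidean_space) atlas => (real => 'p) => 'p tangent => real => bool" where
 "has_velocity A c v t \<longleftrightarrow> (\<forall>f\<in>\<F> A. ((%s. f (c s)) has_real_derivative v f) (at t))"

lemma smooth_on_Lipschitz_cball: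
 fixes V :: "'e::euclidean_space => 'f::real_normed_vector"
 assumes V: "smooth_on W V" and sub: "cball y r \<subseteq> W"
 obtains L where "L >= 0" "!!u w. u : cball y r ==> w : cball y r ==> norm (V u - V w) <= L * norm (u - w)"
proof -
 have "\<exists>B. \<forall>x\<in>cball y r. norm (Df V x b) <= B" for b
 proof -
  have "compact ((%x. Df V x b) ` cball y r)"
   by (intro compact_continuous_image smooth_on_imp_continuous_on
     smooth_on_subset[OF smooth_on_frechet_derivative[OF V] sub] compact_cball)
  thus ?thesis using compact_imp_bounded[of "(%x. Df V x b) ` cball y r"]
   by (auto simp: bounded_iff)
 qed
 then obtain M where M: "!!b x. x : cball y r ==> norm (Df V x b) <= M b" by metis
 have "norm (V u - V w) <= (SUM b:Basis. \<bar>M b\<bar>) * norm (u - w)" if "u : cball y r" "w : cball y r" for u w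
 proof (rule differentiable_bound[OF convex_cball])
  fix z assume z: "z : cball y r"
  have Dz: "(V has_derivative Df V z) (at z)"
   by (rule smooth_on_has_derivative[OF V]) (use z sub in blast)
  thus "(V has_derivative Df V z) (at z within cball y r)" by (rule has_derivative_at_withinI)
  have l: "linear (Df V z)" by (rule has_derivative_linear[OF Dz])
  show "onorm (Df V z) <= (SUM b:Basis. \<bar>M b\<bar>)"
  proof (rule onorm_le)
   fix v
   have "norm (Df V z (SUM b:Basis. (v \<bullet> b) *\<^sub>R b)) <= (SUM b:Basis. \<bar>M b\<bar> * norm v)"
    unfolding linear_sum[OF l] linear_cmul[OF l]
   proof (rule sum_norm_le)
    fix b :: 'e assume b: "b : Basis"
    have "norm ((v \<bullet> b) *\<^sub>R Df V z b) <= norm v * \<bar>M b\<bar>"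
     using Basis_le_norm[OF b, of v] M[OF z, of b] by (simp add: mult_mono)
    thus "norm ((v \<bullet> b) *\<^sub>R Df V z b) <= \<bar>M b\<bar> * norm v" by (simp add: mult.commute)
   qed
   thus "norm (Df V z v) <= (SUM b:Basis. \<bar>M b\<bar>) * norm v"
    by (simp add: euclidean_representation sum_distrib_right)
  qed
 qed (use that in auto)
 thus thesis using that[of "SUM b:Basis. \<bar>M b\<bar>"] by (simp add: sum_nonneg)
qed

context smooth_manifold
begin

lemma bump_at:
 assumes "open W" "p : W"
 obtains f where "f : \<F> A" "f p = (1::real)" "!!q. q \<notin> W ==> f q = 0"
proof -
 obtain U \<phi> where U: "(U, \<phi>) : A" "p : U" by (rule chart_at)
 have o: "open (\<phi> ` (U \<inter> W))" by (rule open_chart_image[OF U(1)]) (use chart(1)[OF U(1)] assms in auto)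
 obtain \<eta> :: "'e => real" and V K where \<eta>: "smooth_on UNIV \<eta>" "open V" "\<phi> p : V" "V \<subseteq> K"
  "!!x. x : V ==> \<eta> x = 1" "compact K" "K \<subseteq> \<phi> ` (U \<inter> W)" "!!x. x \<notin> K ==> \<eta> x = 0"
  using exists_cutoff_function[OF o, of "\<phi> p"] U(2) assms(2) by blast
 have KU: "\<phi> ` (U \<inter> W) \<subseteq> \<phi> ` U" by blast
 show thesis
 proof (rule that[OF cutoff_extension_smooth[OF U(1) o KU smooth_on_const[of _ 1] \<eta>(1,6,7,8)]])
  show "(if q : U then \<eta> (\<phi> q) * 1 else 0) = 0" if "q \<notin> W" for q
  proof (cases "q : U")
   case True
   have "\<phi> q \<notin> \<phi> ` (U \<inter> W)" using that inj_onD[OF chart(4)[OF U(1)] _ True] by blast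
   thus ?thesis using \<eta>(7,8) by auto
  qed simp
 qed (use U \<eta>(5)[OF \<eta>(3)] in simp_all)
qed

lemma has_velocity_continuous:
 assumes "has_velocity A c v t" shows "isCont c t"
 unfolding continuous_at_open
proof (intro allI impI)
 fix W assume W: "open W & c t : W"
 obtain f where f: "f : \<F> A" "f (c t) = (1::real)" "!!q. q \<notin> W ==> f q = 0"
  by (rule bump_at[of W "c t"]) (use W in auto)
 have "isCont (%s. f (c s)) t" using assms f(1) DERIV_isCont unfolding has_velocity_def by blast
 then obtain S where S: "open S" "t : S" "!!s. s : S ==> f (c s) : {0<..}"
  using f(2) unfolding continuous_at_open by (metis greaterThan_iff open_greaterThan zero_less_one)
 have "c s : W" if "s : S" for s using S(3)[OF that] f(3)[of "c s"] by (metis greaterThan_iff less_irrefl)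
 thus "\<exists>S. open S & t : S & (\<forall>s\<in>S. c s : W)" using S by blast
qed

lemma has_velocity_chart:
 assumes U: "(U, \<phi>) : A" "c t : U" and v: "has_velocity A c (chart_tangent U \<phi> (c t) a) t"
 shows "((%s. \<phi> (c s)) has_vector_derivative a) (at t)"
proof -
 have "((%s. \<phi> (c s) \<bullet> b) has_derivative (%h. (h *\<^sub>R a) \<bullet> b)) (at t)" for b
 proof -
  obtain f W where f: "f : \<F> A" "open W" "c t : W" "W \<subseteq> U" "!!q. q : W ==> f q = \<phi> q \<bullet> b"
   "!!q a. q : W ==> chart_tangent U \<phi> q a f = a \<bullet> b" by (rule coordinate_extension[OF U, where b=b]) blast
  have "((%s. f (c s)) has_real_derivative a \<bullet> b) (at t)"
   using v f(1,3,6) unfolding has_velocity_def by metis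
  hence D: "((%s. f (c s)) has_derivative (%h. (h *\<^sub>R a) \<bullet> b)) (at t)"
   unfolding has_field_derivative_def by (rule has_derivative_eq_rhs) (simp add: fun_eq_iff)
  obtain S where S: "open S" "t : S" "!!s. s : S ==> c s : W"
   using has_velocity_continuous[OF v] f(2,3) unfolding continuous_at_open by metis
  show ?thesis
   by (rule has_derivative_transform_within_open[OF D S(1,2)]) (use f(5) S(3) in auto)
 qed
 thus ?thesis unfolding has_vector_derivative_def
  by (subst has_derivative_componentwise_within) simp
qed

lemma chart_curve_has_velocity:
 assumes U: "(U, \<phi>) : A" and c: "(c has_vector_derivative a) (at t)" "c t : \<phi> ` U"
 shows "has_velocity A (%s. inv_into U \<phi> (c s)) (chart_tangent U \<phi> (inv_into U \<phi> (c t)) a) t"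
 unfolding has_velocity_def
proof
 fix f assume f: "f : \<F> A"
 have p: "inv_into U \<phi> (c t) : U" "\<phi> (inv_into U \<phi> (c t)) = c t" using c(2) by (auto simp: inv_into_into f_inv_into_f)
 have D: "((%y. f (inv_into U \<phi> y)) has_derivative (%a. chart_tangent U \<phi> (inv_into U \<phi> (c t)) a f)) (at (c t))"
  using chart_rep_has_derivative[OF U p(1) f] unfolding p(2) .
 have "((%s. f (inv_into U \<phi> (c s))) has_derivative (%h. chart_tangent U \<phi> (inv_into U \<phi> (c t)) (h *\<^sub>R a) f)) (at t)"
  using has_derivative_compose[OF c(1)[unfolded has_vector_derivative_def] D] .
 thus "((%s. f (inv_into U \<phi> (c s))) has_real_derivative chart_tangent U \<phi> (inv_into U \<phi> (c t)) a f) (at t)"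
  unfolding has_field_derivative_def
  by (rule has_derivative_eq_rhs) (simp add: fun_eq_iff linear_cmul[OF has_derivative_linear[OF D]])
qed

text \<open>A curve whose velocity is prescribed as a time dependent combination of vector fields is determined by one of its points.
  In a chart the squared distance of two solutions satisfies a Gronwall estimate.\<close>

lemma integral_curve_unique:
 assumes Y: "!!i. i : I ==> Y i : \<XX> A" and I: "finite I"
  and w: "!!i. i : I ==> continuous_on T (w i)" and T: "open T" "connected T"
  and c: "!!t. t : T ==> has_velocity A c (%f. SUM i:I. w i t * Y i (c t) f) t"
  and d: "!!t. t : T ==> has_velocity A d (%f. SUM i:I. w i t * Y i (d t) f) t"
  and s: "s : T" "c s = d s" and t: "t : T"
 shows "c t = d t"
proof -
 define Z where "Z = {t : T. c t = d t}"
 have contc: "isCont c t" "isCont d t" if "t : T" for t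
  using has_velocity_continuous c[OF that] d[OF that] by blast+
 have "openin (top_of_set T) Z"
 proof -
  have "\<exists>e>0. ball t0 e \<subseteq> Z" if t0: "t0 : Z" for t0
  proof -
   have t0T: "t0 : T" and eq: "c t0 = d t0" using t0 by (auto simp: Z_def)
   obtain U \<phi> where U: "(U, \<phi>) : A" "c t0 : U" by (rule chart_at)
   have "\<forall>i. \<exists>V. i : I --> smooth_on (\<phi> ` U) V & (\<forall>p\<in>U. Y i p = chart_tangent U \<phi> p (V (\<phi> p)))"
    using vector_field_chart_rep[OF Y U(1)] by metis
   then obtain V where V: "!!i. i : I ==> smooth_on (\<phi> ` U) (V i)"
    "!!i p. i : I ==> p : U ==> Y i p = chart_tangent U \<phi> p (V i (\<phi> p))" by metis
   obtain r where r: "r > 0" "cball (\<phi> (c t0)) r \<subseteq> \<phi> ` U"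
    using chart(2)[OF U(1)] U(2) open_contains_cball by blast
   let ?B = "cball (\<phi> (c t0)) r"
   have "\<forall>i. \<exists>L. i : I --> L >= 0 & (\<forall>u\<in>?B. \<forall>w\<in>?B. norm (V i u - V i w) <= L * norm (u - w))"
    using smooth_on_Lipschitz_cball[OF V(1) r(2)] by metis
   then obtain L where L: "!!i. i : I ==> L i >= (0::real)"
    "!!i u w. i : I ==> u : ?B ==> w : ?B ==> norm (V i u - V i w) <= L i * norm (u - w)" by metis
   obtain k where k: "k > 0" "cball t0 k \<subseteq> T" using T(1) t0T open_contains_cball by blast
   have "\<exists>M. \<forall>t\<in>cball t0 k. \<bar>w i t\<bar> <= M" if "i : I" for i
   proof -
    have "compact (w i ` cball t0 k)"
     by (intro compact_continuous_image continuous_on_subset[OF w[OF that] k(2)] compact_cball)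
    thus ?thesis using compact_imp_bounded[of "w i ` cball t0 k"] by (auto simp: bounded_iff)
   qed
   then obtain M where M: "!!i t. i : I ==> t : cball t0 k ==> \<bar>w i t\<bar> <= M i" by metis
   have oB: "open (U \<inter> \<phi> -` ball (\<phi> (c t0)) r)"
    by (rule continuous_open_preimage[OF chart(5)[OF U(1)] chart(1)[OF U(1)] open_ball])
   have inB: "c t0 : U \<inter> \<phi> -` ball (\<phi> (c t0)) r" using U r by simp
   obtain S1 where S1: "open S1" "t0 : S1" "!!t. t : S1 ==> c t : U \<inter> \<phi> -` ball (\<phi> (c t0)) r"
    using contc(1)[OF t0T] oB inB unfolding continuous_at_open by metis
   obtain S2 where S2: "open S2" "t0 : S2" "!!t. t : S2 ==> d t : U \<inter> \<phi> -` ball (\<phi> (c t0)) r"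
    using contc(2)[OF t0T] oB inB eq unfolding continuous_at_open by metis
   have "open (S1 \<inter> S2 \<inter> ball t0 k)" "t0 : S1 \<inter> S2 \<inter> ball t0 k" using S1 S2 k by auto
   then obtain e where e: "e > 0" "cball t0 e \<subseteq> S1 \<inter> S2 \<inter> ball t0 k" using open_contains_cball by blast
   define u1 where "u1 = (%t. \<phi> (c t))"
   define u2 where "u2 = (%t. \<phi> (d t))"
   define R where "R = (%t x. SUM i:I. w i t *\<^sub>R V i x)"
   have near: "c t : U" "d t : U" "u1 t : ?B" "u2 t : ?B" "t : cball t0 k" "t : T" if "t : cball t0 e" for t
   proof -
    have S: "t : S1" "t : S2" "t : ball t0 k" using that e(2) by blast+
    show "t : cball t0 k" "t : T" using S(3) ball_subset_cball k(2) by blast+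
    show "c t : U" "d t : U" "u1 t : ?B" "u2 t : ?B"
     using S1(3)[OF S(1)] S2(3)[OF S(2)] by (auto simp: u1_def u2_def)
   qed
   have near_chart: "((%t. \<phi> (c t)) has_vector_derivative R t (\<phi> (c t))) (at t)"
    if "c t : U" "has_velocity A c (%f. SUM i:I. w i t * Y i (c t) f) t" for c t
   proof -
    have "(%f. SUM i:I. w i t * Y i (c t) f) = chart_tangent U \<phi> (c t) (R t (\<phi> (c t)))"
     unfolding R_def chart_tangent_linear(3)[OF U(1) that(1), symmetric] using V(2) that(1) by (auto intro!: sum.cong ext)
    thus ?thesis using has_velocity_chart[where c=c and t=t, OF U(1) that(1)] that(2) by simp
   qed
   have d1: "(u1 has_vector_derivative R t (u1 t)) (at t)" and d2: "(u2 has_vector_derivative R t (u2 t)) (at t)"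
    if "t : cball t0 e" for t
    unfolding u1_def u2_def by (rule near_chart near c d that)+
   define C where "C = (SUM i:I. M i * L i)"
   have RL: "norm (R t (u1 t) - R t (u2 t)) <= C * norm (u1 t - u2 t)" if "t : cball t0 e" for t
   proof -
    have "norm (R t (u1 t) - R t (u2 t)) = norm (SUM i:I. w i t *\<^sub>R (V i (u1 t) - V i (u2 t)))"
     by (simp add: R_def sum_subtractf scaleR_diff_right)
    also have "\<dots> <= (SUM i:I. M i * L i * norm (u1 t - u2 t))"
    proof (rule sum_norm_le)
     fix i assume i: "i : I"
     have "\<bar>w i t\<bar> * norm (V i (u1 t) - V i (u2 t)) <= M i * (L i * norm (u1 t - u2 t))"
      by (rule mult_mono) (use M[OF i near(5)[OF that]] L(2)[OF i near(3,4)[OF that]] in auto)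
     thus "norm (w i t *\<^sub>R (V i (u1 t) - V i (u2 t))) <= M i * L i * norm (u1 t - u2 t)" by (simp add: mult.assoc)
    qed
    also have "\<dots> = C * norm (u1 t - u2 t)" by (simp add: C_def sum_distrib_right)
    finally show ?thesis .
   qed
   define h where "h = (%t. (u1 t - u2 t) \<bullet> (u1 t - u2 t))"
   have hz: "h t = 0" if t: "t : {t0 - e..t0 + e}" for t
   proof (rule gronwall_zero[where h'="%t. 2 * ((u1 t - u2 t) \<bullet> (R t (u1 t) - R t (u2 t)))" and C="2 * C" and s=t0
      and h=h and t=t and a="t0 - e" and b="t0 + e"])
    fix t assume "t : {t0 - e..t0 + e}"
    hence te: "t : cball t0 e" by (auto simp: dist_real_def)
    have "((%t. u1 t - u2 t) has_vector_derivative R t (u1 t) - R t (u2 t)) (at t)"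
     by (intro has_vector_derivative_diff d1 d2 te)
    hence D: "((%t. u1 t - u2 t) has_derivative (%h. h *\<^sub>R (R t (u1 t) - R t (u2 t)))) (at t)"
     unfolding has_vector_derivative_def .
    show "(h has_real_derivative 2 * ((u1 t - u2 t) \<bullet> (R t (u1 t) - R t (u2 t)))) (at t)"
     unfolding h_def has_field_derivative_def
     by (rule has_derivative_eq_rhs[OF has_derivative_inner[OF D D]]) (auto simp: fun_eq_iff inner_commute)
    have "\<bar>(u1 t - u2 t) \<bullet> (R t (u1 t) - R t (u2 t))\<bar> <= norm (u1 t - u2 t) * norm (R t (u1 t) - R t (u2 t))"
     by (rule Cauchy_Schwarz_ineq2)
    also have "\<dots> <= norm (u1 t - u2 t) * (C * norm (u1 t - u2 t))" by (intro mult_left_mono RL te) simp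
    also have "\<dots> = C * h t" by (simp add: h_def flip: power2_norm_eq_inner) (simp add: power2_eq_square)
    finally show "\<bar>2 * ((u1 t - u2 t) \<bullet> (R t (u1 t) - R t (u2 t)))\<bar> <= 2 * C * h t" by simp
   qed (use t e eq in "auto simp: h_def u1_def u2_def")
   have "t : Z" if "t : ball t0 e" for t
   proof -
    have "t : cball t0 e" "t : {t0 - e..t0 + e}" using that by (auto simp: dist_real_def)
    hence "u1 t = u2 t" "c t : U" "d t : U" "t : T" using hz near by (auto simp: h_def)
    thus ?thesis using inj_onD[OF chart(4)[OF U(1)]] by (simp add: Z_def u1_def u2_def)
   qed
   thus ?thesis using e by blast
  qed
  hence "open Z" unfolding open_contains_ball by blast
  thus ?thesis by (auto simp: Z_def intro: open_subset)
 qed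
 moreover have "closedin (top_of_set T) Z"
 proof -
  have "\<exists>S. open S & t : S & S \<subseteq> T - Z" if t: "t : T - Z" for t
  proof -
   have tT: "t : T" "c t ~= d t" using t by (auto simp: Z_def)
   obtain P Q where PQ: "open P" "open Q" "c t : P" "d t : Q" "P \<inter> Q = {}"
    using hausdorff[OF tT(2)] by blast
   obtain S1 where S1: "open S1" "t : S1" "!!t. t : S1 ==> c t : P"
    using contc(1)[OF tT(1)] PQ(1,3) unfolding continuous_at_open by metis
   obtain S2 where S2: "open S2" "t : S2" "!!t. t : S2 ==> d t : Q"
    using contc(2)[OF tT(1)] PQ(2,4) unfolding continuous_at_open by metis
   have "S1 \<inter> S2 \<inter> T \<subseteq> T - Z"
   proof
    fix t assume "t : S1 \<inter> S2 \<inter> T"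
    thus "t : T - Z" using S1(3)[of t] S2(3)[of t] PQ(5) by (auto simp: Z_def)
   qed
   thus ?thesis using S1(1,2) S2(1,2) T(1) tT(1) by (intro exI[of _ "S1 \<inter> S2 \<inter> T"]) auto
  qed
  hence "open (T - Z)" by (subst open_subopen) blast
  hence "openin (top_of_set T) (T - Z)" by (auto intro: open_subset)
  thus ?thesis by (auto simp: closedin_def Z_def)
 qed
 ultimately have "Z = {} | Z = T" using T(2) connected_clopen by blast
 thus ?thesis using s t by (auto simp: Z_def)
qed

end

section \<open>Orthonormal frames on Riemannian three-manifolds\<close>

lemma bounded_bilinear_component:
 assumes "bounded_bilinear (B :: real^3 => real^3 => real^3)"
 shows "B x y $ k = (SUM i:UNIV. SUM j:UNIV. (x $ i * y $ j) * B (axis i 1) (axis j 1) $ k)"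
proof -
 interpret bounded_bilinear B by fact
 have "B x y = B (SUM i:UNIV. x $ i *\<^sub>R axis i 1) (SUM j:UNIV. y $ j *\<^sub>R axis j 1)"
  using basis_expansion[of x] basis_expansion[of y] by (simp add: scalar_mult_eq_scaleR)
 also have "\<dots> = (SUM i:UNIV. SUM j:UNIV. (x $ i * y $ j) *\<^sub>R B (axis i 1) (axis j 1))"
  by (simp add: sum_3 add_left add_right scaleR_left scaleR_right algebra_simps)
 finally show ?thesis by simp
qed

lemma bounded_bilinear_cross3: "bounded_bilinear cross3"
 using bilinear_conv_bounded_bilinear bilinear_cross by blast

locale orthonormal_frame = smooth_manifold A
 for A :: "('p::t2_space, real^3) atlas" +
 fixes g :: "'p metric" and e :: "3 => 'p vfield"
 assumes metric: "riemannian_metric A g"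
  and frame_field: "!!i. e i : \<XX> A"
  and orthonormal: "!!p i j. g p (e i p) (e j p) = (if i = j then 1 else 0)"
begin

lemma frame_tangent: "e i p : \<T> A p"
 using vector_fieldD(1)[OF frame_field] .

lemma metric_sym: "u : \<T> A p ==> v : \<T> A p ==> g p u v = g p v u"
 using metric unfolding riemannian_metric_def by blast

lemma metric_add:
 "u : \<T> A p ==> v : \<T> A p ==> w : \<T> A p ==>
  g p (tadd u v) w = g p u w + g p v w"
 using metric unfolding riemannian_metric_def by blast

lemma metric_scale:
 "u : \<T> A p ==> v : \<T> A p ==> g p (tscale c u) v = c * g p u v"
 using metric unfolding riemannian_metric_def by blast

definition tvec :: "'p => real^3 => 'p tangent" where
 "tvec p x = (%f. SUM i:UNIV. x $ i * e i p f)"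

definition coord :: "'p => 'p tangent => real^3" where
 "coord p u = (\<chi> i. g p u (e i p))"

lemma tvec_tangent [simp]: "tvec p x : \<T> A p"
 unfolding tvec_def by (rule tangent_combination) (rule frame_tangent)

lemma tvec_3: "tvec p x = tadd (tscale (x $ 1) (e 1 p)) (tadd (tscale (x $ 2) (e 2 p)) (tscale (x $ 3) (e 3 p)))"
 by (auto simp: tvec_def sum_3)

lemma tvec_add: "tadd (tvec p x) (tvec p y) = tvec p (x + y)"
 by (auto simp: tvec_3 algebra_simps)

lemma tvec_scale: "tscale c (tvec p x) = tvec p (c *\<^sub>R x)"
 by (auto simp: tvec_3 algebra_simps)

lemma tvec_0: "tvec p 0 = tzero"
 by (auto simp: tvec_3)

lemma tvec_axis: "tvec p (axis i 1) = e i p"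
 by (auto simp: tvec_def axis_def if_distrib[of "%c. c * _"] cong: if_cong)

lemma coord_tvec [simp]: "coord p (tvec p x) = x"
proof -
 have "\<forall>i. g p (tvec p x) (e i p) = x $ i"
  unfolding tvec_3 forall_3
  by (simp add: metric_add metric_scale tangent_tadd tangent_tscale frame_tangent orthonormal)
 thus ?thesis by (simp add: coord_def vec_eq_iff)
qed

lemma tvec_coord [simp]:
 assumes "u : \<T> A p" shows "tvec p (coord p u) = u"
proof -
 obtain c where "u = tvec p c"
 proof (rule independent_tangents_span[of "%i. e i p" p, OF frame_tangent _ _ assms])
  show "c = 0" if "(%f. SUM i:UNIV. c $ i * e i p f) = tzero" for c
  proof -
   have "tvec p c = tvec p 0" using that tvec_0 unfolding tvec_def by simp
   thus ?thesis by (metis coord_tvec)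
  qed
 qed (auto simp: tvec_def)
 thus ?thesis by simp
qed

lemma tvec_inject [simp]: "tvec p x = tvec p y \<longleftrightarrow> x = y"
 by (metis coord_tvec)

lemma metric_tvec: "u : \<T> A p ==> v : \<T> A p ==> g p u v = coord p u \<bullet> coord p v"
proof -
 have "g p (tvec p x) v = x \<bullet> coord p v" if v: "v : \<T> A p" for v x
  unfolding tvec_3 using v
  by (simp add: metric_add metric_scale tangent_tadd tangent_tscale frame_tangent coord_def inner_vec_def sum_3
    metric_sym[OF v frame_tangent])
 thus "u : \<T> A p ==> v : \<T> A p ==> g p u v = coord p u \<bullet> coord p v"
  using tvec_coord by metis
qed

lemma coord_linear:
 assumes "u : \<T> A p" "v : \<T> A p"
 shows "coord p (tadd u v) = coord p u + coord p v" "coord p (tscale c u) = c *\<^sub>R coord p u"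
 using assms tvec_add tvec_scale coord_tvec tvec_coord by metis+

lemma coord_frame [simp]: "coord p (e i p) = axis i 1"
 by (metis coord_tvec tvec_axis)

subsection \<open>Vector fields as vector-valued functions\<close>

definition smooth_vec :: "('p => real^3) => bool" where
 "smooth_vec x \<longleftrightarrow> (\<forall>i. (%p. x p $ i) : \<F> A)"

definition field :: "('p => real^3) => 'p vfield" where
 "field x = (%p. tvec p (x p))"

definition fder :: "'p tangent => ('p => real^3) => real^3" where
 "fder u y = (\<chi> k. u (%q. y q $ k))"

lemma smooth_vecD: "smooth_vec x ==> (%p. x p $ i) : \<F> A"
 by (simp add: smooth_vec_def)

lemma smooth_vec_const [simp]: "smooth_vec (%_. c)"
 by (simp add: smooth_vec_def smooth_functions_const)

lemma smooth_vec_add: "smooth_vec x ==> smooth_vec y ==> smooth_vec (%p. x p + y p)"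
 by (simp add: smooth_vec_def smooth_functions_add)

lemma smooth_vec_diff: "smooth_vec x ==> smooth_vec y ==> smooth_vec (%p. x p - y p)"
 by (simp add: smooth_vec_def smooth_functions_diff)

lemma smooth_vec_scaleR: "f : \<F> A ==> smooth_vec y ==> smooth_vec (%p. f p *\<^sub>R y p)"
 by (simp add: smooth_vec_def smooth_functions_mult)

lemma smooth_vec_bilinear:
 assumes "bounded_bilinear B" "smooth_vec x" "smooth_vec y"
 shows "smooth_vec (%p. B (x p) (y p))"
 unfolding smooth_vec_def bounded_bilinear_component[OF assms(1), of "x _" "y _"]
 by (auto intro!: smooth_functions_sum smooth_functions_mult smooth_functions_const smooth_vecD assms)

lemma field_vector_field: "smooth_vec x ==> field x : \<XX> A"
 unfolding field_def tvec_def by (rule vector_field_combination) (auto intro: frame_field smooth_vecD)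

lemma vector_field_eq_field:
 assumes "X : \<XX> A"
 shows "field (%p. coord p (X p)) = X" "smooth_vec (%p. coord p (X p))"
proof -
 show "field (%p. coord p (X p)) = X"
  by (simp add: field_def fun_eq_iff vector_fieldD(1)[OF assms])
 show "smooth_vec (%p. coord p (X p))"
  using metric assms frame_field unfolding smooth_vec_def coord_def riemannian_metric_def by simp
qed

lemma vector_field_cases:
 assumes "X : \<XX> A" obtains x where "smooth_vec x" "X = field x"
 by (rule that[OF vector_field_eq_field(2)[OF assms] vector_field_eq_field(1)[OF assms, symmetric]])

lemma all_vector_fields: "(\<forall>X\<in>\<XX> A. P X) \<longleftrightarrow> (\<forall>x. smooth_vec x --> P (field x))"
 using field_vector_field by (auto elim!: vector_field_cases)

lemma field_eq_iff [simp]: "field x = field y \<longleftrightarrow> x = y"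
 by (auto simp: field_def fun_eq_iff[of x] dest: fun_cong)

lemma field_at [simp]: "field x p = tvec p (x p)"
 by (simp add: field_def)

lemma field_const_axis: "field (%_. axis i 1) = e i"
 by (auto simp: field_def tvec_axis)

lemma vadd_field: "vadd (field x) (field y) = field (%p. x p + y p)"
 by (auto simp: vadd_def field_def tvec_add)

lemma vscale_field: "vscale f (field x) = field (%p. f p *\<^sub>R x p)"
 by (auto simp: vscale_def field_def tvec_scale)

lemma tvec_diff: "(%f. tvec p x f - tvec p y f) = tvec p (x - y)"
 by (auto simp: tvec_3 algebra_simps)

lemma vsub_field: "vsub (field x) (field y) = field (%p. x p - y p)"
proof (intro ext)
 fix p f
 show "vsub (field x) (field y) p f = field (%p. x p - y p) p f"
  using fun_cong[OF tvec_diff[of p "x p" "y p"], of f] by (simp add: vsub_def)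
qed

lemma fder_const: "u : \<T> A p ==> fder u (%_. c) = 0"
 by (simp add: fder_def vec_eq_iff tangent_const)

lemma fder_add:
 "u : \<T> A p ==> smooth_vec x ==> smooth_vec y ==> fder u (%q. x q + y q) = fder u x + fder u y"
 by (simp add: fder_def vec_eq_iff tangent_add[OF _ smooth_vecD smooth_vecD])

lemma fder_bilinear:
 assumes B: "bounded_bilinear B" and u: "u : \<T> A p" and x: "smooth_vec x" and y: "smooth_vec y"
 shows "fder u (%q. B (x q) (y q)) = B (fder u x) (y p) + B (x p) (fder u y)"
proof -
 have "u (%q. B (x q) (y q) $ k) =
   (SUM i:UNIV. SUM j:UNIV. (x p $ i * u (%q. y q $ j) + y p $ j * u (%q. x q $ i)) * B (axis i 1) (axis j 1) $ k)" for k
 proof -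
  have m: "u (%q. (x q $ i * y q $ j) * c) = (x p $ i * u (%q. y q $ j) + y p $ j * u (%q. x q $ i)) * c" for i j c
   using tangent_cmult[OF u smooth_functions_mult[OF smooth_vecD[OF x] smooth_vecD[OF y]], of c i j]
    tangent_mult[OF u smooth_vecD[OF x] smooth_vecD[OF y], of i j] by (simp add: mult.commute)
  have sm: "(%q. (x q $ i * y q $ j) * c) : \<F> A" for i j c
   by (intro smooth_functions_mult smooth_functions_const smooth_vecD x y)
  have "u (%q. B (x q) (y q) $ k) =
    (SUM i:UNIV. u (%q. SUM j:UNIV. (x q $ i * y q $ j) * B (axis i 1) (axis j 1) $ k))"
   unfolding bounded_bilinear_component[OF B, of "x _"] by (rule tangent_sum[OF u]) (intro smooth_functions_sum sm)
  also have "\<dots> = (SUM i:UNIV. SUM j:UNIV. u (%q. (x q $ i * y q $ j) * B (axis i 1) (axis j 1) $ k))"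
   by (rule sum.cong[OF refl tangent_sum[OF u sm]])
  finally show ?thesis unfolding m .
 qed
 thus ?thesis
  by (simp add: fder_def vec_eq_iff bounded_bilinear_component[OF B, of "vec_lambda _"]
    bounded_bilinear_component[OF B, of "x p"] sum.distrib[symmetric] algebra_simps)
qed

lemma fder_smooth: "smooth_vec x ==> smooth_vec y ==> smooth_vec (%p. fder (tvec p (x p)) y)"
 unfolding smooth_vec_def fder_def
 using vector_fieldD(2)[OF field_vector_field[of x]] by (simp add: smooth_vec_def)

subsection \<open>Connections\<close>

lemma affine_connectionD:
 assumes "affine_connection A D" and X: "X : \<XX> A" and Y: "Y : \<XX> A"
 shows "D X Y : \<XX> A"
  "Z : \<XX> A ==> D (vadd X Y) Z = vadd (D X Z) (D Y Z)"
  "f : \<F> A ==> D (vscale f X) Y = vscale f (D X Y)"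
  "Z : \<XX> A ==> D X (vadd Y Z) = vadd (D X Y) (D X Z)"
  "f : \<F> A ==> D X (vscale f Y) = vadd (vscale f (D X Y)) (vscale (%p. X p f) Y)"
 using assms smooth_functions_const unfolding affine_connection_def by blast+

lemma affine_connection_formula:
 assumes D: "affine_connection A D" and x: "smooth_vec x" and y: "smooth_vec y"
 shows "D (field x) (field y) = field (%p. fder (tvec p (x p)) y +
  (SUM i:UNIV. SUM j:UNIV. (x p $ i * y p $ j) *\<^sub>R coord p (D (e i) (e j) p)))"
proof -
 note L = affine_connectionD[OF D]
 have sc: "vscale (%p. z p $ i) (e i) : \<XX> A" if "smooth_vec z" for z i
 proof -
  have "vscale (%p. z p $ i) (field (%_. axis i 1)) : \<XX> A"
   unfolding vscale_field by (intro field_vector_field smooth_vec_scaleR smooth_vecD[OF that] smooth_vec_const)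
  thus ?thesis unfolding field_const_axis .
 qed
 have ad: "vadd X Y : \<XX> A" if "X : \<XX> A" "Y : \<XX> A" for X Y
  using that by (auto elim!: vector_field_cases simp: vadd_field intro!: field_vector_field smooth_vec_add)
 have exp: "field z = vadd (vscale (%p. z p $ 1) (e 1)) (vadd (vscale (%p. z p $ 2) (e 2)) (vscale (%p. z p $ 3) (e 3)))" for z
  by (auto simp: tvec_3 vadd_def vscale_def)
 have fx: "field x : \<XX> A" by (rule field_vector_field[OF x])
 define G where "G = (%i j p. coord p (D (e i) (e j) p))"
 have G: "D (e i) (e j) = field (G i j)" "smooth_vec (G i j)" for i j
  unfolding G_def using vector_field_eq_field L(1)[OF frame_field frame_field] by auto
 have Dxe: "D (field x) (e j) = field (%p. SUM i:UNIV. x p $ i *\<^sub>R G i j p)" for j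
 proof -
  have "D (field x) (e j) = vadd (vscale (%p. x p $ 1) (D (e 1) (e j)))
    (vadd (vscale (%p. x p $ 2) (D (e 2) (e j))) (vscale (%p. x p $ 3) (D (e 3) (e j))))"
   unfolding exp
   by (simp add: L(2,3) sc[OF x] ad smooth_vecD[OF x] frame_field)
  thus ?thesis by (simp add: G vscale_field vadd_field sum_3 add.assoc)
 qed
 have Dye: "D (field x) (vscale (%p. y p $ j) (e j)) =
   field (%p. y p $ j *\<^sub>R (SUM i:UNIV. x p $ i *\<^sub>R G i j p) + tvec p (x p) (%q. y q $ j) *\<^sub>R axis j 1)" for j
 proof -
  have "D (field x) (vscale (%p. y p $ j) (e j)) =
    vadd (vscale (%p. y p $ j) (D (field x) (e j))) (vscale (%p. field x p (%q. y q $ j)) (e j))"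
   by (rule L(5)[OF fx frame_field smooth_vecD[OF y]])
  thus ?thesis unfolding Dxe
   by (subst (asm) (2) field_const_axis[symmetric]) (simp add: vscale_field vadd_field)
 qed
 have "D (field x) (field y) = vadd (D (field x) (vscale (%p. y p $ 1) (e 1)))
   (vadd (D (field x) (vscale (%p. y p $ 2) (e 2))) (D (field x) (vscale (%p. y p $ 3) (e 3))))"
  unfolding exp[of y]
  by (simp add: L(4)[OF fx] sc[OF y] ad)
 note D3 = this[unfolded Dye vadd_field]
 have fder3: "fder u y = u (%q. y q $ 1) *\<^sub>R axis 1 1 + u (%q. y q $ 2) *\<^sub>R axis 2 1 + u (%q. y q $ 3) *\<^sub>R axis 3 1" for u
  by (simp add: fder_def vec_eq_iff forall_3 axis_def)
 show ?thesis unfolding D3 field_eq_iff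
  by (rule ext) (simp add: fder3 G_def sum_3 scaleR_add_right add_ac mult.commute)
qed

lemma vbracket_field:
 assumes x: "smooth_vec x" and y: "smooth_vec y"
  and C: "bounded_bilinear C" "!!i j. vbracket A (e i) (e j) = field (%_. C (axis i 1) (axis j 1))"
 shows "vbracket A (field x) (field y) =
  field (%p. fder (tvec p (x p)) y - fder (tvec p (y p)) x + C (x p) (y p))"
proof (intro ext)
 fix p f
 show "vbracket A (field x) (field y) p f =
  field (%p. fder (tvec p (x p)) y - fder (tvec p (y p)) x + C (x p) (y p)) p f"
 proof (cases "f : \<F> A")
  case False
  thus ?thesis using tangent_nonsmooth[OF tvec_tangent False] by (simp add: vbracket_def)
 next
  case True
  have ef: "(%q. e j q f) : \<F> A" for j by (rule vector_fieldD(2)[OF frame_field True])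
  have 1: "tvec p u (%q. tvec q (z q) f) =
    (SUM j:UNIV. z p $ j * tvec p u (%q. e j q f) + e j p f * tvec p u (%q. z q $ j))" if z: "smooth_vec z" for z u
   unfolding tvec_def[of _ "z _"]
   by (subst tangent_sum[OF tvec_tangent]) (simp_all add: smooth_functions_mult smooth_vecD[OF z] ef
     tangent_mult[OF tvec_tangent smooth_vecD[OF z] ef])
  have 2: "e i p (%q. e j q f) - e j p (%q. e i q f) = tvec p (C (axis i 1) (axis j 1)) f" for i j
   using fun_cong[OF fun_cong[OF C(2)[of i j], of p], of f] True by (simp add: vbracket_def)
  have "vbracket A (field x) (field y) p f = tvec p (x p) (%q. tvec q (y q) f) - tvec p (y p) (%q. tvec q (x q) f)"
   using True by (simp add: vbracket_def)
  also have "\<dots> = (SUM i:UNIV. SUM j:UNIV. (x p $ i * y p $ j) * (e i p (%q. e j q f) - e j p (%q. e i q f)))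
    + tvec p (fder (tvec p (x p)) y - fder (tvec p (y p)) x) f"
   unfolding 1[OF x] 1[OF y]
   by (simp add: tvec_def fder_def sum_3 algebra_simps)
  also have "(SUM i:UNIV. SUM j:UNIV. (x p $ i * y p $ j) * (e i p (%q. e j q f) - e j p (%q. e i q f))) = tvec p (C (x p) (y p)) f"
   unfolding 2 tvec_def bounded_bilinear_component[OF C(1), of "x p" "y p"]
   by (simp add: sum_3 algebra_simps)
  finally have F: "vbracket A (field x) (field y) p f =
    tvec p (C (x p) (y p)) f + tvec p (fder (tvec p (x p)) y - fder (tvec p (y p)) x) f" .
  show ?thesis unfolding F field_at tvec_add[symmetric] tadd_apply by (rule add.commute)
 qed
qed

subsection \<open>A Gronwall estimate on connected manifolds\<close>

text \<open>Along a coordinate segment the derivative of \<open>h\<close> is a combination of the frame derivatives with bounded coefficients.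
  So the zero set of \<open>h\<close> is open.\<close>

lemma frame_gronwall_zero:
 assumes conn: "connected (UNIV :: 'p set)" and h: "h : \<F> A" and nn: "!!p. h p >= 0"
  and bd: "!!p i. \<bar>e i p h\<bar> <= C * h p" and z: "h p0 = 0"
 shows "h p = 0"
proof -
 define Z where "Z = {p. h p = 0}"
 have "closed Z"
  using continuous_closed_vimage[of "{0}" h] smooth_functions_continuous[OF h]
  by (simp add: Z_def vimage_def continuous_on_eq_continuous_at)
 moreover have "open Z"
 proof (subst open_subopen, rule ballI)
  fix p1 assume p1: "p1 : Z"
  obtain U \<phi> where U: "(U, \<phi>) : A" "p1 : U" by (rule chart_at)
  have "\<forall>b. \<exists>X W. X : \<XX> A & open W & p1 : W & W \<subseteq> U & (\<forall>q\<in>W. X q = chart_tangent U \<phi> q b)"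
  proof
   fix b
   show "\<exists>X W. X : \<XX> A & open W & p1 : W & W \<subseteq> U & (\<forall>q\<in>W. X q = chart_tangent U \<phi> q b)"
    by (rule coordinate_field_extension[OF U, where b=b]) blast
  qed
  then obtain X W where X: "!!b. X b : \<XX> A" "!!b. open (W b)" "!!b. p1 : W b" "!!b. W b \<subseteq> U"
   "!!b q. q : W b ==> X b q = chart_tangent U \<phi> q b" by metis
  define N where "N = U \<inter> (\<Inter>b\<in>Basis. W b)"
  have "open N" unfolding N_def by (intro open_Int open_INT chart(1)[OF U(1)] ballI X(2)) simp
  hence N: "open N" "p1 : N" "N \<subseteq> U" using X(3) U by (auto simp: N_def)
  have oN: "open (\<phi> ` N)" by (rule open_chart_image[OF U(1) N(1,3)])
  then obtain r where r: "r > 0" "cball (\<phi> p1) r \<subseteq> \<phi> ` N"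
   using N(2) open_contains_cball by blast
  let ?B = "cball (\<phi> p1) r"
  let ?i = "inv_into U \<phi>"
  have iN: "?i y : N" "\<phi> (?i y) = y" if "y : ?B" for y
   using that r(2) U(1) N(3) by (auto simp: subset_iff image_iff)
  have "\<exists>M. \<forall>y\<in>?B. \<bar>coord (?i y) (X b (?i y)) $ j\<bar> <= M" for b j
  proof -
   have "continuous_on UNIV (%q. coord q (X b q) $ j)"
    by (rule smooth_functions_continuous[OF smooth_vecD[OF vector_field_eq_field(2)[OF X(1)]]])
   hence "continuous_on ?B (%y. coord (?i y) (X b (?i y)) $ j)"
    by (rule continuous_on_compose2[OF _ continuous_on_subset[OF chart(6)[OF U(1)]]]) (use r(2) N(3) in auto)
   hence "compact ((%y. coord (?i y) (X b (?i y)) $ j) ` ?B)" by (intro compact_continuous_image compact_cball)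
   hence "bounded ((%y. coord (?i y) (X b (?i y)) $ j) ` ?B)" by (rule compact_imp_bounded)
   thus ?thesis by (auto simp: bounded_iff)
  qed
  then obtain M where M: "!!b j y. y : ?B ==> \<bar>coord (?i y) (X b (?i y)) $ j\<bar> <= M b j" by metis
  define K where "K = (SUM b:Basis. r * (SUM j:UNIV. M b j * C))"
  have Z1: "?i y : Z" if y: "y : ball (\<phi> p1) r" for y
  proof -
   define v where "v = y - \<phi> p1"
   define c where "c = (%t. \<phi> p1 + t *\<^sub>R v)"
   have v: "norm v <= r" using y by (simp add: v_def dist_norm norm_minus_commute)
   have cB: "c t : ?B" if "t : {0..1}" for t
   proof -
    have "\<bar>t\<bar> * norm v <= 1 * r" using that v by (intro mult_mono) auto
    thus ?thesis by (simp add: c_def dist_norm)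
   qed
   have dc: "(c has_vector_derivative v) (at t)" for t
    unfolding c_def by (auto intro!: derivative_eq_intros)
   have "h (?i (c 1)) = 0"
   proof (rule gronwall_zero[where h="%t. h (?i (c t))" and h'="%t. chart_tangent U \<phi> (?i (c t)) v h"
      and C=K and a=0 and b=1 and s=0 and t=1])
    fix t :: real assume t: "t : {0..1}"
    have ct: "c t : \<phi> ` U" using cB[OF t] r(2) N(3) by blast
    show "((%t. h (?i (c t))) has_real_derivative chart_tangent U \<phi> (?i (c t)) v h) (at t)"
     using chart_curve_has_velocity[OF U(1) dc ct] h unfolding has_velocity_def by blast
    define q where "q = ?i (c t)"
    have q: "q : N" "q : U" using iN(1)[OF cB[OF t]] N(3) by (auto simp: q_def)
    have "chart_tangent U \<phi> q v = (%f. SUM b:Basis. (v \<bullet> b) * chart_tangent U \<phi> q b f)"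
     by (simp add: chart_tangent_linear(3)[OF U(1) q(2)] euclidean_representation)
    also have "\<dots> = (%f. SUM b:Basis. (v \<bullet> b) * X b q f)"
     using q(1) X(5) by (auto simp: N_def intro!: ext sum.cong)
    finally have "chart_tangent U \<phi> q v h = (SUM b:Basis. (v \<bullet> b) * X b q h)" by metis
    moreover have "\<bar>(v \<bullet> b) * X b q h\<bar> <= (r * (SUM j:UNIV. M b j * C)) * h q" if b: "b : Basis" for b
    proof -
     have "X b q = tvec q (coord q (X b q))" by (simp add: vector_fieldD(1)[OF X(1)])
     hence "X b q h = (SUM j:UNIV. coord q (X b q) $ j * e j q h)" unfolding tvec_def by metis
     also have "\<bar>\<dots>\<bar> <= (SUM j:UNIV. M b j * (C * h q))"
     proof (rule order_trans[OF sum_abs sum_mono])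
      fix j
      show "\<bar>coord q (X b q) $ j * e j q h\<bar> <= M b j * (C * h q)"
       unfolding abs_mult
       by (rule mult_mono[OF _ bd]) (use M[OF cB[OF t], of b j] in "auto simp: q_def")
     qed
     finally have Xb: "\<bar>X b q h\<bar> <= (SUM j:UNIV. M b j * C) * h q" by (simp add: sum_distrib_right mult.assoc)
     have "\<bar>v \<bullet> b\<bar> <= r" using Basis_le_norm[OF b, of v] v by simp
     hence "\<bar>v \<bullet> b\<bar> * \<bar>X b q h\<bar> <= r * ((SUM j:UNIV. M b j * C) * h q)"
      by (rule mult_mono[OF _ Xb]) (use r in auto)
     thus ?thesis by (simp add: abs_mult mult.assoc)
    qed
    hence "\<bar>SUM b:Basis. (v \<bullet> b) * X b q h\<bar> <= K * h q"
     unfolding K_def sum_distrib_right by (rule order_trans[OF sum_abs sum_mono])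
    ultimately show "\<bar>chart_tangent U \<phi> (?i (c t)) v h\<bar> <= K * h (?i (c t))" by (simp add: q_def)
   qed (use p1 U nn in "auto simp: Z_def c_def")
   thus ?thesis by (simp add: c_def v_def Z_def)
  qed
  have "open (U \<inter> \<phi> -` ball (\<phi> p1) r)"
   by (rule continuous_open_preimage[OF chart(5)[OF U(1)] chart(1)[OF U(1)] open_ball])
  moreover have "U \<inter> \<phi> -` ball (\<phi> p1) r \<subseteq> Z"
  proof
   fix q assume q: "q : U \<inter> \<phi> -` ball (\<phi> p1) r"
   hence "?i (\<phi> q) : Z" by (intro Z1) simp
   thus "q : Z" using q U(1) by simp
  qed
  ultimately show "\<exists>T. open T & p1 : T & T \<subseteq> Z" using U(2) r(1)
   by (intro exI[of _ "U \<inter> \<phi> -` ball (\<phi> p1) r"]) auto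
 qed
 moreover have "p0 : Z" using z by (simp add: Z_def)
 ultimately have "Z = UNIV" using conn by (metis connected_clopen open_openin closed_closedin subtopology_UNIV empty_iff)
 thus ?thesis by (auto simp: Z_def)
qed

lemma frame_constant:
 assumes conn: "connected (UNIV :: 'p set)" and h: "h : \<F> A" and d: "!!p i. e i p h = 0"
 shows "h p = h q"
proof -
 have s: "(%p. h p - h q) : \<F> A" by (intro smooth_functions_intros h)
 have d2: "\<bar>e i p (%p. (h p - h q) * (h p - h q))\<bar> <= 0 * ((h p - h q) * (h p - h q))" for p i
  using tangent_mult[OF frame_tangent s s] tangent_diff[OF frame_tangent h smooth_functions_const]
   tangent_const[OF frame_tangent] d by simp
 have "(h p - h q) * (h p - h q) = 0"
  by (rule frame_gronwall_zero[OF conn smooth_functions_mult[OF s s] _ d2, of q]) simp_all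
 thus ?thesis by simp
qed

end

section \<open>Homogeneous structures in a frame with the brackets of \<open>G(\<alpha>, \<beta>)\<close>\<close>

text \<open>In dimension three an alternating bilinear map is a linear map applied to the cross product, and a skew operator is the
  cross product with a vector. So brackets, connections, curvature and metric structures are all encoded by
  linear maps: \<open>brk\<close> by \<open>[x, y] = brk (x \<times> y)\<close>, \<open>lam\<close> by
  \<open>\<nabla>\<^sub>x y = lam x \<times> y\<close>, and \<open>curvop\<close> by \<open>R(x, y) z = curvop (x \<times> y) \<times> z\<close>.\<close>

definition brk :: "real => real => real^3 => real^3" where
 "brk \<alpha> \<beta> w = vector [0, (1 - \<alpha>) * \<beta> * w $ 2 + (1 + \<alpha>) * w $ 3, (1 + \<alpha>) * \<beta> * w $ 3 - (1 - \<alpha>) * w $ 2]"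

definition lam :: "real => real => real^3 => real^3" where
 "lam \<alpha> \<beta> x = vector [\<beta> * x $ 1, \<alpha> * \<beta> * x $ 2 + (1 - \<alpha>) * x $ 3, - (1 + \<alpha>) * x $ 2 - \<alpha> * \<beta> * x $ 3]"

definition curvop :: "real => real => real^3 => real^3" where
 "curvop \<alpha> \<beta> w = vector [(1 - \<alpha>\<^sup>2 - \<alpha>\<^sup>2 * \<beta>\<^sup>2) * w $ 1,
   ((1 - \<alpha>)\<^sup>2 - 2 * \<alpha> * \<beta>\<^sup>2 + \<alpha>\<^sup>2 * \<beta>\<^sup>2) * w $ 2, ((1 + \<alpha>)\<^sup>2 + 2 * \<alpha> * \<beta>\<^sup>2 + \<alpha>\<^sup>2 * \<beta>\<^sup>2) * w $ 3]"

lemma linear_maps: "bounded_linear (brk \<alpha> \<beta>)" "bounded_linear (lam \<alpha> \<beta>)" "bounded_linear (curvop \<alpha> \<beta>)"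
 unfolding linear_conv_bounded_linear[symmetric]
 by (rule linearI; simp add: brk_def lam_def curvop_def vec_eq_iff forall_3 algebra_simps)+

lemmas bounded_bilinear_cross3_left = bounded_bilinear.comp1[OF bounded_bilinear_cross3]

lemma bounded_bilinear_brk: "bounded_bilinear (%x y. brk \<alpha> \<beta> (cross3 x y))"
proof -
 interpret B: bounded_linear "brk \<alpha> \<beta>" by (rule linear_maps)
 have "bilinear (%x y. brk \<alpha> \<beta> (cross3 x y))"
  by (simp add: bilinear_def linear_iff Cross3.left_diff_distrib cross_mult_left cross_mult_right
    cross_add_left cross_add_right B.add B.scaleR)
 thus ?thesis by (simp add: bilinear_conv_bounded_bilinear)
qed

lemma lam_torsion: "cross3 (lam \<alpha> \<beta> x) y - cross3 (lam \<alpha> \<beta> y) x = brk \<alpha> \<beta> (cross3 x y)"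
 by (simp add: lam_def brk_def cross3_def vec_eq_iff forall_3 algebra_simps)

lemma curvop_lam: "cross3 (lam \<alpha> \<beta> x) (lam \<alpha> \<beta> y) - lam \<alpha> \<beta> (brk \<alpha> \<beta> (cross3 x y)) = curvop \<alpha> \<beta> (cross3 x y)"
 by (simp add: lam_def brk_def curvop_def cross3_def vec_eq_iff forall_3 algebra_simps power2_eq_square)

lemma cross3_jacobi: "cross3 u (cross3 v w) - cross3 v (cross3 u w) = cross3 (cross3 u v) w"
 by (simp add: cross3_def vec_eq_iff forall_3 algebra_simps)

lemma cross3_skew: "cross3 u v \<bullet> w + v \<bullet> cross3 u w = 0"
 by (simp add: cross3_def inner_vec_def sum_3 algebra_simps)

lemma curvop_commute_components:
 assumes "!!v. cross3 t (curvop \<alpha> \<beta> v) = curvop \<alpha> \<beta> (cross3 t v)"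
 shows "t $ 3 * (\<alpha> * (1 - \<alpha>)) = 0" "t $ 2 * (\<alpha> * (1 + \<alpha>)) = 0" "t $ 1 * \<alpha> = 0"
proof -
 have b: "1 + \<beta>\<^sup>2 ~= 0" using zero_le_power2[of \<beta>] by linarith
 have 1: "t $ 3 * ((1 - \<alpha>\<^sup>2 - \<alpha>\<^sup>2 * \<beta>\<^sup>2) - ((1 - \<alpha>)\<^sup>2 - 2 * \<alpha> * \<beta>\<^sup>2 + \<alpha>\<^sup>2 * \<beta>\<^sup>2)) = 0"
  "t $ 2 * ((1 - \<alpha>\<^sup>2 - \<alpha>\<^sup>2 * \<beta>\<^sup>2) - ((1 + \<alpha>)\<^sup>2 + 2 * \<alpha> * \<beta>\<^sup>2 + \<alpha>\<^sup>2 * \<beta>\<^sup>2)) = 0"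
  using assms[of "axis 1 1"]
  by (simp_all add: curvop_def cross3_def vec_eq_iff forall_3 axis_def algebra_simps)
 have 2: "t $ 1 * (((1 - \<alpha>)\<^sup>2 - 2 * \<alpha> * \<beta>\<^sup>2 + \<alpha>\<^sup>2 * \<beta>\<^sup>2) - ((1 + \<alpha>)\<^sup>2 + 2 * \<alpha> * \<beta>\<^sup>2 + \<alpha>\<^sup>2 * \<beta>\<^sup>2)) = 0"
  using assms[of "axis 2 1"]
  by (simp add: curvop_def cross3_def vec_eq_iff forall_3 axis_def algebra_simps)
 have "t $ 3 * (\<alpha> * (1 - \<alpha>)) * (2 * (1 + \<beta>\<^sup>2)) = 0" "t $ 2 * (\<alpha> * (1 + \<alpha>)) * (2 * (1 + \<beta>\<^sup>2)) = 0"
  "t $ 1 * \<alpha> * (4 * (1 + \<beta>\<^sup>2)) = 0"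
  using 1 2 by (simp_all add: algebra_simps power2_eq_square)
 thus "t $ 3 * (\<alpha> * (1 - \<alpha>)) = 0" "t $ 2 * (\<alpha> * (1 + \<alpha>)) = 0" "t $ 1 * \<alpha> = 0" using b by auto
qed

lemma skew_symmetric_eq_0:
 fixes d :: "'i => 'i => 'i => real"
 assumes "!!i j k. d i j k = d j i k" "!!i j k. d i j k = - d i k j"
 shows "d i j k = 0"
proof -
 have "d i j k = d j i k" by (rule assms)
 also have "\<dots> = - d j k i" by (rule assms)
 also have "\<dots> = - d k j i" by (simp add: assms(1)[of j k i])
 also have "\<dots> = d k i j" by (simp add: assms(2)[of k j i])
 also have "\<dots> = d i k j" by (rule assms)
 also have "\<dots> = - d i j k" by (rule assms)
 finally show ?thesis by simp
qed

context orthonormal_frame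
begin

lemma fder_nth: "fder u y $ i = u (%q. y q $ i)"
 by (simp add: fder_def)

lemma field_eq_pointwise: "field x = field y \<longleftrightarrow> (\<forall>p. x p = y p)"
 unfolding field_eq_iff by (rule fun_eq_iff)

definition tcomp :: "'p tensor12 => 'p => real^3 => real^3 => real^3" where
 "tcomp S p x y = coord p (S p (tvec p x) (tvec p y))"

definition tensor_of :: "('p => real^3 => real^3 => real^3) => 'p tensor12" where
 "tensor_of s p u v = tvec p (s p (coord p u) (coord p v))"

lemma tcomp_tensor_of [simp]: "tcomp (tensor_of s) = s"
 by (simp add: tcomp_def tensor_of_def fun_eq_iff)

lemma tensor_fieldD:
 assumes "tensor_field12 A S"
 shows "u : \<T> A p ==> v : \<T> A p ==> S p u v : \<T> A p"
  and "S p (tvec p x) (tvec p y) = tvec p (tcomp S p x y)"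
  and "bounded_bilinear (tcomp S p)"
  and "smooth_vec x' ==> smooth_vec y' ==> smooth_vec (%p. tcomp S p (x' p) (y' p))"
proof -
 have T: "S p u v : \<T> A p" "S p (tadd u v) w = tadd (S p u w) (S p v w)"
   "S p w (tadd u v) = tadd (S p w u) (S p w v)"
   "S p (tscale c u) v = tscale c (S p u v)" "S p u (tscale c v) = tscale c (S p u v)"
  if "u : \<T> A p" "v : \<T> A p" "w : \<T> A p" for u v w c
  using assms that unfolding tensor_field12_def by blast+
 show "u : \<T> A p ==> v : \<T> A p ==> S p u v : \<T> A p"
  using T(1) by blast
 show e: "S p (tvec p x) (tvec p y) = tvec p (tcomp S p x y)" for x y
  by (simp add: tcomp_def T(1)[OF tvec_tangent tvec_tangent tvec_tangent])
 note T' = T(2-5)[OF tvec_tangent tvec_tangent tvec_tangent, unfolded tvec_add tvec_scale e, unfolded tvec_inject]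
 have "bilinear (tcomp S p)" by (simp add: bilinear_def linear_iff T')
 thus "bounded_bilinear (tcomp S p)" by (simp add: bilinear_conv_bounded_bilinear)
 assume xy: "smooth_vec x'" "smooth_vec y'"
 have "(%p. S p (field x' p) (field y' p)) : \<XX> A"
  using assms field_vector_field xy unfolding tensor_field12_def by blast
 from vector_field_eq_field(2)[OF this] show "smooth_vec (%p. tcomp S p (x' p) (y' p))"
  by (simp add: tcomp_def)
qed

lemma tensor_apply_field:
 "tensor_field12 A S ==> (%p. S p (field x p) (field y p)) = field (%p. tcomp S p (x p) (y p))"
 using tensor_fieldD(2) by (auto simp: field_def)

lemma tensor_of_tensor_field:
 assumes "!!p. bounded_bilinear (s p)" "!!x y. smooth_vec x ==> smooth_vec y ==> smooth_vec (%p. s p (x p) (y p))"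
 shows "tensor_field12 A (tensor_of s)"
proof -
 have "(%p. tensor_of s p (X p) (Y p)) : \<XX> A" if X: "X : \<XX> A" and Y: "Y : \<XX> A" for X Y
 proof -
  obtain x where x: "smooth_vec x" "X = field x" by (rule vector_field_cases[OF X])
  obtain y where y: "smooth_vec y" "Y = field y" by (rule vector_field_cases[OF Y])
  have "(%p. tensor_of s p (X p) (Y p)) = field (%p. s p (x p) (y p))" by (auto simp: tensor_of_def x y)
  thus ?thesis using field_vector_field[OF assms(2)[OF x(1) y(1)]] by simp
 qed
 thus ?thesis unfolding tensor_field12_def
  by (auto simp: tensor_of_def coord_linear tvec_add tvec_scale bounded_bilinear.add_left[OF assms(1)]
    bounded_bilinear.add_right[OF assms(1)] bounded_bilinear.scaleR_left[OF assms(1)] bounded_bilinear.scaleR_right[OF assms(1)])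
qed

end

locale G_frame = orthonormal_frame A g e
 for A :: "('p::t2_space, real^3) atlas" and g e +
 fixes \<alpha> \<beta> :: real and D :: "'p connection"
 assumes brackets: "!!i j. vbracket A (e i) (e j) = field (%_. brk \<alpha> \<beta> (cross3 (axis i 1) (axis j 1)))"
  and levi_civita: "levi_civita A g D"
begin

lemmas bracket_field = vbracket_field[OF _ _ bounded_bilinear_brk brackets]

lemma D_affine: "affine_connection A D" and D_metric: "metric_connection A g D"
 using levi_civita unfolding levi_civita_def by auto

text \<open>Koszul's argument: two metric torsion free connections differ by a tensor that is symmetric in the first two and skew
  in the last two arguments, hence zero.\<close>

lemma levi_civita_field:
 assumes x: "smooth_vec x" and y: "smooth_vec y"
 shows "D (field x) (field y) = field (%p. fder (tvec p (x p)) y + cross3 (lam \<alpha> \<beta> (x p)) (y p))"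
proof -
 define G where "G = (%i j p. coord p (D (e i) (e j) p))"
 define \<Gamma> where "\<Gamma> = (%i j. cross3 (lam \<alpha> \<beta> (axis i 1)) (axis j 1))"
 note DT = affine_connectionD(1)[OF D_affine frame_field frame_field]
 have Gs: "G i j p $ k = - G i k p $ j" for i j k p
 proof -
  have "e i p (%q. g q (e j q) (e k q)) = g p (D (e i) (e j) p) (e k p) + g p (e j p) (D (e i) (e k) p)"
   using D_metric frame_field unfolding metric_connection_def by blast
  thus ?thesis
   by (simp add: orthonormal tangent_const[OF frame_tangent] metric_tvec vector_fieldD(1)[OF DT] frame_tangent
     inner_axis inner_axis' G_def)
 qed
 have Gt: "G i j p - G j i p = \<Gamma> i j - \<Gamma> j i" for i j p
 proof -
  have "vsub (D (e i) (e j)) (D (e j) (e i)) = vbracket A (e i) (e j)"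
   using levi_civita frame_field unfolding levi_civita_def by blast
  moreover have "D (e i) (e j) = field (G i j)" for i j
   unfolding G_def by (rule vector_field_eq_field(1)[OF DT, symmetric])
  ultimately have "(%p. G i j p - G j i p) = (%_. brk \<alpha> \<beta> (cross3 (axis i 1) (axis j 1)))"
   by (simp only: brackets vsub_field field_eq_iff)
  thus ?thesis unfolding \<Gamma>_def lam_torsion by metis
 qed
 have \<Gamma>s: "\<Gamma> i j $ k = - \<Gamma> i k $ j" for i j k
  using cross3_skew[of "lam \<alpha> \<beta> (axis i 1)" "axis j 1" "axis k 1"] by (simp add: \<Gamma>_def inner_axis inner_axis')
 have "(G i j p - \<Gamma> i j) $ k = 0" for i j k p
 proof (rule skew_symmetric_eq_0[of "%i j k. (G i j p - \<Gamma> i j) $ k"])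
  show "(G i j p - \<Gamma> i j) $ k = (G j i p - \<Gamma> j i) $ k" for i j k
   using arg_cong[OF Gt[of i j p], of "%v. v $ k"] by simp
  show "(G i j p - \<Gamma> i j) $ k = - (G i k p - \<Gamma> i k) $ j" for i j k using Gs[of i j p k] \<Gamma>s[of i j k] by simp
 qed
 hence G\<Gamma>: "coord p (D (e i) (e j) p) = \<Gamma> i j" for i j p by (simp add: vec_eq_iff G_def)
 have "(SUM i:UNIV. SUM j:UNIV. (a $ i * b $ j) *\<^sub>R \<Gamma> i j) = cross3 (lam \<alpha> \<beta> a) b" for a b
  using bounded_bilinear_component[OF bounded_bilinear_cross3_left[OF linear_maps(2)], of \<alpha> \<beta> a b]
  by (simp add: vec_eq_iff \<Gamma>_def)
 thus ?thesis
  unfolding affine_connection_formula[OF D_affine x y] G\<Gamma> by simp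
qed

lemma bracket_derivation:
 assumes "smooth_vec x" "smooth_vec y" "smooth_vec z"
 shows "fder (tvec p (x p)) (%q. fder (tvec q (y q)) z) - fder (tvec p (y p)) (%q. fder (tvec q (x q)) z) =
  fder (tvec p (fder (tvec p (x p)) y - fder (tvec p (y p)) x + brk \<alpha> \<beta> (cross3 (x p) (y p)))) z"
proof -
 have "tvec p (x p) (%q. tvec q (y q) f) - tvec p (y p) (%q. tvec q (x q) f) =
   tvec p (fder (tvec p (x p)) y - fder (tvec p (y p)) x + brk \<alpha> \<beta> (cross3 (x p) (y p))) f"
  if "f : \<F> A" for f
  using fun_cong[OF fun_cong[OF bracket_field[OF assms(1,2)], of p], of f] that by (simp add: vbracket_def)
 from this[OF smooth_vecD[OF assms(3)]] show ?thesis
  by (simp add: vec_eq_iff fder_nth)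
qed

text \<open>For constant \<open>\<tau>\<close> the derivatives in the curvature cancel against the bracket, and the Jacobi identity of the cross product
  leaves one operator.\<close>

lemma connection_curvature_field:
 assumes \<tau>: "bounded_linear \<tau>" and \<nabla>: "!!x y. smooth_vec x ==> smooth_vec y ==>
   D' (field x) (field y) = field (%p. fder (tvec p (x p)) y + cross3 (\<tau> (x p)) (y p))"
  and x: "smooth_vec x" and y: "smooth_vec y" and z: "smooth_vec z"
 shows "curvature A D' (field x) (field y) (field z) = field (%p. cross3 (cross3 (\<tau> (x p)) (\<tau> (y p)) - \<tau> (brk \<alpha> \<beta> (cross3 (x p) (y p)))) (z p))"
proof -
 let ?w = "%y p. fder (tvec p (y p)) z + cross3 (\<tau> (y p)) (z p)"
 let ?b = "%p. fder (tvec p (x p)) y - fder (tvec p (y p)) x + brk \<alpha> \<beta> (cross3 (x p) (y p))"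
 interpret L: bounded_linear \<tau> by (rule \<tau>)
 have Lz: "smooth_vec (%p. cross3 (\<tau> (y p)) (z p))" if "smooth_vec y" for y
  by (rule smooth_vec_bilinear[OF bounded_bilinear_cross3_left[OF \<tau>] that z])
 have w: "smooth_vec (?w y)" if "smooth_vec y" for y
  by (intro smooth_vec_add fder_smooth Lz that z)
 have b: "smooth_vec ?b"
  by (intro smooth_vec_add smooth_vec_diff fder_smooth smooth_vec_bilinear[OF bounded_bilinear_brk] x y)
 have dw: "fder (tvec p (x p)) (?w y) = fder (tvec p (x p)) (%q. fder (tvec q (y q)) z) +
   (cross3 (\<tau> (fder (tvec p (x p)) y)) (z p) + cross3 (\<tau> (y p)) (fder (tvec p (x p)) z))"
  if x: "smooth_vec x" and y: "smooth_vec y" for x y p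
  by (simp add: fder_add[OF tvec_tangent fder_smooth[OF y z] Lz[OF y]]
    fder_bilinear[OF bounded_bilinear_cross3_left[OF \<tau>] tvec_tangent y z])
 have "curvature A D' (field x) (field y) (field z) =
   field (%p. (fder (tvec p (x p)) (?w y) + cross3 (\<tau> (x p)) (?w y p))
    - (fder (tvec p (y p)) (?w x) + cross3 (\<tau> (y p)) (?w x p))
    - (fder (tvec p (?b p)) z + cross3 (\<tau> (?b p)) (z p)))"
  unfolding curvature_def bracket_field[OF x y] \<nabla>[OF x z] \<nabla>[OF y z]
   \<nabla>[OF x w[OF y]] \<nabla>[OF y w[OF x]] \<nabla>[OF b z] vsub_field ..
 also have "\<dots> = field (%p. cross3 (cross3 (\<tau> (x p)) (\<tau> (y p)) - \<tau> (brk \<alpha> \<beta> (cross3 (x p) (y p)))) (z p))"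
  unfolding field_eq_iff
 proof
  fix p
  have "cross3 (\<tau> (x p)) (cross3 (\<tau> (y p)) (z p)) - cross3 (\<tau> (y p)) (cross3 (\<tau> (x p)) (z p))
    - cross3 (\<tau> (brk \<alpha> \<beta> (cross3 (x p) (y p)))) (z p) = cross3 (cross3 (\<tau> (x p)) (\<tau> (y p)) - \<tau> (brk \<alpha> \<beta> (cross3 (x p) (y p)))) (z p)"
   unfolding cross3_jacobi by (simp add: Cross3.left_diff_distrib)
  thus "(fder (tvec p (x p)) (?w y) + cross3 (\<tau> (x p)) (?w y p))
    - (fder (tvec p (y p)) (?w x) + cross3 (\<tau> (y p)) (?w x p))
    - (fder (tvec p (?b p)) z + cross3 (\<tau> (?b p)) (z p)) = cross3 (cross3 (\<tau> (x p)) (\<tau> (y p)) - \<tau> (brk \<alpha> \<beta> (cross3 (x p) (y p)))) (z p)"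
   unfolding dw[OF x y] dw[OF y x] bracket_derivation[OF x y z, symmetric]
   by (simp add: L.add L.diff cross_add_left cross_add_right Cross3.left_diff_distrib algebra_simps)
 qed
 finally show ?thesis .
qed

lemma curvature_field:
 assumes "smooth_vec x" "smooth_vec y" "smooth_vec z"
 shows "curvature A D (field x) (field y) (field z) = field (%p. cross3 (curvop \<alpha> \<beta> (cross3 (x p) (y p))) (z p))"
 using connection_curvature_field[OF linear_maps(2) levi_civita_field assms] unfolding curvop_lam .

lemma connection_plus_field:
 assumes S: "tensor_field12 A S" and x: "smooth_vec x" and y: "smooth_vec y"
 shows "connection_plus D S (field x) (field y) =
   field (%p. fder (tvec p (x p)) y + cross3 (lam \<alpha> \<beta> (x p)) (y p) + tcomp S p (x p) (y p))"
  and "smooth_vec (%p. fder (tvec p (x p)) y + cross3 (lam \<alpha> \<beta> (x p)) (y p) + tcomp S p (x p) (y p))"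
 unfolding connection_plus_def levi_civita_field[OF x y] tensor_apply_field[OF S] vadd_field
 by (simp, intro smooth_vec_add fder_smooth smooth_vec_bilinear[OF bounded_bilinear_cross3_left[OF linear_maps(2)]]
   tensor_fieldD(4)[OF S] x y)

lemma metric_connection_plus_iff:
 assumes S: "tensor_field12 A S"
 shows "metric_connection A g (connection_plus D S) \<longleftrightarrow>
  (\<exists>a. \<forall>p x y. tcomp S p x y = cross3 (a p x) y)" (is "?M \<longleftrightarrow> _")
proof -
 have M: "?M \<longleftrightarrow> (\<forall>p x y z. tcomp S p x y \<bullet> z + y \<bullet> tcomp S p x z = 0)"
 proof
  assume m: ?M
  show "\<forall>p x y z. tcomp S p x y \<bullet> z + y \<bullet> tcomp S p x z = 0"
  proof (intro allI)
   fix p x y z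
   have "field (%_. x) p (%q. g q (field (%_. y) q) (field (%_. z) q)) =
     g p (connection_plus D S (field (%_. x)) (field (%_. y)) p) (field (%_. z) p) +
     g p (field (%_. y) p) (connection_plus D S (field (%_. x)) (field (%_. z)) p)"
    using m field_vector_field[OF smooth_vec_const] unfolding metric_connection_def by blast
   thus "tcomp S p x y \<bullet> z + y \<bullet> tcomp S p x z = 0"
    unfolding connection_plus_field(1)[OF S smooth_vec_const smooth_vec_const]
    using cross3_skew[of "lam \<alpha> \<beta> x" y z]
    by (simp add: metric_tvec tangent_const[OF tvec_tangent] fder_const[OF tvec_tangent] inner_add_left inner_add_right)
  qed
 next
  assume m: "\<forall>p x y z. tcomp S p x y \<bullet> z + y \<bullet> tcomp S p x z = 0"
  show ?M unfolding metric_connection_def all_vector_fields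
  proof (intro allI impI)
   fix x y z p assume xyz: "smooth_vec x" "smooth_vec y" "smooth_vec z"
   have "field x p (%q. g q (field y q) (field z q)) =
     g p (D (field x) (field y) p) (field z p) + g p (field y p) (D (field x) (field z) p)"
    using D_metric field_vector_field xyz unfolding metric_connection_def by blast
   thus "field x p (%q. g q (field y q) (field z q)) =
     g p (connection_plus D S (field x) (field y) p) (field z p) +
     g p (field y p) (connection_plus D S (field x) (field z) p)"
    unfolding connection_plus_field(1)[OF S xyz(1,2)] connection_plus_field(1)[OF S xyz(1,3)]
     levi_civita_field[OF xyz(1,2)] levi_civita_field[OF xyz(1,3)]
    using m[rule_format, of p "x p" "y p" "z p"] by (simp add: metric_tvec inner_add_left inner_add_right)
  qed
 qed
 show ?thesis unfolding M
 proof
  assume m: "\<forall>p x y z. tcomp S p x y \<bullet> z + y \<bullet> tcomp S p x z = 0"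
  define a where "a = (%p x. vector [tcomp S p x (axis 2 1) $ 3, tcomp S p x (axis 3 1) $ 1, tcomp S p x (axis 1 1) $ 2] :: real^3)"
  have "tcomp S p x y = cross3 (a p x) y" for p x y
  proof -
   interpret B: bounded_bilinear "tcomp S p" by (rule tensor_fieldD(3)[OF S])
   have sk: "tcomp S p x (axis i 1) $ j = - tcomp S p x (axis j 1) $ i" for i j
    using m[rule_format, of p x "axis i 1" "axis j 1"] by (simp add: inner_axis inner_axis')
   have z: "tcomp S p x (axis i 1) $ i = 0" for i using sk[of i i] by simp
   have "y = y $ 1 *\<^sub>R axis 1 1 + y $ 2 *\<^sub>R axis 2 1 + y $ 3 *\<^sub>R axis 3 1"
    by (simp add: vec_eq_iff forall_3 axis_def)
   hence "tcomp S p x y = y $ 1 *\<^sub>R tcomp S p x (axis 1 1) + y $ 2 *\<^sub>R tcomp S p x (axis 2 1) + y $ 3 *\<^sub>R tcomp S p x (axis 3 1)"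
    by (metis B.add_right B.scaleR_right)
   thus ?thesis
    by (simp add: vec_eq_iff forall_3 a_def cross3_def z sk[of 2 1] sk[of 3 2] sk[of 1 3] mult.commute)
  qed
  thus "\<exists>a. \<forall>p x y. tcomp S p x y = cross3 (a p x) y" by blast
 next
  assume "\<exists>a. \<forall>p x y. tcomp S p x y = cross3 (a p x) y"
  thus "\<forall>p x y z. tcomp S p x y \<bullet> z + y \<bullet> tcomp S p x z = 0" using cross3_skew by metis
 qed
qed

lemma parallel_curvature_iff:
 assumes S: "tensor_field12 A S" and a: "!!p x y. tcomp S p x y = cross3 (a p x) y"
 shows "parallel_curvature A (connection_plus D S) D \<longleftrightarrow>
  (\<forall>p x v. cross3 (lam \<alpha> \<beta> x + a p x) (curvop \<alpha> \<beta> v) = curvop \<alpha> \<beta> (cross3 (lam \<alpha> \<beta> x + a p x) v))"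
proof -
 let ?K = "curvop \<alpha> \<beta>"
 interpret K: bounded_linear ?K by (rule linear_maps)
 define t where "t = (%p x. lam \<alpha> \<beta> x + a p x)"
 have D': "connection_plus D S (field x) (field y) = field (%p. fder (tvec p (x p)) y + cross3 (t p (x p)) (y p))"
  "smooth_vec (%p. fder (tvec p (x p)) y + cross3 (t p (x p)) (y p))"
  if "smooth_vec x" "smooth_vec y" for x y
  using connection_plus_field[OF S that] by (simp_all add: a t_def cross_add_left add.assoc)
 have sC: "smooth_vec (%p. cross3 (?K (cross3 (y p) (z p))) (w p))" if "smooth_vec y" "smooth_vec z" "smooth_vec w" for y z w
  by (intro smooth_vec_bilinear[OF bounded_bilinear_cross3_left[OF linear_maps(3)]] smooth_vec_bilinear[OF bounded_bilinear_cross3] that)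
 have fC: "fder u (%q. cross3 (?K (cross3 (y q) (z q))) (w q)) =
   cross3 (?K (cross3 (fder u y) (z p))) (w p) + cross3 (?K (cross3 (y p) (fder u z))) (w p)
    + cross3 (?K (cross3 (y p) (z p))) (fder u w)"
  if "u : \<T> A p" "smooth_vec y" "smooth_vec z" "smooth_vec w" for u p y z w
  using that by (simp add: fder_bilinear[OF bounded_bilinear_cross3_left[OF linear_maps(3)], where x="%q. cross3 (y q) (z q)"]
    fder_bilinear[OF bounded_bilinear_cross3] smooth_vec_bilinear[OF bounded_bilinear_cross3] K.add cross_add_left)
 have eq: "connection_plus D S (field x) (curvature A D (field y) (field z) (field w)) =
   vadd (vadd (curvature A D (connection_plus D S (field x) (field y)) (field z) (field w))
      (curvature A D (field y) (connection_plus D S (field x) (field z)) (field w)))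
      (curvature A D (field y) (field z) (connection_plus D S (field x) (field w))) \<longleftrightarrow>
   (\<forall>p. cross3 (t p (x p)) (cross3 (?K (cross3 (y p) (z p))) (w p)) =
    cross3 (?K (cross3 (cross3 (t p (x p)) (y p)) (z p))) (w p) + cross3 (?K (cross3 (y p) (cross3 (t p (x p)) (z p)))) (w p)
    + cross3 (?K (cross3 (y p) (z p))) (cross3 (t p (x p)) (w p)))"
  if x: "smooth_vec x" and y: "smooth_vec y" and z: "smooth_vec z" and w: "smooth_vec w" for x y z w
  unfolding D'(1)[OF x y] D'(1)[OF x z] D'(1)[OF x w] curvature_field[OF y z w] D'(1)[OF x sC[OF y z w]]
   curvature_field[OF D'(2)[OF x y] z w] curvature_field[OF y D'(2)[OF x z] w] curvature_field[OF y z D'(2)[OF x w]]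
   vadd_field field_eq_pointwise fC[OF tvec_tangent y z w]
  by (simp add: cross_add_left cross_add_right K.add algebra_simps)
 have alg: "cross3 \<tau> (cross3 (?K (cross3 y z)) w) =
    cross3 (?K (cross3 (cross3 \<tau> y) z)) w + cross3 (?K (cross3 y (cross3 \<tau> z))) w + cross3 (?K (cross3 y z)) (cross3 \<tau> w)
   \<longleftrightarrow> cross3 (cross3 \<tau> (?K (cross3 y z)) - ?K (cross3 \<tau> (cross3 y z))) w = 0" for \<tau> y z w
 proof -
  have "cross3 \<tau> (cross3 y z) = cross3 (cross3 \<tau> y) z + cross3 y (cross3 \<tau> z)"
   using cross3_jacobi[of \<tau> y z] by (simp add: algebra_simps)
  hence "cross3 (?K (cross3 (cross3 \<tau> y) z)) w + cross3 (?K (cross3 y (cross3 \<tau> z))) w = cross3 (?K (cross3 \<tau> (cross3 y z))) w"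
   by (simp add: K.add cross_add_left)
  thus ?thesis using cross3_jacobi[of \<tau> "?K (cross3 y z)" w]
   by (simp add: Cross3.left_diff_distrib) (metis (no_types, lifting) add_diff_cancel_right' diff_add_cancel)
 qed
 have cr0: "u = 0" if "!!w. cross3 u w = 0" for u :: "real^3"
  using that[of "axis 1 1"] that[of "axis 2 1"] by (simp add: cross3_def vec_eq_iff forall_3 axis_def)
 have ex: "\<exists>y z. v = cross3 y z" for v :: "real^3"
 proof -
  obtain y :: "real^3" where y: "y ~= 0" "y \<bullet> v = 0"
  proof (cases "v $ 1 = 0 & v $ 2 = 0")
   case True
   thus thesis using that[of "axis 1 1"] by (simp add: inner_axis' axis_eq_0_iff)
  next
   case False
   thus thesis using that[of "vector [- v $ 2, v $ 1, 0]"]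
    by (auto simp: inner_vec_def sum_3 vec_eq_iff forall_3)
  qed
  have "cross3 y (cross3 v y) = (y \<bullet> y) *\<^sub>R v" using y(2)
   by (simp add: cross3_def inner_vec_def sum_3 vec_eq_iff forall_3) algebra
  hence "v = cross3 y ((1 / (y \<bullet> y)) *\<^sub>R cross3 v y)" using y(1) by (simp add: cross_mult_right)
  thus ?thesis by blast
 qed
 have "lam \<alpha> \<beta> x + a p x = t p x" for p x by (simp add: t_def)
 note tpx = this
 show ?thesis unfolding tpx
 proof
  assume p: "parallel_curvature A (connection_plus D S) D"
  have all0: "\<forall>q. cross3 (cross3 (t q x) (?K (cross3 y z)) - ?K (cross3 (t q x) (cross3 y z))) w = 0" for x y z w
   unfolding alg[symmetric]
   using p eq[OF smooth_vec_const smooth_vec_const smooth_vec_const smooth_vec_const, of x y z w]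
    field_vector_field[OF smooth_vec_const] unfolding parallel_curvature_def by blast
  have cc: "cross3 (t q x) (?K (cross3 y z)) - ?K (cross3 (t q x) (cross3 y z)) = 0" for q x y z
   by (rule cr0) (use all0 in simp)
  show "\<forall>p x v. cross3 (t p x) (?K v) = ?K (cross3 (t p x) v)"
  proof (intro allI)
   fix p x v
   obtain y z where "v = cross3 y z" using ex by blast
   thus "cross3 (t p x) (?K v) = ?K (cross3 (t p x) v)" using cc[of p x y z] by simp
  qed
 next
  assume "\<forall>p x v. cross3 (t p x) (?K v) = ?K (cross3 (t p x) v)"
  thus "parallel_curvature A (connection_plus D S) D"
   unfolding parallel_curvature_def all_vector_fields by (simp add: eq alg)
 qed
qed

lemma parallel_tensor_iff:
 assumes S: "tensor_field12 A S"
 shows "parallel_tensor12 A (connection_plus D S) S \<longleftrightarrow>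
  (\<forall>x y z. smooth_vec x --> smooth_vec y --> smooth_vec z --> (\<forall>p.
   fder (tvec p (x p)) (%q. tcomp S q (y q) (z q)) + cross3 (lam \<alpha> \<beta> (x p)) (tcomp S p (y p) (z p)) + tcomp S p (x p) (tcomp S p (y p) (z p)) =
   tcomp S p (fder (tvec p (x p)) y + cross3 (lam \<alpha> \<beta> (x p)) (y p) + tcomp S p (x p) (y p)) (z p) +
   tcomp S p (y p) (fder (tvec p (x p)) z + cross3 (lam \<alpha> \<beta> (x p)) (z p) + tcomp S p (x p) (z p))))"
proof -
 have "connection_plus D S (field x) (%p. S p (field y p) (field z p)) =
   vadd (%p. S p (connection_plus D S (field x) (field y) p) (field z p)) (%p. S p (field y p) (connection_plus D S (field x) (field z) p)) \<longleftrightarrow>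
   (\<forall>p. fder (tvec p (x p)) (%q. tcomp S q (y q) (z q)) + cross3 (lam \<alpha> \<beta> (x p)) (tcomp S p (y p) (z p)) + tcomp S p (x p) (tcomp S p (y p) (z p)) =
   tcomp S p (fder (tvec p (x p)) y + cross3 (lam \<alpha> \<beta> (x p)) (y p) + tcomp S p (x p) (y p)) (z p) +
   tcomp S p (y p) (fder (tvec p (x p)) z + cross3 (lam \<alpha> \<beta> (x p)) (z p) + tcomp S p (x p) (z p)))"
  if x: "smooth_vec x" and y: "smooth_vec y" and z: "smooth_vec z" for x y z
  unfolding connection_plus_field(1)[OF S x y] connection_plus_field(1)[OF S x z] tensor_apply_field[OF S]
   connection_plus_field(1)[OF S x tensor_fieldD(4)[OF S y z]] vadd_field field_eq_pointwise ..
 thus ?thesis unfolding parallel_tensor12_def all_vector_fields by auto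
qed

lemma tensor_comp_const_smooth:
 "tensor_field12 A S ==> (%p. tcomp S p x y $ k) : \<F> A"
 using smooth_vecD[OF tensor_fieldD(4)[OF _ smooth_vec_const smooth_vec_const]] .

text \<open>The structure whose connection makes the frame parallel.\<close>

lemma homogeneous_frame_parallel:
 assumes S: "tensor_field12 A S" and c: "!!p x y. tcomp S p x y = - cross3 (lam \<alpha> \<beta> x) y"
 shows "homogeneous_structure A g D S"
proof -
 interpret L: bounded_linear "lam \<alpha> \<beta>" by (rule linear_maps)
 interpret K: bounded_linear "curvop \<alpha> \<beta>" by (rule linear_maps)
 have c': "tcomp S p x y = cross3 (- lam \<alpha> \<beta> x) y" for p x y unfolding c by (simp add: cross_minus_left)
 have "metric_connection A g (connection_plus D S)"
  unfolding metric_connection_plus_iff[OF S] by (rule exI[of _ "%p x. - lam \<alpha> \<beta> x"]) (simp add: c')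
 moreover have "parallel_curvature A (connection_plus D S) D"
  unfolding parallel_curvature_iff[where a="%p x. - lam \<alpha> \<beta> x", OF S c'] by (simp add: K.zero)
 moreover have "parallel_tensor12 A (connection_plus D S) S"
 proof -
  have B: "bounded_bilinear (%x y. cross3 (- lam \<alpha> \<beta> x) y)"
   by (intro bounded_bilinear_cross3_left bounded_linear_minus linear_maps)
  have "fder u (%q. - cross3 (lam \<alpha> \<beta> (y q)) (z q)) =
    - cross3 (lam \<alpha> \<beta> (fder u y)) (z p) - cross3 (lam \<alpha> \<beta> (y p)) (fder u z)"
   if "u : \<T> A p" "smooth_vec y" "smooth_vec z" for u p y z
   using fder_bilinear[OF B that] by (simp add: cross_minus_left)
  thus ?thesis unfolding parallel_tensor_iff[OF S] c'
   by (simp add: cross_minus_left)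
 qed
 ultimately show ?thesis unfolding homogeneous_structure_def using S by blast
qed

text \<open>If the Ricci curvatures are distinct, no nonzero skew operator commutes with the curvature, and the frame must be parallel.\<close>

lemma homogeneous_generic:
 assumes h: "homogeneous_structure A g D S" and \<alpha>: "\<alpha> >= 0" "\<alpha> ~= 0" "\<alpha> ~= 1"
 shows "tcomp S p x y = - cross3 (lam \<alpha> \<beta> x) y"
proof -
 have S: "tensor_field12 A S" using h unfolding homogeneous_structure_def by blast
 obtain a where a: "!!p x y. tcomp S p x y = cross3 (a p x) y"
  using h metric_connection_plus_iff[OF S] unfolding homogeneous_structure_def by blast
 have cm: "cross3 (lam \<alpha> \<beta> x + a p x) (curvop \<alpha> \<beta> v) = curvop \<alpha> \<beta> (cross3 (lam \<alpha> \<beta> x + a p x) v)" for p x v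
  using h parallel_curvature_iff[OF S a] unfolding homogeneous_structure_def by blast
 have "lam \<alpha> \<beta> x + a p x = 0"
  using curvop_commute_components[OF cm, of x p] \<alpha> by (auto simp: vec_eq_iff forall_3)
 hence "a p x = - lam \<alpha> \<beta> x" by (simp add: eq_neg_iff_add_eq_0 add.commute)
 thus ?thesis by (simp add: a cross_minus_left)
qed

lemma locally_symmetric_cases:
 assumes "\<alpha> = 0 | \<alpha> = 1 & \<beta> = 0" shows "locally_symmetric A D"
proof -
 have "bilinear (%(x::real^3) (y::real^3). 0 :: real^3)" by (simp add: bilinear_def linear_iff)
 hence z: "bounded_bilinear (%(x::real^3) (y::real^3). 0 :: real^3)" by (simp add: bilinear_conv_bounded_bilinear)
 define Z where "Z = tensor_of (%p x y. 0 :: real^3)"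
 have S: "tensor_field12 A Z" unfolding Z_def by (rule tensor_of_tensor_field[OF z]) simp
 have c: "tcomp Z p x y = cross3 0 y" for p x y by (simp add: Z_def)
 have "cross3 (lam \<alpha> \<beta> x) (curvop \<alpha> \<beta> v) = curvop \<alpha> \<beta> (cross3 (lam \<alpha> \<beta> x) v)" for x v
  using assms by (auto simp: lam_def curvop_def cross3_def vec_eq_iff forall_3 algebra_simps)
 hence par: "parallel_curvature A (connection_plus D Z) D"
  using parallel_curvature_iff[where a="%_ _. 0", OF S c] by simp
 have eq: "connection_plus D Z X Y = D X Y" for X Y
  by (auto simp: connection_plus_def vadd_def Z_def tensor_of_def tvec_0 tadd_def)
 have "connection_plus D Z = D" using eq by blast
 thus ?thesis using par by (simp add: locally_symmetric_def)
qed

end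

section \<open>The case \<open>\<alpha> = 1\<close>\<close>

text \<open>For \<open>\<alpha> = 1\<close> the curvature only forces the difference from the frame-parallel connection to be a rotation about \<open>e 3\<close>. The
  structures are then determined by a covector field \<open>\<mu>\<close>: \<open>S x y = ax \<beta> \<mu> x \<times> y\<close>. That \<open>S\<close> is parallel
  becomes a total differential equation for \<open>\<mu>\<close>.\<close>

definition ax :: "real => real^3 => real^3 => real^3" where
 "ax \<beta> m x = vector [- \<beta> * x $ 1, - \<beta> * x $ 2, m \<bullet> x]"

locale G1_frame = G_frame A g e 1 \<beta> D
 for A :: "('p::t2_space, real^3) atlas" and g e \<beta> D
begin

definition twisted :: "'p tensor12 => ('p => real^3) => bool" where
 "twisted S \<mu> \<longleftrightarrow> (\<forall>p x y. tcomp S p x y = cross3 (ax \<beta> (\<mu> p) x) y)"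

definition twist_equation :: "('p => real^3) => bool" where
 "twist_equation \<mu> \<longleftrightarrow> (\<forall>p x. fder (tvec p x) \<mu> =
   (x \<bullet> \<mu> p - 2 * x $ 2 - \<beta> * x $ 3) *\<^sub>R vector [\<mu> p $ 2, - \<mu> p $ 1, 0])"

lemma ax_lam: "lam 1 \<beta> x + ax \<beta> m x = (x \<bullet> m - 2 * x $ 2 - \<beta> * x $ 3) *\<^sub>R axis 3 1"
 by (simp add: lam_def ax_def vec_eq_iff forall_3 axis_def inner_vec_def sum_3 algebra_simps)

lemma homogeneous_twisted:
 assumes h: "homogeneous_structure A g D S"
 obtains \<mu> where "smooth_vec \<mu>" "twisted S \<mu>" "twist_equation \<mu>"
proof -
 have S: "tensor_field12 A S" using h unfolding homogeneous_structure_def by blast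
 obtain a where a: "!!p x y. tcomp S p x y = cross3 (a p x) y"
  using h metric_connection_plus_iff[OF S] unfolding homogeneous_structure_def by blast
 have cm: "cross3 (lam 1 \<beta> x + a p x) (curvop 1 \<beta> v) = curvop 1 \<beta> (cross3 (lam 1 \<beta> x + a p x) v)" for p x v
  using h parallel_curvature_iff[OF S a] unfolding homogeneous_structure_def by blast
 have t: "lam 1 \<beta> x $ 1 + a p x $ 1 = 0" "lam 1 \<beta> x $ 2 + a p x $ 2 = 0" for p x
  using curvop_commute_components[OF cm, of x p] by simp_all
 define \<mu> where "\<mu> = (%p. vector [tcomp S p (axis 1 1) (axis 1 1) $ 2, tcomp S p (axis 2 1) (axis 1 1) $ 2,
   tcomp S p (axis 3 1) (axis 1 1) $ 2] :: real^3)"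
 have \<mu>s: "smooth_vec \<mu>"
  unfolding smooth_vec_def forall_3 by (simp add: \<mu>_def tensor_comp_const_smooth[OF S])
 have a3: "a p x $ 3 = \<mu> p \<bullet> x" for p x
 proof -
  interpret B: bounded_bilinear "tcomp S p" by (rule tensor_fieldD(3)[OF S])
  have "x = x $ 1 *\<^sub>R axis 1 1 + x $ 2 *\<^sub>R axis 2 1 + x $ 3 *\<^sub>R axis 3 1"
   by (simp add: vec_eq_iff forall_3 axis_def)
  hence "tcomp S p x (axis 1 1) = x $ 1 *\<^sub>R tcomp S p (axis 1 1) (axis 1 1) + x $ 2 *\<^sub>R tcomp S p (axis 2 1) (axis 1 1)
    + x $ 3 *\<^sub>R tcomp S p (axis 3 1) (axis 1 1)"
   by (metis B.add_left B.scaleR_left)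
  moreover have "a p x $ 3 = tcomp S p x (axis 1 1) $ 2" by (simp add: a cross3_def axis_def)
  ultimately show ?thesis by (simp add: \<mu>_def inner_vec_def sum_3 algebra_simps)
 qed
 have "a p x = ax \<beta> (\<mu> p) x" for p x
  using t[of x p] a3[of p x] by (simp add: ax_def lam_def vec_eq_iff forall_3)
 hence tw: "twisted S \<mu>" unfolding twisted_def a by simp
 have "fder (tvec p x) \<mu> $ j = (x \<bullet> \<mu> p - 2 * x $ 2 - \<beta> * x $ 3) * (vector [\<mu> p $ 2, - \<mu> p $ 1, 0] :: real^3) $ j" for p x j
 proof -
  let ?y = "axis j 1 :: real^3" and ?z = "axis 1 1 :: real^3" and ?\<tau> = "x \<bullet> \<mu> p - 2 * x $ 2 - \<beta> * x $ 3"
  have s: "tcomp S q y z = cross3 (ax \<beta> (\<mu> q) y) z" for q y z using tw unfolding twisted_def by blast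
  have "parallel_tensor12 A (connection_plus D S) S" using h unfolding homogeneous_structure_def by blast
  from this[unfolded parallel_tensor_iff[OF S], rule_format, OF smooth_vec_const smooth_vec_const smooth_vec_const, of p x ?y ?z]
  have "fder (tvec p x) (%q. tcomp S q ?y ?z) + (cross3 (lam 1 \<beta> x) (tcomp S p ?y ?z) + tcomp S p x (tcomp S p ?y ?z)) =
    tcomp S p (cross3 (lam 1 \<beta> x) ?y + tcomp S p x ?y) ?z + tcomp S p ?y (cross3 (lam 1 \<beta> x) ?z + tcomp S p x ?z)"
   by (simp add: fder_const[OF tvec_tangent] add.assoc)
  from arg_cong[OF this, of "%v. v $ 2"] have "fder (tvec p x) (%q. tcomp S q ?y ?z) $ 2 + cross3 (?\<tau> *\<^sub>R axis 3 1) (cross3 (ax \<beta> (\<mu> p) ?y) ?z) $ 2 =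
    cross3 (ax \<beta> (\<mu> p) (cross3 (?\<tau> *\<^sub>R axis 3 1) ?y)) ?z $ 2 + cross3 (ax \<beta> (\<mu> p) ?y) (cross3 (?\<tau> *\<^sub>R axis 3 1) ?z) $ 2"
   unfolding ax_lam[symmetric] by (simp add: s cross_add_left)
  moreover have "fder (tvec p x) (%q. tcomp S q ?y ?z) $ 2 = fder (tvec p x) \<mu> $ j"
   by (simp add: fder_nth s cross3_def ax_def axis_def[of 1] inner_axis)
  ultimately show ?thesis
   using exhaust_3[of j] by (auto simp: cross3_def ax_def axis_def inner_vec_def sum_3 algebra_simps)
 qed
 hence "twist_equation \<mu>" unfolding twist_equation_def by (simp add: vec_eq_iff)
 thus thesis using that \<mu>s tw by blast
qed

lemma twisted_homogeneous:
 assumes S: "tensor_field12 A S" and \<mu>: "smooth_vec \<mu>" and tw: "twisted S \<mu>" and te: "twist_equation \<mu>"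
 shows "homogeneous_structure A g D S"
proof -
 have s: "tcomp S q y z = cross3 (ax \<beta> (\<mu> q) y) z" for q y z using tw unfolding twisted_def by blast
 have "metric_connection A g (connection_plus D S)"
  unfolding metric_connection_plus_iff[OF S] by (rule exI[of _ "%p. ax \<beta> (\<mu> p)"]) (simp add: s)
 moreover have "parallel_curvature A (connection_plus D S) D"
  unfolding parallel_curvature_iff[where a="%p. ax \<beta> (\<mu> p)", OF S s] ax_lam
  by (simp add: curvop_def cross3_def axis_def vec_eq_iff forall_3 algebra_simps)
 moreover have "parallel_tensor12 A (connection_plus D S) S"
  unfolding parallel_tensor_iff[OF S]
 proof (intro allI impI)
  fix x y z p assume x: "smooth_vec x" and y: "smooth_vec y" and z: "smooth_vec z"
  define P where "P = (%v::real^3. vector [- \<beta> * v $ 1, - \<beta> * v $ 2, 0] :: real^3)"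
  define Q where "Q = (%m v::real^3. vector [0, 0, m \<bullet> v] :: real^3)"
  have axPQ: "ax \<beta> m v = P v + Q m v" for m v
   by (simp add: ax_def P_def Q_def vec_eq_iff forall_3)
  have P: "bounded_linear P"
   unfolding linear_conv_bounded_linear[symmetric]
   by (rule linearI) (simp_all add: P_def vec_eq_iff forall_3 algebra_simps)
  have "bilinear Q" by (simp add: bilinear_def linear_iff Q_def vec_eq_iff forall_3 inner_add_left inner_add_right algebra_simps)
  hence Q: "bounded_bilinear Q" by (simp add: bilinear_conv_bounded_bilinear)
  note B1 = bounded_bilinear_cross3_left[OF P]
  let ?u = "tvec p (x p)"
  have "fder ?u (%q. tcomp S q (y q) (z q)) = fder ?u (%q. cross3 (P (y q)) (z q) + cross3 (Q (\<mu> q) (y q)) (z q))"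
   by (simp add: s axPQ cross_add_left)
  also have "\<dots> = cross3 (P (fder ?u y)) (z p) + cross3 (P (y p)) (fder ?u z) +
    (cross3 (Q (fder ?u \<mu>) (y p) + Q (\<mu> p) (fder ?u y)) (z p) + cross3 (Q (\<mu> p) (y p)) (fder ?u z))"
   by (simp add: fder_add[OF tvec_tangent smooth_vec_bilinear[OF B1 y z]
      smooth_vec_bilinear[OF bounded_bilinear_cross3 smooth_vec_bilinear[OF Q \<mu> y] z]]
     fder_bilinear[OF B1 tvec_tangent y z] fder_bilinear[OF Q tvec_tangent \<mu> y]
     fder_bilinear[OF bounded_bilinear_cross3 tvec_tangent smooth_vec_bilinear[OF Q \<mu> y] z])
  finally have 1: "fder ?u (%q. tcomp S q (y q) (z q)) =
    cross3 (ax \<beta> (\<mu> p) (fder ?u y)) (z p) + cross3 (ax \<beta> (\<mu> p) (y p)) (fder ?u z) + cross3 (Q (fder ?u \<mu>) (y p)) (z p)"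
   by (simp add: axPQ cross_add_left algebra_simps)
  have 2: "fder ?u \<mu> = (x p \<bullet> \<mu> p - 2 * x p $ 2 - \<beta> * x p $ 3) *\<^sub>R vector [\<mu> p $ 2, - \<mu> p $ 1, 0]" (is "_ = ?\<tau> *\<^sub>R _")
   using te unfolding twist_equation_def by blast
  have t: "cross3 (lam 1 \<beta> (x p)) v + cross3 (ax \<beta> (\<mu> p) (x p)) v = ?\<tau> *\<^sub>R cross3 (axis 3 1) v" for v
   unfolding cross_add_left[symmetric] ax_lam by (simp add: cross_mult_left)
  have 3: "cross3 (Q (?\<tau> *\<^sub>R vector [\<mu> p $ 2, - \<mu> p $ 1, 0]) v) w + ?\<tau> *\<^sub>R cross3 (axis 3 1) (cross3 (ax \<beta> (\<mu> p) v) w) =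
    cross3 (ax \<beta> (\<mu> p) (?\<tau> *\<^sub>R cross3 (axis 3 1) v)) w + cross3 (ax \<beta> (\<mu> p) v) (?\<tau> *\<^sub>R cross3 (axis 3 1) w)" for v w
   by (simp add: Q_def ax_def cross3_def axis_def vec_eq_iff forall_3 inner_vec_def sum_3 algebra_simps)
  have axadd: "ax \<beta> m (v + w) = ax \<beta> m v + ax \<beta> m w" for m v w
   by (simp add: ax_def vec_eq_iff forall_3 inner_add_right algebra_simps)
  have "fder ?u (%q. tcomp S q (y q) (z q)) + (cross3 (lam 1 \<beta> (x p)) (tcomp S p (y p) (z p)) + tcomp S p (x p) (tcomp S p (y p) (z p))) =
    tcomp S p (fder ?u y + (cross3 (lam 1 \<beta> (x p)) (y p) + tcomp S p (x p) (y p))) (z p) +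
    tcomp S p (y p) (fder ?u z + (cross3 (lam 1 \<beta> (x p)) (z p) + tcomp S p (x p) (z p)))"
   unfolding 1 unfolding s t axadd cross_add_left cross_add_right 2 using 3[of "y p" "z p"] by (simp add: algebra_simps)
  thus "fder ?u (%q. tcomp S q (y q) (z q)) + cross3 (lam 1 \<beta> (x p)) (tcomp S p (y p) (z p)) + tcomp S p (x p) (tcomp S p (y p) (z p)) =
    tcomp S p (fder ?u y + cross3 (lam 1 \<beta> (x p)) (y p) + tcomp S p (x p) (y p)) (z p) +
    tcomp S p (y p) (fder ?u z + cross3 (lam 1 \<beta> (x p)) (z p) + tcomp S p (x p) (z p))"
   by (simp only: add.assoc)
 qed
 ultimately show ?thesis unfolding homogeneous_structure_def using S by blast
qed

lemma twist_equation_frame: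
 assumes "twist_equation \<mu>"
 shows "e 1 p (%q. \<mu> q $ 1) = \<mu> p $ 1 * \<mu> p $ 2" "e 2 p (%q. \<mu> q $ 1) = (\<mu> p $ 2 - 2) * \<mu> p $ 2"
  "e 3 p (%q. \<mu> q $ 1) = (\<mu> p $ 3 - \<beta>) * \<mu> p $ 2"
  "e 1 p (%q. \<mu> q $ 2) = - (\<mu> p $ 1 * \<mu> p $ 1)" "e 2 p (%q. \<mu> q $ 2) = - ((\<mu> p $ 2 - 2) * \<mu> p $ 1)"
  "e 3 p (%q. \<mu> q $ 2) = - ((\<mu> p $ 3 - \<beta>) * \<mu> p $ 1)"
  "e i p (%q. \<mu> q $ 3) = 0"
proof -
 have "fder (tvec p (axis i 1)) \<mu> $ j =
   (axis i 1 \<bullet> \<mu> p - 2 * axis i 1 $ 2 - \<beta> * axis i 1 $ 3) * (vector [\<mu> p $ 2, - \<mu> p $ 1, 0] :: real^3) $ j" for i j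
  using assms unfolding twist_equation_def by (metis vector_scaleR_component real_scaleR_def)
 hence *: "e i p (%q. \<mu> q $ j) =
   (\<mu> p $ i - 2 * (axis i 1 :: real^3) $ 2 - \<beta> * (axis i 1 :: real^3) $ 3) * (vector [\<mu> p $ 2, - \<mu> p $ 1, 0] :: real^3) $ j" for i j
  by (simp add: fder_nth tvec_axis inner_axis')
 show "e 1 p (%q. \<mu> q $ 1) = \<mu> p $ 1 * \<mu> p $ 2" "e 2 p (%q. \<mu> q $ 1) = (\<mu> p $ 2 - 2) * \<mu> p $ 2"
  "e 3 p (%q. \<mu> q $ 1) = (\<mu> p $ 3 - \<beta>) * \<mu> p $ 2"
  "e 1 p (%q. \<mu> q $ 2) = - (\<mu> p $ 1 * \<mu> p $ 1)" "e 2 p (%q. \<mu> q $ 2) = - ((\<mu> p $ 2 - 2) * \<mu> p $ 1)"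
  "e 3 p (%q. \<mu> q $ 2) = - ((\<mu> p $ 3 - \<beta>) * \<mu> p $ 1)"
  "e i p (%q. \<mu> q $ 3) = 0"
  unfolding * by (simp_all add: axis_def)
qed

lemma bracket_function:
 assumes f: "f : \<F> A"
 shows "e 1 p (%q. e 2 q f) - e 2 p (%q. e 1 q f) = 2 * e 2 p f + 2 * \<beta> * e 3 p f"
  "e 1 p (%q. e 3 q f) - e 3 p (%q. e 1 q f) = 0" "e 2 p (%q. e 3 q f) - e 3 p (%q. e 2 q f) = 0"
proof -
 have *: "e i p (%q. e j q f) - e j p (%q. e i q f) = tvec p (brk 1 \<beta> (cross3 (axis i 1) (axis j 1))) f" for i j
  using fun_cong[OF fun_cong[OF brackets[of i j], of p], of f] f by (simp add: vbracket_def)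
 show "e 1 p (%q. e 2 q f) - e 2 p (%q. e 1 q f) = 2 * e 2 p f + 2 * \<beta> * e 3 p f"
  "e 1 p (%q. e 3 q f) - e 3 p (%q. e 1 q f) = 0" "e 2 p (%q. e 3 q f) - e 3 p (%q. e 2 q f) = 0"
  unfolding * by (simp_all add: tvec_def sum_3 brk_def cross3_def axis_def)
qed

text \<open>The brackets of the frame, applied to the components of \<open>\<mu>\<close>, give integrability conditions. They leave \<open>\<mu> = (0, 0, c)\<close> with a
  constant \<open>c\<close>, or a \<open>\<mu>\<close> on the circle of radius \<open>2\<close> at height \<open>\<beta>\<close>.\<close>

lemma twist_equation_cases:
 assumes conn: "connected (UNIV :: 'p set)" and \<mu>: "smooth_vec \<mu>" and te: "twist_equation \<mu>"
 shows "(\<exists>c. \<forall>p. \<mu> p = vector [0, 0, c]) | (\<forall>p. (\<mu> p $ 1)\<^sup>2 + (\<mu> p $ 2)\<^sup>2 = 4 & \<mu> p $ 3 = \<beta>)"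
proof -
 note d = twist_equation_frame[OF te] and s = smooth_vecD[OF \<mu>]
 note tm = tangent_mult[OF frame_tangent] and td = tangent_diff[OF frame_tangent] and tc = tangent_const[OF frame_tangent]
  and tn = tangent_cmult[OF frame_tangent, where c="-1", simplified]
 have m3: "\<mu> p $ 3 = \<mu> q $ 3" for p q
  by (rule frame_constant[OF conn s]) (rule d(7))
 have rho: "(\<mu> p $ 1)\<^sup>2 + (\<mu> p $ 2)\<^sup>2 = (\<mu> q $ 1)\<^sup>2 + (\<mu> q $ 2)\<^sup>2" for p q
 proof -
  have "\<mu> p $ 1 * \<mu> p $ 1 + \<mu> p $ 2 * \<mu> p $ 2 = \<mu> q $ 1 * \<mu> q $ 1 + \<mu> q $ 2 * \<mu> q $ 2"
  proof (rule frame_constant[OF conn, of "%p. \<mu> p $ 1 * \<mu> p $ 1 + \<mu> p $ 2 * \<mu> p $ 2"])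
   show "(%p. \<mu> p $ 1 * \<mu> p $ 1 + \<mu> p $ 2 * \<mu> p $ 2) : \<F> A"
    by (intro smooth_functions_add smooth_functions_mult s)
   show "e i p (%p. \<mu> p $ 1 * \<mu> p $ 1 + \<mu> p $ 2 * \<mu> p $ 2) = 0" for p i
    using exhaust_3[of i]
    by (auto simp: tangent_add[OF frame_tangent smooth_functions_mult[OF s s] smooth_functions_mult[OF s s]] tm[OF s s] d algebra_simps)
  qed
  thus ?thesis by (simp add: power2_eq_square)
 qed
 have e2: "e i p (%q. (\<mu> q $ j - c) * \<mu> q $ k) = (\<mu> p $ j - c) * e i p (%q. \<mu> q $ k) + \<mu> p $ k * e i p (%q. \<mu> q $ j)" for i j k c p
  by (simp add: tm[OF smooth_functions_diff[OF s smooth_functions_const] s] td[OF s smooth_functions_const] tc)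
 have e1: "e i p (%q. \<mu> q $ j * \<mu> q $ k) = \<mu> p $ j * e i p (%q. \<mu> q $ k) + \<mu> p $ k * e i p (%q. \<mu> q $ j)" for i j k p
  by (rule tm[OF s s])
 have e1n: "e i p (%q. - (\<mu> q $ j * \<mu> q $ k)) = - (\<mu> p $ j * e i p (%q. \<mu> q $ k) + \<mu> p $ k * e i p (%q. \<mu> q $ j))" for i j k p
  by (simp add: tn[OF smooth_functions_mult[OF s s]] e1)
 have e2n: "e i p (%q. - ((\<mu> q $ j - c) * \<mu> q $ k)) = - ((\<mu> p $ j - c) * e i p (%q. \<mu> q $ k) + \<mu> p $ k * e i p (%q. \<mu> q $ j))" for i j k c p
  by (simp add: tn[OF smooth_functions_mult[OF smooth_functions_diff[OF s smooth_functions_const] s]] e2)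
 have i1: "(\<mu> p $ 3 - \<beta>) * (\<mu> p $ 2)\<^sup>2 = 0" for p
  using bracket_function(2)[OF s[of 1], of p] unfolding d e1 e2 by (auto simp: algebra_simps power2_eq_square)
 have i2: "(\<mu> p $ 3 - \<beta>) * (\<mu> p $ 1)\<^sup>2 = 0" for p
  using bracket_function(3)[OF s[of 2], of p] unfolding d e1 e2 e1n e2n by (auto simp: algebra_simps power2_eq_square)
 show ?thesis
 proof (cases "\<exists>p. (\<mu> p $ 1)\<^sup>2 + (\<mu> p $ 2)\<^sup>2 ~= 0")
  case False
  hence z: "\<mu> p $ 1 = 0 & \<mu> p $ 2 = 0" for p by (simp add: sum_power2_eq_zero_iff)
  have "\<mu> p = vector [0, 0, \<mu> undefined $ 3]" for p
   using z[of p] m3[of p undefined] by (simp add: vec_eq_iff forall_3)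
  thus ?thesis by blast
 next
  case True
  then obtain p0 where p0: "(\<mu> p0 $ 1)\<^sup>2 + (\<mu> p0 $ 2)\<^sup>2 ~= 0" by blast
  have "(\<mu> p0 $ 3 - \<beta>) * ((\<mu> p0 $ 1)\<^sup>2 + (\<mu> p0 $ 2)\<^sup>2) = 0"
   unfolding distrib_left i1 i2 by simp
  hence "\<mu> p0 $ 3 = \<beta>" using p0 by (metis eq_iff_diff_eq_0 mult_eq_0_iff)
  hence b: "\<mu> p $ 3 = \<beta>" for p using m3[of p p0] by simp
  have j1: "\<mu> p0 $ 2 * (4 - ((\<mu> p0 $ 1)\<^sup>2 + (\<mu> p0 $ 2)\<^sup>2)) = 0"
   using bracket_function(1)[OF s[of 1], of p0] unfolding d e1 e2 b by (simp add: algebra_simps power2_eq_square)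
  have j2: "\<mu> p0 $ 1 * (4 - ((\<mu> p0 $ 1)\<^sup>2 + (\<mu> p0 $ 2)\<^sup>2)) = 0"
   using bracket_function(1)[OF s[of 2], of p0] unfolding d e1 e2 e1n e2n b by (simp add: algebra_simps power2_eq_square)
  have "(\<mu> p0 $ 1)\<^sup>2 + (\<mu> p0 $ 2)\<^sup>2 = 4"
  proof (rule ccontr)
   assume "(\<mu> p0 $ 1)\<^sup>2 + (\<mu> p0 $ 2)\<^sup>2 ~= 4"
   hence "\<mu> p0 $ 1 = 0 & \<mu> p0 $ 2 = 0" using j1 j2 by auto
   thus False using p0 by simp
  qed
  thus ?thesis using b rho by metis
 qed
qed

text \<open>On the circle the equation determines \<open>\<mu>\<close> from one value, by Gronwall's inequality for the squared difference.\<close>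

lemma twist_equation_unique:
 assumes conn: "connected (UNIV :: 'p set)" and \<mu>: "smooth_vec \<mu>" "twist_equation \<mu>" and \<nu>: "smooth_vec \<nu>" "twist_equation \<nu>"
  and c\<mu>: "!!p. (\<mu> p $ 1)\<^sup>2 + (\<mu> p $ 2)\<^sup>2 = 4 & \<mu> p $ 3 = \<beta>" and c\<nu>: "!!p. (\<nu> p $ 1)\<^sup>2 + (\<nu> p $ 2)\<^sup>2 = 4 & \<nu> p $ 3 = \<beta>"
  and eq: "\<mu> p0 = \<nu> p0"
 shows "\<mu> p = \<nu> p"
proof -
 note d\<mu> = twist_equation_frame[OF \<mu>(2)] and d\<nu> = twist_equation_frame[OF \<nu>(2)]
 define a where "a = (%p. \<mu> p $ 1 - \<nu> p $ 1)"
 define b where "b = (%p. \<mu> p $ 2 - \<nu> p $ 2)"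
 define h where "h = (%p. a p * a p + b p * b p)"
 have s: "a : \<F> A" "b : \<F> A"
  unfolding a_def b_def by (intro smooth_functions_diff smooth_vecD \<mu> \<nu>)+
 have hs: "h : \<F> A" unfolding h_def by (intro smooth_functions_add smooth_functions_mult s)
 have dh: "e i p h = 2 * (a p * e i p a + b p * e i p b)" for i p
  unfolding h_def
  by (simp add: tangent_add[OF frame_tangent smooth_functions_mult[OF s(1) s(1)] smooth_functions_mult[OF s(2) s(2)]]
    tangent_mult[OF frame_tangent s(1) s(1)] tangent_mult[OF frame_tangent s(2) s(2)])
 have da: "e i p a = e i p (%q. \<mu> q $ 1) - e i p (%q. \<nu> q $ 1)" "e i p b = e i p (%q. \<mu> q $ 2) - e i p (%q. \<nu> q $ 2)" for i p
  unfolding a_def b_def by (intro tangent_diff[OF frame_tangent] smooth_vecD \<mu> \<nu>)+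
 have \<nu>2: "\<bar>\<nu> p $ 1\<bar> <= 2" "\<bar>\<nu> p $ 2\<bar> <= 2" for p
 proof -
  have "(\<nu> p $ 1)\<^sup>2 + (\<nu> p $ 2)\<^sup>2 = 4" using c\<nu> by blast
  hence "(\<nu> p $ 1)\<^sup>2 <= 4" "(\<nu> p $ 2)\<^sup>2 <= 4"
   using zero_le_power2[of "\<nu> p $ 1"] zero_le_power2[of "\<nu> p $ 2"] by linarith+
  hence "(\<nu> p $ 1)\<^sup>2 <= 2\<^sup>2" "(\<nu> p $ 2)\<^sup>2 <= 2\<^sup>2" by simp_all
  thus "\<bar>\<nu> p $ 1\<bar> <= 2" "\<bar>\<nu> p $ 2\<bar> <= 2"
   using power2_le_imp_le[of "\<bar>\<nu> p $ 1\<bar>" 2] power2_le_imp_le[of "\<bar>\<nu> p $ 2\<bar>" 2] by simp_all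
 qed
 have bd: "\<bar>2 * (k * (a p * \<nu> p $ 2 - b p * \<nu> p $ 1))\<bar> <= 8 * h p" if "k = a p | k = b p | k = 0" for k p
 proof -
  have "\<bar>a p * \<nu> p $ 2 - b p * \<nu> p $ 1\<bar> <= 2 * (\<bar>a p\<bar> + \<bar>b p\<bar>)"
   using mult_left_mono[OF \<nu>2(2), of "\<bar>a p\<bar>" p] mult_left_mono[OF \<nu>2(1), of "\<bar>b p\<bar>" p]
    abs_triangle_ineq4[of "a p * \<nu> p $ 2" "b p * \<nu> p $ 1"] by (simp add: abs_mult)
  moreover have "\<bar>k\<bar> <= \<bar>a p\<bar> + \<bar>b p\<bar>" using that by auto
  ultimately have "\<bar>k\<bar> * \<bar>a p * \<nu> p $ 2 - b p * \<nu> p $ 1\<bar> <= (\<bar>a p\<bar> + \<bar>b p\<bar>) * (2 * (\<bar>a p\<bar> + \<bar>b p\<bar>))"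
   by (intro mult_mono) auto
  moreover have "(\<bar>a p\<bar> + \<bar>b p\<bar>) * (2 * (\<bar>a p\<bar> + \<bar>b p\<bar>)) <= 4 * h p"
   using zero_le_power2[of "\<bar>a p\<bar> - \<bar>b p\<bar>"] by (simp add: h_def power2_eq_square algebra_simps)
  ultimately show ?thesis by (simp add: abs_mult)
 qed
 have bdh: "\<bar>e i p h\<bar> <= 8 * h p" for i p
 proof -
  consider "i = 1" | "i = 2" | "i = 3" using exhaust_3[of i] by blast
  thus ?thesis
  proof cases
   case 1
   have "e i p h = 2 * (a p * (a p * \<nu> p $ 2 - b p * \<nu> p $ 1))"
    unfolding 1 dh da d\<mu> d\<nu> by (simp add: a_def b_def algebra_simps)
   thus ?thesis using bd[of "a p" p] by simp
  next
   case 2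
   have "e i p h = 2 * (b p * (a p * \<nu> p $ 2 - b p * \<nu> p $ 1))"
    unfolding 2 dh da d\<mu> d\<nu> by (simp add: a_def b_def algebra_simps)
   thus ?thesis using bd[of "b p" p] by simp
  next
   case 3
   have "e i p h = 0" unfolding 3 dh da d\<mu> d\<nu> using c\<mu>[of p] c\<nu>[of p] by (simp add: a_def b_def algebra_simps)
   thus ?thesis using bd[of 0 p] by simp
  qed
 qed
 have "h p = 0" for p
  by (rule frame_gronwall_zero[OF conn hs _ bdh, of p0]) (simp_all add: h_def a_def b_def eq)
 hence "a p = 0" "b p = 0" by (simp_all add: h_def sum_squares_eq_zero_iff)
 thus ?thesis using c\<mu>[of p] c\<nu>[of p] by (simp add: a_def b_def vec_eq_iff forall_3)
qed

lemma twist_equation_const: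
 assumes "m = vector [0, 0, c] | m = vector [0, 2, \<beta>]"
 shows "twist_equation (%_. m)"
 using assms unfolding twist_equation_def
 by (auto simp: fder_const[OF tvec_tangent] vec_eq_iff forall_3 inner_vec_def sum_3)

end

section \<open>The named structures in a frame\<close>

context orthonormal_frame
begin

lemma tensor_of_bilinear:
 assumes "bounded_bilinear B" shows "tensor_field12 A (tensor_of (%p. B))"
 by (rule tensor_of_tensor_field) (use assms smooth_vec_bilinear in auto)

lemma tensor_eq_of_tcomp:
 assumes "tensor_field12 A S" "tensor_field12 A S'" "tcomp S p = tcomp S' p" "u : \<T> A p" "v : \<T> A p"
 shows "S p u v = S' p u v"
 using tensor_fieldD(2)[OF assms(1), of p "coord p u" "coord p v"] tensor_fieldD(2)[OF assms(2), of p "coord p u" "coord p v"] assms(3-)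
 by simp

end

lemma (in G1_frame) structure_r_iff:
 "structure_r A g (e 1) (e 2) (e 3) \<beta> r S \<longleftrightarrow> tensor_field12 A S & twisted S (%_. vector [0, 0, - r])"
proof (cases "tensor_field12 A S")
 case S: True
 have th: "g p (e i p) (tvec p x) = x $ i" for p i x
  by (simp add: metric_tvec frame_tangent inner_axis')
 have val: "- 2 * r * x $ 3 * ((y $ 1 * z $ 2 - y $ 2 * z $ 1) / 2) - 2 * \<beta> * x $ 1 * ((y $ 2 * z $ 3 - y $ 3 * z $ 2) / 2)
   - 2 * \<beta> * x $ 2 * ((y $ 3 * z $ 1 - y $ 1 * z $ 3) / 2) = cross3 (ax \<beta> (vector [0, 0, - r]) x) y \<bullet> z" for x y z :: "real^3"
  by (simp add: ax_def cross3_def inner_vec_def sum_3 field_simps)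
 have all: "(\<forall>u\<in>\<T> A p. P u) \<longleftrightarrow> (\<forall>x. P (tvec p x))" for p P
  by (metis tvec_coord tvec_tangent)
 have "structure_r A g (e 1) (e 2) (e 3) \<beta> r S \<longleftrightarrow>
   (\<forall>p x y z. tcomp S p x y \<bullet> z = cross3 (ax \<beta> (vector [0, 0, - r]) x) y \<bullet> z)"
  using S unfolding structure_r_def Let_def all wedge_def th val tensor_fieldD(2)[OF S] by (simp add: metric_tvec)
 also have "\<dots> \<longleftrightarrow> (\<forall>p x y. tcomp S p x y = cross3 (ax \<beta> (vector [0, 0, - r]) x) y)"
  by (metis vector_eq_ldot inner_commute)
 finally show ?thesis using S unfolding twisted_def by simp
next
 case False
 thus ?thesis by (simp add: structure_r_def)
qed

lemma (in G_frame) difference_tensor_iff: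
 assumes Dm: "affine_connection A Dm" "!!i j. Dm (e i) (e j) = vzero"
 shows "difference_tensor A Dm D S \<longleftrightarrow> tensor_field12 A S & (\<forall>p x y. tcomp S p x y = - cross3 (lam \<alpha> \<beta> x) y)"
proof (cases "tensor_field12 A S")
 case S: True
 have z: "coord p tzero = 0" for p using coord_tvec[of p 0] by (simp add: tvec_0)
 have Dmf: "Dm (field x) (field y) = field (%p. fder (tvec p (x p)) y)" if "smooth_vec x" "smooth_vec y" for x y
  unfolding affine_connection_formula[OF Dm(1) that] Dm(2) z by simp
 have "difference_tensor A Dm D S \<longleftrightarrow>
   (\<forall>x y. smooth_vec x --> smooth_vec y --> (\<forall>p. tcomp S p (x p) (y p) = - cross3 (lam \<alpha> \<beta> (x p)) (y p)))"
  unfolding difference_tensor_def all_vector_fields tensor_apply_field[OF S]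
  by (simp add: S Dmf levi_civita_field vsub_field field_eq_pointwise del: field_eq_iff field_at)
 also have "\<dots> \<longleftrightarrow> (\<forall>p x y. tcomp S p x y = - cross3 (lam \<alpha> \<beta> x) y)"
 proof
  assume l: "\<forall>x y. smooth_vec x --> smooth_vec y --> (\<forall>p. tcomp S p (x p) (y p) = - cross3 (lam \<alpha> \<beta> (x p)) (y p))"
  show "\<forall>p x y. tcomp S p x y = - cross3 (lam \<alpha> \<beta> x) y"
   using l[rule_format, OF smooth_vec_const smooth_vec_const] by simp
 qed simp
 finally show ?thesis using S by simp
next
 case False
 thus ?thesis by (simp add: difference_tensor_def)
qed

lemma (in G1_frame) twisted_minus_lam:
 "twisted S (%_. vector [0, 2, \<beta>]) \<longleftrightarrow> (\<forall>p x y. tcomp S p x y = - cross3 (lam 1 \<beta> x) y)"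
proof -
 have "ax \<beta> (vector [0, 2, \<beta>]) x = - lam 1 \<beta> x" for x
  by (simp add: ax_def lam_def vec_eq_iff forall_3 inner_vec_def sum_3)
 thus ?thesis by (simp add: twisted_def cross_minus_left)
qed

lemma (in G_frame) minus_lam_tensor:
 obtains S where "tensor_field12 A S" "!!p x y. tcomp S p x y = - cross3 (lam \<alpha> \<beta> x) y"
proof -
 have "bounded_bilinear (%x y. cross3 (- lam \<alpha> \<beta> x) y)"
  by (intro bounded_bilinear_cross3_left bounded_linear_minus linear_maps)
 thus thesis using that[OF tensor_of_bilinear] by (simp add: cross_minus_left)
qed

lemma (in G1_frame) twisted_const_tensor:
 obtains S where "tensor_field12 A S" "twisted S (%_. m)"
proof -
 have "linear (ax \<beta> m)"
  by (rule linearI) (simp_all add: ax_def vec_eq_iff forall_3 inner_add_right algebra_simps)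
 hence "bounded_bilinear (%x y. cross3 (ax \<beta> m x) y)"
  by (intro bounded_bilinear_cross3_left) (simp add: linear_conv_bounded_linear)
 thus thesis using that[OF tensor_of_bilinear] by (simp add: twisted_def)
qed

section \<open>Isometries\<close>

locale frame_isometry = orthonormal_frame A g e
 for A :: "('p::t2_space, real^3) atlas" and g e +
 fixes F :: "'p => 'p"
 assumes isometry: "isometry A g F"
begin

sublocale self: two_manifolds A A ..

lemma F_smooth: "smooth_map A A F" and Finv_smooth: "smooth_map A A (inv_into UNIV F)" and F_bij: "bij F"
 using isometry unfolding isometry_def by auto

lemma F_inv [simp]: "F (inv_into UNIV F q) = q" "inv_into UNIV F (F p) = p"
 using F_bij by (auto simp: bij_is_surj bij_is_inj surj_f_inv_f)

definition push_frame :: "3 => 'p vfield" where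
 "push_frame i = (%q. push A F (e i (inv_into UNIV F q)))"

lemma push_field_bracket:
 assumes f: "f : \<F> A" and i: "!!f. f : \<F> A ==> (%q. X q f) : \<F> A"
 shows "push A F u (%q. push A F (X (inv_into UNIV F q)) f) = u (%q. X q (%x. f (F x)))"
proof -
 have fF: "(%x. f (F x)) : \<F> A" by (rule self.smooth_functions_comp[OF F_smooth f])
 have "(%q. push A F (X (inv_into UNIV F q)) f) : \<F> A"
  using self.smooth_functions_comp[OF Finv_smooth i[OF fF]] f by (simp add: self.push_apply)
 thus ?thesis using f by (simp add: self.push_apply)
qed

lemma push_frame_orthonormal: "orthonormal_frame A g push_frame"
proof (unfold_locales)
 show "riemannian_metric A g" by (rule metric)
 show "push_frame i : \<XX> A" for i
  unfolding vector_fields_def push_frame_def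
 proof (intro CollectI conjI allI ballI)
  show "push A F (e i (inv_into UNIV F p)) : \<T> A p" for p
   using self.push_in_tangent_space[OF F_smooth frame_tangent, of i "inv_into UNIV F p"] by simp
  fix f assume f: "f : \<F> A"
  have fF: "(%x. f (F x)) : \<F> A" by (rule self.smooth_functions_comp[OF F_smooth f])
  show "(%p. push A F (e i (inv_into UNIV F p)) f) : \<F> A"
   using self.smooth_functions_comp[OF Finv_smooth vector_fieldD(2)[OF frame_field fF]] f by (simp add: self.push_apply)
 qed
 show "g p (push_frame i p) (push_frame j p) = (if i = j then 1 else 0)" for p i j
 proof -
  have "g (F (inv_into UNIV F p)) (push A F (e i (inv_into UNIV F p))) (push A F (e j (inv_into UNIV F p))) = g (inv_into UNIV F p) (e i (inv_into UNIV F p)) (e j (inv_into UNIV F p))"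
   using isometry frame_tangent unfolding isometry_def by blast
  thus ?thesis by (simp add: push_frame_def orthonormal)
 qed
qed

lemma push_frame_tvec: "orthonormal_frame.tvec push_frame (F p) x = push A F (tvec p x)"
proof -
 interpret P: orthonormal_frame A g push_frame by (rule push_frame_orthonormal)
 show ?thesis by (simp add: P.tvec_def tvec_def push_combination push_frame_def)
qed

lemma push_frame_tcomp:
 assumes S': "tensor_field12 A S'" and S: "tensor_field12 A S" and c: "carries_tensor A F S' S"
 shows "orthonormal_frame.tcomp g push_frame S (F p) x y = tcomp S' p x y"
proof -
 interpret P: orthonormal_frame A g push_frame by (rule push_frame_orthonormal)
 have "P.tvec (F p) (P.tcomp S (F p) x y) = S (F p) (push A F (tvec p x)) (push A F (tvec p y))"
  by (simp only: P.tensor_fieldD(2)[OF S, symmetric] push_frame_tvec)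
 also have "\<dots> = push A F (S' p (tvec p x) (tvec p y))"
  using c unfolding carries_tensor_def by simp
 also have "\<dots> = P.tvec (F p) (tcomp S' p x y)" by (simp only: tensor_fieldD(2)[OF S'] push_frame_tvec)
 finally show ?thesis by simp
qed

lemma transported_tensor:
 assumes S': "tensor_field12 A S'" and B: "bounded_bilinear B" "!!p. tcomp S' p = B"
 obtains S where "tensor_field12 A S" "carries_tensor A F S' S"
proof -
 interpret P: orthonormal_frame A g push_frame by (rule push_frame_orthonormal)
 define S where "S = P.tensor_of (%p. B)"
 have S: "tensor_field12 A S" unfolding S_def by (rule P.tensor_of_bilinear[OF B(1)])
 have "S (F p) (push A F u) (push A F v) = push A F (S' p u v)"
  if "u : \<T> A p" "v : \<T> A p" for p u v
 proof -
  have "S (F p) (P.tvec (F p) (coord p u)) (P.tvec (F p) (coord p v)) = P.tvec (F p) (tcomp S' p (coord p u) (coord p v))"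
   by (simp add: S_def P.tensor_of_def B(2))
  thus ?thesis unfolding push_frame_tvec tensor_fieldD(2)[OF S', symmetric] using that by simp
 qed
 thus thesis using that[OF S] unfolding carries_tensor_def by blast
qed

end

lemma G_frame_push_frame:
 assumes "G_frame A g e \<alpha> \<beta> D" "isometry A g F"
 shows "G_frame A g (frame_isometry.push_frame A e F) \<alpha> \<beta> D"
proof -
 interpret G_frame A g e \<alpha> \<beta> D by fact
 interpret I: frame_isometry A g e F by unfold_locales fact
 interpret P: orthonormal_frame A g I.push_frame by (rule I.push_frame_orthonormal)
 show ?thesis
 proof (unfold_locales)
  show "levi_civita A g D" by (rule levi_civita)
  fix i j
  show "vbracket A (I.push_frame i) (I.push_frame j) = P.field (%_. brk \<alpha> \<beta> (cross3 (axis i 1) (axis j 1)))"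
  proof (intro ext)
   fix q f
   show "vbracket A (I.push_frame i) (I.push_frame j) q f = P.field (%_. brk \<alpha> \<beta> (cross3 (axis i 1) (axis j 1))) q f"
   proof (cases "f : \<F> A")
    case False
    thus ?thesis using tangent_nonsmooth[OF P.tvec_tangent] by (simp add: vbracket_def)
   next
    case True
    let ?p = "inv_into UNIV F q" and ?fF = "%x. f (F x)"
    have fF: "?fF : \<F> A" by (rule I.self.smooth_functions_comp[OF I.F_smooth True])
    have pb: "push A F u (%q. push A F (e i (inv_into UNIV F q)) f) = u (%q. e i q ?fF)" for u i
     by (rule I.push_field_bracket[OF True vector_fieldD(2)[OF frame_field]])
    have "vbracket A (I.push_frame i) (I.push_frame j) q f =
      push A F (e i ?p) (%q. push A F (e j (inv_into UNIV F q)) f) - push A F (e j ?p) (%q. push A F (e i (inv_into UNIV F q)) f)"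
     using True by (simp add: vbracket_def I.push_frame_def)
    also have "\<dots> = vbracket A (e i) (e j) ?p ?fF" unfolding pb using fF by (simp add: vbracket_def)
    also have "\<dots> = push A F (tvec ?p (brk \<alpha> \<beta> (cross3 (axis i 1) (axis j 1)))) f"
     unfolding brackets using True by (simp add: I.self.push_apply)
    also have "\<dots> = P.field (%_. brk \<alpha> \<beta> (cross3 (axis i 1) (axis j 1))) q f"
     using I.push_frame_tvec[of ?p] by simp
    finally show ?thesis .
   qed
  qed
 qed
qed

context G1_frame
begin

text \<open>The pushed frame has the same brackets, so what holds for structures with constant components in the frame holds for those with
  constant components in the pushed frame.\<close>

lemma carried_homogeneous:
 assumes F: "isometry A g F" and S': "tensor_field12 A S'" "twisted S' (%_. m)" and m: "m = vector [0, 0, c] | m = vector [0, 2, \<beta>]"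
  and S: "tensor_field12 A S" "carries_tensor A F S' S"
 shows "homogeneous_structure A g D S"
proof -
 interpret I: frame_isometry A g e F by unfold_locales fact
 interpret P: G_frame A g I.push_frame 1 \<beta> D by (rule G_frame_push_frame[OF G_frame_axioms F])
 interpret P1: G1_frame A g I.push_frame \<beta> D ..
 have "P.tcomp S q x y = cross3 (ax \<beta> m x) y" for q x y
  using I.push_frame_tcomp[OF S'(1) S, of "inv_into UNIV F q"] S'(2) by (simp add: twisted_def)
 hence "P1.twisted S (%_. m)" by (simp add: P1.twisted_def)
 thus ?thesis by (rule P1.twisted_homogeneous[OF S(1) P.smooth_vec_const _ P1.twist_equation_const[OF m]])
qed

text \<open>If all rotations of the tangent space at \<open>p0\<close> about \<open>e 3\<close> come from isometries, then a structure of the second kind can be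
  brought to the frame-parallel one at \<open>p0\<close>, hence everywhere.\<close>

lemma homogeneous_carried:
 assumes conn: "connected (UNIV :: 'p set)"
  and rot: "!!\<theta>. \<exists>F. isometry A g F & F p0 = p0 & (\<forall>x. push A F (tvec p0 x) =
    tvec p0 (vector [cos \<theta> * x $ 1 - sin \<theta> * x $ 2, sin \<theta> * x $ 1 + cos \<theta> * x $ 2, x $ 3]))"
  and h: "homogeneous_structure A g D S"
 obtains S' F m where "isometry A g F" "F p0 = p0" "tensor_field12 A S'" "twisted S' (%_. m)"
  "(\<exists>c. m = vector [0, 0, c]) | m = vector [0, 2, \<beta>]" "carries_tensor A F S' S"
proof -
 have S: "tensor_field12 A S" using h unfolding homogeneous_structure_def by blast
 obtain \<mu> where \<mu>: "smooth_vec \<mu>" "twisted S \<mu>" "twist_equation \<mu>" by (rule homogeneous_twisted[OF h])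
 from twist_equation_cases[OF conn \<mu>(1,3)] show thesis
 proof
  assume "\<exists>c. \<forall>p. \<mu> p = vector [0, 0, c]"
  then obtain c where "\<mu> = (%_. vector [0, 0, c])" by auto
  hence "twisted S (%_. vector [0, 0, c])" using \<mu>(2) by simp
  moreover have "isometry A g (%x. x)" unfolding isometry_def
  proof (intro conjI allI ballI)
   interpret self: two_manifolds A A ..
   show "smooth_map A A (%x. x)" using self.smooth_map_iff smooth_at_id[OF smooth_manifold_axioms] by blast
   thus "smooth_map A A (inv_into UNIV (%x. x))" by (simp add: inv_id[unfolded id_def])
  qed (simp_all add: push_id bij_id[unfolded id_def])
  moreover have "carries_tensor A (%x. x) S S"
   unfolding carries_tensor_def by (auto simp: push_id push_id[OF tensor_fieldD(1)[OF S]])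
  ultimately show thesis using that[of "%x. x" S "vector [0, 0, c]"] S by blast
 next
  assume circ: "\<forall>p. (\<mu> p $ 1)\<^sup>2 + (\<mu> p $ 2)\<^sup>2 = 4 & \<mu> p $ 3 = \<beta>"
  have "(- (\<mu> p0 $ 1) / 2)\<^sup>2 + (\<mu> p0 $ 2 / 2)\<^sup>2 = 1"
   using circ by (simp add: power_divide) (metis add_divide_distrib divide_self zero_neq_numeral)
  then obtain \<theta> where \<theta>: "\<mu> p0 $ 2 / 2 = cos \<theta>" "- (\<mu> p0 $ 1) / 2 = sin \<theta>"
   using sincos_total_2pi[of "\<mu> p0 $ 2 / 2" "- (\<mu> p0 $ 1) / 2"] by (auto simp: add.commute)
  define R where "R = (%x::real^3. vector [cos \<theta> * x $ 1 - sin \<theta> * x $ 2, sin \<theta> * x $ 1 + cos \<theta> * x $ 2, x $ 3] :: real^3)"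
  obtain F where F: "isometry A g F" "F p0 = p0" "!!x. push A F (tvec p0 x) = tvec p0 (R x)"
   using rot[of \<theta>] unfolding R_def by blast
  interpret I: frame_isometry A g e F by unfold_locales (rule F)
  let ?m = "vector [0, 2, \<beta>] :: real^3"
  obtain S' where S': "tensor_field12 A S'" "twisted S' (%_. ?m)" by (rule twisted_const_tensor)
  have lin: "linear (ax \<beta> ?m)"
   by (rule linearI) (simp_all add: ax_def vec_eq_iff forall_3 inner_add_right algebra_simps)
  have B: "bounded_bilinear (%x y. cross3 (ax \<beta> ?m x) y)"
   by (intro bounded_bilinear_cross3_left) (simp add: lin linear_conv_bounded_linear[symmetric])
  have S'c: "tcomp S' p = (%x y. cross3 (ax \<beta> ?m x) y)" for p using S'(2) by (auto simp: twisted_def fun_eq_iff)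
  obtain T where T: "tensor_field12 A T" "carries_tensor A F S' T" by (rule I.transported_tensor[OF S'(1) B S'c])
  have hT: "homogeneous_structure A g D T" by (rule carried_homogeneous[OF F(1) S' _ T]) simp
  obtain \<nu> where \<nu>: "smooth_vec \<nu>" "twisted T \<nu>" "twist_equation \<nu>" by (rule homogeneous_twisted[OF hT])
  have Tc: "tcomp T p0 (R x) (R y) = R (cross3 (ax \<beta> ?m x) y)" for x y
  proof -
   have "tvec p0 (tcomp T p0 (R x) (R y)) = T (F p0) (push A F (tvec p0 x)) (push A F (tvec p0 y))"
    by (simp only: F(2,3) tensor_fieldD(2)[OF T(1)])
   also have "\<dots> = push A F (S' p0 (tvec p0 x) (tvec p0 y))" using T(2) unfolding carries_tensor_def by simp
   also have "\<dots> = tvec p0 (R (cross3 (ax \<beta> ?m x) y))" by (simp only: tensor_fieldD(2)[OF S'(1)] F(3) S'c)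
   finally show ?thesis by simp
  qed
  have "\<nu> p0 = \<mu> p0"
  proof -
   have sc: "sin \<theta> * sin \<theta> + cos \<theta> * cos \<theta> = 1" using sin_cos_squared_add[of \<theta>] by (simp add: power2_eq_square)
   have "cross3 (ax \<beta> (\<nu> p0) (R x)) (R y) = R (cross3 (ax \<beta> ?m x) y)" for x y
    using Tc[of x y] \<nu>(2) by (simp add: twisted_def)
   moreover have "R (cross3 u v) = cross3 (R u) (R v)" for u v
    using sc by (simp add: R_def cross3_def vec_eq_iff forall_3) algebra
   ultimately have *: "cross3 (ax \<beta> (\<nu> p0) (R x)) (R y) = cross3 (R (ax \<beta> ?m x)) (R y)" for x y by simp
   have "\<nu> p0 \<bullet> R x = ?m \<bullet> x" for x
   proof -
    define y where "y = (vector [cos \<theta>, - sin \<theta>, 0] :: real^3)"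
    have "R y = axis 1 1" using sc by (simp add: R_def y_def vec_eq_iff forall_3 axis_def algebra_simps)
    thus ?thesis using arg_cong[OF *[of x y], of "%v. v $ 2"]
     by (simp add: cross3_def axis_def) (simp add: ax_def R_def)
   qed
   from this[of "vector [cos \<theta>, - sin \<theta>, 0]"] this[of "vector [sin \<theta>, cos \<theta>, 0]"] this[of "vector [0, 0, 1]"]
   have "\<nu> p0 $ 1 * (sin \<theta> * sin \<theta> + cos \<theta> * cos \<theta>) = - 2 * sin \<theta>"
    "\<nu> p0 $ 2 * (sin \<theta> * sin \<theta> + cos \<theta> * cos \<theta>) = 2 * cos \<theta>" "\<nu> p0 $ 3 = \<beta>"
    by (simp_all add: R_def inner_vec_def sum_3 algebra_simps)
   thus ?thesis using \<theta> circ sc by (simp add: vec_eq_iff forall_3)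
  qed
  moreover have "\<forall>p. (\<nu> p $ 1)\<^sup>2 + (\<nu> p $ 2)\<^sup>2 = 4 & \<nu> p $ 3 = \<beta>"
   using twist_equation_cases[OF conn \<nu>(1,3)]
  proof
   assume "\<exists>c. \<forall>p. \<nu> p = vector [0, 0, c]"
   hence "(\<nu> p0 $ 1)\<^sup>2 + (\<nu> p0 $ 2)\<^sup>2 = 0" by auto
   thus ?thesis using circ \<open>\<nu> p0 = \<mu> p0\<close> by simp
  qed
  ultimately have "\<mu> p = \<nu> p" for p
   using twist_equation_unique[OF conn \<mu>(1,3) \<nu>(1,3), of p0 p] circ by simp
  hence "tcomp S p = tcomp T p" for p using \<mu>(2) \<nu>(2) by (simp add: twisted_def fun_eq_iff)
  hence "carries_tensor A F S' S"
   using T(2) tensor_eq_of_tcomp[OF S T(1)] I.self.push_in_tangent_space[OF I.F_smooth]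
   unfolding carries_tensor_def by simp
  thus thesis using that[OF F(1,2) S'] by simp
 qed
qed

end

section \<open>Lie groups and one-parameter subgroups\<close>

locale Lie_group =
 fixes G :: "'p::{t2_space, second_countable_topology} monoid" (structure)
  and A :: "('p, 'e::euclidean_space) atlas"
 assumes lie_group: "lie_group G A"
begin

sublocale smooth_manifold A
 using lie_group unfolding lie_group_def by unfold_locales auto

sublocale self: two_manifolds A A ..

sublocale group G
 using lie_group unfolding lie_group_def by blast

lemma carrier_UNIV [simp]: "carrier G = UNIV"
 using lie_group unfolding lie_group_def by blast

lemmas mfd = smooth_manifold_axioms

lemma smooth_at_mult:
 assumes "smooth_manifold B" "smooth_at B A f p" "smooth_at B A h p"
 shows "smooth_at B A (%x. f x \<otimes> h x) p"
proof -
 interpret P: smooth_manifold "prod_atlas A A" by (rule smooth_manifold_prod[OF mfd mfd])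
 interpret PA: two_manifolds "prod_atlas A A" A ..
 have "smooth_map (prod_atlas A A) A (%(x, y). x \<otimes> y)"
  using lie_group unfolding lie_group_def by blast
 hence "smooth_at (prod_atlas A A) A (%(x, y). x \<otimes> y) (f p, h p)" unfolding PA.smooth_map_iff by blast
 from smooth_at_compose[OF assms(1) P.smooth_manifold_axioms mfd smooth_at_Pair[OF assms(1) mfd mfd assms(2,3)] this]
 show ?thesis by simp
qed

lemma smooth_map_mult:
 assumes B: "smooth_manifold B" and "smooth_map B A f" "smooth_map B A h"
 shows "smooth_map B A (%x. f x \<otimes> h x)"
proof -
 interpret B: smooth_manifold B by fact
 interpret BA: two_manifolds B A ..
 show ?thesis using assms smooth_at_mult[OF B] unfolding BA.smooth_map_iff by blast
qed

lemma smooth_map_const: "smooth_manifold B ==> smooth_map B A (%x. c)"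
proof -
 assume B: "smooth_manifold B"
 then interpret B: smooth_manifold B .
 interpret BA: two_manifolds B A ..
 show ?thesis using smooth_at_const[OF B mfd] unfolding BA.smooth_map_iff by blast
qed

lemma smooth_map_ident: "smooth_map A A (%x. x)"
 using smooth_at_id[OF mfd] unfolding self.smooth_map_iff by blast

lemma left_translation_smooth: "smooth_map A A (%x. a \<otimes> x)"
 by (intro smooth_map_mult mfd smooth_map_const smooth_map_ident)

lemma left_invariantD:
 assumes "X : \<L> G A"
 shows "X : \<XX> A" "push A (%x. a \<otimes> x) (X p) = X (a \<otimes> p)"
 using assms unfolding left_invariant_fields_def by auto

lemma left_invariant_apply:
 assumes "X : \<L> G A" "f : \<F> A"
 shows "X p (%x. f (a \<otimes> x)) = X (a \<otimes> p) f"
 using left_invariantD(2)[OF assms(1), of a p] self.push_apply[OF assms(2), of "%x. a \<otimes> x" "X p"] by simp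

lemma left_invariant_combination:
 assumes "!!i. i : I ==> X i : \<L> G A"
 shows "(%p f. SUM i:I. c i * X i p f) : \<L> G A"
 unfolding left_invariant_fields_def
proof (intro CollectI conjI allI)
 show "(%p f. SUM i:I. c i * X i p f) : \<XX> A"
  by (rule vector_field_combination) (use assms left_invariantD(1) smooth_functions_const in auto)
 show "push A (%x. a \<otimes> x) (%f. SUM i:I. c i * X i p f) = (%f. SUM i:I. c i * X i (a \<otimes> p) f)" for a p
  unfolding push_combination by (simp add: left_invariantD(2)[OF assms])
qed

lemma left_invariant_scale:
 "X : \<L> G A ==> (%p f. c * X p f) : \<L> G A"
 using left_invariant_combination[of "{()}" "%_. X" "%_. c"] by simp

text \<open>A homomorphism whose initial velocity is \<open>X \<one>\<close> is an integral curve of the left invariant field \<open>X\<close>.\<close>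

definition generates :: "'p vfield => (real => 'p) => bool" where
 "generates X \<gamma> \<longleftrightarrow> one_parameter_subgroup G A \<gamma> & has_velocity A \<gamma> (X \<one>) 0"

lemma one_parameter_add:
 assumes "one_parameter_subgroup G A \<gamma>"
 shows "\<gamma> (s + t) = \<gamma> s \<otimes> \<gamma> t" "\<gamma> 0 = \<one>" "\<gamma> (- t) = inv (\<gamma> t)"
proof -
 have h: "\<gamma> (s + t) = \<gamma> s \<otimes> \<gamma> t" for s t
  using assms unfolding one_parameter_subgroup_def hom_def real_group_def by auto
 thus "\<gamma> (s + t) = \<gamma> s \<otimes> \<gamma> t" by blast
 show z: "\<gamma> 0 = \<one>" using h[of 0 0] by (metis add_0 r_cancel_one' UNIV_I carrier_UNIV)
 show "\<gamma> (- t) = inv (\<gamma> t)" using h[of "- t" t] z by (metis add.left_inverse inv_equality UNIV_I carrier_UNIV)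
qed

lemma one_parameter_smooth: "one_parameter_subgroup G A \<gamma> ==> smooth_map flat_atlas A \<gamma>"
 by (simp add: one_parameter_subgroup_def real_atlas_flat)

lemma translated_velocity:
 assumes X: "X : \<L> G A" and c: "has_velocity A c (X (c t)) t"
 shows "has_velocity A (%s. a \<otimes> c s) (X (a \<otimes> c t)) t"
 unfolding has_velocity_def
proof
 fix f assume f: "f : \<F> A"
 have "(%x. f (a \<otimes> x)) : \<F> A"
  by (rule self.smooth_functions_comp[OF left_translation_smooth f])
 hence "((%s. f (a \<otimes> c s)) has_real_derivative X (c t) (%x. f (a \<otimes> x))) (at t)"
  by (rule c[unfolded has_velocity_def, rule_format])
 thus "((%s. f (a \<otimes> c s)) has_real_derivative X (a \<otimes> c t) f) (at t)"
  by (simp only: left_invariant_apply[OF X f])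
qed

lemma shifted_velocity:
 "has_velocity A (%s. c (a + s)) v t \<longleftrightarrow> has_velocity A c v (a + t)"
 unfolding has_velocity_def using DERIV_shift[of "%s. _ (c s)" _ t a] by (simp add: add.commute)

lemma generates_velocity:
 assumes X: "X : \<L> G A" and g: "generates X \<gamma>"
 shows "has_velocity A \<gamma> (X (\<gamma> t)) t"
proof -
 have o: "one_parameter_subgroup G A \<gamma>" and v: "has_velocity A \<gamma> (X \<one>) 0" using g unfolding generates_def by auto
 have "has_velocity A (%s. \<gamma> t \<otimes> \<gamma> s) (X (\<gamma> t \<otimes> \<gamma> 0)) 0"
  by (rule translated_velocity[OF X]) (simp add: one_parameter_add(2)[OF o] v)
 hence "has_velocity A (%s. \<gamma> (t + s)) (X (\<gamma> t)) 0"
  by (simp add: one_parameter_add[OF o])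
 thus ?thesis unfolding shifted_velocity by simp
qed

lemma integral_curves_eq:
 assumes X: "X : \<XX> A" and T: "open T" "connected T"
  and "!!t. t : T ==> has_velocity A c (X (c t)) t" "!!t. t : T ==> has_velocity A d (X (d t)) t"
  and "s : T" "c s = d s" "t : T"
 shows "c t = d t"
 by (rule integral_curve_unique[of "{()}" "%_. X" T "%_ _. 1"]) (use assms in auto)

lemma generates_unique:
 assumes X: "X : \<L> G A" and "generates X \<gamma>" "generates X \<delta>"
 shows "\<gamma> = \<delta>"
proof
 fix t
 have "\<gamma> 0 = \<delta> 0" using assms one_parameter_add(2) unfolding generates_def by metis
 thus "\<gamma> t = \<delta> t"
  by (rule integral_curves_eq[OF left_invariantD(1)[OF X] open_UNIV connected_UNIV
     generates_velocity[OF X assms(2)] generates_velocity[OF X assms(3)] UNIV_I _ UNIV_I])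
qed

lemma generates_rescale:
 assumes "generates X \<gamma>" shows "generates (%p f. c * X p f) (%t. \<gamma> (c * t))"
proof -
 have o: "one_parameter_subgroup G A \<gamma>" and v: "has_velocity A \<gamma> (X \<one>) 0" using assms unfolding generates_def by auto
 have "smooth_map flat_atlas A (%t. \<gamma> (c * t))"
 proof (rule smooth_map_compose[OF smooth_manifold_flat smooth_manifold_flat mfd _ one_parameter_smooth[OF o]])
  show "smooth_map flat_atlas flat_atlas (%t. c * t)" unfolding smooth_map_flat by (intro smooth_intros open_UNIV)
 qed
 hence "one_parameter_subgroup G A (%t. \<gamma> (c * t))"
  using one_parameter_add(1)[OF o] by (simp add: one_parameter_subgroup_def real_atlas_flat hom_def real_group_def distrib_left)
 moreover have "has_velocity A (%t. \<gamma> (c * t)) (%f. c * X \<one> f) 0"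
  unfolding has_velocity_def
 proof
  fix f assume "f : \<F> A"
  hence "((%s. f (\<gamma> s)) has_real_derivative X \<one> f) (at (c * 0))" using v unfolding has_velocity_def by simp
  from DERIV_chain2[OF this DERIV_cmult_Id] show "((%t. f (\<gamma> (c * t))) has_real_derivative c * X \<one> f) (at 0)"
   by (simp add: mult.commute)
 qed
 ultimately show ?thesis unfolding generates_def by blast
qed

text \<open>Existence: a local integral curve through \<open>\<one>\<close> is a local homomorphism by uniqueness; powers of its small values extend it to the
  whole real line.\<close>

lemma local_hom_extends:
 assumes e: "e > 0" and hom: "!!s t. \<bar>s\<bar> < e ==> \<bar>t\<bar> < e ==> \<bar>s + t\<bar> < e ==> \<delta> (s + t) = \<delta> s \<otimes> \<delta> t"
 obtains \<gamma> where "!!s t :: real. \<gamma> (s + t) = \<gamma> s \<otimes> \<gamma> t" "!!t. \<bar>t\<bar> < e ==> \<gamma> t = \<delta> t"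
proof -
 have \<delta>0: "\<delta> 0 = \<one>" using hom[of 0 0] e by (metis abs_zero add_0 r_cancel_one' UNIV_I carrier_UNIV)
 have pow: "\<delta> (of_nat k * r) = \<delta> r [^] k" if "\<bar>of_nat k * r\<bar> < e" for k :: nat and r
  using that
 proof (induction k)
  case (Suc k)
  have le: "\<bar>of_nat k * r\<bar> <= \<bar>of_nat (Suc k) * r\<bar>" "\<bar>r\<bar> <= \<bar>of_nat (Suc k) * r\<bar>"
   by (auto simp: abs_mult intro!: mult_right_mono) (simp add: distrib_right)
  hence "\<delta> (of_nat k * r + r) = \<delta> (of_nat k * r) \<otimes> \<delta> r"
   using Suc.prems by (intro hom) (auto simp: algebra_simps)
  thus ?case using Suc le by (simp add: algebra_simps)
 qed (simp add: \<delta>0)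
 define N where "N = (%t. SOME n. (0::nat) < n & \<bar>t\<bar> < n * e)"
 have Nex: "\<exists>n. (0::nat) < n & \<bar>t\<bar> < n * e" for t
 proof -
  obtain n :: nat where "\<bar>t\<bar> / e < n" using reals_Archimedean2 by blast
  hence "\<bar>t\<bar> < n * e" "n > 0" using e by (auto simp: field_simps intro: gr0I)
  thus ?thesis by (intro exI[of _ n]) simp
 qed
 have N: "(0::nat) < N t & \<bar>t\<bar> < N t * e" for t unfolding N_def by (rule someI_ex[OF Nex])
 define \<gamma> where "\<gamma> = (%t. \<delta> (t / N t) [^] N t)"
 have \<gamma>: "\<gamma> t = \<delta> (t / n) [^] n" if n: "n > 0" "\<bar>t\<bar> < n * e" for t and n :: nat
 proof -
  have aux: "\<delta> (t / m) [^] m = \<delta> (t / (m * k)) [^] (m * k)" if "m > 0" "k > 0" "\<bar>t\<bar> < m * e" for m k :: nat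
  proof -
   have "\<bar>of_nat k * (t / (of_nat m * of_nat k))\<bar> < e" using that by (simp add: field_simps)
   hence "\<delta> (of_nat k * (t / (of_nat m * of_nat k))) = \<delta> (t / (of_nat m * of_nat k)) [^] k" by (rule pow)
   moreover have "of_nat k * (t / (of_nat m * of_nat k)) = t / m" using that by simp
   ultimately show ?thesis by (simp add: nat_pow_pow mult.commute)
  qed
  show ?thesis unfolding \<gamma>_def using aux[of "N t" n] aux[of n "N t"] n N[of t] by (simp add: mult.commute)
 qed
 have "\<gamma> (s + t) = \<gamma> s \<otimes> \<gamma> t" for s t
 proof -
  obtain n :: nat where n: "n > 0" "\<bar>\<bar>s\<bar> + \<bar>t\<bar>\<bar> < n * e" using Nex by blast
  have b: "\<bar>s\<bar> < n * e" "\<bar>t\<bar> < n * e" "\<bar>s + t\<bar> < n * e" using n by auto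
  hence b': "\<bar>s / n\<bar> < e" "\<bar>t / n\<bar> < e" "\<bar>s / n + t / n\<bar> < e"
   using n(1) by (simp_all add: field_simps add_divide_distrib[symmetric])
  have st: "\<delta> (s / n + t / n) = \<delta> (s / n) \<otimes> \<delta> (t / n)" by (rule hom[OF b'])
  have ts: "\<delta> (s / n + t / n) = \<delta> (t / n) \<otimes> \<delta> (s / n)" using hom[OF b'(2,1)] b'(3) by (simp add: add.commute)
  have "\<gamma> (s + t) = (\<delta> (s / n) \<otimes> \<delta> (t / n)) [^] n"
   using \<gamma>[OF n(1) b(3)] st by (simp add: add_divide_distrib)
  also have "\<dots> = \<delta> (s / n) [^] n \<otimes> \<delta> (t / n) [^] n"
   using st ts by (intro pow_mult_distrib) auto
  finally show ?thesis using \<gamma>[OF n(1) b(1)] \<gamma>[OF n(1) b(2)] by simp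
 qed
 moreover have "\<gamma> t = \<delta> t" if "\<bar>t\<bar> < e" for t using \<gamma>[of 1 t] that by simp
 ultimately show thesis using that by blast
qed

lemma exists_generated:
 assumes X: "X : \<L> G A"
 obtains \<gamma> where "generates X \<gamma>"
proof -
 obtain U \<phi> where U: "(U, \<phi>) : A" "\<one> : U" by (rule chart_at)
 obtain V where V: "smooth_on (\<phi> ` U) V" "!!p. p : U ==> X p = chart_tangent U \<phi> p (V (\<phi> p))"
  by (rule vector_field_chart_rep[OF left_invariantD(1)[OF X] U(1)]) blast
 obtain c e where c: "e > 0" "c 0 = \<phi> \<one>" "!!t. t : {-e<..<e} ==> c t : \<phi> ` U"
  "!!t. t : {-e<..<e} ==> (c has_vector_derivative V (c t)) (at t)"
  by (rule Picard_Lindelof[OF chart(2)[OF U(1)] imageI[OF U(2)] V(1)]) blast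
 define \<delta> where "\<delta> = (%t. inv_into U \<phi> (c t))"
 have inU: "\<delta> t : U" "\<phi> (\<delta> t) = c t" if "\<bar>t\<bar> < e" for t
  using c(3)[of t] that by (auto simp: \<delta>_def inv_into_into f_inv_into_f abs_less_iff)
 have \<delta>v: "has_velocity A \<delta> (X (\<delta> t)) t" if "\<bar>t\<bar> < e" for t
 proof -
  have t: "t : {-e<..<e}" using that by auto
  show ?thesis using chart_curve_has_velocity[OF U(1) c(4)[OF t] c(3)[OF t]] V(2)[OF inU(1)[OF that]] inU(2)[OF that]
   by (simp add: \<delta>_def)
 qed
 have \<delta>0: "\<delta> 0 = \<one>" using c(2) U by (simp add: \<delta>_def)
 have \<delta>s: "smooth_at flat_atlas A \<delta> t" if "\<bar>t\<bar> < e" for t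
 proof (rule smooth_atI[of UNIV id flat_atlas U \<phi> A "{-e<..<e}"])
  have "smooth_on {-e<..<e} c" by (rule smooth_on_integral_curve[OF V(1) _ c(3,4)]) auto
  hence "smooth_on {-e<..<e} (%y. \<phi> (\<delta> (inv_into UNIV id y)))"
   by (rule smooth_on_cong) (auto simp: inU abs_less_iff)
  thus "smooth_on (id ` {-e<..<e}) (%y. \<phi> (\<delta> (inv_into UNIV id y)))" by (simp only: image_id id_apply)
 qed (use U that inU in "auto simp: abs_less_iff")
 have "\<delta> (s + t) = \<delta> s \<otimes> \<delta> t" if st: "\<bar>s\<bar> < e" "\<bar>t\<bar> < e" "\<bar>s + t\<bar> < e" for s t
 proof -
  have T: "open ({-e<..<e} \<inter> {-e-s<..<e-s})" "connected ({-e<..<e} \<inter> {-e-s<..<e-s})"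
   by (auto intro!: convex_connected convex_Int)
  have "(%t. \<delta> (s + t)) t = (%t. \<delta> s \<otimes> \<delta> t) t"
  proof (rule integral_curves_eq[OF left_invariantD(1)[OF X] T, of "%t. \<delta> (s + t)" "%t. \<delta> s \<otimes> \<delta> t" 0])
   fix t assume t: "t : {-e<..<e} \<inter> {-e-s<..<e-s}"
   show "has_velocity A (%t. \<delta> (s + t)) (X (\<delta> (s + t))) t"
    unfolding shifted_velocity using t by (intro \<delta>v) auto
   show "has_velocity A (%t. \<delta> s \<otimes> \<delta> t) (X (\<delta> s \<otimes> \<delta> t)) t"
    by (rule translated_velocity[OF X]) (use t \<delta>v in auto)
  qed (use st \<delta>0 c(1) in auto)
  thus ?thesis by simp
 qed
 then obtain \<gamma> where \<gamma>: "!!s t. \<gamma> (s + t) = \<gamma> s \<otimes> \<gamma> t" "!!t. \<bar>t\<bar> < e ==> \<gamma> t = \<delta> t"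
  by (rule local_hom_extends[OF c(1), of \<delta>]) blast+
 interpret R: smooth_manifold "flat_atlas :: (real, real) atlas" by (rule smooth_manifold_flat)
 interpret RA: two_manifolds "flat_atlas :: (real, real) atlas" A ..
 have "smooth_at flat_atlas A \<gamma> t0" for t0
 proof -
  have "smooth_at flat_atlas flat_atlas (%t. t - t0) t0"
   unfolding smooth_at_flat by (intro exI[of _ UNIV]) (auto intro!: smooth_intros)
  hence "smooth_at flat_atlas A (%t. \<delta> (t - t0)) t0"
   using smooth_at_compose[OF smooth_manifold_flat smooth_manifold_flat mfd, of "%t. t - t0" t0 \<delta>] \<delta>s[of "t0 - t0"] c(1) by simp
  hence "smooth_at flat_atlas A (%t. \<gamma> t0 \<otimes> \<delta> (t - t0)) t0"
   by (intro smooth_at_mult smooth_manifold_flat smooth_at_const mfd)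
  thus ?thesis
  proof (rule RA.smooth_at_local[of _ _ "ball t0 e"])
   show "\<gamma> t0 \<otimes> \<delta> (t - t0) = \<gamma> t" if "t : ball t0 e" for t
    using \<gamma>(1)[of t0 "t - t0"] \<gamma>(2)[of "t - t0"] that by (simp add: dist_real_def abs_minus_commute)
  qed (use c(1) in auto)
 qed
 hence "one_parameter_subgroup G A \<gamma>"
  using \<gamma>(1) by (simp add: one_parameter_subgroup_def real_atlas_flat RA.smooth_map_iff hom_def real_group_def)
 moreover have "has_velocity A \<gamma> (X \<one>) 0"
  unfolding has_velocity_def
 proof
  fix f assume "f : \<F> A"
  hence "((%s. f (\<delta> s)) has_real_derivative X \<one> f) (at 0)"
   using \<delta>v[of 0] c(1) \<delta>0 unfolding has_velocity_def by simp
  thus "((%s. f (\<gamma> s)) has_real_derivative X \<one> f) (at 0)"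
   by (rule has_field_derivative_transform_within_open[of _ _ _ "{-e<..<e}"]) (use c(1) \<gamma>(2) in auto)
 qed
 ultimately show thesis using that unfolding generates_def by blast
qed

text \<open>If \<open>[X, Y]\<close> is a multiple of \<open>Y\<close>, conjugation by the subgroup of \<open>X\<close> rescales the subgroup of \<open>Y\<close>. The initial velocity \<open>W v\<close> of the
  conjugated subgroup satisfies \<open>W' = l W\<close>: at \<open>v = 0\<close> the mixed second derivatives of \<open>f (\<gamma> v \<eta> s \<gamma> (- v))\<close> give the bracket.\<close>

lemma conjugate_generated:
 assumes X: "X : \<L> G A" and Y: "Y : \<L> G A"
  and \<gamma>: "generates X \<gamma>" and \<eta>: "generates Y \<eta>"
  and br: "!!f. f : \<F> A ==> X \<one> (%q. Y q f) - Y \<one> (%q. X q f) = l * Y \<one> f"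
 shows "\<gamma> v \<otimes> \<eta> s \<otimes> \<gamma> (- v) = \<eta> (exp (l * v) * s)"
proof -
 have og: "one_parameter_subgroup G A \<gamma>" and oe: "one_parameter_subgroup G A \<eta>" using \<gamma> \<eta> unfolding generates_def by auto
 note ga = one_parameter_add[OF og] and ea = one_parameter_add[OF oe]
 note vg = generates_velocity[OF X \<gamma>, unfolded has_velocity_def, rule_format]
  and ve = generates_velocity[OF Y \<eta>, unfolded has_velocity_def, rule_format]
 interpret R3: smooth_manifold "flat_atlas :: ((real \<times> real) \<times> real, (real \<times> real) \<times> real) atlas" by (rule smooth_manifold_flat)
 interpret RA: two_manifolds "flat_atlas :: ((real \<times> real) \<times> real, (real \<times> real) \<times> real) atlas" A ..
 note line = smooth_on_has_real_derivative_line[OF _ UNIV_I]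
 define W where "W = (%v f. Y \<one> (%x. f (\<gamma> v \<otimes> x \<otimes> \<gamma> (- v))))"
 have conj_smooth: "(%x. f (\<gamma> v \<otimes> x \<otimes> \<gamma> (- v))) : \<F> A" if "f : \<F> A" for f v
  by (rule self.smooth_functions_comp[OF _ that]) (intro smooth_map_mult mfd smooth_map_const smooth_map_ident)
 have Wd: "((%s. f (\<gamma> v \<otimes> \<eta> s \<otimes> \<gamma> (- v))) has_real_derivative W v f) (at 0)" if f: "f : \<F> A" for f v
  using ve[OF conj_smooth[OF f, of v], of 0] by (simp add: W_def ea)
 have W0: "((%v. W v f) has_real_derivative l * Y \<one> f) (at 0)" if f: "f : \<F> A" for f
 proof -
  define H where "H = (%z :: (real \<times> real) \<times> real. f (\<gamma> (fst (fst z)) \<otimes> \<eta> (snd z) \<otimes> \<gamma> (snd (fst z))))"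
  define W2 where "W2 = (%z. Df H z ((0, 0), 1))"
  have sm1: "smooth_map flat_atlas A (%z :: (real \<times> real) \<times> real. \<kappa> (h z))"
   if "one_parameter_subgroup G A \<kappa>" "smooth_on UNIV h" for \<kappa> h
   by (rule smooth_map_compose[OF smooth_manifold_flat smooth_manifold_flat mfd _ one_parameter_smooth[OF that(1)]])
    (simp add: smooth_map_flat that(2))
  have "H : \<F> flat_atlas"
   unfolding H_def by (intro RA.smooth_functions_comp[OF _ f] smooth_map_mult smooth_manifold_flat sm1[OF og] sm1[OF oe])
    (auto intro!: smooth_intros)
  hence H: "smooth_on UNIV H" by (simp add: smooth_functions_flat)
  have Hd: "H ((a, b), c) = f (\<gamma> a \<otimes> \<eta> c \<otimes> \<gamma> b)" for a b c by (simp add: H_def)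
  have W2: "smooth_on UNIV W2" unfolding W2_def by (rule smooth_on_frechet_derivative[OF H])
  have Yf: "(%q. Y q f) : \<F> A" and Xf: "(%q. X q f) : \<F> A"
   using vector_fieldD(2)[OF left_invariantD(1)[OF Y] f] vector_fieldD(2)[OF left_invariantD(1)[OF X] f] by auto
  have "W v f = W2 ((v, - v), 0)" for v
   by (rule DERIV_unique[OF Wd[OF f]]) (use line[OF H, of "((v, - v), 0)" "((0, 0), 1)" 0] in "simp add: Hd W2_def")
  hence D: "((%v. W v f) has_real_derivative Df W2 ((0, 0), 0) ((1, - 1), 0)) (at 0)"
   using line[OF W2, of "((0, 0), 0)" "((1, - 1), 0)" 0] by simp
  have "linear (Df W2 ((0, 0), 0))"
   by (rule has_derivative_linear[OF smooth_on_has_derivative[OF W2 UNIV_I]])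
  from linear_diff[OF this, of "((1, 0), 0)" "((0, 1), 0)"]
  have L: "Df W2 ((0, 0), 0) ((1, - 1), 0) =
    Df W2 ((0, 0), 0) ((1, 0), 0) - Df W2 ((0, 0), 0) ((0, 1), 0)" by simp
  have Yd: "((%h. f (\<gamma> a \<otimes> \<eta> h)) has_real_derivative Y (\<gamma> a) f) (at 0)" for a
   using translated_velocity[OF Y generates_velocity[OF Y \<eta>, of 0], of "\<gamma> a"] f unfolding has_velocity_def by (simp add: ea)
  have "W2 ((a, 0), 0) = Y (\<gamma> a) f" for a
   by (rule DERIV_unique[OF _ Yd]) (use line[OF H, of "((a, 0), 0)" "((0, 0), 1)" 0] in "simp add: Hd W2_def ga(2)")
  hence XY: "Df W2 ((0, 0), 0) ((1, 0), 0) = X \<one> (%q. Y q f)"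
   using DERIV_unique[OF line[OF W2, of "((0, 0), 0)" "((1, 0), 0)" 0, simplified]] vg[OF Yf, of 0] by (simp add: ga(2))
  let ?V = "%z. Df H z ((0, 1), 0)"
  have V: "smooth_on UNIV ?V" by (rule smooth_on_frechet_derivative[OF H])
  have Xd: "((%h. f (\<eta> s \<otimes> \<gamma> h)) has_real_derivative X (\<eta> s) f) (at 0)" for s
   using translated_velocity[OF X generates_velocity[OF X \<gamma>, of 0], of "\<eta> s"] f unfolding has_velocity_def by (simp add: ga)
  have "?V ((0, 0), s) = X (\<eta> s) f" for s
   by (rule DERIV_unique[OF _ Xd]) (use line[OF H, of "((0, 0), s)" "((0, 1), 0)" 0] in "simp add: Hd ga(2)")
  hence "Df ?V ((0, 0), 0) ((0, 0), 1) = Y \<one> (%q. X q f)"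
   using DERIV_unique[OF line[OF V, of "((0, 0), 0)" "((0, 0), 1)" 0, simplified]]
    ve[OF Xf, of 0] by (simp add: ea(2))
  hence "Df W2 ((0, 0), 0) ((0, 1), 0) = Y \<one> (%q. X q f)"
   unfolding W2_def using smooth_on_second_derivative_symmetric[OF open_UNIV UNIV_I H] by metis
  with D show ?thesis unfolding L XY by (simp add: br[OF f])
 qed
 have Wv: "((%v. W v f) has_real_derivative l * W v f) (at v)" if f: "f : \<F> A" for f v
 proof -
  have minus_add: "- (v + h) = - h + - v" for h by simp
  have "W (v + h) f = W h (%x. f (\<gamma> v \<otimes> x \<otimes> \<gamma> (- v)))" for h
  proof -
   have "\<gamma> (v + h) \<otimes> x \<otimes> \<gamma> (- (v + h)) = \<gamma> v \<otimes> (\<gamma> h \<otimes> x \<otimes> \<gamma> (- h)) \<otimes> \<gamma> (- v)" for x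
    unfolding minus_add ga(1) by (simp add: m_assoc)
   thus ?thesis by (simp add: W_def)
  qed
  hence "((%h. W (v + h) f) has_real_derivative l * W v f) (at 0)"
   using W0[OF conj_smooth[OF f], of v] by (simp add: W_def)
  thus ?thesis using DERIV_shift[of "%v. W v f" _ 0 v] by (simp add: add.commute)
 qed
 have Wexp: "W v f = exp (l * v) * Y \<one> f" if f: "f : \<F> A" for f v
 proof -
  have "((%v. W v f * exp (- (l * v))) has_real_derivative 0) (at v)" for v
   using Wv[OF f, of v] by (auto intro!: derivative_eq_intros)
  hence "W v f * exp (- (l * v)) = W 0 f * exp (- (l * 0))" by (rule DERIV_isconst_all[rule_format])
  moreover have "W 0 f = Y \<one> f" by (simp add: W_def ga)
  ultimately show ?thesis by (simp add: exp_minus field_simps)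
 qed
 let ?Z = "%p f. exp (l * v) * Y p f"
 have Z: "?Z : \<L> G A" by (rule left_invariant_scale[OF Y])
 have "generates ?Z (%s. \<gamma> v \<otimes> \<eta> s \<otimes> \<gamma> (- v))"
  unfolding generates_def
 proof
  have "\<gamma> v \<otimes> \<eta> (s + t) \<otimes> \<gamma> (- v) = (\<gamma> v \<otimes> \<eta> s \<otimes> \<gamma> (- v)) \<otimes> (\<gamma> v \<otimes> \<eta> t \<otimes> \<gamma> (- v))" for s t
  proof -
   have "\<gamma> (- v) \<otimes> (\<gamma> v \<otimes> x) = x" for x using ga(1)[of "- v" v] ga(2) by (simp add: m_assoc[symmetric])
   thus ?thesis by (simp add: ea(1) m_assoc)
  qed
  moreover have "smooth_map flat_atlas A (%s. \<gamma> v \<otimes> \<eta> s \<otimes> \<gamma> (- v))"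
   by (intro smooth_map_mult smooth_manifold_flat smooth_map_const one_parameter_smooth oe)
  ultimately show "one_parameter_subgroup G A (%s. \<gamma> v \<otimes> \<eta> s \<otimes> \<gamma> (- v))"
   by (simp add: one_parameter_subgroup_def real_atlas_flat hom_def real_group_def)
  show "has_velocity A (%s. \<gamma> v \<otimes> \<eta> s \<otimes> \<gamma> (- v)) (?Z \<one>) 0"
   unfolding has_velocity_def using Wd Wexp by simp
 qed
 from generates_unique[OF Z this generates_rescale[OF \<eta>]] show ?thesis by metis
qed

end

section \<open>The half-plane model and the universal covering group of \<open>SL\<^sub>2\<close>\<close>

definition rot :: "real => real^3 => real^3" where
 "rot \<theta> x = vector [cos \<theta> * x $ 1 - sin \<theta> * x $ 2, sin \<theta> * x $ 1 + cos \<theta> * x $ 2, x $ 3]"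

lemma rot_rot: "rot a (rot b x) = rot (a + b) x"
 by (simp add: rot_def vec_eq_iff forall_3 cos_add sin_add algebra_simps)

lemma rot_0 [simp]: "rot 0 x = x"
 by (simp add: rot_def vec_eq_iff forall_3)

lemma rot_linear: "rot \<theta> (x + y) = rot \<theta> x + rot \<theta> y" "rot \<theta> (c *\<^sub>R x) = c *\<^sub>R rot \<theta> x"
 by (simp_all add: rot_def vec_eq_iff forall_3 algebra_simps)

lemma rot_complex: "Complex (rot \<theta> x $ 1) (rot \<theta> x $ 2) = cis \<theta> * Complex (x $ 1) (x $ 2)"
 by (simp add: rot_def complex_eq_iff)

lemma has_derivative_vec:
 fixes f :: "'e::real_normed_vector => real^'n"
 assumes "!!i. ((%x. f x $ i) has_derivative (%h. D h $ i)) (at x)"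
 shows "(f has_derivative D) (at x)"
 using assms by (subst has_derivative_componentwise_within) (auto simp: Basis_vec_def inner_axis)

subsection \<open>Vector fields on \<open>\<real>\<^sup>3\<close>\<close>

definition fld :: "('e::euclidean_space => 'e) => 'e vfield" where
 "fld V = (%m f. if f : \<F> flat_atlas then Df f m (V m) else 0)"

interpretation flat: smooth_manifold "flat_atlas :: ('e::euclidean_space, 'e) atlas"
 by (rule smooth_manifold_flat)

interpretation flat: two_manifolds "flat_atlas :: ('e::euclidean_space, 'e) atlas" "flat_atlas :: ('f::euclidean_space, 'f) atlas" ..

lemma fld_chart_tangent: "fld V m = flat.chart_tangent UNIV id m (V m)"
 by (rule ext) (simp add: fld_def flat.chart_tangent_def)

lemma fld_apply: "smooth_on UNIV f ==> fld V m f = Df f m (V m)"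
 by (simp add: fld_def smooth_functions_flat)

lemma fld_inject: "fld V m = fld W n ==> m = n ==> V m = W n"
 using flat.chart_tangent_inject[of UNIV id m "V m" "W n"] by (simp add: fld_chart_tangent)

lemma fld_cases:
 assumes "v : \<T> flat_atlas m" obtains a where "v = fld (%_. a) m"
proof (rule flat.tangent_is_chart_tangent[OF _ _ assms, of UNIV id])
qed (use that in "auto simp: fld_chart_tangent")

lemma smooth_fld_apply:
 assumes f: "smooth_on UNIV f" and V: "smooth_on UNIV V"
 shows "smooth_on UNIV (%m. Df f m (V m) :: real)"
proof -
 have "Df f m (V m) = (SUM b:Basis. (V m \<bullet> b) * Df f m b)" for m
 proof -
  have lin: "linear (Df f m)" using has_derivative_linear[OF smooth_on_has_derivative[OF f UNIV_I]] .
  show ?thesis using linear_sum[OF lin, of "%b. (V m \<bullet> b) *\<^sub>R b" Basis] by (simp add: euclidean_representation linear_cmul[OF lin])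
 qed
 thus ?thesis using f V by (simp only:) (intro smooth_intros open_UNIV smooth_on_frechet_derivative)
qed

lemma fld_vector_field: "smooth_on UNIV V ==> fld V : \<XX> flat_atlas"
 unfolding vector_fields_def
proof (intro CollectI conjI allI ballI)
 show "fld V m : \<T> flat_atlas m" for m
  unfolding fld_chart_tangent by (rule flat.chart_tangent_in_tangent_space) auto
 show "(%p. fld V p f) : \<F> flat_atlas" if "smooth_on UNIV V" "f : \<F> flat_atlas" for f
  using that smooth_fld_apply[of f V] by (simp add: fld_def smooth_functions_flat)
qed

lemma push_fld:
 assumes B: "smooth_manifold B" and H: "smooth_map flat_atlas B H"
  and D: "!!f. f : \<F> B ==> Df (%x. f (H x)) m (V m) = v f"
  and v: "!!f. f \<notin> \<F> B ==> v f = 0"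
 shows "push B H (fld V m) = v"
proof -
 interpret smooth_manifold B by (rule B)
 interpret FB: two_manifolds flat_atlas B ..
 show ?thesis
 proof
  fix f show "push B H (fld V m) f = v f"
  proof (cases "f : \<F> B")
   case True
   hence "smooth_on UNIV (%x. f (H x))" using FB.smooth_functions_comp[OF H] by (simp add: smooth_functions_flat)
   thus ?thesis using True D by (simp add: FB.push_apply fld_apply)
  qed (simp add: push_def v)
 qed
qed

lemma frechet_derivative_compose:
 assumes "(H has_derivative D) (at m)" "smooth_on UNIV f"
 shows "Df (%x. f (H x)) m h = Df f (H m) (D h)"
 using has_derivative_compose[OF assms(1) smooth_on_has_derivative[OF assms(2) UNIV_I]]
 by (metis frechet_derivative_at)

lemma push_fld_flat:
 assumes "smooth_on UNIV H" "(H has_derivative D) (at m)"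
 shows "push flat_atlas H (fld V m) = fld (%_. D (V m)) (H m)"
 by (rule push_fld[OF smooth_manifold_flat])
  (use assms in "auto simp: smooth_map_flat fld_def smooth_functions_flat frechet_derivative_compose[OF assms(2)]")

lemma vbracket_fld:
 assumes V: "smooth_on UNIV V" and W: "smooth_on UNIV W"
  and DV: "(V has_derivative DV) (at m)" and DW: "(W has_derivative DW) (at m)"
 shows "vbracket flat_atlas (fld V) (fld W) m = fld (%_. DW (V m) - DV (W m)) m"
proof
 fix f :: "'a => real"
 have 1: "fld V m (%q. fld W q f) = Df (%q. Df f q (W m)) m (V m)
   + Df f m (DW (V m))"
  if f: "smooth_on UNIV f" and V: "smooth_on UNIV V" and W: "smooth_on UNIV W" and DW: "(W has_derivative DW) (at m)"
  for V W DW
 proof -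
  have lin: "linear (Df f m)" for m using has_derivative_linear[OF smooth_on_has_derivative[OF f UNIV_I]] .
  have rep: "Df f q w = (SUM b:Basis. (w \<bullet> b) * Df f q b)" for q w
   using linear_sum[OF lin[of q], of "%b. (w \<bullet> b) *\<^sub>R b" Basis] by (simp add: euclidean_representation linear_cmul[OF lin])
  have fb: "((%q. Df f q b) has_derivative Df (%q. Df f q b) m) (at m)" for b
   by (rule smooth_on_has_derivative[OF smooth_on_frechet_derivative[OF f] UNIV_I])
  have "((%q. Df f q w) has_derivative
    (%h. SUM b:Basis. (w \<bullet> b) * Df (%q. Df f q b) m h)) (at m)" for w
   unfolding rep[of _ w] by (intro has_derivative_sum has_derivative_mult_right fb)
  hence 2: "Df (%q. Df f q w) m h =
    (SUM b:Basis. (w \<bullet> b) * Df (%q. Df f q b) m h)" for w h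
   by (rule fun_cong[OF frechet_derivative_at[symmetric]])
  have "((%q. Df f q (W q)) has_derivative (%h. SUM b:Basis. (W m \<bullet> b) *
    Df (%q. Df f q b) m h + (DW h \<bullet> b) * Df f m b)) (at m)"
   unfolding rep[of _ "W _"] by (intro has_derivative_sum has_derivative_mult fb has_derivative_inner_left DW)
  from fun_cong[OF frechet_derivative_at[OF this, symmetric]]
  have "Df (%q. Df f q (W q)) m h =
    Df (%q. Df f q (W m)) m h + Df f m (DW h)" for h
   by (simp only: 2[of "W m"] rep[of m "DW h"] sum.distrib)
  thus ?thesis by (simp only: fld_apply[OF smooth_fld_apply[OF f W]] fld_apply[OF f])
 qed
 show "vbracket flat_atlas (fld V) (fld W) m f = fld (%_. DW (V m) - DV (W m)) m f"
 proof (cases "smooth_on UNIV f")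
  case True
  have lin: "linear (Df f m)" using has_derivative_linear[OF smooth_on_has_derivative[OF True UNIV_I]] .
  have "vbracket flat_atlas (fld V) (fld W) m f = fld V m (%q. fld W q f) - fld W m (%q. fld V q f)"
   by (simp add: vbracket_def smooth_functions_flat True)
  thus ?thesis
   unfolding 1[OF True V W DW] 1[OF True W V DV]
   using smooth_on_second_derivative_symmetric[OF open_UNIV UNIV_I True, of "W m" m "V m"]
   by (simp add: fld_apply[OF True] linear_diff[OF lin])
 qed (simp add: vbracket_def fld_def smooth_functions_flat)
qed

subsection \<open>Maps preserving a coframe up to a rotation\<close>

text \<open>The coframe \<open>cof\<close> is dual to the orthonormal frame of \<open>G(1, \<beta>)\<close> in the coordinates \<open>\<gamma>\<^sub>2(x) \<gamma>\<^sub>1(v) \<gamma>\<^sub>3(t)\<close>, where \<open>mmult\<close> is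
  the group law. Every isometry considered here rotates \<open>\<theta>\<^sup>1, \<theta>\<^sup>2\<close> by an angle
  that varies from point to point exactly as \<open>- 2 t / \<beta>\<close> does, so that it
  rotates the coframe \<open>phi\<close> by a constant angle. Maps with this property are determined by the angle and
  one value; this replaces all explicit verifications of composition laws below.\<close>

definition mmult :: "real^3 => real^3 => real^3" where
 "mmult a b = vector [a $ 1 + exp (a $ 2) * b $ 1, a $ 2 + b $ 2, a $ 3 + b $ 3]"

definition minv :: "real^3 => real^3" where
 "minv a = vector [- exp (- a $ 2) * a $ 1, - a $ 2, - a $ 3]"

lemma mmult_0 [simp]: "mmult a 0 = a" "mmult 0 a = a"
 by (simp_all add: mmult_def vec_eq_iff forall_3)

lemma mmult_assoc: "mmult (mmult a b) c = mmult a (mmult b c)"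
 by (simp add: mmult_def vec_eq_iff forall_3 exp_add algebra_simps)

lemma mmult_minv [simp]: "mmult a (minv a) = 0" "mmult (minv a) a = 0"
 by (simp_all add: mmult_def minv_def vec_eq_iff forall_3 exp_minus field_simps)

lemma smooth_mmult [smooth_intros]:
 assumes "open U" "smooth_on U f" "smooth_on U h"
 shows "smooth_on U (%x. mmult (f x) (h x))"
 by (rule smooth_on_vec_lambda[OF assms(1)], rule forall_3[THEN iffD2, rule_format])
  (auto simp: mmult_def intro!: smooth_intros assms)

lemma smooth_minv [smooth_intros]:
 assumes "open U" "smooth_on U f"
 shows "smooth_on U (%x. minv (f x))"
 by (rule smooth_on_vec_lambda[OF assms(1)], rule forall_3[THEN iffD2, rule_format])
  (auto simp: minv_def intro!: smooth_intros assms)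

definition cof :: "real => real^3 => real^3 => real^3" where
 "cof \<beta> m h = vector [h $ 2 / 2, exp (- m $ 2) * h $ 1 / 2, h $ 3 + \<beta> * exp (- m $ 2) * h $ 1 / 2]"

lemma cof_inject: "cof \<beta> m h = cof \<beta> m k ==> h = k"
 by (auto simp add: cof_def vec_eq_iff forall_3)

locale half_plane_model =
 fixes \<beta> :: real
 assumes beta: "\<beta> > 0"
begin

definition phi :: "real^3 => real^3 => real^3" where
 "phi m h = rot (2 * m $ 3 / \<beta>) (cof \<beta> m h)"

definition ifr :: "real^3 => real^3 => real^3" where
 "ifr m u = (let q = rot (- 2 * m $ 3 / \<beta>) u in vector [2 * exp (m $ 2) * q $ 2, 2 * q $ 1, q $ 3 - \<beta> * q $ 2])"

lemma cof_ifr: "cof \<beta> m (ifr m u) = rot (- 2 * m $ 3 / \<beta>) u"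
 by (simp add: cof_def ifr_def Let_def vec_eq_iff forall_3 exp_minus)

lemma phi_ifr [simp]: "phi m (ifr m u) = u"
 by (simp add: phi_def cof_ifr rot_rot)

lemma ifr_phi [simp]: "ifr m (phi m h) = h"
proof (rule cof_inject[of \<beta> m])
 show "cof \<beta> m (ifr m (phi m h)) = cof \<beta> m h" by (simp add: cof_ifr phi_def rot_rot)
qed

lemma ifr_linear: "ifr m (u + v) = ifr m u + ifr m v" "ifr m (c *\<^sub>R u) = c *\<^sub>R ifr m u"
 by (simp_all add: ifr_def Let_def rot_linear vec_eq_iff forall_3 algebra_simps)

lemma smooth_ifr: "smooth_on UNIV (%m. ifr m u)"
 by (rule smooth_on_vec_lambda[OF open_UNIV], rule forall_3[THEN iffD2, rule_format])
  (auto simp: ifr_def rot_def Let_def beta[THEN less_imp_neq, symmetric] intro!: smooth_intros)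

lemma smooth_phi:
 assumes "smooth_on UNIV f" shows "smooth_on UNIV (%x. phi (f x) h)"
 by (rule smooth_on_vec_lambda[OF open_UNIV], rule forall_3[THEN iffD2, rule_format])
  (auto simp: phi_def rot_def cof_def beta[THEN less_imp_neq, symmetric] intro!: smooth_intros assms)

definition turns :: "real => (real^3 => real^3) => bool" where
 "turns \<theta> H \<longleftrightarrow> smooth_on UNIV H & (\<forall>m h. phi (H m) (Df H m h) = rot \<theta> (phi m h))"

lemma turnsI:
 assumes "smooth_on UNIV H" "!!m. (H has_derivative D m) (at m)" "!!m h. phi (H m) (D m h) = rot \<theta> (phi m h)"
 shows "turns \<theta> H"
 unfolding turns_def using assms frechet_derivative_at[OF assms(2)] by metis

lemma turns_compose:
 assumes "turns a H" "turns b K" shows "turns (a + b) (%m. H (K m))"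
proof (rule turnsI)
 show "smooth_on UNIV (%m. H (K m))"
  by (rule smooth_on_compose[of UNIV H]) (use assms in "auto simp: turns_def")
 show "((%m. H (K m)) has_derivative (%h. Df H (K m) (Df K m h))) (at m)" for m
  by (rule has_derivative_compose[OF smooth_on_has_derivative smooth_on_has_derivative, of UNIV _ _ UNIV])
   (use assms in "auto simp: turns_def")
 show "phi (H (K m)) (Df H (K m) (Df K m h)) = rot (a + b) (phi m h)" for m h
  using assms by (simp add: turns_def rot_rot)
qed

lemma turns_mmult: "turns (2 * a $ 3 / \<beta>) (mmult a)"
proof (rule turnsI)
 show "smooth_on UNIV (mmult a)" by (intro smooth_intros open_UNIV)
 show "(mmult a has_derivative (%h. vector [exp (a $ 2) * h $ 1, h $ 2, h $ 3])) (at m)" for m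
 proof (rule has_derivative_vec)
  fix i :: 3
  show "((%b. mmult a b $ i) has_derivative (%h. vector [exp (a $ 2) * h $ 1, h $ 2, h $ 3] $ i)) (at m)"
   using exhaust_3[of i] by (auto simp: mmult_def intro!: derivative_eq_intros bounded_linear_imp_has_derivative bounded_linear_vec_nth)
 qed
 show "phi (mmult a m) (vector [exp (a $ 2) * h $ 1, h $ 2, h $ 3]) = rot (2 * a $ 3 / \<beta>) (phi m h)" for m h
 proof -
  have "cof \<beta> (mmult a m) (vector [exp (a $ 2) * h $ 1, h $ 2, h $ 3]) = cof \<beta> m h"
   by (simp add: cof_def mmult_def vec_eq_iff forall_3 exp_add exp_diff exp_minus field_simps)
  thus ?thesis by (simp add: phi_def rot_rot mmult_def add_divide_distrib distrib_left)
 qed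
qed

definition lfield :: "real^3 => (real^3) vfield" where
 "lfield u = fld (%m. ifr m u)"

lemma lfield_vector_field: "lfield u : \<XX> flat_atlas"
 unfolding lfield_def by (rule fld_vector_field[OF smooth_ifr])

lemma lfield_apply: "smooth_on UNIV f ==> lfield u m f = Df f m (ifr m u)"
 by (simp add: lfield_def fld_apply)

lemma lfield_linear: "lfield (u + v) m = tadd (lfield u m) (lfield v m)" "lfield (c *\<^sub>R u) m = tscale c (lfield u m)"
 using flat.chart_tangent_linear(1,2)[of UNIV id m]
 by (simp_all add: lfield_def fld_chart_tangent ifr_linear)

lemma lfield_expand: "lfield u m f = (SUM i:UNIV. u $ i * lfield (axis i 1) m f)"
proof -
 have "u = u $ 1 *\<^sub>R axis 1 1 + (u $ 2 *\<^sub>R axis 2 1 + u $ 3 *\<^sub>R axis 3 1)"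
  by (simp add: vec_eq_iff forall_3 axis_def)
 hence "lfield u m f = lfield (u $ 1 *\<^sub>R axis 1 1 + (u $ 2 *\<^sub>R axis 2 1 + u $ 3 *\<^sub>R axis 3 1)) m f" by simp
 thus ?thesis by (simp add: lfield_linear sum_3)
qed

lemma lfield_inject [simp]: "lfield u m = lfield w m \<longleftrightarrow> u = w"
 using fld_inject[of "%m. ifr m u" m "%m. ifr m w" m] unfolding lfield_def by (metis phi_ifr)

lemma lfield_cases:
 assumes "v : \<T> flat_atlas m" obtains u where "v = lfield u m"
proof -
 obtain a where "v = fld (%_. a) m" by (rule fld_cases[OF assms])
 hence "v = lfield (phi m a) m" by (intro ext) (simp add: lfield_def fld_def)
 thus thesis by (rule that)
qed

text \<open>Along the rays from the origin, maps with the same rotation angle are integral curves of the same time-dependent field.\<close>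

lemma turns_unique:
 assumes H: "turns \<theta> H" and K: "turns \<theta> K" and 0: "H 0 = K 0"
 shows "H m = K m"
proof -
 define w where "w = (%s. rot \<theta> (phi (s *\<^sub>R m) m))"
 have v: "has_velocity flat_atlas (%s. H (s *\<^sub>R m)) (%f. SUM i:UNIV. w s $ i * lfield (axis i 1) (H (s *\<^sub>R m)) f) s"
  if H: "turns \<theta> H" for H s
  unfolding has_velocity_def
 proof
  fix f :: "real^3 => real" assume "f : \<F> flat_atlas"
  hence f: "smooth_on UNIV f" by (simp add: smooth_functions_flat)
  have Hs: "smooth_on UNIV H" using H by (simp add: turns_def)
  have "((%s. f (H (s *\<^sub>R m))) has_derivative
    (%h. Df f (H (s *\<^sub>R m)) (Df H (s *\<^sub>R m) (h *\<^sub>R m)))) (at s)"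
   by (rule has_derivative_compose[OF has_derivative_compose[OF _ smooth_on_has_derivative[OF Hs UNIV_I]]
      smooth_on_has_derivative[OF f UNIV_I]]) (auto intro!: derivative_eq_intros)
  moreover have "Df f (H (s *\<^sub>R m)) (Df H (s *\<^sub>R m) (h *\<^sub>R m)) =
    Df f (H (s *\<^sub>R m)) (Df H (s *\<^sub>R m) m) * h" for h
   using linear_cmul[OF has_derivative_linear[OF smooth_on_has_derivative[OF Hs UNIV_I]]]
    linear_cmul[OF has_derivative_linear[OF smooth_on_has_derivative[OF f UNIV_I]]] by simp
  moreover have "Df H (s *\<^sub>R m) m = ifr (H (s *\<^sub>R m)) (w s)"
   using H ifr_phi unfolding turns_def w_def by metis
  ultimately show "((%s. f (H (s *\<^sub>R m))) has_real_derivative (SUM i:UNIV. w s $ i * lfield (axis i 1) (H (s *\<^sub>R m)) f)) (at s)"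
   unfolding lfield_expand[symmetric] unfolding has_field_derivative_def lfield_apply[OF f] by (simp only:)
 qed
 have "(%s. H (s *\<^sub>R m)) 1 = (%s. K (s *\<^sub>R m)) 1"
 proof (rule flat.integral_curve_unique[OF lfield_vector_field finite_class.finite_UNIV _ open_UNIV connected_UNIV v[OF H] v[OF K], of 0])
  show "continuous_on UNIV (%s. w s $ i)" for i
  proof -
   have "smooth_on UNIV (%s. phi (s *\<^sub>R m) m $ j)" for j by (intro smooth_intros open_UNIV smooth_phi)
   hence c: "continuous_on UNIV (%s. phi (s *\<^sub>R m) m $ j)" for j by (rule smooth_on_imp_continuous_on)
   show ?thesis using exhaust_3[of i]
    by (elim disjE) (simp_all add: w_def rot_def continuous_on_diff continuous_on_add continuous_on_mult_left c)
  qed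
 qed (simp_all add: 0)
 thus ?thesis by simp
qed

end

subsection \<open>The rotations of the disc\<close>

text \<open>In the coordinate \<open>w = (z - i) / (z + i)\<close> of the unit disc, \<open>z = x + i e\<^sup>v\<close>, and with \<open>s = t + \<beta> arg (1 - w)\<close>,
  the coframe \<open>phi\<close> is \<open>(e\<^bsup>2 i s / \<beta>\<^esup> d w\<^sup>* / (1 - |w|\<^sup>2), ds + \<beta> Im (w\<^sup>* dw) / (1 - |w|\<^sup>2))\<close>. So rotations of the disc
  rotate it by a constant angle.\<close>

definition upper :: "real^3 => complex" where
 "upper m = Complex (m $ 1) (exp (m $ 2))"

definition disc :: "real^3 => complex" where
 "disc m = (upper m - \<i>) / (upper m + \<i>)"

lemma upper_nonzero [simp]: "upper m + \<i> ~= 0" "\<i> + upper m ~= 0"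
 by (auto simp: upper_def complex_eq_iff add_pos_pos less_imp_neq[symmetric])

lemma one_minus_disc: "1 - disc m = 2 * \<i> / (upper m + \<i>)"
 by (simp add: disc_def field_simps)

lemma norm_upper: "(cmod (upper m + \<i>))\<^sup>2 - (cmod (upper m - \<i>))\<^sup>2 = 4 * exp (m $ 2)"
 by (simp add: cmod_power2 upper_def) (simp add: power2_eq_square algebra_simps)

lemma one_minus_norm_disc: "1 - (cmod (disc m))\<^sup>2 = 4 * exp (m $ 2) / (cmod (upper m + \<i>))\<^sup>2"
 unfolding norm_upper[symmetric] disc_def norm_divide power_divide by (simp add: diff_divide_distrib)

lemma norm_disc: "cmod (disc m) < 1"
proof -
 have "1 - (cmod (disc m))\<^sup>2 > 0" unfolding one_minus_norm_disc by (auto intro!: divide_pos_pos)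
 thus ?thesis by (simp add: power_less_one_iff abs_square_less_1)
qed

lemma disc_0 [simp]: "disc 0 = 0"
 by (simp add: disc_def upper_def complex_eq_iff[of "Complex _ _"])

lemma disc_vertical: "disc (mmult (vector [0, 0, t]) m) = disc m"
 by (simp add: disc_def upper_def mmult_def)

lemma smooth_upper: "smooth_on UNIV upper"
 unfolding upper_def by (intro smooth_intros open_UNIV)

lemma smooth_disc: "smooth_on UNIV disc"
 unfolding disc_def by (intro smooth_intros smooth_upper open_UNIV) simp_all

lemma upper_has_derivative: "(upper has_derivative (%h. Complex (h $ 1) (exp (m $ 2) * h $ 2))) (at m)"
proof -
 have "((%m. complex_of_real (m $ 1) + \<i> * complex_of_real (exp (m $ 2))) has_derivative
   (%h. complex_of_real (h $ 1) + \<i> * complex_of_real (exp (m $ 2) * h $ 2))) (at m)"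
  by (auto intro!: derivative_eq_intros bounded_linear_imp_has_derivative bounded_linear_vec_nth)
 thus ?thesis unfolding upper_def Complex_eq by simp
qed

lemma disc_has_derivative:
 "(disc has_derivative (%h. 2 * \<i> * Complex (h $ 1) (exp (m $ 2) * h $ 2) / (upper m + \<i>)\<^sup>2)) (at m)"
proof -
 have "(disc has_derivative (%h. (Complex (h $ 1) (exp (m $ 2) * h $ 2) * (upper m + \<i>) -
   (upper m - \<i>) * Complex (h $ 1) (exp (m $ 2) * h $ 2)) / ((upper m + \<i>) * (upper m + \<i>)))) (at m)"
  unfolding disc_def by (rule has_derivative_divide') (auto intro!: derivative_eq_intros upper_has_derivative)
 thus ?thesis by (simp add: algebra_simps power2_eq_square)
qed

lemma Re_one_minus: "cmod w < 1 ==> Re (1 - w) > 0"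
 using complex_Re_le_cmod[of w] by simp

lemma cis_Im_Ln: "z ~= 0 ==> cis (Im (Ln z)) = z / cmod z"
 using exp_Ln[of z] by (simp add: exp_eq_polar[of "Ln z"] field_simps)

context half_plane_model
begin

definition height :: "real^3 => real" where
 "height m = m $ 3 + \<beta> * Im (Ln (1 - disc m))"

lemma smooth_height: "smooth_on UNIV height"
 unfolding height_def
 by (intro smooth_intros smooth_disc open_UNIV) (use norm_disc Re_one_minus in "auto simp: complex_nonpos_Reals_iff not_le")

lemma phi_disc:
 fixes m h defines "\<delta> \<equiv> Df disc m h" and "c \<equiv> 1 / (1 - (cmod (disc m))\<^sup>2)"
 shows "Complex (phi m h $ 1) (phi m h $ 2) = cis (2 * height m / \<beta>) * cnj \<delta> * c"
  and "phi m h $ 3 = Df height m h + \<beta> * Im (cnj (disc m) * \<delta>) * c"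
proof -
 let ?z = "upper m + \<i>" and ?y = "exp (m $ 2)"
 define k where "k = Complex (h $ 1) (?y * h $ 2)"
 have z: "?z ~= 0" "cnj ?z ~= 0" unfolding complex_cnj_zero_iff by simp_all
 have \<delta>: "\<delta> = 2 * \<i> * k / ?z\<^sup>2"
  unfolding \<delta>_def k_def frechet_derivative_at[OF disc_has_derivative, symmetric] ..
 have nz: "complex_of_real ((cmod ?z)\<^sup>2) = ?z * cnj ?z" by (simp only: complex_norm_square)
 have c: "complex_of_real c = ?z * cnj ?z / (4 * ?y)"
  unfolding c_def one_minus_norm_disc nz[symmetric] by simp
 have q: "(2 * \<i> / Z) / cnj (2 * \<i> / Z) = - cnj Z / Z" if "Z ~= 0" for Z :: complex
  using that by (simp add: field_simps)
 have q': "(C * (- cnj Z / Z)) * cnj (2 * \<i> * k / Z\<^sup>2) * (Z * cnj Z / (4 * ?y)) = C * (\<i> * cnj k / (2 * ?y))"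
  if "Z ~= 0" for Z C :: complex
  using that by (simp add: field_simps power2_eq_square)
 have "cis (2 * Im (Ln (1 - disc m))) = (1 - disc m) / cnj (1 - disc m)"
 proof -
  have n: "1 - disc m ~= 0" using norm_disc[of m] by auto
  have "cis (2 * Im (Ln (1 - disc m))) = ((1 - disc m) / cmod (1 - disc m))\<^sup>2"
   using Complex.DeMoivre[of "Im (Ln (1 - disc m))" 2] cis_Im_Ln[OF n] by simp
  also have "\<dots> = (1 - disc m) * (1 - disc m) / complex_of_real ((cmod (1 - disc m))\<^sup>2)"
   by (simp add: power2_eq_square)
  also have "\<dots> = (1 - disc m) / cnj (1 - disc m)"
   unfolding complex_norm_square using n by simp
  finally show ?thesis .
 qed
 moreover have "2 * height m / \<beta> = 2 * m $ 3 / \<beta> + 2 * Im (Ln (1 - disc m))"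
  using beta by (simp add: height_def field_simps)
 ultimately have cis: "cis (2 * height m / \<beta>) = cis (2 * m $ 3 / \<beta>) * (- cnj ?z / ?z)"
  unfolding one_minus_disc q[OF z(1)] by (simp only: cis_mult[symmetric])
 have "cis (2 * height m / \<beta>) * cnj \<delta> * c = cis (2 * m $ 3 / \<beta>) * (\<i> * cnj k / (2 * ?y))"
  unfolding cis \<delta> c using q'[OF z(1), of "cis (2 * m $ 3 / \<beta>)"] by (simp only:)
 also have "\<i> * cnj k / (2 * ?y) = Complex (cof \<beta> m h $ 1) (cof \<beta> m h $ 2)"
  by (simp add: complex_eq_iff k_def cof_def exp_minus field_simps)
 finally show "Complex (phi m h $ 1) (phi m h $ 2) = cis (2 * height m / \<beta>) * cnj \<delta> * c"
  unfolding phi_def rot_complex by simp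
 have A: "((%m. 1 - disc m) has_derivative (%h. - (2 * \<i> * Complex (h $ 1) (exp (m $ 2) * h $ 2) / (upper m + \<i>)\<^sup>2))) (at m)"
  using has_derivative_diff[OF has_derivative_const disc_has_derivative, of 1 m] by simp
 have B: "(Ln has_derivative (*) (inverse (1 - disc m))) (at (1 - disc m))"
  using has_field_derivative_Ln[of "1 - disc m"] Re_one_minus[OF norm_disc, of m]
  by (auto simp: has_field_derivative_def complex_nonpos_Reals_iff not_le inverse_eq_divide)
 from has_derivative_compose[OF A B]
 have "(height has_derivative (%h. h $ 3 + \<beta> * Im (inverse (1 - disc m) * (- (2 * \<i> * Complex (h $ 1) (exp (m $ 2) * h $ 2) / (upper m + \<i>)\<^sup>2))))) (at m)"
  unfolding height_def
  by (intro has_derivative_add has_derivative_mult_right has_derivative_Im bounded_linear_imp_has_derivative bounded_linear_vec_nth)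
 from frechet_derivative_at[OF this, symmetric]
 have "Df height m h = h $ 3 - \<beta> * Im (inverse (1 - disc m) * \<delta>)"
  by (simp add: \<delta> k_def)
 moreover have "Im (cnj (disc m) * \<delta>) * c - Im (inverse (1 - disc m) * \<delta>) = exp (- m $ 2) * h $ 1 / 2"
 proof -
  have q'': "cnj ((Z - 2 * \<i>) / Z) * (2 * \<i> * k / Z\<^sup>2) * (Z * cnj Z / (4 * ?y)) - inverse (2 * \<i> / Z) * (2 * \<i> * k / Z\<^sup>2)
    = k / Z * (\<i> * cnj Z - 2 - 2 * ?y) / (2 * ?y)" if "Z ~= 0" for Z :: complex
   using that by (simp add: field_simps power2_eq_square)
  have w: "disc m = (?z - 2 * \<i>) / ?z" by (simp add: disc_def)
  have "\<i> * cnj ?z - 2 - 2 * ?y = \<i> * ?z" by (simp add: upper_def complex_eq_iff)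
  moreover have "cnj (disc m) * \<delta> * c - inverse (1 - disc m) * \<delta> = k / ?z * (\<i> * cnj ?z - 2 - 2 * ?y) / (2 * ?y)"
   unfolding c one_minus_disc \<delta> unfolding w by (rule q''[OF z(1)])
  ultimately have "cnj (disc m) * \<delta> * c - inverse (1 - disc m) * \<delta> = \<i> * k / (2 * ?y)" using z by simp
  hence "Im (cnj (disc m) * \<delta> * c - inverse (1 - disc m) * \<delta>) = h $ 1 / (2 * ?y)" by (simp add: k_def)
  thus ?thesis by (simp add: exp_minus field_simps)
 qed
 moreover have "phi m h $ 3 = h $ 3 + \<beta> * (exp (- m $ 2) * h $ 1 / 2)" by (simp add: phi_def rot_def cof_def)
 moreover have "p = a + \<beta> * J * c" if "a = h $ 3 - \<beta> * I" "J * c - I = X" "p = h $ 3 + \<beta> * X" for a I J X p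
  unfolding that(3) that(1) that(2)[symmetric] by (simp add: algebra_simps)
 ultimately show "phi m h $ 3 = Df height m h + \<beta> * Im (cnj (disc m) * \<delta>) * c" by metis
qed

definition undisc :: "complex => real => real^3" where
 "undisc w s = vector [Re (\<i> * (1 + w) / (1 - w)), ln (Im (\<i> * (1 + w) / (1 - w))), s - \<beta> * Im (Ln (1 - w))]"

lemma Im_undisc:
 assumes "cmod w < 1" shows "Im (\<i> * (1 + w) / (1 - w)) > 0"
proof -
 have n: "(cmod (1 - w))\<^sup>2 > 0" using assms by auto
 have "Im (\<i> * (1 + w) / (1 - w)) * (cmod (1 - w))\<^sup>2 = Im (\<i> * (1 + w) * cnj (1 - w))"
  unfolding complex_div_cnj[of "\<i> * (1 + w)"] using n by (simp add: Im_divide_of_real)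
 also have "\<dots> = 1 - (cmod w)\<^sup>2" unfolding cmod_power2 by (simp add: power2_eq_square algebra_simps)
 also have "\<dots> > 0" using assms by (simp add: power_less_one_iff)
 finally show ?thesis using n by (simp add: zero_less_mult_iff)
qed

lemma disc_undisc:
 assumes "cmod w < 1" shows "disc (undisc w s) = w" "height (undisc w s) = s"
proof -
 have n: "1 - w ~= 0" using assms by auto
 have "upper (undisc w s) = \<i> * (1 + w) / (1 - w)"
  using Im_undisc[OF assms] by (simp add: upper_def undisc_def complex_eq_iff)
 hence "disc (undisc w s) = (\<i> * (1 + w) / (1 - w) - \<i>) / (\<i> * (1 + w) / (1 - w) + \<i>)" by (simp add: disc_def)
 also have "\<dots> = (2 * \<i> * w / (1 - w)) / (2 * \<i> / (1 - w))"
  using n by (intro arg_cong2[of _ _ _ _ divide]) (simp_all add: field_simps)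
 also have "\<dots> = w" using n by simp
 finally show d: "disc (undisc w s) = w" .
 show "height (undisc w s) = s" unfolding height_def d by (simp add: undisc_def)
qed

lemma undisc_disc [simp]: "undisc (disc m) (height m) = m"
proof -
 have "1 + disc m = 2 * upper m / (upper m + \<i>)" by (simp add: disc_def field_simps)
 hence "\<i> * (1 + disc m) / (1 - disc m) = upper m" by (simp add: one_minus_disc)
 thus ?thesis unfolding undisc_def by (simp add: height_def upper_def vec_eq_iff forall_3)
qed

definition spin :: "real => real^3 => real^3" where
 "spin \<theta> m = undisc (cis (- \<theta>) * disc m) (height m)"

lemma disc_spin: "disc (spin \<theta> m) = cis (- \<theta>) * disc m" "height (spin \<theta> m) = height m"
 using disc_undisc[of "cis (- \<theta>) * disc m"] norm_disc[of m] by (simp_all add: spin_def norm_mult)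

lemma smooth_spin [smooth_intros]:
 fixes f :: "'e::euclidean_space => real"
 assumes f: "smooth_on UNIV f" and h: "smooth_on UNIV h"
 shows "smooth_on UNIV (%x. spin (f x) (h x))"
proof -
 have d: "smooth_on UNIV (%x. disc (h x))" and t: "smooth_on UNIV (%x. height (h x))"
  by (rule smooth_on_compose[OF smooth_disc open_UNIV h] smooth_on_compose[OF smooth_height open_UNIV h]; simp)+
 have w: "smooth_on UNIV (%x. cis (- f x) * disc (h x))"
  unfolding cis_conv_exp by (intro smooth_intros open_UNIV f d)
 have n: "cmod (cis (- f x) * disc (h x)) < 1" for x using norm_disc[of "h x"] by (simp add: norm_mult)
 hence n1: "1 - cis (- f x) * disc (h x) ~= 0" for x by (metis eq_iff_diff_eq_0 norm_one order_less_irrefl)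
 have q: "smooth_on UNIV (%x. \<i> * (1 + cis (- f x) * disc (h x)) / (1 - cis (- f x) * disc (h x)))"
  by (intro smooth_intros open_UNIV w n1)
 show ?thesis
  by (rule smooth_on_vec_lambda[OF open_UNIV], rule forall_3[THEN iffD2, rule_format], unfold spin_def undisc_def vector_3)
   (intro conjI smooth_intros open_UNIV q w t, use Im_undisc[OF n] Re_one_minus[OF n] in "auto simp: complex_nonpos_Reals_iff not_le")
qed

lemma turns_spin: "turns \<theta> (spin \<theta>)"
 unfolding turns_def
proof (intro conjI allI)
 show s: "smooth_on UNIV (spin \<theta>)" by (intro smooth_intros)
 fix m h
 let ?k = "Df (spin \<theta>) m h"
 have D: "(spin \<theta> has_derivative Df (spin \<theta>) m) (at m)"
  by (rule smooth_on_has_derivative[OF s UNIV_I])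
 have d: "Df disc (spin \<theta> m) ?k = cis (- \<theta>) * Df disc m h"
 proof -
  have "((%m. disc (spin \<theta> m)) has_derivative (%h. Df disc (spin \<theta> m) (Df (spin \<theta>) m h))) (at m)"
   by (rule has_derivative_compose[OF D smooth_on_has_derivative[OF smooth_disc UNIV_I]])
  moreover have "((%m. disc (spin \<theta> m)) has_derivative (%h. cis (- \<theta>) * Df disc m h)) (at m)"
   unfolding disc_spin by (rule has_derivative_mult_right[OF smooth_on_has_derivative[OF smooth_disc UNIV_I]])
  ultimately show ?thesis using has_derivative_unique by metis
 qed
 have t: "Df height (spin \<theta> m) ?k = Df height m h"
 proof -
  have "((%m. height (spin \<theta> m)) has_derivative (%h. Df height (spin \<theta> m) (Df (spin \<theta>) m h))) (at m)"
   by (rule has_derivative_compose[OF D smooth_on_has_derivative[OF smooth_height UNIV_I]])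
  moreover have "((%m. height (spin \<theta> m)) has_derivative Df height m) (at m)"
   unfolding disc_spin by (rule smooth_on_has_derivative[OF smooth_height UNIV_I])
  ultimately show ?thesis using has_derivative_unique by metis
 qed
 have "cnj (cis (- \<theta>) * w) * (cis (- \<theta>) * z) = (cis \<theta> * cis (- \<theta>)) * (cnj w * z)" for w z
  by (simp only: complex_cnj_mult cis_cnj minus_minus mult_ac)
 hence e: "cnj (cis (- \<theta>) * w) * (cis (- \<theta>) * z) = cnj w * z" for w z by (simp add: cis_mult)
 have n: "cmod (cis (- \<theta>) * w) = cmod w" for w by (simp add: norm_mult)
 have p: "Complex (phi (spin \<theta> m) ?k $ 1) (phi (spin \<theta> m) ?k $ 2) = cis \<theta> * Complex (phi m h $ 1) (phi m h $ 2)"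
  unfolding phi_disc(1) disc_spin n d by (simp add: cis_cnj mult_ac)
 have p3: "phi (spin \<theta> m) ?k $ 3 = phi m h $ 3"
  unfolding phi_disc(2) disc_spin n d t e ..
 show "phi (spin \<theta> m) ?k = rot \<theta> (phi m h)"
  using p[folded rot_complex] p3 by (simp add: vec_eq_iff forall_3 rot_def)
qed

lemma spin_vertical: "spin \<theta> (vector [0, 0, t]) = vector [0, 0, t]"
proof -
 have "disc (vector [0, 0, t]) = 0" using disc_vertical[of t 0] by simp
 thus ?thesis using undisc_disc[of "vector [0, 0, t]"] by (simp add: spin_def)
qed

lemma spin_0 [simp]: "spin \<theta> 0 = 0" "spin 0 m = m"
 by (simp_all add: spin_def) (use undisc_disc[of 0] in simp)

lemma spin_spin: "spin a (spin b m) = spin (a + b) m"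
 by (rule turns_unique[OF turns_compose[OF turns_spin turns_spin] turns_spin]) simp

lemma spin_mmult_vertical: "spin \<theta> (mmult (vector [0, 0, t]) m) = mmult (vector [0, 0, t]) (spin \<theta> m)"
 by (rule turns_unique[OF turns_compose[OF turns_spin turns_mmult]
    turns_compose[OF turns_mmult turns_spin, of "vector [0, 0, t]" \<theta>, unfolded add.commute[of _ \<theta>]]])
  (simp add: spin_vertical)

subsection \<open>The group structure on \<open>\<real>\<^sup>3\<close> preserving \<open>phi\<close>\<close>

definition lmult :: "real^3 => real^3 => real^3" where
 "lmult a b = mmult a (spin (- 2 * a $ 3 / \<beta>) b)"

definition linv :: "real^3 => real^3" where
 "linv a = spin (2 * a $ 3 / \<beta>) (minv a)"

lemma lmult_0 [simp]: "lmult a 0 = a" "lmult 0 a = a"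
 by (simp_all add: lmult_def)

lemma lmult_linv: "lmult a (linv a) = 0"
 by (simp add: lmult_def linv_def spin_spin)

lemma turns_lmult: "turns 0 (lmult a)"
proof -
 have "turns (2 * a $ 3 / \<beta> + - 2 * a $ 3 / \<beta>) (%b. mmult a (spin (- 2 * a $ 3 / \<beta>) b))"
  by (rule turns_compose[OF turns_mmult turns_spin])
 moreover have "2 * a $ 3 / \<beta> + - 2 * a $ 3 / \<beta> = 0" by simp
 ultimately show ?thesis unfolding lmult_def[abs_def] by metis
qed

lemma lmult_assoc: "lmult (lmult a b) c = lmult a (lmult b c)"
 by (rule turns_unique[OF turns_lmult, of "%c. lmult a (lmult b c)"])
  (use turns_compose[OF turns_lmult turns_lmult] in auto)

definition L :: "(real^3) monoid" where
 "L = \<lparr>carrier = UNIV, mult = lmult, one = 0\<rparr>"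

lemma L_simps [simp]: "carrier L = UNIV" "mult L = lmult" "one L = 0"
 by (simp_all add: L_def)

lemma L_group: "group L"
proof (rule groupI)
 show "\<exists>y\<in>carrier L. y \<otimes>\<^bsub>L\<^esub> x = \<one>\<^bsub>L\<^esub>" if "x : carrier L" for x
 proof -
  have "linv x = lmult (linv x) (lmult x (linv (x)))" by (simp add: lmult_linv)
  have "lmult x (linv x) = 0" "lmult (linv x) (linv (linv x)) = 0" by (simp_all add: lmult_linv)
  hence "x = linv (linv x)" by (metis lmult_assoc lmult_0)
  thus ?thesis using lmult_linv[of "linv x"] by auto
 qed
qed (simp_all add: lmult_assoc)

lemma L_inv: "inv\<^bsub>L\<^esub> x = linv x"
proof -
 interpret group L by (rule L_group)
 show ?thesis using inv_equality[of "x" "linv x"] lmult_linv[of "linv x"] lmult_linv[of x] by (metis inv_equality inv_inv L_simps UNIV_I)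
qed

lemma L_lie_group: "lie_group L flat_atlas"
 unfolding lie_group_def
proof (intro conjI)
 show "group L" by (rule L_group)
 show "smooth_atlas (flat_atlas :: (real^3, real^3) atlas)" using flat.smooth_atlas .
 show "smooth_map (prod_atlas flat_atlas flat_atlas) flat_atlas (%(x, y). x \<otimes>\<^bsub>L\<^esub> y)"
  unfolding prod_flat_atlas smooth_map_flat case_prod_beta L_simps lmult_def
  by (intro smooth_intros open_UNIV) (use beta in auto)
 show "smooth_map flat_atlas flat_atlas (%x. inv\<^bsub>L\<^esub> x)"
  unfolding smooth_map_flat L_inv linv_def by (intro smooth_intros open_UNIV) (use beta in auto)
qed simp

lemma lfield_left_invariant: "lfield u : \<L> L flat_atlas"
 unfolding left_invariant_fields_def
proof (intro CollectI conjI allI lfield_vector_field)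
 fix a p
 have s: "smooth_on UNIV (lmult a)" using turns_lmult by (simp add: turns_def)
 have "phi (lmult a p) (Df (lmult a) p (ifr p u)) = u"
  using turns_lmult[of a] by (simp add: turns_def)
 hence "Df (lmult a) p (ifr p u) = ifr (lmult a p) u" by (metis ifr_phi)
 hence "fld (%_. Df (lmult a) p (ifr p u)) (lmult a p) = fld (%m. ifr m u) (lmult a p)"
  by (simp add: fld_def)
 thus "push flat_atlas (%x. a \<otimes>\<^bsub>L\<^esub> x) (lfield u p) = lfield u (a \<otimes>\<^bsub>L\<^esub> p)"
  unfolding lfield_def using push_fld_flat[OF s smooth_on_has_derivative[OF s UNIV_I], of "%m. ifr m u" p] by simp
qed

definition lbr :: "real^3 => real^3 => real^3" where
 "lbr u v = (let c = cross3 u v in vector [- 2 / \<beta> * c $ 1, - 2 / \<beta> * c $ 2, 2 * \<beta> * c $ 3])"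

lemma ifr_has_derivative:
 "((%m. ifr m u) has_derivative (%k. let q = rot (- 2 * m $ 3 / \<beta>) u; s = 2 * k $ 3 / \<beta> in
   vector [2 * exp (m $ 2) * (k $ 2 * q $ 2 - s * q $ 1), 2 * s * q $ 2, \<beta> * s * q $ 1])) (at m)"
proof (rule has_derivative_vec)
 note c = bounded_linear_imp_has_derivative[OF bounded_linear_vec_nth]
 fix i :: 3
 show "((%m. ifr m u $ i) has_derivative (%k. (let q = rot (- 2 * m $ 3 / \<beta>) u; s = 2 * k $ 3 / \<beta> in
   vector [2 * exp (m $ 2) * (k $ 2 * q $ 2 - s * q $ 1), 2 * s * q $ 2, \<beta> * s * q $ 1]) $ i)) (at m)"
  using exhaust_3[of i] beta
  by (elim disjE) (simp only: ifr_def rot_def Let_def vector_3, rule has_derivative_eq_rhs,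
   (rule derivative_eq_intros c refl | simp)+, simp add: fun_eq_iff field_simps)+
qed

lemma lfield_bracket: "vbracket flat_atlas (lfield u) (lfield v) = lfield (lbr u v)"
proof
 fix m :: "real^3"
 define q p where "q = rot (- 2 * m $ 3 / \<beta>) u" and "p = rot (- 2 * m $ 3 / \<beta>) v"
 have 3: "u $ 3 = q $ 3" "v $ 3 = p $ 3" by (simp_all add: q_def p_def rot_def)
 have r: "rot (- 2 * m $ 3 / \<beta>) (lbr u v) = lbr q p"
 proof -
  have "rot s (lbr u v) = lbr (rot s u) (rot s v)" for s
  proof -
   have "(cos s * a - sin s * b) * (sin s * c + cos s * d) - (sin s * a + cos s * b) * (cos s * c - sin s * d) = a * d - b * c" for a b c d :: real
   proof -
    have "(x * a - y * b) * (y * c + x * d) - (y * a + x * b) * (x * c - y * d) = (y\<^sup>2 + x\<^sup>2) * (a * d - b * c)" for x y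
     by (simp add: power2_eq_square algebra_simps)
    from this[of "cos s" "sin s"] show ?thesis by simp
   qed
   hence "rot s (lbr u v) $ 3 = lbr (rot s u) (rot s v) $ 3" by (simp add: lbr_def rot_def Let_def cross3_def)
   moreover have "rot s (lbr u v) $ 1 = lbr (rot s u) (rot s v) $ 1" "rot s (lbr u v) $ 2 = lbr (rot s u) (rot s v) $ 2"
    by (simp_all add: lbr_def rot_def Let_def cross3_def) (simp_all add: add_divide_distrib diff_divide_distrib algebra_simps)
   ultimately show ?thesis by (simp add: vec_eq_iff forall_3)
  qed
  thus ?thesis unfolding q_def p_def by blast
 qed
 let ?D = "%u k. let q = rot (- 2 * m $ 3 / \<beta>) u; s = 2 * k $ 3 / \<beta> in
   vector [2 * exp (m $ 2) * (k $ 2 * q $ 2 - s * q $ 1), 2 * s * q $ 2, \<beta> * s * q $ 1] :: real^3"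
 have eq: "?D v (ifr m u) - ?D u (ifr m v) = ifr m (lbr u v)"
  unfolding ifr_def r unfolding q_def[symmetric] p_def[symmetric]
  using beta by (simp add: Let_def lbr_def cross3_def 3 vec_eq_iff forall_3) (simp add: field_simps)
 show "vbracket flat_atlas (lfield u) (lfield v) m = lfield (lbr u v) m"
  unfolding lfield_def vbracket_fld[OF smooth_ifr smooth_ifr ifr_has_derivative ifr_has_derivative] eq
  unfolding fld_def ..
qed

end

section \<open>The groups \<open>G(\<alpha>, \<beta>)\<close>\<close>

lemma (in Lie_group) left_invariant_eq:
 assumes X: "X : \<L> G A" and Y: "Y : \<L> G A" and eq: "X \<one> = Y \<one>"
 shows "X = Y"
proof
 fix p
 have "p \<otimes> \<one> = p" by simp
 thus "X p = Y p" using left_invariantD(2)[OF X, of p \<one>] left_invariantD(2)[OF Y, of p \<one>] eq by simp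
qed

locale metric_group = Lie_group G A
 for G :: "'p::{t2_space, second_countable_topology} monoid" (structure) and A :: "('p, real^3) atlas" +
 fixes g :: "'p metric" and e1 e2 e3 :: "'p vfield" and \<alpha> \<beta> :: real and D :: "'p connection"
 assumes group_G: "group_G \<alpha> \<beta> G A g e1 e2 e3" and levi_civita_D: "levi_civita A g D"
begin

definition frame :: "3 => 'p vfield" where
 "frame i = (if i = 1 then e1 else if i = 2 then e2 else e3)"

lemma frame_simps [simp]: "frame 1 = e1" "frame 2 = e2" "frame 3 = e3"
 by (simp_all add: frame_def)

lemma metric_group_facts:
 shows alpha_nonneg: "\<alpha> >= 0" and beta_nonneg: "\<beta> >= 0" and connected_group: "connected (UNIV :: 'p set)"
  and left_invariant_g: "left_invariant_metric G A g"
  and frame_left_invariant: "frame i : \<L> G A"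
 using group_G unfolding group_G_def frame_def by auto

sublocale orthonormal_frame A g frame
proof
 show "riemannian_metric A g" using left_invariant_g unfolding left_invariant_metric_def by blast
 hence sym: "g p u v = g p v u" if "u : \<T> A p" "v : \<T> A p" for p u v
  using that unfolding riemannian_metric_def by blast
 show v: "frame i : \<XX> A" for i by (rule left_invariantD(1)[OF frame_left_invariant])
 have "g p (e2 p) (e1 p) = g p (e1 p) (e2 p)" "g p (e3 p) (e2 p) = g p (e2 p) (e3 p)" "g p (e3 p) (e1 p) = g p (e1 p) (e3 p)" for p
  using sym vector_fieldD(1)[OF v, of _ p] frame_simps by metis+
 thus "g p (frame i p) (frame j p) = (if i = j then 1 else 0)" for p i j
  using exhaust_3[of i] exhaust_3[of j] group_G unfolding group_G_def by auto
qed

lemma scaled_frame: "vscale (%_. c) (frame i) = field (%_. c *\<^sub>R axis i 1)"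
 using vscale_field[of "%_. c" "%_. axis i 1"] by (simp only: field_const_axis)

lemma vbracket_skew: "vbracket A Y X = (%p f. - vbracket A X Y p f)"
 by (auto simp: vbracket_def fun_eq_iff)

sublocale G_frame A g frame \<alpha> \<beta> D
proof
 show "levi_civita A g D" by (rule levi_civita_D)
 have neg: "(%p f. - field (%_. u) p f) = field (%_. - u)" for u
  using tvec_scale[of "-1" _ u] by (simp add: fun_eq_iff tscale_def)
 have B: "vbracket A e1 e2 = vadd (vscale (%_. 1 + \<alpha>) e2) (vscale (%_. (1 + \<alpha>) * \<beta>) e3)" "vbracket A e2 e3 = vzero"
  "vbracket A e3 e1 = vadd (vscale (%_. (1 - \<alpha>) * \<beta>) e2) (vscale (%_. - (1 - \<alpha>)) e3)"
  using group_G unfolding group_G_def by blast+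
 have v: "vzero = field (%_. 0)" by (simp add: fun_eq_iff tvec_0)
 have b: "vbracket A e1 e2 = field (%_. brk \<alpha> \<beta> (cross3 (axis 1 1) (axis 2 1)))"
  "vbracket A e2 e3 = field (%_. brk \<alpha> \<beta> (cross3 (axis 2 1) (axis 3 1)))"
  "vbracket A e3 e1 = field (%_. brk \<alpha> \<beta> (cross3 (axis 3 1) (axis 1 1)))"
  unfolding B v scaled_frame[of _ 2, unfolded frame_simps] scaled_frame[of _ 3, unfolded frame_simps] vadd_field field_eq_iff
  by (simp_all add: brk_def cross3_def axis_def vec_eq_iff forall_3 fun_eq_iff)
 have s: "vbracket A X X = field (%_. 0)" for X by (intro ext) (simp add: vbracket_def tvec_0)
 have n: "brk \<alpha> \<beta> (- w) = - brk \<alpha> \<beta> w" for w by (simp add: brk_def vec_eq_iff forall_3)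
 have c: "cross3 (axis j 1) (axis i 1) = - cross3 (axis i 1) (axis j 1)" for i j :: 3 by (rule cross_skew)
 have b': "vbracket A e2 e1 = field (%_. brk \<alpha> \<beta> (cross3 (axis 2 1) (axis 1 1)))"
  "vbracket A e3 e2 = field (%_. brk \<alpha> \<beta> (cross3 (axis 3 1) (axis 2 1)))"
  "vbracket A e1 e3 = field (%_. brk \<alpha> \<beta> (cross3 (axis 1 1) (axis 3 1)))"
  unfolding vbracket_skew[of e2 e1] vbracket_skew[of e3 e2] vbracket_skew[of e1 e3] b neg c[of 1 2] c[of 2 3] c[of 3 1] n minus_minus by (rule refl)+
 have z: "brk \<alpha> \<beta> 0 = 0" by (simp add: brk_def vec_eq_iff forall_3)
 show "vbracket A (frame i) (frame j) = field (%_. brk \<alpha> \<beta> (cross3 (axis i 1) (axis j 1)))" for i j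
  using exhaust_3[of i] exhaust_3[of j] by (elim disjE) (simp_all only: frame_simps b b' s z cross_refl)
qed

lemma left_field: "field (%_. u) : \<L> G A"
 unfolding field_def tvec_def by (rule left_invariant_combination) (rule frame_left_invariant)

lemma left_field_cases:
 assumes "X : \<L> G A" shows "X = field (%_. coord \<one> (X \<one>))"
 by (rule left_invariant_eq[OF assms left_field]) (simp add: vector_fieldD(1)[OF left_invariantD(1)[OF assms]])

lemma left_field_bracket: "vbracket A (field (%_. u)) (field (%_. v)) = field (%_. brk \<alpha> \<beta> (cross3 u v))"
 by (simp add: bracket_field fder_const[OF tvec_tangent])

lemma left_field_bracket_apply:
 assumes "f : \<F> A"
 shows "tvec p u (%q. tvec q v f) - tvec p v (%q. tvec q u f) = tvec p (brk \<alpha> \<beta> (cross3 u v)) f"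
proof -
 have "vbracket A (field (%_. u)) (field (%_. v)) p f = tvec p (brk \<alpha> \<beta> (cross3 u v)) f" by (simp add: left_field_bracket)
 thus ?thesis using assms by (simp add: vbracket_def)
qed

lemma push_translation: "push A (%x. a \<otimes> x) (tvec p u) = tvec (a \<otimes> p) u"
 using left_invariantD(2)[OF left_field, of a u p] by simp

lemma translation_isometry: "isometry A g (%x. a \<otimes> x)"
 unfolding isometry_def
proof (intro conjI allI ballI)
 have i: "inv_into UNIV (%x. a \<otimes> x) = (%x. inv a \<otimes> x)"
  by (rule inv_unique_comp) (auto simp: fun_eq_iff m_assoc[symmetric])
 show "bij (%x. a \<otimes> x)" by (rule o_bij[of "%x. inv a \<otimes> x"]) (auto simp: fun_eq_iff m_assoc[symmetric])
 show "smooth_map A A (%x. a \<otimes> x)" "smooth_map A A (inv_into UNIV (%x. a \<otimes> x))"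
  unfolding i by (rule left_translation_smooth)+
 show "g (a \<otimes> p) (push A (%x. a \<otimes> x) u) (push A (%x. a \<otimes> x) v) = g p u v"
  if "u : \<T> A p" "v : \<T> A p" for p u v
  using left_invariant_g that unfolding left_invariant_metric_def by blast
qed

end

lemma smooth_on_from_derivative:
 fixes f :: "'e::euclidean_space => 'f::real_normed_vector"
 assumes "open V" "!!y. y : V ==> (f has_derivative D y) (at y)" "!!w. smooth_on V (%y. D y w)"
 shows "smooth_on V f"
 unfolding smooth_on_def
proof
 fix k
 have "Ck_on (Suc k) V f" by (rule Ck_on_SucI[OF assms(1,2)]) (use assms(3) in "auto simp: smooth_on_def")
 thus "Ck_on k V f" by (rule Ck_on_SucD)
qed

subsection \<open>Coordinates for \<open>\<alpha> = 1\<close>\<close>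

text \<open>The frame \<open>e\<^sub>1/2, (e\<^sub>2 + \<beta> e\<^sub>3)/2, e\<^sub>3\<close> has the single bracket \<open>[E\<^sub>1, E\<^sub>2] = E\<^sub>2\<close>, so the group is a quotient of the
  product of the affine group and the line by a discrete central subgroup.\<close>

locale special_group = metric_group G A g e1 e2 e3 1 \<beta> D
 for G :: "'p::{t2_space, second_countable_topology} monoid" (structure) and A :: "('p, real^3) atlas"
  and g e1 e2 e3 \<beta> D +
 assumes not_symmetric: "\<not> locally_symmetric A D"
begin

sublocale G1_frame A g frame \<beta> D ..

lemma beta_pos: "\<beta> > 0"
 using not_symmetric locally_symmetric_cases beta_nonneg by fastforce

sublocale half_plane_model \<beta> by unfold_locales (rule beta_pos)

definition gam :: "real^3 => real => 'p" where
 "gam u = (SOME \<gamma>. generates (field (%_. u)) \<gamma>)"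

lemma gam_generates: "generates (field (%_. u)) (gam u)"
 unfolding gam_def using exists_generated[OF left_field, of u] by (metis someI_ex)

lemma gam_hom: "one_parameter_subgroup G A (gam u)"
 using gam_generates unfolding generates_def by blast

lemmas gam_add = one_parameter_add[OF gam_hom]

abbreviation "\<gamma>1 \<equiv> gam (vector [0, 1/2, \<beta>/2])"
abbreviation "\<gamma>2 \<equiv> gam (vector [1/2, 0, 0])"
abbreviation "\<gamma>3 \<equiv> gam (vector [0, 0, 1])"

lemma gam_conjugate:
 assumes "brk 1 \<beta> (cross3 u v) = l *\<^sub>R v"
 shows "gam u s \<otimes> gam v t = gam v (exp (l * s) * t) \<otimes> gam u s"
proof -
 have "gam u s \<otimes> gam v t \<otimes> gam u (- s) = gam v (exp (l * s) * t)"
  by (rule conjugate_generated[OF left_field left_field gam_generates gam_generates])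
   (simp add: left_field_bracket_apply assms tvec_scale[symmetric])
 hence "gam v (exp (l * s) * t) \<otimes> gam u s = gam u s \<otimes> gam v t \<otimes> (gam u (- s) \<otimes> gam u s)"
  by (metis m_assoc UNIV_I carrier_UNIV)
 thus ?thesis by (simp add: gam_add)
qed

lemma gam_relations:
 "\<gamma>2 s \<otimes> \<gamma>1 t = \<gamma>1 (exp s * t) \<otimes> \<gamma>2 s" "\<gamma>3 s \<otimes> \<gamma>1 t = \<gamma>1 t \<otimes> \<gamma>3 s" "\<gamma>3 s \<otimes> \<gamma>2 t = \<gamma>2 t \<otimes> \<gamma>3 s"
 using gam_conjugate[of "vector [1/2, 0, 0]" "vector [0, 1/2, \<beta>/2]" 1 s t]
  gam_conjugate[of "vector [0, 0, 1]" "vector [0, 1/2, \<beta>/2]" 0 s t]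
  gam_conjugate[of "vector [0, 0, 1]" "vector [1/2, 0, 0]" 0 s t]
 by (simp_all add: brk_def cross3_def vec_eq_iff forall_3)

definition Psi :: "real^3 => 'p" where
 "Psi m = \<gamma>1 (m $ 1) \<otimes> \<gamma>2 (m $ 2) \<otimes> \<gamma>3 (m $ 3)"

lemma Psi_mult: "Psi (mmult a b) = Psi a \<otimes> Psi b"
proof -
 have "\<gamma>3 (a $ 3) \<otimes> (\<gamma>1 (b $ 1) \<otimes> (\<gamma>2 (b $ 2) \<otimes> \<gamma>3 (b $ 3))) = \<gamma>1 (b $ 1) \<otimes> (\<gamma>2 (b $ 2) \<otimes> (\<gamma>3 (a $ 3) \<otimes> \<gamma>3 (b $ 3)))"
  by (metis gam_relations(2,3) m_assoc UNIV_I carrier_UNIV)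
 moreover have "\<gamma>2 (a $ 2) \<otimes> (\<gamma>1 (b $ 1) \<otimes> z) = \<gamma>1 (exp (a $ 2) * b $ 1) \<otimes> (\<gamma>2 (a $ 2) \<otimes> z)" for z
  by (metis gam_relations(1) m_assoc UNIV_I carrier_UNIV)
 ultimately show ?thesis by (simp add: Psi_def mmult_def gam_add(1) m_assoc)
qed

lemma Psi_0 [simp]: "Psi 0 = \<one>"
 by (simp add: Psi_def gam_add)

lemma Psi_minv: "Psi (minv a) = inv (Psi a)"
 using Psi_mult[of "minv a" a] inv_equality[of "Psi (minv a)" "Psi a"] by simp

lemma Psi_smooth: "smooth_map flat_atlas A Psi"
proof -
 have "smooth_map (flat_atlas :: (real^3, real^3) atlas) A (%m. gam u (m $ i))" for u i
  by (rule smooth_map_compose[OF smooth_manifold_flat smooth_manifold_flat mfd _ one_parameter_smooth[OF gam_hom]])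
   (simp add: smooth_map_flat, intro smooth_intros open_UNIV)
 thus ?thesis unfolding Psi_def by (intro smooth_map_mult smooth_manifold_flat)
qed

sublocale MG: two_manifolds "flat_atlas :: (real^3, real^3) atlas" A ..

lemma Psi_comp: "f : \<F> A ==> smooth_on UNIV (%m. f (Psi m))"
 using MG.smooth_functions_comp[OF Psi_smooth] by (simp add: smooth_functions_flat)

lemma Psi_derivative:
 assumes f: "f : \<F> A"
 shows "Df (%m. f (Psi m)) m h = tvec (Psi m) (cof \<beta> m h) f"
proof -
 note S = Psi_comp[OF f]
 have lin: "linear (Df (%m. f (Psi m)) m)"
  by (rule has_derivative_linear[OF smooth_on_has_derivative[OF S UNIV_I]])
 have partial: "Df (%m. f (Psi m)) m k = c * tvec (Psi m) u f"
  if "!!s. Psi (m + s *\<^sub>R k) = Psi m \<otimes> gam u (c * s)" for k u c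
 proof -
  have "has_velocity A (%s. Psi m \<otimes> gam u s) (field (%_. u) (Psi m \<otimes> gam u 0)) 0"
   by (rule translated_velocity[OF left_field generates_velocity[OF left_field gam_generates]])
  hence "((%s. f (Psi m \<otimes> gam u s)) has_real_derivative tvec (Psi m) u f) (at (c * 0))"
   using f unfolding has_velocity_def by (simp add: gam_add)
  from DERIV_chain2[OF this DERIV_cmult_Id]
  have "((%s. f (Psi (m + s *\<^sub>R k))) has_real_derivative c * tvec (Psi m) u f) (at 0)"
   by (simp add: that mult.commute)
  moreover have "((%s. f (Psi (m + s *\<^sub>R k))) has_real_derivative Df (%m. f (Psi m)) m k) (at 0)"
   using smooth_on_has_real_derivative_line[OF S, of m 0 k] by simp
  ultimately show ?thesis using DERIV_unique by blast
 qed
 have a: "m + s *\<^sub>R axis 1 1 = mmult m (vector [exp (- m $ 2) * s, 0, 0])" "m + s *\<^sub>R axis 2 1 = mmult m (vector [0, s, 0])"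
  "m + s *\<^sub>R axis 3 1 = mmult m (vector [0, 0, s])" for s
  by (simp_all add: mmult_def vec_eq_iff forall_3 axis_def exp_minus)
 have P: "Psi (vector [s, 0, 0]) = \<gamma>1 s" "Psi (vector [0, s, 0]) = \<gamma>2 s" "Psi (vector [0, 0, s]) = \<gamma>3 s" for s
  by (simp_all add: Psi_def gam_add)
 have "h = h $ 1 *\<^sub>R axis 1 1 + (h $ 2 *\<^sub>R axis 2 1 + h $ 3 *\<^sub>R axis 3 1)"
  by (simp add: vec_eq_iff forall_3 axis_def)
 hence "Df (%m. f (Psi m)) m h =
   Df (%m. f (Psi m)) m (h $ 1 *\<^sub>R axis 1 1 + (h $ 2 *\<^sub>R axis 2 1 + h $ 3 *\<^sub>R axis 3 1))" by simp
 also have "\<dots> = h $ 1 * (exp (- m $ 2) * tvec (Psi m) (vector [0, 1/2, \<beta>/2]) f)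
   + (h $ 2 * (1 * tvec (Psi m) (vector [1/2, 0, 0]) f) + h $ 3 * (1 * tvec (Psi m) (vector [0, 0, 1]) f))"
  unfolding linear_add[OF lin] linear_cmul[OF lin] real_scaleR_def
  by (intro arg_cong2[of _ _ _ _ plus] arg_cong2[of _ _ _ _ times] refl partial) (simp_all only: a Psi_mult P mult_1)
 also have "\<dots> = tvec (Psi m) (cof \<beta> m h) f"
  by (simp add: tvec_def sum_3 cof_def algebra_simps)
 finally show ?thesis .
qed

lemma Psi_push: "push A Psi (fld V m) = tvec (Psi m) (cof \<beta> m (V m))"
 by (rule push_fld[OF mfd Psi_smooth Psi_derivative tangent_nonsmooth[OF tvec_tangent]])

lemma coord_chart_tangent_smooth:
 assumes U: "(U, \<phi>) : A"
 shows "smooth_on (\<phi> ` U) (%y. coord (inv_into U \<phi> y) (chart_tangent U \<phi> (inv_into U \<phi> y) w) $ i)"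
proof (rule smooth_on_local)
 fix y assume y: "y : \<phi> ` U"
 hence p: "inv_into U \<phi> y : U" by (rule inv_into_into)
 obtain X W where X: "X : \<XX> A" "open W" "inv_into U \<phi> y : W" "W \<subseteq> U" "!!q. q : W ==> X q = chart_tangent U \<phi> q w"
  by (rule coordinate_field_extension[OF U p]) blast
 have o: "open (\<phi> ` W)" by (rule open_chart_image[OF U X(2,4)])
 have "(%q. coord q (X q) $ i) : \<F> A"
  using vector_field_eq_field(2)[OF X(1)] smooth_vecD by blast
 hence "smooth_on (\<phi> ` U) (%y. coord (inv_into U \<phi> y) (X (inv_into U \<phi> y)) $ i)"
  by (rule smooth_functions_chart[OF _ U])
 hence "smooth_on (\<phi> ` W) (%y. coord (inv_into U \<phi> y) (X (inv_into U \<phi> y)) $ i)"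
  by (rule smooth_on_subset) (use X(4) in blast)
 hence "smooth_on (\<phi> ` W) (%y. coord (inv_into U \<phi> y) (chart_tangent U \<phi> (inv_into U \<phi> y) w) $ i)"
  by (rule smooth_on_cong[OF _ o]) (use X(5) chart_inverse_mem[OF U X(4)] in auto)
 moreover have "y : \<phi> ` W" using imageI[OF X(3), of \<phi>] f_inv_into_f[OF y] by simp
 ultimately show "\<exists>V. open V & y : V & smooth_on V (%y. coord (inv_into U \<phi> y) (chart_tangent U \<phi> (inv_into U \<phi> y) w) $ i)"
  using o by blast
qed

text \<open>The local inverse given by the inverse function theorem is smooth because its derivative is known: \<open>dv/2, e\<^sup>-\<^sup>v dx/2\<close> and
  \<open>dt + \<beta> e\<^sup>-\<^sup>v dx/2\<close> are the components of a tangent vector in the frame.\<close>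

lemma Psi_local_section:
 obtains V \<sigma> U' where "open V" "Psi m0 : V" "!!p. p : V ==> Psi (\<sigma> p) = p" "!!p. p : V ==> smooth_at A flat_atlas \<sigma> p"
  "open U'" "m0 : U'" "inj_on Psi U'"
proof -
 obtain U \<phi> where U: "(U, \<phi>) : A" "Psi m0 : U" by (rule chart_at)
 note ch = chart[OF U(1)]
 have cont: "continuous_on UNIV Psi" using Psi_smooth unfolding smooth_map_def by blast
 define W0 where "W0 = Psi -` U"
 have W0: "open W0" "m0 : W0" using open_vimage[OF ch(1) cont] U(2) by (auto simp: W0_def)
 define f where "f = (%m. \<phi> (Psi m))"
 have fs: "smooth_on W0 f"
 proof -
  have "smooth_on (id ` (UNIV \<inter> Psi -` U)) (\<phi> \<circ> Psi \<circ> inv_into UNIV id)"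
   using Psi_smooth U(1) unfolding smooth_map_def by blast
  thus ?thesis by (simp add: f_def W0_def o_def id_def)
 qed
 have tv: "tvec (Psi m) (cof \<beta> m h) = chart_tangent U \<phi> (Psi m) (Df f m h)" if m: "m : W0" for m h
 proof (rule tangent_eqI[OF tvec_tangent chart_tangent_in_tangent_space])
  show PU: "(U, \<phi>) : A" "Psi m : U" using U m by (auto simp: W0_def)
  fix F assume F: "F : \<F> A"
  have 1: "((%y. F (inv_into U \<phi> y)) has_derivative (%a. chart_tangent U \<phi> (Psi m) a F)) (at (f m))"
   unfolding f_def by (rule chart_rep_has_derivative[OF PU F])
  have "((%m. F (inv_into U \<phi> (f m))) has_derivative (%h. chart_tangent U \<phi> (Psi m) (Df f m h) F)) (at m)"
   by (rule has_derivative_compose[OF smooth_on_has_derivative[OF fs m] 1])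
  hence "((%m. F (Psi m)) has_derivative (%h. chart_tangent U \<phi> (Psi m) (Df f m h) F)) (at m)"
   by (rule has_derivative_transform_within_open[OF _ W0(1) m]) (use U(1) in "auto simp: f_def W0_def")
  from frechet_derivative_at[OF this]
  show "tvec (Psi m) (cof \<beta> m h) F = chart_tangent U \<phi> (Psi m) (Df f m h) F"
   using Psi_derivative[OF F] by metis
 qed
 have inj: "inj (Df f m)" if m: "m : W0" for m
 proof (rule injI)
  fix x y assume "Df f m x = Df f m y"
  hence "tvec (Psi m) (cof \<beta> m x) = tvec (Psi m) (cof \<beta> m y)" using tv[OF m] by simp
  thus "x = y" using cof_inject by simp
 qed
 define f' where "f' = (%m. Blinfun (Df f m))"
 have fd: "blinfun_apply (f' m) = Df f m" if "m : W0" for m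
  unfolding f'_def by (rule bounded_linear_Blinfun_apply[OF has_derivative_bounded_linear[OF smooth_on_has_derivative[OF fs that]]])
 have der: "(f has_derivative blinfun_apply (f' m)) (at m)" if "m : W0" for m
  unfolding fd[OF that] by (rule smooth_on_has_derivative[OF fs that])
 have cf: "continuous_on W0 f'"
 proof (rule continuous_on_blinfun_componentwise)
  show "continuous_on W0 (%m. blinfun_apply (f' m) i)" for i
   using smooth_on_imp_continuous_on[OF smooth_on_frechet_derivative[OF fs, of i]]
   by (rule continuous_on_eq) (simp add: fd)
 qed
 obtain h where h: "linear h" "h \<circ> Df f m0 = id"
  using linear_injective_left_inverse[OF has_derivative_linear[OF smooth_on_has_derivative[OF fs W0(2)]] inj[OF W0(2)]] by blast
 have "Blinfun h o\<^sub>L f' m0 = id_blinfun"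
  by (rule blinfun_eqI) (use fun_cong[OF h(2)] h(1) in
   "simp add: fd[OF W0(2)] bounded_linear_Blinfun_apply linear_conv_bounded_linear")
 from inverse_function_theorem[OF W0(1) der cf W0(2) this]
 obtain U' V k k' where IF: "open U'" "U' \<subseteq> W0" "m0 : U'" "open V" "f m0 : V" "homeomorphism U' V f k"
  "!!y. y : V ==> (k has_derivative k' y) (at y)" "!!y. y : V ==> k' y = inv_into UNIV (blinfun_apply (f' (k y)))"
  "!!y. y : V ==> bij (blinfun_apply (f' (k y)))" by blast
 have kV: "k y : U'" "f (k y) = y" if "y : V" for y
  using homeomorphism_apply2[OF IF(6) that] homeomorphism_image2[OF IF(6)] that by auto
 have VU: "V \<subseteq> \<phi> ` U" using IF(2) homeomorphism_image1[OF IF(6)] by (auto simp: f_def W0_def)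
 have Pk: "Psi (k y) = inv_into U \<phi> y" if "y : V" for y
 proof -
  have "Psi (k y) : U" using kV[OF that] IF(2) by (auto simp: W0_def)
  from chart_inverse[OF U(1) this] show ?thesis using kV(2)[OF that] unfolding f_def by simp
 qed
 define \<omega> where "\<omega> = (%w y. coord (inv_into U \<phi> y) (chart_tangent U \<phi> (inv_into U \<phi> y) w))"
 have w: "cof \<beta> (k y) (k' y w) = \<omega> w y" if y: "y : V" for y w
 proof -
  have W: "k y : W0" using kV[OF y] IF(2) by blast
  have "blinfun_apply (f' (k y)) (k' y w) = w"
   unfolding IF(8)[OF y] by (rule surj_f_inv_f[OF bij_is_surj[OF IF(9)[OF y]]])
  hence "tvec (Psi (k y)) (cof \<beta> (k y) (k' y w)) = chart_tangent U \<phi> (Psi (k y)) w"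
   using tv[OF W, of "k' y w"] fd[OF W] by simp
  thus ?thesis unfolding \<omega>_def Pk[OF y, symmetric] by (metis coord_tvec)
 qed
 have \<omega>s: "smooth_on V (%y. \<omega> w y $ i)" for w i
  unfolding \<omega>_def by (rule smooth_on_subset[OF coord_chart_tangent_smooth[OF U(1)] VU])
 have kd: "((%y. k y $ i) has_derivative (%w. k' y w $ i)) (at y)" if "y : V" for y i
  by (rule has_derivative_compose[OF IF(7)[OF that] bounded_linear_imp_has_derivative[OF bounded_linear_vec_nth]])
 have c: "k' y w $ 2 = 2 * \<omega> w y $ 1" "k' y w $ 1 = 2 * exp (k y $ 2) * \<omega> w y $ 2" "k' y w $ 3 = \<omega> w y $ 3 - \<beta> * \<omega> w y $ 2"
  if "y : V" for y w
  unfolding w[OF that, symmetric] by (simp_all add: cof_def exp_minus)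
 have sk: "smooth_on V (%y. k y $ i)" if "!!w y. y : V ==> k' y w $ i = r w y" "!!w. smooth_on V (r w)" for r i
  by (rule smooth_on_from_derivative[OF IF(4) kd], assumption, rule smooth_on_cong[OF that(2) IF(4)], rule that(1)[symmetric])
 have k2: "smooth_on V (%y. k y $ 2)"
  by (rule sk[OF c(1)], assumption) (intro smooth_intros IF(4) \<omega>s)
 have k1: "smooth_on V (%y. k y $ 1)"
  by (rule sk[OF c(2)], assumption) (intro smooth_intros IF(4) \<omega>s k2)
 have k3: "smooth_on V (%y. k y $ 3)"
  by (rule sk[OF c(3)], assumption) (intro smooth_intros IF(4) \<omega>s)
 have ks: "smooth_on V k"
  by (rule smooth_on_vec_lambda[OF IF(4)], rule forall_3[THEN iffD2, rule_format]) (intro conjI k1 k2 k3)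
 show thesis
 proof (rule that[of "U \<inter> \<phi> -` V" "%p. k (\<phi> p)" U'])
  show oV: "open (U \<inter> \<phi> -` V)" by (rule continuous_open_preimage[OF ch(5,1) IF(4)])
  show "Psi m0 : U \<inter> \<phi> -` V" using U(2) IF(5) by (simp add: f_def)
  show "Psi (k (\<phi> p)) = p" if "p : U \<inter> \<phi> -` V" for p using that Pk[of "\<phi> p"] U(1) by simp
  show "inj_on Psi U'"
  proof (rule inj_onI)
   fix x y assume "x : U'" "y : U'" "Psi x = Psi y"
   thus "x = y" using homeomorphism_apply1[OF IF(6)] f_def by metis
  qed
  show "smooth_at A flat_atlas (%p. k (\<phi> p)) p" if "p : U \<inter> \<phi> -` V" for p
  proof (rule smooth_atI[OF U(1) _ oV that])
   have "smooth_on (\<phi> ` (U \<inter> \<phi> -` V)) k" by (rule smooth_on_subset[OF ks]) blast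
   thus "smooth_on (\<phi> ` (U \<inter> \<phi> -` V)) (%y. id (k (\<phi> (inv_into U \<phi> y))))"
    by (rule smooth_on_cong[OF _ open_chart_image[OF U(1) oV]]) (use U(1) in auto)
  qed auto
 qed (rule IF(1,3))+
qed

end

subsection \<open>The covering by the half-plane model\<close>

lemma (in smooth_manifold) smooth_at_isCont: "smooth_manifold B ==> smooth_at A B F p ==> isCont F p"
proof -
 assume B: "smooth_manifold B" and F: "smooth_at A B F p"
 interpret B: smooth_manifold B by (rule B)
 interpret AB: two_manifolds A B ..
 obtain U \<phi> where U: "(U, \<phi>) : A" "p : U" by (rule chart_at)
 obtain V \<psi> where V: "(V, \<psi>) : B" "F p : V" by (rule B.chart_at)
 obtain W where "open W" "p : W" "continuous_on W F" by (rule AB.smooth_at_charts[OF F U V]) blast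
 thus "isCont F p" using continuous_on_eq_continuous_at by blast
qed

context special_group
begin

lemma Psi_surj: "surj Psi"
proof -
 have 1: "open (range Psi)"
  unfolding open_subopen[of "range Psi"]
 proof
  fix p assume "p : range Psi"
  then obtain m where m: "p = Psi m" by blast
  obtain V \<sigma> U' where "open V" "Psi m : V" "!!p. p : V ==> Psi (\<sigma> p) = p"
   by (rule Psi_local_section[of m]) blast
  thus "\<exists>T. open T & p : T & T \<subseteq> range Psi" using m by (metis rangeI subsetI)
 qed
 have "open (- range Psi)"
  unfolding open_subopen[of "- range Psi"]
 proof
  fix q assume q: "q : - range Psi"
  have c: "continuous_on UNIV (%p. inv q \<otimes> p)" using left_translation_smooth unfolding smooth_map_def by blast
  have "inv q \<otimes> q : range Psi" using Psi_0 by (metis l_inv UNIV_I carrier_UNIV rangeI)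
  moreover have "p : - range Psi" if iqp: "inv q \<otimes> p : range Psi" for p
  proof
   assume "p : range Psi"
   then obtain m where m: "p = Psi m" by blast
   obtain n where n: "inv q \<otimes> p = Psi n" using iqp by blast
   have "q = p \<otimes> inv (inv q \<otimes> p)" by (simp add: inv_mult_group m_assoc[symmetric])
   hence "q = Psi (mmult m (minv n))" unfolding n unfolding m by (simp add: Psi_mult Psi_minv)
   thus False using q by blast
  qed
  ultimately show "\<exists>T. open T & q : T & T \<subseteq> - range Psi"
   using open_vimage[OF 1 c] by (intro exI[of _ "(%p. inv q \<otimes> p) -` range Psi"]) auto
 qed
 hence "closed (range Psi)" by (simp add: closed_def)
 moreover have "\<forall>T :: 'p set. open T & closed T --> T = {} | T = UNIV"
  using connected_group by (simp add: connected_clopen)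
 ultimately have "range Psi = {} | range Psi = UNIV" using 1 by blast
 thus ?thesis by blast
qed

lemma Psi_kernel_discrete:
 obtains r where "r > 0" "!!m. Psi m = \<one> ==> norm m < r ==> m = 0"
proof -
 obtain U' where U': "open U'" "0 : U'" "inj_on Psi U'" by (rule Psi_local_section[of 0]) blast
 then obtain r where r: "r > 0" "ball 0 r \<subseteq> U'" using open_contains_ball by blast
 show thesis
  by (rule that[OF r(1)]) (use r U' Psi_0 in "auto simp: inj_on_def subset_iff")
qed

text \<open>The kernel is a discrete normal subgroup. Commutators of its elements with small elements vanish, so it is central.\<close>

lemma Psi_kernel:
 assumes n: "Psi n = \<one>" shows "n $ 1 = 0" "n $ 2 = 0"
proof -
 obtain r where r: "r > 0" "!!m. Psi m = \<one> ==> norm m < r ==> m = 0" by (rule Psi_kernel_discrete) blast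
 have small: "x = 0" if "Psi (vector [x, 0, 0]) = \<one>" "\<bar>x\<bar> < r" for x
  using r(2)[OF that(1)] that(2) by (simp add: norm_vec_def L2_set_def sum_3 vec_eq_iff forall_3)
 have conj: "Psi (mmult (mmult (mmult c n) (minv c)) (minv n)) = \<one>" for c
  by (simp add: Psi_mult Psi_minv n)
 have c1: "mmult (mmult (mmult (vector [x, 0, 0]) n) (minv (vector [x, 0, 0]))) (minv n) = vector [x * (1 - exp (n $ 2)), 0, 0]" for x
  by (simp add: mmult_def minv_def vec_eq_iff forall_3 exp_minus field_simps)
\<comment> \<open>Nonzero, but so small that the commutator \<open>c1\<close> lies in the ball on which the kernel is trivial.\<close>
 define x where "x = (r / 2) / (1 + \<bar>1 - exp (n $ 2)\<bar>)"
 have "\<bar>x * (1 - exp (n $ 2))\<bar> = (r / 2) * (\<bar>1 - exp (n $ 2)\<bar> / (1 + \<bar>1 - exp (n $ 2)\<bar>))"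
  using r by (simp add: x_def abs_mult)
 also have "\<dots> <= (r / 2) * 1" using r by (intro mult_left_mono) auto
 finally have "x * (1 - exp (n $ 2)) = 0" using small[of "x * (1 - exp (n $ 2))"] conj[of "vector [x, 0, 0]", unfolded c1] r by simp
 moreover have "x ~= 0" using r unfolding x_def by (auto simp: add_nonneg_eq_0_iff)
 ultimately show n2: "n $ 2 = 0" by simp
 have c2: "mmult (mmult (mmult (vector [0, v, 0]) n) (minv (vector [0, v, 0]))) (minv n) = vector [(exp v - 1) * n $ 1, 0, 0]" for v
  using n2 by (simp add: mmult_def minv_def vec_eq_iff forall_3 exp_minus field_simps)
 define \<epsilon> where "\<epsilon> = (r / 2) / (1 + \<bar>n $ 1\<bar>)"
 have \<epsilon>: "\<epsilon> > 0" using r by (simp add: \<epsilon>_def)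
 have "\<bar>\<epsilon> * n $ 1\<bar> = (r / 2) * (\<bar>n $ 1\<bar> / (1 + \<bar>n $ 1\<bar>))"
  using r by (simp add: \<epsilon>_def abs_mult)
 also have "\<dots> <= (r / 2) * 1" using r by (intro mult_left_mono) auto
 finally have "\<epsilon> * n $ 1 = 0" using small[of "\<epsilon> * n $ 1"] conj[of "vector [0, ln (1 + \<epsilon>), 0]", unfolded c2] r \<epsilon> by simp
 thus "n $ 1 = 0" using \<epsilon> by simp
qed

lemma Psi_eqD:
 assumes "Psi m = Psi n"
 obtains t where "Psi (vector [0, 0, t]) = \<one>" "n = mmult (vector [0, 0, t]) m"
proof (rule that)
 have "Psi (mmult n (minv m)) = \<one>" using assms by (simp add: Psi_mult Psi_minv)
 moreover from Psi_kernel[OF this] have "mmult n (minv m) = vector [0, 0, n $ 3 - m $ 3]"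
  by (simp add: vec_eq_iff forall_3) (simp add: mmult_def minv_def)
 ultimately show "Psi (vector [0, 0, n $ 3 - m $ 3]) = \<one>" "n = mmult (vector [0, 0, n $ 3 - m $ 3]) m"
  by (metis mmult_assoc mmult_minv(2) mmult_0(1))+
qed

subsection \<open>Maps descending from the model\<close>

text \<open>Local sections of \<open>Psi\<close> reduce smoothness on \<open>G\<close> to smoothness on the model, together with the parameter \<open>k\<close>.\<close>

lemma descend_action_smooth:
 fixes h :: "'k::{euclidean_space, second_countable_topology} \<times> (real^3) => real^3"
 assumes h: "smooth_on UNIV h" and act: "!!k m. act k (Psi m) = Psi (h (k, m))"
 shows "smooth_map (prod_atlas flat_atlas A) A (%(k, p). act k p)"
proof -
 interpret KA: smooth_manifold "prod_atlas (flat_atlas :: ('k, 'k) atlas) A" by (rule smooth_manifold_prod[OF smooth_manifold_flat mfd])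
 interpret KAA: two_manifolds "prod_atlas (flat_atlas :: ('k, 'k) atlas) A" A ..
 have "smooth_at (prod_atlas flat_atlas A) A (%(k, p). act k p) z" for z
 proof -
  obtain m where m: "snd z = Psi m" using Psi_surj by blast
  obtain V \<sigma> U' where V: "open V" "Psi m : V" "!!p. p : V ==> Psi (\<sigma> p) = p" "!!p. p : V ==> smooth_at A flat_atlas \<sigma> p"
   by (rule Psi_local_section[of m]) blast
  have 1: "smooth_at (prod_atlas flat_atlas A) (prod_atlas flat_atlas flat_atlas) (%z. (fst z, \<sigma> (snd z))) z"
   by (intro smooth_at_Pair KA.smooth_manifold_axioms smooth_manifold_flat smooth_at_fst_snd mfd
     smooth_at_compose[OF KA.smooth_manifold_axioms mfd smooth_manifold_flat smooth_at_fst_snd(2)[OF smooth_manifold_flat mfd]])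
    (simp add: m V)
  have 2: "smooth_at flat_atlas flat_atlas h x" for x unfolding smooth_at_flat using h by blast
  have 3: "smooth_at flat_atlas A Psi x" for x using Psi_smooth unfolding MG.smooth_map_iff by blast
  have "smooth_at (prod_atlas flat_atlas A) A (%z. Psi (h (fst z, \<sigma> (snd z)))) z"
   by (rule smooth_at_compose[OF KA.smooth_manifold_axioms smooth_manifold_flat mfd smooth_at_compose[OF KA.smooth_manifold_axioms
      smooth_manifold_flat smooth_manifold_flat 1[unfolded prod_flat_atlas] 2] 3])
  thus ?thesis
  proof (rule KAA.smooth_at_local[of _ _ "UNIV \<times> V"])
   show "Psi (h (fst q, \<sigma> (snd q))) = (case q of (k, p) => act k p)" if "q : UNIV \<times> V" for q
    using that V(3) act[of "fst q" "\<sigma> (snd q)"] by (auto simp: case_prod_beta)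
  qed (use V m in "auto intro: open_Times simp: mem_Times_iff")
 qed
 thus ?thesis unfolding KAA.smooth_map_iff by blast
qed

lemma descend_smooth:
 assumes H: "smooth_on UNIV H" and F: "!!m. F (Psi m) = Psi (H m)"
 shows "smooth_map A A F"
proof -
 interpret RA: smooth_manifold "prod_atlas (flat_atlas :: (real, real) atlas) A" by (rule smooth_manifold_prod[OF smooth_manifold_flat mfd])
 interpret A_RA: two_manifolds A "prod_atlas (flat_atlas :: (real, real) atlas) A" ..
 have "smooth_on UNIV (%z :: real \<times> (real^3). H (snd z))"
  by (rule smooth_on_compose[OF H open_UNIV]) (auto intro: smooth_intros)
 hence s: "smooth_map (prod_atlas flat_atlas A) A (%(k :: real, p). F p)"
  by (rule descend_action_smooth) (simp add: F)
 have "smooth_map A (prod_atlas flat_atlas A) (%p. (0 :: real, p))"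
  unfolding A_RA.smooth_map_iff by (intro allI smooth_at_Pair mfd smooth_manifold_flat smooth_at_const smooth_at_id)
 from smooth_map_compose[OF mfd RA.smooth_manifold_axioms mfd this s] show ?thesis by simp
qed

text \<open>\<open>Psi\<close> carries the coframe \<open>cof\<close> to the one dual to the frame, and \<open>phi\<close> is \<open>cof\<close> turned by \<open>2 t / \<beta>\<close>; this is where the
  position dependent part of the angle comes from.\<close>

lemma descend_push:
 assumes H: "turns \<theta> H" and F: "!!m. F (Psi m) = Psi (H m)"
 shows "push A F (tvec (Psi m) x) = tvec (Psi (H m)) (rot (\<theta> + 2 * m $ 3 / \<beta> - 2 * H m $ 3 / \<beta>) x)"
proof -
 have Hs: "smooth_on UNIV H" using H by (simp add: turns_def)
 have cof: "cof \<beta> m y = rot (- 2 * m $ 3 / \<beta>) (phi m y)" for m y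
  using cof_ifr[of m "phi m y"] by simp
 define h where "h = ifr m (rot (2 * m $ 3 / \<beta>) x)"
 have x: "cof \<beta> m h = x" by (simp add: h_def cof_ifr rot_rot)
 have "push A F (tvec (Psi m) x) = push A F (push A Psi (fld (%_. h) m))" by (simp add: Psi_push x)
 also have "\<dots> = push A Psi (push flat_atlas H (fld (%_. h) m))"
  unfolding push_compose[OF mfd mfd descend_smooth[where H=H, OF Hs F]] push_compose[OF smooth_manifold_flat mfd Psi_smooth] F ..
 also have "\<dots> = tvec (Psi (H m)) (cof \<beta> (H m) (Df H m h))"
  unfolding push_fld_flat[OF Hs smooth_on_has_derivative[OF Hs UNIV_I]] Psi_push ..
 also have "cof \<beta> (H m) (Df H m h) = rot (- 2 * H m $ 3 / \<beta>) (rot \<theta> (phi m h))"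
  unfolding cof using H by (simp add: turns_def)
 also have "phi m h = rot (2 * m $ 3 / \<beta>) x" by (simp add: h_def)
 also have "rot (- 2 * H m $ 3 / \<beta>) (rot \<theta> (rot (2 * m $ 3 / \<beta>) x)) = rot (\<theta> + 2 * m $ 3 / \<beta> - 2 * H m $ 3 / \<beta>) x"
  unfolding rot_rot by (rule arg_cong[of _ _ "%a. rot a x"]) simp
 finally show ?thesis .
qed

lemma rot_inner: "rot a x \<bullet> rot a y = x \<bullet> y"
proof -
 have "rot a x \<bullet> rot a y = ((sin a)\<^sup>2 + (cos a)\<^sup>2) * (x $ 1 * y $ 1 + x $ 2 * y $ 2) + x $ 3 * y $ 3"
  unfolding inner_vec_def sum_3 rot_def vector_3 inner_real_def power2_eq_square by (simp only: algebra_simps)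
 thus ?thesis by (simp add: inner_vec_def sum_3)
qed

lemma descend_isometry:
 assumes H: "turns \<theta> H" and F: "!!m. F (Psi m) = Psi (H m)"
  and K: "smooth_on UNIV K" and F': "!!m. F' (Psi m) = Psi (K m)" and inv: "!!p. F' (F p) = p" "!!p. F (F' p) = p"
 shows "isometry A g F"
 unfolding isometry_def
proof (intro conjI allI ballI)
 have s: "smooth_map A A F" by (rule descend_smooth[where H=H, OF _ F]) (use H in "simp add: turns_def")
 have i: "inv_into UNIV F = F'" by (rule inv_unique_comp) (auto simp: inv fun_eq_iff)
 show "bij F" by (rule o_bij[of F']) (auto simp: inv fun_eq_iff)
 show "smooth_map A A F" by (rule s)
 show "smooth_map A A (inv_into UNIV F)" unfolding i by (rule descend_smooth[where H=K, OF K F'])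
 fix p u v assume uv: "u : \<T> A p" "v : \<T> A p"
 obtain m where m: "p = Psi m" using Psi_surj by blast
 have "push A F u = tvec (F p) (rot (\<theta> + 2 * m $ 3 / \<beta> - 2 * H m $ 3 / \<beta>) (coord p u))"
  "push A F v = tvec (F p) (rot (\<theta> + 2 * m $ 3 / \<beta> - 2 * H m $ 3 / \<beta>) (coord p v))"
  using descend_push[OF H F, where m=m] tvec_coord[OF uv(1)] tvec_coord[OF uv(2)] unfolding m F by metis+
 thus "g (F p) (push A F u) (push A F v) = g p u v"
  using uv by (simp add: metric_tvec rot_inner)
qed

text \<open>The kernel of \<open>Psi\<close> consists of vertical vectors, so a map commuting with the vertical translations descends.\<close>

definition descent :: "(real^3 => real^3) => 'p => 'p" where
 "descent H p = Psi (H (inv_into UNIV Psi p))"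

lemma descent_Psi:
 assumes "!!t m. H (mmult (vector [0, 0, t]) m) = mmult (vector [0, 0, t]) (H m)"
 shows "descent H (Psi m) = Psi (H m)"
proof -
 obtain t where t: "Psi (vector [0, 0, t]) = \<one>" "m = mmult (vector [0, 0, t]) (inv_into UNIV Psi (Psi m))"
  by (rule Psi_eqD[of "inv_into UNIV Psi (Psi m)" m]) (auto simp: f_inv_into_f)
 have "Psi (H m) = Psi (mmult (vector [0, 0, t]) (H (inv_into UNIV Psi (Psi m))))" using t(2) assms by metis
 thus ?thesis by (simp add: descent_def Psi_mult t(1))
qed

lemma isotropy_rotations:
 "\<exists>F. isometry A g F & F \<one> = \<one> & (\<forall>x. push A F (tvec \<one> x) =
   tvec \<one> (vector [cos \<theta> * x $ 1 - sin \<theta> * x $ 2, sin \<theta> * x $ 1 + cos \<theta> * x $ 2, x $ 3]))"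
proof (intro exI conjI allI)
 have F: "descent (spin a) (Psi m) = Psi (spin a m)" for a m by (rule descent_Psi[OF spin_mmult_vertical])
 have i: "descent (spin a) (descent (spin b) p) = p" if "a + b = 0" for a b p
 proof -
  obtain m where "p = Psi m" using Psi_surj by blast
  thus ?thesis using that by (simp add: F spin_spin)
 qed
 have s: "smooth_on UNIV (spin (- \<theta>))" by (intro smooth_intros)
 show "isometry A g (descent (spin \<theta>))"
  by (rule descend_isometry[where H="spin \<theta>" and K="spin (- \<theta>)" and F'="descent (spin (- \<theta>))", OF turns_spin F s F]) (simp_all add: i)
 show "descent (spin \<theta>) \<one> = \<one>" using F[of \<theta> 0] by simp
 show "push A (descent (spin \<theta>)) (tvec \<one> x) =
   tvec \<one> (vector [cos \<theta> * x $ 1 - sin \<theta> * x $ 2, sin \<theta> * x $ 1 + cos \<theta> * x $ 2, x $ 3])" for x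
  using descend_push[where m=0 and x=x, OF turns_spin F, of \<theta>] by (simp add: rot_def)
qed

subsection \<open>The simply connected case\<close>

text \<open>A nontrivial kernel is generated by some \<open>(0, 0, t0)\<close>; the map \<open>exp (2 \<pi> i t / t0)\<close> then descends to \<open>G\<close> and
  takes the loop \<open>\<gamma>\<^sub>3 (t0 s)\<close>, \<open>0 \<le> s \<le> 1\<close>, to the unit circle, which is not contractible in the punctured plane.\<close>

lemma discrete_subgroup_generator:
 fixes N :: "real set"
 assumes diff: "!!s t. s : N ==> t : N ==> s - t : N" and r: "r > 0" "!!t. t : N ==> \<bar>t\<bar> < r ==> t = 0"
  and a: "a : N" "a ~= 0"
 obtains t0 where "t0 > 0" "t0 : N" "!!t. t : N ==> \<exists>k::int. t = k * t0"
proof -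
 have 0: "0 : N" using diff[OF a(1) a(1)] by simp
 have neg: "- t : N" if "t : N" for t using diff[OF 0 that] by simp
 have add: "s + t : N" if "s : N" "t : N" for s t using diff[OF that(1) neg[OF that(2)]] by simp
 have ge: "t >= r" if "t : N" "t > 0" for t using r(2)[OF that(1)] that(2) by fastforce
 define P where "P = (%n::nat. \<exists>t\<in>N. 0 < t & t <= n * r)"
 have "\<exists>n. P n"
 proof -
  obtain n :: nat where "\<bar>a\<bar> / r < n" using reals_Archimedean2 by blast
  hence "\<bar>a\<bar> <= n * r" using r(1) by (simp add: field_simps)
  moreover have "\<bar>a\<bar> : N" using a neg by (simp add: abs_if)
  ultimately have "P n" using a(2) unfolding P_def by (intro bexI[of _ "\<bar>a\<bar>"]) auto
  thus ?thesis ..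
 qed
 hence L: "P (LEAST n. P n)" by (rule LeastI_ex)
 then obtain t0 where t0: "t0 : N" "0 < t0" "t0 <= (LEAST n. P n) * r" unfolding P_def by blast
 have pos: "0 < (LEAST n. P n)" using t0 by (cases "(LEAST n. P n) = 0") auto
 have min: "\<not> (0 < t & t < t0)" if "t : N" for t
 proof
  assume t: "0 < t & t < t0"
  hence "t0 - t >= r" using ge diff[OF t0(1) that] by simp
  hence "t <= (LEAST n. P n) * r - r" using t0(3) by simp
  also have "\<dots> = ((LEAST n. P n) - 1 :: nat) * r" using pos by (simp add: of_nat_diff algebra_simps)
  finally have "P ((LEAST n. P n) - 1)" using that t unfolding P_def by blast
  thus False using not_less_Least[of "(LEAST n. P n) - 1" P] pos by simp
 qed
 have mult: "real n * t0 : N" for n by (induction n) (auto simp: 0 algebra_simps intro: add t0)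
 have imult: "of_int k * t0 : N" for k :: int
 proof (cases "k >= 0")
  case True thus ?thesis using mult[of "nat k"] by simp
 next
  case False thus ?thesis using neg[OF mult[of "nat (- k)"]] by simp
 qed
 show thesis
 proof (rule that[OF t0(2,1)])
  fix t assume t: "t : N"
  define k where "k = \<lfloor>t / t0\<rfloor>"
  have "of_int k <= t / t0" "t / t0 < of_int k + 1" unfolding k_def by linarith+
  hence "0 <= t - k * t0" "t - k * t0 < t0" using t0(2) by (simp_all add: field_simps)
  moreover have "\<not> (0 < t - k * t0 & t - k * t0 < t0)" by (rule min[OF diff[OF t imult]])
  ultimately show "\<exists>k::int. t = k * t0" by (intro exI[of _ k]) linarith
 qed
qed

lemma Psi_inj:
 assumes sc: "simply_connected (UNIV :: 'p set)"
 shows "inj Psi"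
proof (rule injI, rule ccontr)
 fix m n assume mn: "Psi m = Psi n" "m ~= n"
 obtain a where a: "Psi (vector [0, 0, a]) = \<one>" "n = mmult (vector [0, 0, a]) m" by (rule Psi_eqD[OF mn(1)])
 hence a0: "a ~= 0" using mn(2) by (auto simp: mmult_def vec_eq_iff forall_3)
 have v3: "\<gamma>3 t = Psi (vector [0, 0, t])" for t by (simp add: Psi_def gam_add)
 define N where "N = {t. \<gamma>3 t = \<one>}"
 have N1: "s - t : N" if "s : N" "t : N" for s t
  using that gam_add(1)[of "vector [0, 0, 1]" s "- t"] by (simp add: N_def gam_add)
 obtain r where r: "r > 0" "!!m. Psi m = \<one> ==> norm m < r ==> m = 0" by (rule Psi_kernel_discrete) blast
 have N2: "t = 0" if "t : N" "\<bar>t\<bar> < r" for t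
  using r(2)[of "vector [0, 0, t]"] that by (simp add: N_def v3 norm_vec_def L2_set_def sum_3 vec_eq_iff forall_3)
 have N3: "a : N" using a by (simp add: N_def v3)
 obtain t0 where t0: "t0 > 0" "t0 : N" "!!t. t : N ==> \<exists>k::int. t = k * t0"
  by (rule discrete_subgroup_generator[OF N1 r(1) N2 N3 a0]) blast+
 define c where "c = (%p. cis (2 * pi * inv_into UNIV Psi p $ 3 / t0))"
 have c: "c (Psi m) = cis (2 * pi * m $ 3 / t0)" for m
 proof -
  obtain t where t: "Psi (vector [0, 0, t]) = \<one>" "inv_into UNIV Psi (Psi m) = mmult (vector [0, 0, t]) m"
   by (rule Psi_eqD[of m "inv_into UNIV Psi (Psi m)"]) (auto simp: f_inv_into_f)
  then obtain k :: int where k: "t = k * t0" using t0(3)[of t] by (auto simp: N_def v3)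
  have "c (Psi m) = cis (2 * pi * k + 2 * pi * m $ 3 / t0)"
   unfolding c_def t(2) using t0(1) by (simp add: mmult_def k field_simps)
  also have "\<dots> = cis (2 * pi * m $ 3 / t0)" by (simp add: cis_mult[symmetric] cis_multiple_2pi)
  finally show ?thesis .
 qed
 have "isCont c p" for p
 proof -
  obtain m where m: "p = Psi m" using Psi_surj by blast
  obtain V \<sigma> where V: "open V" "Psi m : V" "!!p. p : V ==> Psi (\<sigma> p) = p" "!!p. p : V ==> smooth_at A flat_atlas \<sigma> p"
   by (rule Psi_local_section[of m]) blast
  have I: "isCont (%q. cis (2 * pi * \<sigma> q $ 3 / t0)) p"
   unfolding cis_conv_exp
   by (intro continuous_intros smooth_at_isCont[OF smooth_manifold_flat]) (use V m t0 in auto)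
  have E: "\<forall>\<^sub>F q in nhds p. cis (2 * pi * \<sigma> q $ 3 / t0) = c q"
   unfolding eventually_nhds using V(1,2) m c V(3) by metis
  show ?thesis using I unfolding isCont_cong[OF E] .
 qed
 hence cc: "continuous_on UNIV c" by (simp add: continuous_at_imp_continuous_on)
 define l where "l = (%s. \<gamma>3 (t0 * s))"
 have "continuous_on UNIV (\<gamma>3)" using one_parameter_smooth[OF gam_hom] unfolding smooth_map_def by blast
 hence "continuous_on {0..1} l" unfolding l_def by (rule continuous_on_compose2) (auto intro!: continuous_intros)
 hence l: "path l" "pathfinish l = pathstart l"
  using t0(2) by (simp_all add: path_def pathfinish_def pathstart_def l_def gam_add N_def)
 have k: "path (%_::real. \<one>)" "pathfinish (%_::real. \<one>) = pathstart (%_::real. \<one>)"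
  by (simp_all add: path_def pathfinish_def pathstart_def)
 have "homotopic_loops UNIV l (%_. \<one>)"
  using sc[unfolded simply_connected_def, rule_format, of l "%_. \<one>"] l k by blast
 hence "homotopic_loops (- {0}) (c \<circ> l) (c \<circ> (%_. \<one>))"
  by (rule homotopic_loops_continuous_image[OF _ cc]) (auto simp: c_def)
 moreover have "c \<circ> l = circlepath 0 1"
  using t0(1) by (auto simp: fun_eq_iff l_def v3 c circlepath cis_conv_exp mult_ac)
 moreover have "c \<circ> (%_. \<one>) = linepath (c \<one>) (c \<one>)" by (simp add: linepath_refl o_def)
 moreover have "c \<one> ~= 0" by (simp add: c_def)
 ultimately show False
  using winding_number_homotopic_loops[of 0 "circlepath 0 1" "linepath (c \<one>) (c \<one>)"]
   winding_number_circlepath_centre[of 1 0] by simp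
qed

end

section \<open>Coset space representations\<close>

lemma group_actionI:
 assumes K: "group K" "carrier K = UNIV" and act: "!!k l p. act (k \<otimes>\<^bsub>K\<^esub> l) p = act k (act l p)" "!!p. act \<one>\<^bsub>K\<^esub> p = p"
 shows "group_action K UNIV act"
proof -
 interpret group K by (rule K)
 have b: "bij (act k)" for k
  by (rule o_bij[of "act (inv\<^bsub>K\<^esub> k)"]) (auto simp: fun_eq_iff act(1)[symmetric] act(2) K(2))
 have "act : hom K (BijGroup UNIV)"
  by (auto simp: hom_def BijGroup_def Bij_def b K(2) fun_eq_iff compose_def act(1))
 thus ?thesis
  unfolding group_action_def group_hom_def group_hom_axioms_def using K(1) group_BijGroup by blast
qed

lemma ineffective_kernel_iff:
 "carrier K = UNIV ==> k : ineffective_kernel K act \<longleftrightarrow> (\<forall>p. act k p = p)"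
 by (auto simp: ineffective_kernel_def kernel_def BijGroup_def fun_eq_iff)

context Lie_group
begin

text \<open>A one-parameter subgroup is determined by its generator, so the subgroup generated by a line is the image of a single
  one-parameter subgroup. Holonomy algebras of dimension at most one need no more. The predicate \<open>P\<close> covers both dimensions.\<close>

lemma lie_subgroup_of_line:
 assumes X: "X : \<L> G A" and \<gamma>: "generates X \<gamma>"
 shows "lie_subgroup_of_algebra G A {vscale (%_. c) X | c. P c} = (if Ex (%c. P c & c ~= 0) then range \<gamma> else {\<one>})"
proof -
 have o: "one_parameter_subgroup G A \<gamma>" using \<gamma> unfolding generates_def by blast
 note ga = one_parameter_add[OF o]
 have sub: "subgroup (range \<gamma>) G"
  by (rule subgroupI) (auto simp: ga(1)[symmetric] ga(3)[symmetric])
 have vs: "vscale (%_. c) X = (%p f. c * X p f)" for c by (simp add: vscale_def tscale_def)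
 have gen: "\<delta> = (%t. \<gamma> (c * t))" if "one_parameter_subgroup G A \<delta>"
  "\<forall>f\<in>\<F> A. ((%s. f (\<delta> s)) has_real_derivative vscale (%_. c) X \<one> f) (at 0)" for \<delta> c
  by (rule generates_unique[OF left_invariant_scale[OF X, of c] _ generates_rescale[OF \<gamma>]])
   (use that in "simp add: generates_def has_velocity_def vs")
 let ?S = "{\<delta> t | \<delta> t. one_parameter_subgroup G A \<delta> & (\<exists>Y\<in>{vscale (%_. c) X | c. P c}. \<forall>f\<in>\<F> A.
   ((%s. f (\<delta> s)) has_real_derivative Y \<one> f) (at 0))}"
 have S: "?S = {\<gamma> (c * t) | c t. P c}"
 proof (intro equalityI subsetI)
  fix x assume "x : ?S"
  then obtain \<delta> t c where "x = \<delta> t" "one_parameter_subgroup G A \<delta>" "P c"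
   "\<forall>f\<in>\<F> A. ((%s. f (\<delta> s)) has_real_derivative vscale (%_. c) X \<one> f) (at 0)" by blast
  thus "x : {\<gamma> (c * t) | c t. P c}" using gen[of \<delta> c] by auto
 next
  fix x assume "x : {\<gamma> (c * t) | c t. P c}"
  then obtain c t where c: "x = \<gamma> (c * t)" "P c" by blast
  have "generates (%p f. c * X p f) (%t. \<gamma> (c * t))" by (rule generates_rescale[OF \<gamma>])
  hence "one_parameter_subgroup G A (%t. \<gamma> (c * t))"
   "\<forall>f\<in>\<F> A. ((%s. f (\<gamma> (c * s))) has_real_derivative vscale (%_. c) X \<one> f) (at 0)"
   by (simp_all add: generates_def has_velocity_def vs)
  moreover have "vscale (%_. c) X : {vscale (%_. c) X | c. P c}" using c(2) by blast
  ultimately show "x : ?S" unfolding c(1)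
   by (intro CollectI, rule_tac x="%t. \<gamma> (c * t)" in exI, rule_tac x=t in exI) blast
 qed
 have "generate G {\<gamma> (c * t) | c t. P c} = (if Ex (%c. P c & c ~= 0) then range \<gamma> else {\<one>})"
 proof (cases "Ex (%c. P c & c ~= 0)")
  case True
  then obtain c where c: "P c" "c ~= 0" by blast
  have "\<gamma> t : {\<gamma> (c * t) | c t. P c}" for t
  proof -
   have "\<gamma> t = \<gamma> (c * (t / c)) & P c" using c by simp
   thus ?thesis by blast
  qed
  hence "range \<gamma> \<subseteq> generate G {\<gamma> (c * t) | c t. P c}" by (auto intro: generate.incl)
  moreover have "generate G {\<gamma> (c * t) | c t. P c} \<subseteq> range \<gamma>" by (rule generate_subgroup_incl[OF _ sub]) auto
  ultimately show ?thesis using True by simp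
 next
  case False
  hence "{\<gamma> (c * t) | c t. P c} \<subseteq> {\<one>}" using ga(2) by auto
  hence "generate G {\<gamma> (c * t) | c t. P c} \<subseteq> {\<one>}" by (rule generate_subgroup_incl[OF _ triv_subgroup])
  thus ?thesis using False generate.one[of G "{\<gamma> (c * t) | c t. P c}"] by auto
 qed
 thus ?thesis unfolding lie_subgroup_of_algebra_def S .
qed

end

context G_frame
begin

text \<open>A left invariant metric connection is given by a linear map \<open>\<tau>\<close>, \<open>\<nabla>\<^sub>x y = \<tau> x \<times> y\<close>; its curvature operators are
  cross products as well.\<close>

definition opr :: "'p => real^3 => 'p tangent => 'p tangent" where
 "opr p r w = (if w : \<T> A p then tvec p (cross3 r (coord p w)) else tzero)"

lemma opr_tvec [simp]: "opr p r (tvec p x) = tvec p (cross3 r x)"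
 by (simp add: opr_def)

lemma opr_algebra:
 shows opr_add: "(%w. tadd (opr p r w) (opr p s w)) = opr p (r + s)"
  and opr_scale: "(%w. tscale c (opr p r w)) = opr p (c *\<^sub>R r)"
  and opr_commutator: "(%w f. opr p r (opr p s w) f - opr p s (opr p r w) f) = opr p (cross3 r s)"
  and opr_diff: "(%w f. opr p r w f - opr p s w f) = opr p (r - s)"
proof -
 have 0: "opr p r tzero = tzero" for r using opr_tvec[of p r 0] by (simp only: tvec_0 cross_zero_right)
 have out: "w \<notin> \<T> A p ==> opr p r w = tzero" for r w by (simp add: opr_def)
 have eqI: "F = opr p r" if F: "!!x. F (tvec p x) = tvec p (cross3 r x)" "!!w. w \<notin> \<T> A p ==> F w = tzero" for F r
 proof
  fix w show "F w = opr p r w"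
   using F(1)[of "coord p w"] F(2)[of w] by (cases "w : \<T> A p") (simp_all add: opr_def)
 qed
 show "(%w. tadd (opr p r w) (opr p s w)) = opr p (r + s)"
  by (rule eqI, simp add: tvec_add cross_add_left, simp add: out fun_eq_iff)
 show "(%w. tscale c (opr p r w)) = opr p (c *\<^sub>R r)"
  by (rule eqI, simp add: tvec_scale cross_mult_left, simp add: out fun_eq_iff)
 show "(%w f. opr p r w f - opr p s w f) = opr p (r - s)"
  by (rule eqI) (simp_all add: out tvec_diff Cross3.left_diff_distrib)
 show "(%w f. opr p r (opr p s w) f - opr p s (opr p r w) f) = opr p (cross3 r s)"
  by (rule eqI) (simp_all add: out 0 tvec_diff cross3_jacobi)
qed

end

text \<open>The transvection algebra when all curvature operators are multiples of the rotation about the third axis; for \<open>k = 0\<close>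
  the connection is flat. The map \<open>E\<close> describes the isomorphism onto the left invariant fields of \<open>K\<close>.\<close>

locale axial_connection = G_frame A g e \<alpha> \<beta> D
 for A :: "('p::t2_space, real^3) atlas" and g e \<alpha> \<beta> D +
 fixes S :: "'p tensor12" and \<tau> :: "real^3 => real^3" and k :: real
 assumes S: "tensor_field12 A S" and \<tau>: "bounded_linear \<tau>"
  and comp: "!!p x y. tcomp S p x y = cross3 (\<tau> x - lam \<alpha> \<beta> x) y"
  and curv: "!!x y. cross3 (\<tau> x) (\<tau> y) - \<tau> (brk \<alpha> \<beta> (cross3 x y)) = (k * cross3 x y $ 3) *\<^sub>R axis 3 1"
begin

abbreviation "D' \<equiv> connection_plus D S"

lemma D'_field:
 assumes "smooth_vec x" "smooth_vec y"
 shows "D' (field x) (field y) = field (%p. fder (tvec p (x p)) y + cross3 (\<tau> (x p)) (y p))"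
 unfolding connection_plus_field(1)[OF S assms] comp by (simp add: Cross3.left_diff_distrib)

lemma curvature_at_axial:
 "curvature_at A D' p (tvec p x) (tvec p y) = opr p ((k * cross3 x y $ 3) *\<^sub>R axis 3 1)"
proof
 fix w
 show "curvature_at A D' p (tvec p x) (tvec p y) w = opr p ((k * cross3 x y $ 3) *\<^sub>R axis 3 1) w"
 proof (cases "w : \<T> A p")
  case True
  have c: "curvature A D' (field x') (field y') (field z') p = tvec p (cross3 ((k * cross3 (x' p) (y' p) $ 3) *\<^sub>R axis 3 1) (z' p))"
   if "smooth_vec x'" "smooth_vec y'" "smooth_vec z'" for x' y' z'
  proof -
   have "curvature A D' (field x') (field y') (field z') =
     field (%p. cross3 (cross3 (\<tau> (x' p)) (\<tau> (y' p)) - \<tau> (brk \<alpha> \<beta> (cross3 (x' p) (y' p)))) (z' p))"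
    by (rule connection_curvature_field[OF \<tau> D'_field that])
   thus ?thesis unfolding curv by simp
  qed
  have "(THE t. \<exists>X\<in>\<XX> A. \<exists>Y\<in>\<XX> A. \<exists>Z\<in>\<XX> A.
    X p = tvec p x & Y p = tvec p y & Z p = w & t = curvature A D' X Y Z p) =
    tvec p (cross3 ((k * cross3 x y $ 3) *\<^sub>R axis 3 1) (coord p w))"
  proof (rule the_equality)
   show "\<exists>X\<in>\<XX> A. \<exists>Y\<in>\<XX> A. \<exists>Z\<in>\<XX> A. X p = tvec p x & Y p = tvec p y & Z p = w \<and>
     tvec p (cross3 ((k * cross3 x y $ 3) *\<^sub>R axis 3 1) (coord p w)) = curvature A D' X Y Z p"
    by (rule bexI[of _ "field (%_. x)"], rule bexI[of _ "field (%_. y)"], rule bexI[of _ "field (%_. coord p w)"])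
     (simp_all only: c[OF smooth_vec_const smooth_vec_const smooth_vec_const] True field_vector_field[OF smooth_vec_const] field_at tvec_coord simp_thms)
  next
   fix t assume "\<exists>X\<in>\<XX> A. \<exists>Y\<in>\<XX> A. \<exists>Z\<in>\<XX> A.
    X p = tvec p x & Y p = tvec p y & Z p = w & t = curvature A D' X Y Z p"
   then obtain X Y Z where X: "X : \<XX> A" "Y : \<XX> A" "Z : \<XX> A"
    "X p = tvec p x" "Y p = tvec p y" "Z p = w" "t = curvature A D' X Y Z p" by blast
   obtain x' where x': "smooth_vec x'" "X = field x'" by (rule vector_field_cases[OF X(1)])
   obtain y' where y': "smooth_vec y'" "Y = field y'" by (rule vector_field_cases[OF X(2)])
   obtain z' where z': "smooth_vec z'" "Z = field z'" by (rule vector_field_cases[OF X(3)])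
   have "x' p = x" "y' p = y" "z' p = coord p w" using X(4,5,6) x'(2) y'(2) z'(2) by auto
   thus "t = tvec p (cross3 ((k * cross3 x y $ 3) *\<^sub>R axis 3 1) (coord p w))"
    unfolding X(7) x'(2) y'(2) z'(2) c[OF x'(1) y'(1) z'(1)] by simp
  qed
  thus ?thesis by (simp add: curvature_at_def opr_def True)
 qed (simp add: curvature_at_def opr_def)
qed

lemma holonomy_axial: "holonomy_algebra A D' p = {opr p (c *\<^sub>R axis 3 1) | c. k ~= 0 | c = 0}"
proof (intro equalityI subsetI)
 fix U assume "U : holonomy_algebra A D' p"
 thus "U : {opr p (c *\<^sub>R axis 3 1) | c. k ~= 0 | c = 0}"
 proof induction
  case (curv u v)
  hence "curvature_at A D' p u v = opr p ((k * cross3 (coord p u) (coord p v) $ 3) *\<^sub>R axis 3 1)"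
   using curvature_at_axial[of p "coord p u" "coord p v"] by simp
  thus ?case by auto
 next
  case (add U V)
  then obtain c d where UV: "U = opr p (c *\<^sub>R axis 3 1)" "V = opr p (d *\<^sub>R axis 3 1)" and cd: "k ~= 0 | c = 0" "k ~= 0 | d = 0" by blast
  have "(%w. tadd (U w) (V w)) = opr p ((c + d) *\<^sub>R axis 3 1)" "k ~= 0 | c + d = 0"
   unfolding UV opr_add scaleR_add_left using cd by auto
  thus ?case by blast
 next
  case (scale U a)
  then obtain c where U: "U = opr p (c *\<^sub>R axis 3 1)" and c: "k ~= 0 | c = 0" by blast
  have "(%w. tscale a (U w)) = opr p ((a * c) *\<^sub>R axis 3 1)" "k ~= 0 | a * c = 0"
   unfolding U opr_scale scaleR_scaleR using c by auto
  thus ?case by blast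
 next
  case (commutator U V)
  then obtain c d where "U = opr p (c *\<^sub>R axis 3 1)" "V = opr p (d *\<^sub>R axis 3 1)" by blast
  hence "(%w f. U (V w) f - V (U w) f) = opr p (0 *\<^sub>R axis 3 1)"
   by (simp only: opr_commutator cross_mult_left cross_mult_right cross_refl scaleR_zero_right scaleR_zero_left)
  thus ?case by blast
 qed
next
 fix U assume "U : {opr p (c *\<^sub>R axis 3 1) | c. k ~= 0 | c = 0}"
 then obtain c where c: "U = opr p (c *\<^sub>R axis 3 1)" "k ~= 0 | c = 0" by blast
 have "cross3 (axis 1 1) (axis 2 1) $ 3 = (1 :: real)" by (simp add: cross3_def axis_def)
 hence "opr p (k *\<^sub>R axis 3 1) : holonomy_algebra A D' p"
  using holonomy_algebra.curv[of "tvec p (axis 1 1)" A p "tvec p (axis 2 1)" D'] by (simp add: curvature_at_axial)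
 from holonomy_algebra.scale[OF this, of "c / k"]
 have "opr p ((c / k * k) *\<^sub>R axis 3 1) : holonomy_algebra A D' p" by (simp add: opr_scale)
 moreover have "c / k * k = c" using c(2) by auto
 ultimately show "U : holonomy_algebra A D' p" using c(1) by simp
qed

text \<open>An element of the transvection algebra at \<open>p\<close> is a pair of a multiple \<open>c\<close> of the rotation about the third axis and a vector with
  components \<open>x\<close>; \<open>br\<close> is its bracket in these coordinates. So it suffices to give \<open>E\<close> on pairs of numbers and vectors.\<close>

lemma coset_presentationI:
 fixes K :: "'k::{t2_space, second_countable_topology} monoid" and B :: "('k, 'f::euclidean_space) atlas"
  and E :: "real => real^3 => 'k vfield"
 defines "I \<equiv> {c. k ~= 0 | c = 0}"
 assumes K: "lie_group K B" "simply_connected (UNIV :: 'k set)" "transitive_isometric_action K B A g act"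
  and bij: "bij_betw (%(c, x). E c x) (I \<times> UNIV) (\<L> K B)"
  and lin: "!!c d x y. E (c + d) (x + y) = vadd (E c x) (E d y)" "!!s c x. E (s * c) (s *\<^sub>R x) = vscale (%_. s) (E c x)"
  and br: "!!c d x y. c : I ==> d : I ==> vbracket B (E c x) (E d y) = E (- k * cross3 x y $ 3)
   (cross3 (c *\<^sub>R axis 3 1) y - cross3 (d *\<^sub>R axis 3 1) x + (brk \<alpha> \<beta> (cross3 x y) - cross3 (\<tau> x) y + cross3 (\<tau> y) x))"
  and orbit: "!!c x. c : I ==> push A (%k. act k p) (E c x \<one>\<^bsub>K\<^esub>) = tvec p x"
  and \<gamma>: "Lie_group.generates K B (E 1 0) \<gamma>" and E1: "E 1 0 : \<L> K B"
  and stab: "stabilizer K act p = (if k ~= 0 then range \<gamma> else {\<one>\<^bsub>K\<^esub>})"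
 shows "coset_presentation A g D S p K B act"
proof -
 interpret K: Lie_group K B by unfold_locales (rule K(1))
\<comment> \<open>The rotation \<open>c e\<^sub>3\<close> maps \<open>e\<^sub>1\<close> to \<open>c e\<^sub>2\<close>, so \<open>cc\<close> recovers \<open>c\<close>.\<close>
 define cc where "cc = (%U. coord p (U (tvec p (axis 1 1))) $ 2)"
 define \<Phi> where "\<Phi> = (%(U, v). E (cc U) (coord p v))"
 let ?J = "%c. opr p (c *\<^sub>R axis 3 1)"
 have cc: "cc (?J c) = c" for c by (simp add: cc_def cross3_def axis_def)
 have \<Phi>: "\<Phi> (?J c, tvec p x) = E c x" for c x by (simp add: \<Phi>_def cc)
 have carr: "holonomy_algebra A D' p \<times> \<T> A p = (%(c, x). (?J c, tvec p x)) ` (I \<times> UNIV)"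
 proof (intro equalityI subsetI)
  fix z assume "z : holonomy_algebra A D' p \<times> \<T> A p"
  then obtain c v where "z = (?J c, v)" "c : I" "v : \<T> A p" unfolding holonomy_axial I_def by blast
  hence "z = (%(c, x). (?J c, tvec p x)) (c, coord p v)" "(c, coord p v) : I \<times> UNIV" by auto
  thus "z : (%(c, x). (?J c, tvec p x)) ` (I \<times> UNIV)" by blast
 qed (auto simp: holonomy_axial I_def)
 have all: "(\<forall>z\<in>holonomy_algebra A D' p \<times> \<T> A p. P z) \<longleftrightarrow> (\<forall>c\<in>I. \<forall>x. P (?J c, tvec p x))" for P
  unfolding carr by auto
 have bij\<Phi>: "bij_betw \<Phi> (holonomy_algebra A D' p \<times> \<T> A p) (\<L> K B)"
 proof -
  have "bij_betw (%(c, x). (?J c, tvec p x)) (I \<times> UNIV) (holonomy_algebra A D' p \<times> \<T> A p)"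
   unfolding carr by (rule inj_on_imp_bij_betw) (auto simp: inj_on_def dest: arg_cong[of _ _ cc] simp: cc)
  moreover have "bij_betw (\<Phi> \<circ> (%(c, x). (?J c, tvec p x))) (I \<times> UNIV) (\<L> K B)"
  proof -
   have "\<Phi> \<circ> (%(c, x). (?J c, tvec p x)) = (%(c, x). E c x)" by (auto simp: fun_eq_iff \<Phi>)
   thus ?thesis using bij by simp
  qed
  ultimately show ?thesis using bij_betw_comp_iff by blast
 qed
 have br1: "(%w f. ?J c (?J d w) f - ?J d (?J c w) f - curvature_at A D' p (tvec p x) (tvec p y) w f) = ?J (- k * cross3 x y $ 3)" for c d x y
 proof -
  have "(%w f. ?J c (?J d w) f - ?J d (?J c w) f) = opr p 0"
   unfolding opr_commutator by (simp add: cross_mult_left cross_mult_right)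
  from fun_cong[OF fun_cong[OF this]]
  have "?J c (?J d w) f - ?J d (?J c w) f = opr p 0 w f" for w f .
  thus ?thesis by (simp add: curvature_at_axial opr_diff)
 qed
 have br2: "(%f. ?J c (tvec p y) f - ?J d (tvec p x) f - S p (tvec p x) (tvec p y) f + S p (tvec p y) (tvec p x) f) =
   tvec p (cross3 (c *\<^sub>R axis 3 1) y - cross3 (d *\<^sub>R axis 3 1) x + (brk \<alpha> \<beta> (cross3 x y) - cross3 (\<tau> x) y + cross3 (\<tau> y) x))" for c d x y
 proof -
  have eq: "(%f. tvec p a f - tvec p b f - tvec p s f + tvec p t f) = tvec p (a - b - s + t)" for a b s t
   using tvec_diff[of p a b] tvec_diff[of p "a - b" s] tvec_add[of p "a - b - s" t] by (simp add: fun_eq_iff)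
  show ?thesis unfolding tensor_fieldD(2)[OF S] opr_tvec comp eq lam_torsion[symmetric]
   by (simp add: Cross3.left_diff_distrib algebra_simps)
 qed
 have iso: "lie_isomorphism (transvection_algebra A D S p) (lie_algebra_of K B) \<Phi>"
  unfolding lie_isomorphism_def transvection_algebra_def lie_algebra_of_def
 proof (simp only: lie_algebra.simps, intro conjI bij\<Phi>)
  show "\<forall>z\<in>holonomy_algebra A D' p \<times> \<T> A p. \<forall>z'\<in>holonomy_algebra A D' p \<times> \<T> A p. \<forall>s.
    \<Phi> ((%(U, X) (V, Y). (%w. tadd (U w) (V w), tadd X Y)) z z') = vadd (\<Phi> z) (\<Phi> z') \<and>
    \<Phi> ((%c (U, X). (%w. tscale c (U w), tscale c X)) s z) = vscale (%_. s) (\<Phi> z) \<and>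
    \<Phi> ((%(U, X) (V, Y). (%w f. U (V w) f - V (U w) f - curvature_at A D' p X Y w f,
      %f. U Y f - V X f - S p X Y f + S p Y X f)) z z') = vbracket B (\<Phi> z) (\<Phi> z')"
   unfolding all
   by (auto simp only: prod.case br1 br2 \<Phi> br opr_add opr_scale tvec_add tvec_scale scaleR_add_left[symmetric] scaleR_scaleR lin)
 qed
 have orb: "\<forall>(U, v)\<in>lcarrier (transvection_algebra A D S p). push A (%k. act k p) (\<Phi> (U, v) \<one>\<^bsub>K\<^esub>) = v"
 proof -
  have "\<forall>z\<in>holonomy_algebra A D' p \<times> \<T> A p. push A (%k. act k p) (\<Phi> z \<one>\<^bsub>K\<^esub>) = snd z"
   unfolding all \<Phi> using orbit by simp
  thus ?thesis by (auto simp: transvection_algebra_def)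
 qed
 have im: "\<Phi> ` (holonomy_algebra A D' p \<times> {tzero}) = {vscale (%_. c) (E 1 0) | c. c : I}"
 proof -
  have E: "vscale (%_. c) (E 1 0) = E c 0" for c using lin(2)[of c 1 0] by simp
  have z: "\<Phi> (?J c, tzero) = E c 0" for c using \<Phi>[of c 0] by (simp add: tvec_0)
  have h: "holonomy_algebra A D' p \<times> {tzero} = (%c. (?J c, tzero)) ` I"
   unfolding holonomy_axial I_def by blast
  show ?thesis unfolding E h image_image z by blast
 qed
 have "stabilizer K act p = lie_subgroup_of_algebra K B (\<Phi> ` (holonomy_algebra A D' p \<times> {tzero}))"
  unfolding im K.lie_subgroup_of_line[OF E1 \<gamma>] stab I_def by (auto intro: exI[of _ 1])
 thus ?thesis unfolding coset_presentation_def using K iso orb by blast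
qed

end

lemma (in Lie_group) generates_vzero: "generates vzero (%_. \<one>)"
proof -
 have "smooth_map flat_atlas A (%_ :: real. \<one>)" by (rule smooth_map_const[OF smooth_manifold_flat])
 thus ?thesis
  by (simp add: generates_def one_parameter_subgroup_def real_atlas_flat hom_def real_group_def has_velocity_def)
qed

lemma trivial_isotropyI:
 assumes "coset_presentation A g D S p K B act" "carrier K = UNIV" "!!q. act \<one>\<^bsub>K\<^esub> q = q" "stabilizer K act p = {\<one>\<^bsub>K\<^esub>}"
 shows "coset_representation_trivial_isotropy A g D S p K B act"
proof -
 have "ineffective_kernel K act \<subseteq> stabilizer K act p"
  using ineffective_kernel_iff[OF assms(2), of _ act] assms(2) by (auto simp: stabilizer_def)
 moreover have "\<one>\<^bsub>K\<^esub> : ineffective_kernel K act" using assms(3) by (simp add: ineffective_kernel_iff[OF assms(2)])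
 ultimately show ?thesis unfolding coset_representation_trivial_isotropy_def using assms(1,4) by blast
qed

lemma transitive_actionI:
 assumes "group_action K UNIV act" "carrier K = UNIV" "!!p. \<exists>k. act k x = p"
 shows "transitive_action K UNIV act"
proof -
 interpret group_action K UNIV act by (rule assms(1))
 interpret group_hom K "BijGroup UNIV" act by (rule group_hom)
 show ?thesis
 proof
  fix p q
  obtain k l where k: "act k x = p" "act l x = q" using assms(3) by metis
  have h: "act (a \<otimes>\<^bsub>K\<^esub> b) r = act a (act b r)" for a b r
   using composition_rule[of r a b] assms(2) by simp
  have "act (l \<otimes>\<^bsub>K\<^esub> inv\<^bsub>K\<^esub> k) p = q"
   unfolding k(1)[symmetric] h[symmetric] using assms(2) k(2) by (simp add: G.m_assoc)
  thus "\<exists>g\<in>carrier K. act g p = q" using assms(2) by blast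
 qed
qed

context metric_group
begin

text \<open>The canonical connection of \<open>G/{e}\<close> is flat with torsion \<open>- [x, y]\<close>, so its transvection algebra is the Lie algebra of \<open>G\<close>.\<close>

lemma difference_representation:
 assumes sc: "simply_connected (UNIV :: 'p set)" and S: "tensor_field12 A S" "!!p x y. tcomp S p x y = - cross3 (lam \<alpha> \<beta> x) y"
 shows "coset_representation_trivial_isotropy A g D S \<one> G A (%a x. a \<otimes> x)"
proof -
 interpret axial_connection A g frame \<alpha> \<beta> D S "%_. 0" 0
 proof (intro axial_connection.intro axial_connection_axioms.intro G_frame_axioms)
  show "tcomp S p x y = cross3 (0 - lam \<alpha> \<beta> x) y" for p x y by (simp add: S(2) cross3_def vec_eq_iff forall_3)
  show "bounded_linear (%_. 0 :: real^3)" by (rule bounded_linear_zero)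
 qed (simp_all add: S(1) brk_def)
 have act: "group_action G UNIV (%a x. a \<otimes> x)"
  by (rule group_actionI) (simp_all add: is_group m_assoc)
 have t: "transitive_isometric_action G A A g (%a x. a \<otimes> x)"
  unfolding transitive_isometric_action_def smooth_action_def
 proof (intro conjI ballI act translation_isometry)
  show "smooth_map (prod_atlas A A) A (%(k, p). k \<otimes> p)" using lie_group unfolding lie_group_def by blast
  show "transitive_action G UNIV (%a x. a \<otimes> x)"
   by (rule transitive_actionI[OF act carrier_UNIV, of \<one>]) simp
 qed
 have stab: "stabilizer G (%a x. a \<otimes> x) \<one> = {\<one>}" by (auto simp: stabilizer_def)
 have vz: "field (%_. 0) = vzero" by (simp add: fun_eq_iff tvec_0)
 have "coset_presentation A g D S \<one> G A (%a x. a \<otimes> x)"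
 proof (rule coset_presentationI[OF lie_group sc t, of "%_ x. field (%_. x)"])
  show "bij_betw (%(c, x). field (%_. x)) ({c. (0 :: real) ~= 0 | c = (0 :: real)} \<times> UNIV) (\<L> G A)"
  proof (rule bij_betw_imageI)
   show "(%(c, x). field (%_. x)) ` ({c. (0 :: real) ~= 0 | c = (0 :: real)} \<times> UNIV) = \<L> G A"
    using left_field_cases left_field by (fastforce simp: image_iff)
  qed (auto simp: inj_on_def field_eq_pointwise simp del: field_eq_iff)
  show "push A (%k. k \<otimes> \<one>) (field (%_. x) \<one>) = tvec \<one> x" for x
   by (simp add: push_id[OF tvec_tangent])
  show "generates (field (%_. 0)) (%_. \<one>)" unfolding vz by (rule generates_vzero)
 qed (simp_all add: vadd_field vscale_field left_field_bracket left_field stab cross3_def[of 0] del: field_at)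
 thus ?thesis by (rule trivial_isotropyI) (simp_all add: stab)
qed

end

context special_group
begin

definition nu :: "real => real^3 => real^3" where
 "nu r x = (- 2 * x $ 2 - (\<beta> + r) * x $ 3) *\<^sub>R axis 3 1"

text \<open>Since \<open>nu r\<close> takes values in one line, \<open>nu r x \<times> nu r y\<close> vanishes and the curvature is \<open>- nu r [x, y]\<close>. The factor \<open>k\<close> is zero
  exactly for \<open>r = - (\<beta>\<^sup>2 + 2) / \<beta>\<close>.\<close>

lemma structure_r_axial:
 assumes "structure_r A g e1 e2 e3 \<beta> r S"
 shows "axial_connection A g frame 1 \<beta> D S (nu r) (4 + 2 * \<beta> * (\<beta> + r))"
proof (intro axial_connection.intro axial_connection_axioms.intro G_frame_axioms)
 have S: "tensor_field12 A S" "twisted S (%_. vector [0, 0, - r])"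
  using assms structure_r_iff[of r S] by simp_all
 show "tensor_field12 A S" by (rule S(1))
 show "bounded_linear (nu r)"
  unfolding linear_conv_bounded_linear[symmetric] by (rule linearI) (simp_all add: nu_def vec_eq_iff algebra_simps)
 show "tcomp S p x y = cross3 (nu r x - lam 1 \<beta> x) y" for p x y
 proof -
  have "nu r x = lam 1 \<beta> x + ax \<beta> (vector [0, 0, - r]) x"
   unfolding ax_lam by (simp add: nu_def inner_vec_def sum_3 algebra_simps)
  thus ?thesis using S(2) by (simp add: twisted_def)
 qed
 show "cross3 (nu r x) (nu r y) - nu r (brk 1 \<beta> (cross3 x y)) = ((4 + 2 * \<beta> * (\<beta> + r)) * cross3 x y $ 3) *\<^sub>R axis 3 1" for x y
  by (simp add: nu_def brk_def cross3_def axis_def vec_eq_iff forall_3 algebra_simps)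
qed

lemma model_action:
 fixes K :: "'k::{euclidean_space, second_countable_topology} monoid" and h :: "'k => real^3 => real^3"
 assumes inj: "inj Psi" and K: "group K" "carrier K = UNIV" and h: "smooth_on UNIV (%z. h (fst z) (snd z))"
  "!!k l m. h (k \<otimes>\<^bsub>K\<^esub> l) m = h k (h l m)" "!!m. h \<one>\<^bsub>K\<^esub> m = m" "!!k. turns (\<theta> k) (h k)" "!!m. \<exists>k. h k 0 = m"
 shows "transitive_isometric_action K flat_atlas A g (%k. descent (h k))"
proof -
 interpret K: group K by (rule K)
 have act: "descent (h k) (Psi m) = Psi (h k m)" for k m by (simp add: descent_def inj)
 have surj: "\<exists>m. p = Psi m" for p using Psi_surj by blast
 have mult: "descent (h (k \<otimes>\<^bsub>K\<^esub> l)) p = descent (h k) (descent (h l) p)" for k l p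
  using surj[of p] by (auto simp: act h(2))
 have one: "descent (h \<one>\<^bsub>K\<^esub>) p = p" for p using surj[of p] by (auto simp: act h(3))
 have ga: "group_action K UNIV (%k. descent (h k))" by (rule group_actionI[OF K]) (simp_all add: mult one)
 show ?thesis
  unfolding transitive_isometric_action_def smooth_action_def
 proof (intro conjI ballI ga)
  show "smooth_map (prod_atlas flat_atlas A) A (%(k, p). descent (h k) p)"
   by (rule descend_action_smooth[OF h(1)]) (simp add: act)
  show "transitive_action K UNIV (%k. descent (h k))"
  proof (rule transitive_actionI[OF ga K(2), of \<one>])
   fix p
   obtain m where "p = Psi m" using surj by blast
   thus "\<exists>k. descent (h k) \<one> = p" using h(5)[of m] act[of _ 0] by auto
  qed
  show "isometry A g (descent (h k))" for k
  proof (rule descend_isometry[where K="h (inv\<^bsub>K\<^esub> k)" and F'="descent (h (inv\<^bsub>K\<^esub> k))", OF h(4) act _ act])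
   show "smooth_on UNIV (h (inv\<^bsub>K\<^esub> k))" using h(4) by (simp add: turns_def)
  qed (simp_all add: mult[symmetric] K(2) one)
 qed
qed

definition rho :: "real^3 => 'p => 'p" where
 "rho a = descent (lmult a)"

lemma smooth_lmult [smooth_intros]:
 fixes f h :: "'e::euclidean_space => real^3"
 assumes "smooth_on UNIV f" "smooth_on UNIV h"
 shows "smooth_on UNIV (%x. lmult (f x) (h x))"
 unfolding lmult_def by (intro smooth_intros open_UNIV assms) (use beta in auto)

lemma rho_action:
 assumes "inj Psi" shows "transitive_isometric_action L flat_atlas A g rho"
 unfolding rho_def
proof (rule model_action[where h=lmult, OF assms L_group])
 show "smooth_on UNIV (%z :: (real^3) \<times> (real^3). lmult (fst z) (snd z))" by (intro smooth_intros open_UNIV)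
 show "turns ((%_. 0) k) (lmult k)" for k by (simp add: turns_lmult)
 show "\<exists>k. lmult k 0 = m" for m by (rule exI[of _ m]) simp
qed (simp_all add: lmult_assoc)

interpretation LL: Lie_group L flat_atlas
 by unfold_locales (rule L_lie_group)

lemma lfield_vadd: "lfield (u + v) = vadd (lfield u) (lfield v)" "lfield (c *\<^sub>R u) = vscale (%_. c) (lfield u)"
 by (simp_all add: fun_eq_iff vadd_def vscale_def lfield_linear)

lemma left_invariant_L: "\<L> L flat_atlas = range lfield"
proof (intro equalityI subsetI)
 fix X assume X: "X : \<L> L flat_atlas"
 obtain u where "X \<one>\<^bsub>L\<^esub> = lfield u \<one>\<^bsub>L\<^esub>"
  by (rule lfield_cases[OF flat.vector_fieldD(1)[OF LL.left_invariantD(1)[OF X]]])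
 thus "X : range lfield" using LL.left_invariant_eq[OF X lfield_left_invariant] by blast
qed (use lfield_left_invariant in auto)

lemma lfield_inj: "inj lfield"
 by (rule injI) (metis lfield_inject)

text \<open>\<open>f\<^sub>1\<close> and \<open>f\<^sub>2\<close> correspond to symmetric matrices of trace zero, \<open>\<beta> f\<^sub>3\<close> to the generator of the rotations.\<close>

definition sl2_matrix :: "real^3 => real^2^2" where
 "sl2_matrix u = vector [vector [u $ 1, u $ 2 + u $ 3 / \<beta>], vector [u $ 2 - u $ 3 / \<beta>, - u $ 1]]"

lemma L_sl2: "\<exists>\<Phi>. lie_isomorphism (lie_algebra_of L flat_atlas) sl2R \<Phi>"
proof -
 define \<Phi> where "\<Phi> = (%X. sl2_matrix (inv_into UNIV lfield X))"
 have \<Phi>: "\<Phi> (lfield u) = sl2_matrix u" for u by (simp add: \<Phi>_def lfield_inj)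
 have b: "bij_betw sl2_matrix UNIV {M. trace M = 0}"
 proof (rule bij_betw_byWitness[where f'="%M. vector [M $ 1 $ 1, (M $ 1 $ 2 + M $ 2 $ 1) / 2, \<beta> * (M $ 1 $ 2 - M $ 2 $ 1) / 2]"])
  show "\<forall>M\<in>{M. trace M = 0}. sl2_matrix (vector [M $ 1 $ 1, (M $ 1 $ 2 + M $ 2 $ 1) / 2, \<beta> * (M $ 1 $ 2 - M $ 2 $ 1) / 2]) = M"
   using beta by (auto simp: sl2_matrix_def trace_def sum_2 vec_eq_iff forall_2 field_simps)
 qed (use beta in "auto simp: sl2_matrix_def trace_def sum_2 vec_eq_iff forall_3 field_simps")
 have "bij_betw (\<Phi> \<circ> lfield) UNIV {M. trace M = 0}" using b by (simp add: comp_def \<Phi>)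
 hence "bij_betw \<Phi> (range lfield) {M. trace M = 0}"
  using bij_betw_comp_iff[OF inj_on_imp_bij_betw[OF lfield_inj]] by blast
 moreover have "sl2_matrix (lbr u v) = sl2_matrix u ** sl2_matrix v - sl2_matrix v ** sl2_matrix u" for u v
  using beta by (simp add: sl2_matrix_def lbr_def Let_def cross3_def matrix_matrix_mult_def sum_2 vec_eq_iff forall_2 field_simps)
 moreover have "sl2_matrix (u + v) = sl2_matrix u + sl2_matrix v" "sl2_matrix (c *\<^sub>R u) = c *\<^sub>R sl2_matrix u" for u v c
  by (simp_all add: sl2_matrix_def vec_eq_iff forall_2 algebra_simps add_divide_distrib)
 ultimately have "lie_isomorphism (lie_algebra_of L flat_atlas) sl2R \<Phi>"
  (is "?I \<Phi>") unfolding lie_isomorphism_def lie_algebra_of_def sl2R_def left_invariant_L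
  by (simp add: lfield_vadd[symmetric] lfield_bracket \<Phi>)
 thus ?thesis by (rule exI[of ?I])
qed

lemma simply_connected_Euclidean: "simply_connected (UNIV :: 'e::euclidean_space set)"
 by (rule convex_imp_simply_connected) simp

text \<open>For this value of \<open>r\<close> the connection is flat, and its torsion has the structure constants of \<open>L\<close> with the opposite sign.\<close>

lemma structure_r_trivial_isotropy:
 assumes inj: "inj Psi" and S: "structure_r A g e1 e2 e3 \<beta> r S" and r: "r = - (\<beta>\<^sup>2 + 2) / \<beta>"
 shows "coset_representation_trivial_isotropy A g D S \<one> L flat_atlas rho"
proof -
 have k: "4 + 2 * \<beta> * (\<beta> + r) = 0" and br: "\<beta> + r = - 2 / \<beta>"
  using beta unfolding r by (simp_all add: field_simps power2_eq_square)
 interpret axial_connection A g frame 1 \<beta> D S "nu r" 0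
  using structure_r_axial[OF S] unfolding k .
 have rho: "rho a (Psi m) = Psi (lmult a m)" for a m by (simp add: rho_def descent_def inj)
 have rho1: "rho a \<one> = Psi a" for a using rho[of a 0] by simp
 have stab: "stabilizer L rho \<one> = {\<one>\<^bsub>L\<^esub>}"
  using injD[OF inj, of _ 0] by (auto simp: stabilizer_def rho1)
 have z: "lfield 0 = vzero" using lfield_vadd(2)[of 0 0] by (simp add: vscale_def tscale_def)
 have "coset_presentation A g D S \<one> L flat_atlas rho"
 proof (rule coset_presentationI[OF L_lie_group simply_connected_Euclidean rho_action[OF inj], of "%_. lfield"])
  show "bij_betw (%(c, x). lfield x) ({c. (0 :: real) ~= 0 | c = (0 :: real)} \<times> UNIV) (\<L> L flat_atlas)"
   unfolding left_invariant_L by (rule bij_betw_imageI) (auto simp: inj_on_def image_iff dest: injD[OF lfield_inj])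
  show "push A (%k. rho k \<one>) (lfield x \<one>\<^bsub>L\<^esub>) = tvec \<one> x" for x
   unfolding rho1 lfield_def Psi_push by (simp add: cof_ifr)
  show "LL.generates (lfield 0) (%_. \<one>\<^bsub>L\<^esub>)" unfolding z by (rule LL.generates_vzero)
  show "vbracket flat_atlas (lfield x) (lfield y) = lfield (cross3 (c *\<^sub>R axis 3 1) y - cross3 (d *\<^sub>R axis 3 1) x +
    (brk 1 \<beta> (cross3 x y) - cross3 (nu r x) y + cross3 (nu r y) x))"
   if "c : {c. (0 :: real) ~= 0 | c = 0}" "d : {c. (0 :: real) ~= 0 | c = 0}" for c d x y
  proof -
   have "lbr x y = brk 1 \<beta> (cross3 x y) - cross3 (nu r x) y + cross3 (nu r y) x"
    unfolding nu_def br using beta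
    by (simp add: lbr_def Let_def brk_def cross3_def axis_def vec_eq_iff forall_3 field_simps)
   thus ?thesis using that by (simp add: lfield_bracket cross3_def[of 0])
  qed
 qed (simp_all add: lfield_vadd lfield_left_invariant stab)
 moreover have "rho 0 q = q" for q using Psi_surj[THEN surjD, of q] by (auto simp: rho)
 ultimately show ?thesis by (intro trivial_isotropyI) (simp_all add: stab[simplified])
qed

end

subsection \<open>The group \<open>L \<times> \<real>\<close>\<close>

text \<open>The second factor acts by the central translations of \<open>G\<close>, which commute with \<open>L\<close>. In both groups the elements \<open>(0, 0, t)\<close> form a
  one-parameter subgroup; they act on \<open>G\<close> as the same translation, followed in \<open>L\<close> by the rotation of angle \<open>- 2 t / \<beta>\<close>
  about the unit. Their quotients are the isotropy group.\<close>

lemma real_group_simps [simp]: "carrier real_group = UNIV" "mult real_group = (+)" "one real_group = 0"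
 by (simp_all add: real_group_def)

lemma real_group_group: "group real_group"
 by (rule groupI) (auto intro: exI[of _ "- _"])

lemma rotation2_mult: "rotation2 s ** rotation2 t = rotation2 (s + t)"
 by (simp add: rotation2_def matrix_matrix_mult_def sum_2 vec_eq_iff forall_2 cos_add sin_add)

lemma rotation2_eq_iff: "rotation2 s = rotation2 t \<longleftrightarrow> (\<exists>n::int. s - t = 2 * pi * n)"
proof
 assume "rotation2 s = rotation2 t"
 hence "cos s = cos t" "sin s = sin t" by (simp_all add: rotation2_def vec_eq_iff forall_2)
 hence "cos (s - t) = (sin t)\<^sup>2 + (cos t)\<^sup>2" by (simp only: cos_diff power2_eq_square add.commute)
 hence "cos (s - t) = 1" by simp
 thus "\<exists>n::int. s - t = 2 * pi * n" by (auto simp: cos_one_2pi_int mult.commute)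
next
 assume "\<exists>n::int. s - t = 2 * pi * n"
 then obtain n :: int where "s = t + 2 * pi * n" by (metis add_diff_cancel_left' diff_add_cancel add.commute)
 thus "rotation2 s = rotation2 t" by (simp add: rotation2_def cos_add sin_add cos_int_2pin sin_int_2pin)
qed

lemma SO2_carrier: "carrier SO2 = range rotation2"
proof (intro equalityI subsetI)
 fix M assume "M : carrier SO2"
 hence o: "transpose M ** M = mat 1" and d: "M $ 1 $ 1 * M $ 2 $ 2 - M $ 1 $ 2 * M $ 2 $ 1 = 1"
  by (simp_all add: SO2_def orthogonal_matrix det_2)
 have r: "(M $ 1 $ 1)\<^sup>2 + (M $ 2 $ 1)\<^sup>2 = 1" "M $ 1 $ 1 * M $ 1 $ 2 + M $ 2 $ 1 * M $ 2 $ 2 = 0" "(M $ 1 $ 2)\<^sup>2 + (M $ 2 $ 2)\<^sup>2 = 1"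
  using o by (simp_all add: matrix_matrix_mult_def transpose_def mat_def sum_2 vec_eq_iff forall_2 power2_eq_square)
 have "(M $ 1 $ 1 - M $ 2 $ 2)\<^sup>2 + (M $ 1 $ 2 + M $ 2 $ 1)\<^sup>2 = 0"
  using r(1,3) d by (simp add: power2_eq_square algebra_simps)
 hence e: "M $ 2 $ 2 = M $ 1 $ 1" "M $ 1 $ 2 = - M $ 2 $ 1" by (simp_all add: sum_power2_eq_zero_iff)
 obtain t where "M $ 1 $ 1 = cos t" "M $ 2 $ 1 = sin t" by (rule sincos_total_2pi[OF r(1)])
 hence "M = rotation2 t" using e by (simp add: rotation2_def vec_eq_iff forall_2)
 thus "M : range rotation2" by blast
next
 fix M assume "M : range rotation2"
 then obtain t where M: "M = rotation2 t" by blast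
 have 1: "cos t * cos t + sin t * sin t = 1" by simp
 have "transpose M ** M = mat 1"
  using 1 by (simp add: M rotation2_def matrix_matrix_mult_def transpose_def mat_def sum_2 vec_eq_iff forall_2 add.commute mult.commute)
 moreover have "det M = 1" using 1 by (simp add: M rotation2_def det_2)
 ultimately show "M : carrier SO2" by (simp add: SO2_def orthogonal_matrix)
qed

context special_group
begin

abbreviation vt :: "real => real^3" where "vt t \<equiv> vector [0, 0, t]"

lemma vt_mmult: "mmult (vt s) (vt t) = vt (s + t)" "mmult a (vt t) = mmult (vt t) a" "vt 0 = 0"
 by (simp_all add: mmult_def vec_eq_iff forall_3 add.commute)

lemma lmult_vt: "lmult (vt t) m = mmult (vt t) (spin (- 2 * t / \<beta>) m)" "lmult a (mmult (vt t) m) = mmult (vt t) (lmult a m)"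
 by (simp add: lmult_def) (simp add: lmult_def spin_mmult_vertical mmult_assoc[symmetric] vt_mmult(2)[of a])

lemma lmult_vt_vt: "lmult (vt s) (vt t) = vt (s + t)"
 by (simp add: lmult_vt(1) spin_vertical vt_mmult(1))

definition KR :: "((real^3) \<times> real) monoid" where
 "KR = L \<times>\<times> real_group"

lemma KR_simps [simp]: "carrier KR = UNIV" "one KR = (0, 0)" "mult KR z w = (lmult (fst z) (fst w), snd z + snd w)"
 by (simp_all add: KR_def DirProd_def case_prod_beta)

lemma KR_group: "group KR"
 unfolding KR_def by (rule DirProd_group[OF L_group real_group_group])

lemma KR_inv: "inv\<^bsub>KR\<^esub> (a, t) = (linv a, - t)"
proof -
 interpret group KR by (rule KR_group)
 have "lmult (linv a) a = 0"
  using group.l_inv[OF L_group, of a] by (simp add: L_inv)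
 thus ?thesis by (intro inv_equality) simp_all
qed

lemma KR_lie: "lie_group KR flat_atlas"
 unfolding lie_group_def
proof (intro conjI KR_group)
 show "smooth_atlas (flat_atlas :: ((real^3) \<times> real, (real^3) \<times> real) atlas)" by (rule flat.smooth_atlas)
 show "smooth_map (prod_atlas flat_atlas flat_atlas) flat_atlas (%(x, y). x \<otimes>\<^bsub>KR\<^esub> y)"
  unfolding prod_flat_atlas smooth_map_flat case_prod_beta KR_simps by (intro smooth_intros open_UNIV)
 have "(%z. inv\<^bsub>KR\<^esub> z) = (%z. (linv (fst z), - snd z))" using KR_inv by (auto simp: fun_eq_iff)
 thus "smooth_map flat_atlas flat_atlas (%z. inv\<^bsub>KR\<^esub> z)"
  unfolding smooth_map_flat linv_def by (simp only:) (intro smooth_intros open_UNIV, use beta in auto)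
qed simp

interpretation KL: Lie_group KR flat_atlas
 by unfold_locales (rule KR_lie)

definition kfield :: "real^3 => real => ((real^3) \<times> real) vfield" where
 "kfield u s = fld (%z. (ifr (fst z) u, s))"

lemma kfield_smooth: "smooth_on UNIV (%z :: (real^3) \<times> real. (ifr (fst z) u, s :: real))"
proof -
 have "smooth_on UNIV (%z :: (real^3) \<times> real. ifr (fst z) u)"
  by (rule smooth_on_compose[OF smooth_ifr open_UNIV]) (auto intro!: smooth_intros)
 thus ?thesis by (intro smooth_on_Pair open_UNIV smooth_on_const)
qed

lemma kfield_linear: "kfield (u + v) (s + t) = vadd (kfield u s) (kfield v t)" "kfield (c *\<^sub>R u) (c * s) = vscale (%_. c) (kfield u s)"
 by (rule ext, simp add: kfield_def fld_chart_tangent ifr_linear vadd_def vscale_def flat.chart_tangent_linear(1,2)[of UNIV id])+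

lemma kfield_inject: "kfield u s z = kfield v t z ==> u = v & s = t"
 using fld_inject[of "%z. (ifr (fst z) u, s)" z "%z. (ifr (fst z) v, t)" z] unfolding kfield_def by (metis phi_ifr prod.inject)

lemma kfield_left_invariant: "kfield u s : \<L> KR flat_atlas"
 unfolding left_invariant_fields_def
proof (intro CollectI conjI allI)
 show "kfield u s : \<XX> flat_atlas" unfolding kfield_def by (rule fld_vector_field[OF kfield_smooth])
 fix a p :: "(real^3) \<times> real"
 have s: "smooth_on UNIV (lmult (fst a))" using turns_lmult by (simp add: turns_def)
 have d: "((%x. (lmult (fst a) (fst x), snd a + snd x)) has_derivative
   (%h. (Df (lmult (fst a)) (fst p) (fst h), snd h))) (at p)"
  by (rule has_derivative_Pair[OF has_derivative_compose[OF bounded_linear_imp_has_derivative[OF bounded_linear_fst]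
     smooth_on_has_derivative[OF s UNIV_I]]]) (auto intro!: derivative_eq_intros)
 have "phi (lmult (fst a) (fst p)) (Df (lmult (fst a)) (fst p) (ifr (fst p) u)) = u"
  using turns_lmult[of "fst a"] by (simp add: turns_def)
 hence e: "Df (lmult (fst a)) (fst p) (ifr (fst p) u) = ifr (lmult (fst a) (fst p)) u" by (metis ifr_phi)
 have m: "smooth_on UNIV (%x. (lmult (fst a) (fst x), snd a + snd x :: real))" by (intro smooth_intros open_UNIV)
 show "push flat_atlas (%x. a \<otimes>\<^bsub>KR\<^esub> x) (kfield u s p) = kfield u s (a \<otimes>\<^bsub>KR\<^esub> p)"
  unfolding kfield_def KR_simps push_fld_flat[OF m d] by (intro ext) (simp add: e fld_def)
qed

lemma kfield_cases:
 assumes X: "X : \<L> KR flat_atlas" obtains u s where "X = kfield u s"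
proof -
 obtain a where a: "X \<one>\<^bsub>KR\<^esub> = fld (%_. a) \<one>\<^bsub>KR\<^esub>"
  by (rule fld_cases[OF flat.vector_fieldD(1)[OF KL.left_invariantD(1)[OF X]]])
 have "X \<one>\<^bsub>KR\<^esub> = kfield (phi 0 (fst a)) (snd a) \<one>\<^bsub>KR\<^esub>" unfolding a by (intro ext) (simp add: kfield_def fld_def)
 from KL.left_invariant_eq[OF X kfield_left_invariant this] show thesis by (rule that)
qed

lemma kfield_bracket: "vbracket flat_atlas (kfield u s) (kfield v t) = kfield (lbr u v) 0"
proof
 fix z :: "(real^3) \<times> real"
 let ?D = "%u. Df (%m. ifr m u) (fst z)"
 have D: "((%m. ifr m u) has_derivative ?D u) (at (fst z))" for u by (rule smooth_on_has_derivative[OF smooth_ifr UNIV_I])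
 have K: "((%z. (ifr (fst z) u, s)) has_derivative (%h. (?D u (fst h), 0))) (at z)" for u s
  by (rule has_derivative_Pair[OF has_derivative_compose[OF bounded_linear_imp_has_derivative[OF bounded_linear_fst] D] has_derivative_const])
 have "fld (%_. ?D v (ifr (fst z) u) - ?D u (ifr (fst z) v)) (fst z) = fld (%m. ifr m (lbr u v)) (fst z)"
  using fun_cong[OF lfield_bracket[of u v], of "fst z"] unfolding lfield_def vbracket_fld[OF smooth_ifr smooth_ifr D D] .
 from fld_inject[OF this refl] have "?D v (ifr (fst z) u) - ?D u (ifr (fst z) v) = ifr (fst z) (lbr u v)" .
 thus "vbracket flat_atlas (kfield u s) (kfield v t) z = kfield (lbr u v) 0 z"
  unfolding kfield_def vbracket_fld[OF kfield_smooth kfield_smooth K K] by (intro ext) (simp add: fld_def)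
qed

definition kact :: "(real^3) \<times> real => real^3 => real^3" where
 "kact z m = mmult (vt (snd z)) (lmult (fst z) m)"

definition kgam :: "real => (real^3) \<times> real" where
 "kgam t = (vt (- (\<beta> * t / 2)), \<beta> * t / 2)"

lemma kact_kgam: "kact (kgam t) m = spin t m"
 using beta by (simp add: kact_def kgam_def lmult_vt(1) mmult_assoc[symmetric] vt_mmult(1,3))

lemma kgam_add: "kgam (s + t) = kgam s \<otimes>\<^bsub>KR\<^esub> kgam t"
 by (simp add: kgam_def lmult_vt_vt add_divide_distrib distrib_left)

lemma kgam_generates: "KL.generates (kfield (vt (- (\<beta> / 2))) (\<beta> / 2)) kgam"
 unfolding KL.generates_def
proof
 have v: "kgam t = t *\<^sub>R (vt (- (\<beta> / 2)), \<beta> / 2)" for t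
  by (simp add: kgam_def vec_eq_iff forall_3)
 have s: "smooth_on UNIV kgam" unfolding v[abs_def] by (intro smooth_intros open_UNIV)
 show "one_parameter_subgroup KR flat_atlas kgam"
  using s by (simp add: one_parameter_subgroup_def real_atlas_flat smooth_map_flat hom_def kgam_add[simplified])
 show "has_velocity flat_atlas kgam (kfield (vt (- (\<beta> / 2))) (\<beta> / 2) \<one>\<^bsub>KR\<^esub>) 0"
  unfolding has_velocity_def
 proof
  fix f :: "(real^3) \<times> real => real" assume "f : \<F> flat_atlas"
  hence f: "smooth_on UNIV f" by (simp add: smooth_functions_flat)
  have "ifr 0 (vt (- (\<beta> / 2))) = vt (- (\<beta> / 2))" by (simp add: ifr_def rot_def Let_def vec_eq_iff forall_3)
  hence "kfield (vt (- (\<beta> / 2))) (\<beta> / 2) \<one>\<^bsub>KR\<^esub> f = Df f (0, 0) (vt (- (\<beta> / 2)), \<beta> / 2)"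
   by (simp add: kfield_def fld_apply[OF f])
  thus "((%s. f (kgam s)) has_real_derivative kfield (vt (- (\<beta> / 2))) (\<beta> / 2) \<one>\<^bsub>KR\<^esub> f) (at 0)"
   using smooth_on_has_real_derivative_line[OF f, of "(0, 0)" 0 "(vt (- (\<beta> / 2)), \<beta> / 2)"] by (simp add: v zero_prod_def[symmetric])
 qed
qed

lemma kact_mult: "kact (z \<otimes>\<^bsub>KR\<^esub> w) m = kact z (kact w m)"
 unfolding kact_def lmult_vt(2) mmult_assoc[symmetric] vt_mmult(1) by (simp add: lmult_assoc)

lemma kact_action:
 assumes "inj Psi" shows "transitive_isometric_action KR flat_atlas A g (%z. descent (kact z))"
proof (rule model_action[where h=kact, OF assms KR_group])
 show "smooth_on UNIV (%z. kact (fst z) (snd z))"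
 proof -
  have "smooth_on UNIV (%z. vt (snd (fst z)))"
   by (rule smooth_on_vec_lambda[OF open_UNIV], rule forall_3[THEN iffD2, rule_format]) (auto intro!: smooth_intros)
  thus ?thesis unfolding kact_def by (intro smooth_intros open_UNIV)
 qed
 show "turns ((%z. 2 * snd z / \<beta> + 0) z) (kact z)" for z
  unfolding kact_def[abs_def] using turns_compose[OF turns_mmult turns_lmult, of "vt (snd z)" "fst z"] by simp
 show "\<exists>z. kact z 0 = m" for m by (rule exI[of _ "(m, 0)"]) (simp add: kact_def vt_mmult(1,3))
qed (simp_all add: kact_mult[simplified], simp add: kact_def vt_mmult(1,3))

end

context special_group
begin

interpretation KL: Lie_group KR flat_atlas
 by unfold_locales (rule KR_lie)

lemma kgam_facts:
 shows kgam_hom: "one_parameter_subgroup KR flat_atlas kgam" and kgam_diff: "kgam s \<otimes>\<^bsub>KR\<^esub> inv\<^bsub>KR\<^esub> kgam t = kgam (s - t)"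
proof -
 show h: "one_parameter_subgroup KR flat_atlas kgam" using kgam_generates unfolding KL.generates_def by blast
 show "kgam s \<otimes>\<^bsub>KR\<^esub> inv\<^bsub>KR\<^esub> kgam t = kgam (s - t)"
  using KL.one_parameter_add(1)[OF h, of s "- t"] KL.one_parameter_add(3)[OF h, of t] by simp
qed

lemma spin_trivial: "(\<forall>m. spin t m = m) \<longleftrightarrow> (\<exists>n::int. t = 2 * pi * n)"
proof
 assume a: "\<forall>m. spin t m = m"
 define m :: "real^3" where "m = vector [1, 0, 0]"
 have "disc m ~= 0"
 proof
  assume "disc m = 0"
  hence "upper m = \<i>" by (simp add: disc_def)
  thus False by (simp add: upper_def m_def complex_eq_iff)
 qed
 moreover have "cis (- t) * disc m = disc m" using disc_spin(1)[of t m] a by simp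
 ultimately have "cis (- t) = 1" by simp
 hence "cos t = 1" by (simp add: complex_eq_iff)
 thus "\<exists>n::int. t = 2 * pi * n" by (auto simp: cos_one_2pi_int mult_ac)
next
 assume "\<exists>n::int. t = 2 * pi * n"
 then obtain n :: int where "t = 2 * pi * n" by blast
 hence "cis (- t) = 1" using cis_multiple_2pi[of "- of_int n"] by simp
 thus "\<forall>m. spin t m = m" by (simp add: spin_def)
qed

context
 assumes inj: "inj Psi"
begin

definition kaction :: "(real^3) \<times> real => 'p => 'p" where
 "kaction z = descent (kact z)"

lemma kaction_Psi: "kaction z (Psi m) = Psi (kact z m)"
 by (simp add: kaction_def descent_def inj)

lemma kaction_one: "kaction z \<one> = Psi (mmult (vt (snd z)) (fst z))"
 using kaction_Psi[of z 0] by (simp add: kact_def)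

lemma kaction_stabilizer: "stabilizer KR kaction \<one> = range kgam"
proof (intro equalityI subsetI)
 fix z assume "z : stabilizer KR kaction \<one>"
 hence "mmult (vt (snd z)) (fst z) = 0" using injD[OF inj, of _ 0] by (simp add: stabilizer_def kaction_one)
 hence "fst z = vt (- snd z)" by (simp add: mmult_def vec_eq_iff forall_3)
 hence "z = kgam (2 * snd z / \<beta>)" using beta by (simp add: kgam_def prod_eq_iff)
 thus "z : range kgam" by blast
next
 fix z assume "z : range kgam"
 thus "z : stabilizer KR kaction \<one>" by (auto simp: stabilizer_def kaction_one kgam_def vt_mmult(1,3))
qed

lemma kernel_iff: "z : ineffective_kernel KR kaction \<longleftrightarrow> (\<exists>n::int. z = kgam (2 * pi * n))"
proof -
 have t: "(\<forall>p. kaction (kgam t) p = p) \<longleftrightarrow> (\<exists>n::int. t = 2 * pi * n)" for t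
 proof -
  have "(\<forall>p. kaction (kgam t) p = p) \<longleftrightarrow> (\<forall>m. Psi (spin t m) = Psi m)"
  proof
   assume "\<forall>m. Psi (spin t m) = Psi m"
   thus "\<forall>p. kaction (kgam t) p = p" using Psi_surj[THEN surjD] by (metis kaction_Psi kact_kgam)
  next
   assume "\<forall>p. kaction (kgam t) p = p"
   thus "\<forall>m. Psi (spin t m) = Psi m" by (simp add: kaction_Psi[symmetric] kact_kgam[symmetric])
  qed
  thus ?thesis using inj spin_trivial by (simp add: inj_eq)
 qed
 show ?thesis
 proof
  assume z: "z : ineffective_kernel KR kaction"
  hence "z : stabilizer KR kaction \<one>" by (simp add: ineffective_kernel_iff stabilizer_def)
  then obtain s where "z = kgam s" unfolding kaction_stabilizer by blast
  thus "\<exists>n::int. z = kgam (2 * pi * n)" using z t[of s] by (auto simp: ineffective_kernel_iff)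
 next
  assume "\<exists>n::int. z = kgam (2 * pi * n)"
  thus "z : ineffective_kernel KR kaction" using t by (auto simp: ineffective_kernel_iff)
 qed
qed

lemma kgam_kernel_iff: "kgam t : ineffective_kernel KR kaction \<longleftrightarrow> (\<exists>n::int. t = 2 * pi * n)"
proof -
 have "kgam s = kgam t \<longleftrightarrow> s = t" for s t using beta by (auto simp: kgam_def)
 thus ?thesis by (simp add: kernel_iff)
qed

lemma kaction_action: "transitive_isometric_action KR flat_atlas A g kaction"
 using kact_action[OF inj] unfolding kaction_def[abs_def] .

text \<open>The rotation \<open>J\<close> corresponds to \<open>(\<beta> / 2) (\<partial>\<^sub>s - f\<^sub>3)\<close>, the generator of the stabilizer, and the central
  element \<open>e\<^sub>3 - (\<beta> + r) J\<close> of the transvection algebra to \<open>\<partial>\<^sub>s\<close>.\<close>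

lemma structure_r_presentation:
 assumes S: "structure_r A g e1 e2 e3 \<beta> r S" and r: "r ~= - (\<beta>\<^sup>2 + 2) / \<beta>"
 shows "coset_presentation A g D S \<one> KR flat_atlas kaction"
proof -
 define k where "k = 4 + 2 * \<beta> * (\<beta> + r)"
 define \<rho> where "\<rho> = \<beta> + r"
 have k: "k ~= 0"
 proof
  assume "k = 0"
  hence "r * \<beta> = - (\<beta>\<^sup>2 + 2)" by (simp add: k_def power2_eq_square algebra_simps)
  thus False using r beta by (simp add: field_simps)
 qed
 interpret axial_connection A g frame 1 \<beta> D S "nu r" k
  using structure_r_axial[OF S] unfolding k_def .
 define E where "E = (%(c :: real) (x :: real^3). kfield (vector [x $ 1, x $ 2, - (\<beta> / 2) * (c + \<rho> * x $ 3)]) (x $ 3 + \<beta> / 2 * (c + \<rho> * x $ 3)))"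
 show ?thesis
 proof (rule coset_presentationI[where E=E, OF KR_lie simply_connected_Euclidean kaction_action])
  show "bij_betw (%(c, x). E c x) ({c. k ~= 0 | c = 0} \<times> UNIV) (\<L> KR flat_atlas)"
  proof (rule bij_betw_imageI)
   show "inj_on (%(c, x). E c x) ({c. k ~= 0 | c = 0} \<times> UNIV)"
   proof (rule inj_onI, clarify)
    fix c x d y assume "E c x = E d y"
    note k = kfield_inject[OF fun_cong[OF this[unfolded E_def], of 0]]
    have e: "x $ 1 = y $ 1" "x $ 2 = y $ 2" "c + \<rho> * x $ 3 = d + \<rho> * y $ 3"
     using conjunct1[OF k] beta by (simp_all add: vec_eq_iff forall_3)
    have "x $ 3 = y $ 3" using conjunct2[OF k] unfolding e(3) by simp
    thus "c = d & x = y" using e by (simp add: vec_eq_iff forall_3)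
   qed
   show "(%(c, x). E c x) ` ({c. k ~= 0 | c = 0} \<times> UNIV) = \<L> KR flat_atlas"
   proof (intro equalityI subsetI)
    fix X assume "X : \<L> KR flat_atlas"
    then obtain u s where X: "X = kfield u s" by (rule kfield_cases)
    have "E (- 2 / \<beta> * u $ 3 - \<rho> * (s + u $ 3)) (vector [u $ 1, u $ 2, s + u $ 3]) = X"
    proof -
     have v: "vector [u $ 1, u $ 2, - (\<beta> / 2) * (- 2 / \<beta> * u $ 3 - \<rho> * (s + u $ 3) + \<rho> * (s + u $ 3))] = u"
      "s + u $ 3 + \<beta> / 2 * (- 2 / \<beta> * u $ 3 - \<rho> * (s + u $ 3) + \<rho> * (s + u $ 3)) = s"
      using beta by (simp_all add: vec_eq_iff forall_3)
     show ?thesis unfolding E_def X vector_3 v ..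
    qed
    thus "X : (%(c, x). E c x) ` ({c. k ~= 0 | c = 0} \<times> UNIV)" using k by force
   qed (auto simp: E_def kfield_left_invariant)
  qed
  show "E (c + d) (x + y) = vadd (E c x) (E d y)" for c d x y
   unfolding E_def kfield_linear(1)[symmetric]
   by (rule arg_cong2[of _ _ _ _ kfield]) (simp_all add: vec_eq_iff forall_3 algebra_simps)
  show "E (s * c) (s *\<^sub>R x) = vscale (%_. s) (E c x)" for s c x
   unfolding E_def kfield_linear(2)[symmetric]
   by (rule arg_cong2[of _ _ _ _ kfield]) (simp_all add: vec_eq_iff forall_3 algebra_simps)
  show "vbracket flat_atlas (E c x) (E d y) = E (- k * cross3 x y $ 3)
   (cross3 (c *\<^sub>R axis 3 1) y - cross3 (d *\<^sub>R axis 3 1) x + (brk 1 \<beta> (cross3 x y) - cross3 (nu r x) y + cross3 (nu r y) x))" for c d x y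
  proof -
   have n: "nu r x = (- 2 * x $ 2 - \<rho> * x $ 3) *\<^sub>R axis 3 1" for x by (simp add: nu_def \<rho>_def)
   have k': "k = 4 + 2 * \<beta> * \<rho>" by (simp add: k_def \<rho>_def)
   show ?thesis
    unfolding E_def kfield_bracket n k'
    by (rule arg_cong2[of _ _ _ _ kfield])
     (use beta in "simp_all add: lbr_def Let_def brk_def cross3_def axis_def vec_eq_iff forall_3 field_simps")
  qed
  show "push A (%z. kaction z \<one>) (E c x \<one>\<^bsub>KR\<^esub>) = tvec \<one> x" for c x
  proof -
   define Q where "Q = (%z :: (real^3) \<times> real. mmult (vt (snd z)) (fst z))"
   have Q: "Q z = fst z + snd z *\<^sub>R axis 3 1" for z by (simp add: Q_def mmult_def vec_eq_iff forall_3 axis_def)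
   have Qs: "smooth_on UNIV Q" unfolding Q[abs_def] by (intro smooth_intros open_UNIV)
   have Qd: "(Q has_derivative Q) (at z)" for z
    unfolding Q[abs_def] by (auto intro!: derivative_eq_intros)
   define u :: "real^3" and s where "u = vector [x $ 1, x $ 2, - (\<beta> / 2) * (c + \<rho> * x $ 3)]" and "s = x $ 3 + \<beta> / 2 * (c + \<rho> * x $ 3)"
   have "push A (%z. kaction z \<one>) (E c x \<one>\<^bsub>KR\<^esub>) = push A Psi (push flat_atlas Q (fld (%z. (ifr (fst z) u, s)) (0, 0)))"
    unfolding push_compose[OF smooth_manifold_flat mfd Psi_smooth]
    by (simp add: kaction_one Q_def E_def kfield_def u_def s_def)
   also have "\<dots> = tvec (Psi (Q (0, 0))) (cof \<beta> (Q (0, 0)) (Q (ifr 0 u, s)))"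
    unfolding push_fld_flat[OF Qs Qd] Psi_push by simp
   also have "\<dots> = tvec \<one> x"
   proof -
    have q: "Q (0, 0) = 0" by (simp add: Q)
    have "cof \<beta> 0 (Q (ifr 0 u, s)) = x"
     by (simp add: Q cof_def ifr_def Let_def axis_def u_def s_def vec_eq_iff forall_3)
    thus ?thesis unfolding q by simp
   qed
   finally show ?thesis .
  qed
  have E1: "E 1 0 = kfield (vt (- (\<beta> / 2))) (\<beta> / 2)" by (simp add: E_def)
  show "KL.generates (E 1 0) kgam" unfolding E1 by (rule kgam_generates)
  show "E 1 0 : \<L> KR flat_atlas" unfolding E1 by (rule kfield_left_invariant)
  show "stabilizer KR kaction \<one> = (if k ~= 0 then range kgam else {\<one>\<^bsub>KR\<^esub>})"
   using k kaction_stabilizer by simp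
 qed
qed

text \<open>The rotation of angle \<open>t\<close> about the unit is the class of \<open>kgam t\<close>, which is trivial exactly for \<open>t \<in> 2 \<pi> \<int>\<close>.\<close>

lemma structure_r_SO2:
 assumes S: "structure_r A g e1 e2 e3 \<beta> r S" and r: "r ~= - (\<beta>\<^sup>2 + 2) / \<beta>"
 shows "coset_representation_SO2 A g D S \<one> L flat_atlas rho"
proof -
 define \<Gamma> where "\<Gamma> = ineffective_kernel KR kaction"
 define Q where "Q = KR Mod \<Gamma>"
 define q where "q = (%k. \<Gamma> #>\<^bsub>KR\<^esub> k)"
\<comment> \<open>The images of \<open>L\<close> and of the stabilizer in the effective quotient \<open>Q\<close>.\<close>
 define N where "N = range (%a. q (a, 0))"
 define H where "H = q ` range kgam"
 have "group_action KR UNIV kaction"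
  using kaction_action unfolding transitive_isometric_action_def smooth_action_def by blast
 then interpret act: group_hom KR "BijGroup UNIV" kaction by (rule group_action.group_hom)
 have nG: "\<Gamma> \<lhd> KR" unfolding \<Gamma>_def ineffective_kernel_def by (rule act.normal_kernel)
 interpret \<Gamma>: normal \<Gamma> KR by (rule nG)
 have Qg: "group Q" unfolding Q_def by (rule \<Gamma>.factorgroup_is_group)
 have qh: "group_hom KR Q q"
  unfolding group_hom_def group_hom_axioms_def Q_def q_def
  using KR_group \<Gamma>.factorgroup_is_group \<Gamma>.r_coset_hom_Mod by blast
 interpret q: group_hom KR Q q by (rule qh)
 have surj: "q ` carrier KR = carrier Q" unfolding Q_def q_def carrier_FactGroup ..
 have q_eq: "q k = q l \<longleftrightarrow> k \<otimes>\<^bsub>KR\<^esub> inv\<^bsub>KR\<^esub> l : \<Gamma>" for k l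
 proof
  assume "q k = q l"
  hence "k : \<Gamma> #>\<^bsub>KR\<^esub> l" using KL.rcos_self[of k \<Gamma>] \<Gamma>.subgroup_axioms unfolding q_def by simp
  thus "k \<otimes>\<^bsub>KR\<^esub> inv\<^bsub>KR\<^esub> l : \<Gamma>" using \<Gamma>.rcos_module[OF KR_group, of l k] by simp
 next
  assume "k \<otimes>\<^bsub>KR\<^esub> inv\<^bsub>KR\<^esub> l : \<Gamma>"
  hence "k : \<Gamma> #>\<^bsub>KR\<^esub> l" using \<Gamma>.rcos_module[OF KR_group, of l k] by simp
  from KL.repr_independence[OF this _ \<Gamma>.subgroup_axioms] show "q k = q l" unfolding q_def by simp
 qed
 have N\<Gamma>: "(a, s) : \<Gamma> ==> \<exists>n::int. s = \<beta> * pi * n & a = vt (- s)" for a s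
  unfolding \<Gamma>_def kernel_iff kgam_def by auto
 have injN: "inj (%a. q (a, 0))"
 proof (rule injI)
  fix a b assume "q (a, 0) = q (b, 0)"
  hence "(lmult a (linv b), 0) : \<Gamma>" unfolding q_eq by (simp add: KR_inv)
  hence "lmult a (linv b) = 0" using N\<Gamma> vt_mmult(3) by force
  hence "lmult (lmult a (linv b)) b = b" by simp
  moreover have "lmult (linv b) b = 0" using group.l_inv[OF L_group, of b] by (simp add: L_inv)
  ultimately show "a = b" by (simp add: lmult_assoc)
 qed
 have normN: "N \<lhd> Q"
 proof -
  have s: "subgroup (range (%a. (a, 0 :: real))) KR"
   by (rule KL.subgroupI) (auto simp: KR_inv image_iff)
  have "range (%a. (a, 0 :: real)) \<lhd> KR"
   by (rule KL.normal_invI[OF s]) (auto simp: KR_inv image_iff)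
  from normal.surj_hom_normal_subgroup[OF this qh surj]
  show ?thesis by (simp add: N_def image_image)
 qed
 have subR: "subgroup (range kgam) KR"
  using group_action.stabilizer_subgroup[OF \<open>group_action KR UNIV kaction\<close>, of \<one>] by (simp add: kaction_stabilizer)
 have subH: "subgroup H Q" unfolding H_def by (rule q.subgroup_img_is_subgroup[OF subR])
 have prod: "N <#>\<^bsub>Q\<^esub> H = carrier Q"
 proof (intro equalityI subsetI)
  fix x assume "x : carrier Q"
  then obtain a s where x: "x = q (a, s)" unfolding surj[symmetric] by auto
  have "(a, s) = (lmult a (vt s), 0) \<otimes>\<^bsub>KR\<^esub> kgam (2 * s / \<beta>)"
   using beta by (simp add: kgam_def lmult_assoc lmult_vt_vt vt_mmult(3))
  hence "x = q (lmult a (vt s), 0) \<otimes>\<^bsub>Q\<^esub> q (kgam (2 * s / \<beta>))" unfolding x by (metis KR_simps(1) UNIV_I q.hom_mult)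
  thus "x : N <#>\<^bsub>Q\<^esub> H" unfolding set_mult_def N_def H_def by blast
 next
  fix x assume "x : N <#>\<^bsub>Q\<^esub> H"
  then obtain y z where "x = y \<otimes>\<^bsub>Q\<^esub> z" "y : N" "z : H" unfolding set_mult_def by blast
  moreover have "N \<subseteq> carrier Q" "H \<subseteq> carrier Q" unfolding N_def H_def surj[symmetric] by auto
  ultimately show "x : carrier Q" using group.is_monoid[OF Qg] monoid.m_closed by blast
 qed
 have kgam0: "q (kgam 0) = \<one>\<^bsub>Q\<^esub>"
 proof -
  have "kgam 0 = \<one>\<^bsub>KR\<^esub>" by (simp add: kgam_def vt_mmult(3))
  thus ?thesis by (simp only: q.hom_one)
 qed
 have meet: "N \<inter> H = {\<one>\<^bsub>Q\<^esub>}"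
 proof (intro equalityI subsetI)
  fix x assume "x : N \<inter> H"
  then obtain a t where x: "x = q (a, 0)" "x = q (kgam t)" unfolding N_def H_def by blast
  hence "(a, 0) \<otimes>\<^bsub>KR\<^esub> inv\<^bsub>KR\<^esub> kgam t : \<Gamma>" unfolding q_eq[symmetric] by simp
  hence "(lmult a (linv (vt (- (\<beta> * t / 2)))), - (\<beta> * t / 2)) : \<Gamma>" by (simp add: kgam_def KR_inv)
  from N\<Gamma>[OF this] obtain n :: int where "- (\<beta> * t / 2) = \<beta> * pi * n" by blast
  hence "\<beta> * (t + 2 * pi * n) = 0" by (simp add: algebra_simps)
  hence "t = 2 * pi * of_int (- n)" using beta by simp
  hence "kgam t : \<Gamma>" unfolding \<Gamma>_def kgam_kernel_iff by blast
  hence "q (kgam t) = q (kgam 0)" unfolding q_eq kgam_diff by simp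
  thus "x : {\<one>\<^bsub>Q\<^esub>}" unfolding x(2) by (simp add: kgam0)
 next
  fix x assume "x : {\<one>\<^bsub>Q\<^esub>}"
  hence x: "x = q (kgam 0)" by (simp add: kgam0)
  have "kgam 0 = (0, 0)" by (simp add: kgam_def vt_mmult(3))
  hence "x : N" unfolding x N_def by auto
  moreover have "x : H" unfolding x H_def by blast
  ultimately show "x : N \<inter> H" by blast
 qed
 have qkgam: "q (kgam s) = q (kgam t) \<longleftrightarrow> rotation2 s = rotation2 t" for s t
  unfolding q_eq kgam_diff \<Gamma>_def kgam_kernel_iff rotation2_eq_iff ..
 define \<psi> where "\<psi> = (%M. q (kgam (SOME t. M = rotation2 t)))"
 have \<psi>: "\<psi> (rotation2 t) = q (kgam t)" for t
  unfolding \<psi>_def qkgam by (rule someI[of "%s. rotation2 t = rotation2 s" t, symmetric]) simp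
 have iso: "\<psi> : iso SO2 (Q\<lparr>carrier := H\<rparr>)"
 proof -
  have m: "\<psi> (M ** M') = \<psi> M \<otimes>\<^bsub>Q\<^esub> \<psi> M'" if "M : carrier SO2" "M' : carrier SO2" for M M'
  proof -
   obtain s t where "M = rotation2 s" "M' = rotation2 t" using \<open>M : _\<close> \<open>M' : _\<close> unfolding SO2_carrier by blast
   thus ?thesis by (simp only: rotation2_mult \<psi> kgam_add q.hom_mult[of "kgam s" "kgam t"] KR_simps(1) UNIV_I)
  qed
  have b: "bij_betw \<psi> (carrier SO2) H"
   unfolding SO2_carrier
   by (rule bij_betw_imageI) (auto simp: inj_on_def \<psi> qkgam H_def image_image)
  have x: "mult SO2 =(**)" by (simp add: SO2_def)
  show ?thesis
   unfolding iso_def hom_def x using m b bij_betw_imp_surj_on[OF b] by auto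
 qed
 have rho: "kaction (a, 0) = rho a" for a
  by (simp add: fun_eq_iff kaction_def rho_def descent_def kact_def vt_mmult(3))
 have circle: "\<exists>\<gamma>. one_parameter_subgroup KR flat_atlas \<gamma> & range \<gamma> = range kgam \<and>
   (\<exists>\<psi>\<in>iso SO2 (Q\<lparr>carrier := H\<rparr>). \<forall>t. \<psi> (rotation2 t) = q (\<gamma> t))"
  using kgam_hom iso \<psi> by blast
 note d = N_def H_def Q_def q_def
 show ?thesis
  unfolding coset_representation_SO2_def Let_def KR_def[symmetric] real_atlas_flat prod_flat_atlas
  by (intro exI[of _ kaction] conjI allI rho structure_r_presentation[OF S r], unfold kaction_stabilizer \<Gamma>_def[symmetric])
   (rule injN[unfolded d] normN[unfolded d] subH[unfolded d] prod[unfolded d] meet[unfolded d] circle[unfolded d])+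
qed

end

end

context metric_group
begin

lemma difference_tensor_facts:
 assumes Dm: "cartan_schouten_minus G A Dm"
 shows difference_tensor_frame: "difference_tensor A Dm D S \<longleftrightarrow> tensor_field12 A S & (\<forall>p x y. tcomp S p x y = - cross3 (lam \<alpha> \<beta> x) y)"
  and difference_tensor_exists: "\<exists>S. difference_tensor A Dm D S"
  and difference_tensor_representation: "simply_connected (UNIV :: 'p set) ==> difference_tensor A Dm D S ==>
   coset_representation_trivial_isotropy A g D S \<one> G A (%a x. a \<otimes> x)"
proof -
 have Dm_affine: "affine_connection A Dm" and Dm_frame: "!!i j. Dm (frame i) (frame j) = vzero"
  using Dm frame_left_invariant unfolding cartan_schouten_minus_def by auto
 have diff: "difference_tensor A Dm D S \<longleftrightarrow> tensor_field12 A S & (\<forall>p x y. tcomp S p x y = - cross3 (lam \<alpha> \<beta> x) y)" for S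
  by (rule difference_tensor_iff[OF Dm_affine Dm_frame])
 thus "difference_tensor A Dm D S \<longleftrightarrow> tensor_field12 A S & (\<forall>p x y. tcomp S p x y = - cross3 (lam \<alpha> \<beta> x) y)" .
 show "\<exists>S. difference_tensor A Dm D S" by (rule minus_lam_tensor) (use diff in blast)
 show "coset_representation_trivial_isotropy A g D S \<one> G A (%a x. a \<otimes> x)"
  if "simply_connected (UNIV :: 'p set)" "difference_tensor A Dm D S"
  using difference_representation[OF that(1)] that(2) unfolding diff by blast
qed

lemma generic_structures:
 assumes "cartan_schouten_minus G A Dm" "\<not> locally_symmetric A D" "\<alpha> ~= 1"
 shows "homogeneous_structure A g D S \<longleftrightarrow> difference_tensor A Dm D S"
proof -
 have "\<alpha> ~= 0" using assms(2) locally_symmetric_cases by blast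
 thus ?thesis
  using homogeneous_generic[OF _ alpha_nonneg _ assms(3), of S] homogeneous_frame_parallel[of S]
  unfolding difference_tensor_frame[OF assms(1)] homogeneous_structure_def by blast
qed

end

context special_group
begin

lemma structure_r_exists: "\<exists>S. structure_r A g e1 e2 e3 \<beta> r S"
 by (rule twisted_const_tensor[of "vector [0, 0, - r]"]) (use structure_r_iff[of r] in auto)

text \<open>Every structure is the image, by an isometry fixing the unit, of one with constant \<open>\<mu>\<close>. Left invariance forces \<open>\<mu>\<close> itself to be
  constant, and the equation for \<open>\<mu>\<close> then leaves only the named values.\<close>

lemma special_structures:
 assumes Dm: "cartan_schouten_minus G A Dm"
 defines "model \<equiv> %S. difference_tensor A Dm D S | (\<exists>r. structure_r A g e1 e2 e3 \<beta> r S)"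
 shows "homogeneous_structure A g D S & left_invariant_tensor G A S \<longleftrightarrow> model S"
  and "homogeneous_structure A g D S \<longleftrightarrow>
   tensor_field12 A S & (\<exists>S' F. model S' & isometry A g F & F \<one> = \<one> & carries_tensor A F S' S)"
proof -
 note diff = difference_tensor_frame[OF Dm]
 have model_iff: "model S \<longleftrightarrow> tensor_field12 A S & (\<exists>m. twisted S (%_. m) & ((\<exists>c. m = vector [0, 0, c]) | m = vector [0, 2, \<beta>]))" for S
 proof -
  have "structure_r A g e1 e2 e3 \<beta> r S \<longleftrightarrow> tensor_field12 A S & twisted S (%_. vector [0, 0, - r])" for r
   using structure_r_iff[of r S] by simp
  moreover have "(\<exists>r. twisted S (%_. vector [0, 0, - r])) \<longleftrightarrow> (\<exists>c. twisted S (%_. vector [0, 0, c]))"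
  proof
   assume "\<exists>c. twisted S (%_. vector [0, 0, c])"
   then obtain c where "twisted S (%_. vector [0, 0, - (- c)])" by auto
   thus "\<exists>r. twisted S (%_. vector [0, 0, - r])" by (rule exI)
  qed blast
  moreover have "difference_tensor A Dm D S \<longleftrightarrow> tensor_field12 A S & twisted S (%_. vector [0, 2, \<beta>])"
   unfolding diff twisted_minus_lam ..
  moreover have "(\<exists>m. twisted S (%_. m) & ((\<exists>c. m = vector [0, 0, c]) | m = vector [0, 2, \<beta>])) \<longleftrightarrow>
    (\<exists>c. twisted S (%_. vector [0, 0, c])) | twisted S (%_. vector [0, 2, \<beta>])" by auto
  ultimately show ?thesis unfolding model_def by auto
 qed
 have hom: "homogeneous_structure A g D S" if mS: "model S" for S
 proof -
  obtain m where m: "tensor_field12 A S" "twisted S (%_. m)" "(\<exists>c. m = vector [0, 0, c]) | m = vector [0, 2, \<beta>]"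
   using mS unfolding model_iff by blast
  then obtain c where "m = vector [0, 0, c] | m = vector [0, 2, \<beta>]" by blast
  from twisted_homogeneous[OF m(1) smooth_vec_const m(2) twist_equation_const[OF this]] show ?thesis .
 qed
 have left: "left_invariant_tensor G A S" if mS: "model S" for S
 proof -
  obtain m where S: "tensor_field12 A S" "twisted S (%_. m)" using mS unfolding model_iff by blast
  have "S (a \<otimes> p) (push A (%x. a \<otimes> x) (tvec p x)) (push A (%x. a \<otimes> x) (tvec p y)) = push A (%x. a \<otimes> x) (S p (tvec p x) (tvec p y))" for a p x y
   using S(2) by (simp add: push_translation tensor_fieldD(2)[OF S(1)] twisted_def)
  thus ?thesis unfolding left_invariant_tensor_def carries_tensor_def by (metis tvec_coord)
 qed
 have conv: "model S" if h: "homogeneous_structure A g D S" and l: "left_invariant_tensor G A S" for S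
 proof -
  have S: "tensor_field12 A S" using h unfolding homogeneous_structure_def by blast
  obtain \<mu> where \<mu>: "twisted S \<mu>" "twist_equation \<mu>" by (rule homogeneous_twisted[OF h])
  have "tcomp S p x y = tcomp S \<one> x y" for p x y
  proof -
   have "S (p \<otimes> \<one>) (push A (%x. p \<otimes> x) (tvec \<one> x)) (push A (%x. p \<otimes> x) (tvec \<one> y)) =
     push A (%x. p \<otimes> x) (S \<one> (tvec \<one> x) (tvec \<one> y))"
    using l tvec_tangent unfolding left_invariant_tensor_def carries_tensor_def by blast
   thus ?thesis by (simp add: push_translation tensor_fieldD(2)[OF S])
  qed
  hence tw: "twisted S (%_. \<mu> \<one>)" using \<mu>(1) unfolding twisted_def by metis
  have "\<mu> p = \<mu> \<one>" for p
  proof -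
   have c: "cross3 (ax \<beta> (\<mu> p) x) y = cross3 (ax \<beta> (\<mu> \<one>) x) y" for x y
    using \<mu>(1) tw unfolding twisted_def by metis
   have "\<mu> p \<bullet> x = \<mu> \<one> \<bullet> x" for x
    using arg_cong[OF c[of x "axis 1 1"], of "%v. v $ 2"] by (simp add: cross3_def ax_def axis_def)
   thus ?thesis using vector_eq_rdot by blast
  qed
  hence "\<mu> = (%_. \<mu> \<one>)" by auto
  hence e: "twist_equation (%_. \<mu> \<one>)" using \<mu>(2) by simp
  have "(x \<bullet> \<mu> \<one> - 2 * x $ 2 - \<beta> * x $ 3) * \<mu> \<one> $ 1 = 0" "(x \<bullet> \<mu> \<one> - 2 * x $ 2 - \<beta> * x $ 3) * \<mu> \<one> $ 2 = 0" for x
   using e unfolding twist_equation_def by (auto simp: fder_const[OF tvec_tangent] vec_eq_iff forall_3)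
  from this[of "axis 1 1"] this[of "axis 2 1"] this[of "axis 3 1"]
  have "(\<exists>c. \<mu> \<one> = vector [0, 0, c]) | \<mu> \<one> = vector [0, 2, \<beta>]"
   by (auto simp: inner_vec_def sum_3 vec_eq_iff forall_3 axis_def)
  thus ?thesis unfolding model_iff using S tw by blast
 qed
 show "homogeneous_structure A g D S & left_invariant_tensor G A S \<longleftrightarrow> model S" using hom left conv by blast
 show "homogeneous_structure A g D S \<longleftrightarrow>
   tensor_field12 A S & (\<exists>S' F. model S' & isometry A g F & F \<one> = \<one> & carries_tensor A F S' S)" (is "?H \<longleftrightarrow> ?R")
 proof
  assume h: ?H
  obtain S' F m where "isometry A g F" "F \<one> = \<one>" "tensor_field12 A S'" "twisted S' (%_. m)"
   "(\<exists>c. m = vector [0, 0, c]) | m = vector [0, 2, \<beta>]" "carries_tensor A F S' S"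
   by (rule homogeneous_carried[OF connected_group isotropy_rotations h])
  thus ?R using h unfolding model_iff homogeneous_structure_def by blast
 next
  assume ?R
  thus ?H using carried_homogeneous unfolding model_iff by blast
 qed
qed

lemma structure_r_representation:
 assumes "simply_connected (UNIV :: 'p set)"
 shows "\<exists>(L :: (real^3) monoid) (B :: (real^3, real^3) atlas) \<rho>.
      lie_group L B & (\<exists>\<Phi>. lie_isomorphism (lie_algebra_of L B) sl2R \<Phi>) \<and>
      transitive_isometric_action L B A g \<rho> \<and>
      (\<forall>r S. structure_r A g e1 e2 e3 \<beta> r S -->
       (r ~= - (\<beta>\<^sup>2 + 2) / \<beta> --> coset_representation_SO2 A g D S \<one> L B \<rho>) \<and>
       (r = - (\<beta>\<^sup>2 + 2) / \<beta> --> coset_representation_trivial_isotropy A g D S \<one> L B \<rho>))"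
proof -
 have inj: "inj Psi" by (rule Psi_inj[OF assms])
 show ?thesis
  by (intro exI[of _ L] exI[of _ flat_atlas] exI[of _ rho] conjI allI impI L_lie_group L_sl2 rho_action[OF inj]
    structure_r_SO2[OF inj] structure_r_trivial_isotropy[OF inj])
qed

end

theorem theorem1p3:
  fixes G :: "'a::{t2_space, second_countable_topology} monoid"
    and A :: "('a, real^3) atlas"
    and g :: "'a metric"
    and D Dm :: "'a connection"
    and e1 e2 e3 :: "'a vfield"
    and \<alpha> \<beta> :: real
  assumes G: "group_G \<alpha> \<beta> G A g e1 e2 e3"
    and D: "levi_civita A g D"
    and Dm: "cartan_schouten_minus G A Dm"
    and not_symmetric: "\<not> locally_symmetric A D"
  shows
    "(\<alpha> \<noteq> 1 \<longrightarrow>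
        (\<exists>S. homogeneous_structure A g D S) \<and>
        (\<forall>S. homogeneous_structure A g D S \<longleftrightarrow> difference_tensor A Dm D S) \<and>
        (simply_connected (UNIV :: 'a set) \<longrightarrow>
          (\<forall>S. difference_tensor A Dm D S \<longrightarrow>
            coset_representation_trivial_isotropy A g D S \<one>\<^bsub>G\<^esub> G A (\<lambda>a x. a \<otimes>\<^bsub>G\<^esub> x)))) \<and>
     (\<alpha> = 1 \<longrightarrow>
        (\<exists>S. difference_tensor A Dm D S) \<and>
        (\<forall>r. \<exists>S. structure_r A g e1 e2 e3 \<beta> r S) \<and>
        (\<forall>S. homogeneous_structure A g D S \<and> left_invariant_tensor G A S \<longleftrightarrow>
           difference_tensor A Dm D S \<or> (\<exists>r. structure_r A g e1 e2 e3 \<beta> r S)) \<and>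
        (\<forall>S. homogeneous_structure A g D S \<longleftrightarrow>
           tensor_field12 A S \<and>
           (\<exists>S' F. (difference_tensor A Dm D S' \<or> (\<exists>r. structure_r A g e1 e2 e3 \<beta> r S')) \<and>
              isometry A g F \<and> F \<one>\<^bsub>G\<^esub> = \<one>\<^bsub>G\<^esub> \<and> carries_tensor A F S' S)) \<and>
        (simply_connected (UNIV :: 'a set) \<longrightarrow>
          (\<forall>S. difference_tensor A Dm D S \<longrightarrow>
            coset_representation_trivial_isotropy A g D S \<one>\<^bsub>G\<^esub> G A (\<lambda>a x. a \<otimes>\<^bsub>G\<^esub> x)) \<and>
          (\<exists>(L :: (real^3) monoid) (B :: (real^3, real^3) atlas) \<rho>.
             lie_group L B \<and> (\<exists>\<Phi>. lie_isomorphism (lie_algebra_of L B) sl2R \<Phi>) \<and>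
             transitive_isometric_action L B A g \<rho> \<and>
             (\<forall>r S. structure_r A g e1 e2 e3 \<beta> r S \<longrightarrow>
               (r \<noteq> - (\<beta>\<^sup>2 + 2) / \<beta> \<longrightarrow>
                  coset_representation_SO2 A g D S \<one>\<^bsub>G\<^esub> L B \<rho>) \<and>
               (r = - (\<beta>\<^sup>2 + 2) / \<beta> \<longrightarrow>
                  coset_representation_trivial_isotropy A g D S \<one>\<^bsub>G\<^esub> L B \<rho>)))))"
proof -
 have M: "metric_group G A g e1 e2 e3 \<alpha> \<beta> D"
  by unfold_locales (use G D in "auto simp: group_G_def")
 note facts = metric_group.difference_tensor_exists[OF M Dm] metric_group.difference_tensor_representation[OF M Dm]
 show ?thesis
 proof (cases "\<alpha> = 1")
  case False
  show ?thesis
   using False facts metric_group.generic_structures[OF M Dm not_symmetric False] by simp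
 next
  case True
  have S: "special_group G A g e1 e2 e3 \<beta> D"
   using M not_symmetric unfolding True special_group_def special_group_axioms_def by blast
  show ?thesis
   using facts special_group.structure_r_exists[OF S] special_group.special_structures[OF S Dm]
    special_group.structure_r_representation[OF S] True by simp
 qed
qed

end
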